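(* Solvably equivalent subgroups need not be integrally equivalent, and this already occurs for number fields of degree $96$: there exist number fields $K_1$ and $K_2$ of degree $96$ over $\mathbf{Q}$ with a common Galois closure $L$ over $\mathbf{Q}$ such that the subgroups $H_1=\mathrm{Gal}(L/K_1)$ and $H_2=\mathrm{Gal}(L/K_2)$ of $G=\mathrm{Gal}(L/\mathbf{Q})$ are solvably equivalent but not integrally equivalent.
   Context: For a finite group $G$ and a subgroup $H\le G$, $[H\backslash G]$ denotes the set of right cosets of $H$ in $G$ with the right action of $G$, and $\mathbf{Z}[H\backslash G]$ denotes the corresponding permutation module (the free $\mathbf{Z}$-module with basis $[H\backslash G]$, with the linear extension of the $G$-action). Subgroups $H_1,H_2\le G$ are integrally equivalent if $\mathbf{Z}[H_1\backslash G]\simeq \mathbf{Z}[H_2\backslash G]$ as $\mathbf{Z}[G]$-modules. They are solvably equivalent if they satisfy the following equivalent properties: (i) there is a bijection between the set of solvable subgroups of $H_1$ and the set of solvable subgroups of $H_2$ that sends each subgroup to a $G$-conjugate of itself; (ii) for every solvable $K\le G$, the number of cosets in $[H_1\backslash G]$ fixed by $K$ equals the number of cosets in $[H_2\backslash G]$ fixed by $K$; (iii) $[H_1\backslash G]$ and $[H_2\backslash G]$ are isomorphic as $K$-sets for every solvable $K\le G$. *)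

theory Defs
  imports
    Complex_Main
    "HOL-Algebra.Algebraic_Closure_Type"
    "HOL-Algebra.Finite_Extensions"
    "HOL-Algebra.Solvable_Groups"
    "HOL-Algebra.Free_Abelian_Groups"
    "HOL-Algebra.Bij"
begin

section \<open>Solvable and integral equivalence of subgroups\<close>

text \<open>Throughout, \<open>[H\G]\<close> is \<open>rcosets\<^bsub>G\<^esub> H\<close>, on which \<open>g\<close> acts from the right by
  \<open>C \<mapsto> C #>\<^bsub>G\<^esub> g\<close>.\<close>

definition fixed_rcosets :: "('a, 'b) monoid_scheme \<Rightarrow> 'a set \<Rightarrow> 'a set \<Rightarrow> 'a set set" where
  "fixed_rcosets G H K = {C \<in> rcosets\<^bsub>G\<^esub> H. \<forall>k\<in>K. C #>\<^bsub>G\<^esub> k = C}"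

text \<open>Of the usual equivalent descriptions of solvable equivalence, the one comparing numbers of
  fixed cosets is taken as the definition. It is meant for finite \<open>G\<close>, hence the finiteness
  condition: \<open>card\<close> is meaningless on infinite sets.\<close>

definition solvably_equivalent ::
    "('a, 'b) monoid_scheme \<Rightarrow> 'a set \<Rightarrow> 'a set \<Rightarrow> bool" where
  "solvably_equivalent G H1 H2 \<longleftrightarrow>
     group G \<and> finite (carrier G) \<and> subgroup H1 G \<and> subgroup H2 G \<and>
     (\<forall>K. subgroup K G \<and> solvable (G\<lparr>carrier := K\<rparr>) \<longrightarrow>
        card (fixed_rcosets G H1 K) = card (fixed_rcosets G H2 K))"

text \<open>The permutation module \<open>Z[H\G]\<close> has underlying group
  \<open>free_Abelian_group (rcosets\<^bsub>G\<^esub> H)\<close>; the group ring \<open>Z[G]\<close> has underlying group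
  \<open>free_Abelian_group (carrier G)\<close> and acts on it by the bilinear extension of the action of
  \<open>G\<close> on cosets.\<close>

definition perm_module_smult ::
    "('a, 'b) monoid_scheme \<Rightarrow> ('a set \<Rightarrow>\<^sub>0 int) \<Rightarrow> ('a \<Rightarrow>\<^sub>0 int) \<Rightarrow> ('a set \<Rightarrow>\<^sub>0 int)" where
  "perm_module_smult G x r =
     frag_extend (\<lambda>g. frag_extend (\<lambda>C. frag_of (C #>\<^bsub>G\<^esub> g)) x) r"

definition integrally_equivalent ::
    "('a, 'b) monoid_scheme \<Rightarrow> 'a set \<Rightarrow> 'a set \<Rightarrow> bool" where
  "integrally_equivalent G H1 H2 \<longleftrightarrow>
     (\<exists>\<phi> \<in> iso (free_Abelian_group (rcosets\<^bsub>G\<^esub> H1)) (free_Abelian_group (rcosets\<^bsub>G\<^esub> H2)).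
        \<forall>x \<in> carrier (free_Abelian_group (rcosets\<^bsub>G\<^esub> H1)).
          \<forall>r \<in> carrier (free_Abelian_group (carrier G)).
            \<phi> (perm_module_smult G x r) = perm_module_smult G (\<phi> x) r)"

section \<open>Number fields inside the complex numbers\<close>

abbreviation complex_field :: "complex ring" where
  "complex_field \<equiv> ring_of_type_algebra"

definition number_field_of_degree :: "nat \<Rightarrow> complex set \<Rightarrow> bool" where
  "number_field_of_degree n K \<longleftrightarrow>
     subfield K complex_field \<and> ring.dimension complex_field n \<rat> K"

definition number_field :: "complex set \<Rightarrow> bool" where
  "number_field K \<longleftrightarrow> (\<exists>n. number_field_of_degree n K)"

text \<open>\<open>Gal L F\<close> is the group of field automorphisms of \<open>L\<close> (extensional functions on \<open>L\<close>, as in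
  \<^const>\<open>BijGroup\<close>) that fix \<open>F\<close> pointwise, under composition.\<close>

definition Gal :: "complex set \<Rightarrow> complex set \<Rightarrow> (complex \<Rightarrow> complex) monoid" where
  "Gal L F = (BijGroup L)\<lparr>carrier :=
     {\<sigma> \<in> Bij L. \<sigma> \<in> ring_iso (complex_field\<lparr>carrier := L\<rparr>) (complex_field\<lparr>carrier := L\<rparr>)
        \<and> (\<forall>x\<in>F. \<sigma> x = x)}\<rparr>"

definition galois_number_field :: "complex set \<Rightarrow> bool" where
  "galois_number_field L \<longleftrightarrow>
     number_field L \<and> {x \<in> L. \<forall>\<sigma> \<in> carrier (Gal L \<rat>). \<sigma> x = x} = \<rat>"

text \<open>The Galois closure of \<open>K\<close> over the rationals, taken inside the complex numbers: the least
  Galois number field containing \<open>K\<close>.\<close>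

definition is_galois_closure :: "complex set \<Rightarrow> complex set \<Rightarrow> bool" where
  "is_galois_closure L K \<longleftrightarrow>
     galois_number_field L \<and> K \<subseteq> L \<and>
     (\<forall>M. galois_number_field M \<and> K \<subseteq> M \<longrightarrow> L \<subseteq> M)"

end

theory Submission
  imports Defs "HOL-Combinatorics.Permutations"
begin

text \<open>Let \<open>f = x\<^sup>6 + 30 x + 25\<close>, whose discriminant is a square and the product of whose roots is a square,
  let \<open>b\<^sub>0, \<dots>, b\<^sub>5\<close> be square roots of the roots of \<open>f\<close>, and let \<open>L\<close> be generated by the products
  \<open>b\<^sub>i b\<^sub>j\<close>. An automorphism of \<open>L\<close> is a pair of a permutation of the indices and a family of
  signs, taken up to a global sign; the permutation is even and the signs have product 1. Frobenius
  elements at 7, 11 and 191 show that all such pairs occur, so that \<open>G = Gal L \<rat>\<close> is an extension of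
  the alternating group of degree 6 by an elementary abelian group \<open>V\<close> of order 16.

  By permuting and switching, \<open>G\<close> acts on the Seidel matrices (symmetric, zero on the diagonal,
  \<open>\<plusminus>1\<close> elsewhere) of order 6. Let \<open>H\<^sub>1\<close> be the stabilizer of the Paley matrix \<open>S\<close> and \<open>H\<^sub>2\<close> that of
  \<open>S\<close> switched at one vertex. Both are isomorphic to the alternating group of degree 5, and the two orbits consist of
  the matrices obtained from \<open>S\<close> by an even permutation and an even, respectively odd, switching.

  If a solvable nontrivial \<open>K\<close> fixes a matrix, it contains an element \<open>x \<noteq> 1\<close> that commutes with all its
  \<open>K\<close>-conjugates. A look at the possible \<open>x\<close> shows that \<open>K\<close> either preserves a set of vertices of odd
  size, and then switching at that set interchanges the two orbits and commutes with \<open>K\<close>, or it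
  commutes with an odd permutation with even signs; as \<open>-S\<close> is obtained from \<open>S\<close> by an odd
  permutation and an odd switching, this odd permutation followed by negation interchanges the orbits. So the two orbits
  contain equally many fixed points of \<open>K\<close>.

  An isomorphism of the permutation modules has a matrix \<open>y\<close>, and \<open>Z = y y\<^sup>T\<close> is an invariant integral
  matrix with an invariant integral inverse. Decompose it along the 16 characters of \<open>V\<close>: each
  component is a 6 by 6 matrix, indexed by the switching classes, with an entry \<open>a\<close> on the diagonal, \<open>b\<close> at complementary
  pairs and \<open>c\<close> elsewhere. Its eigenvalues \<open>a + b + 4 c\<close>, \<open>a + b - 2 c\<close> and \<open>a - b\<close> are units, which
  forces \<open>a \<le> 1\<close>. Averaging over the characters, the diagonal entries of \<open>Z\<close> are at most 1, so
  each row of \<open>y\<close> has exactly one nonzero entry and \<open>H\<^sub>1\<close> fixes a coset of \<open>H\<^sub>2\<close>. Then \<open>H\<^sub>1\<close> fixes a matrix in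
  the second orbit. As \<open>H\<^sub>1\<close> is 2-transitive on the vertices, this matrix is \<open>S\<close> or \<open>-S\<close>, but neither lies
  in the second orbit.\<close>

section \<open>Subfields of the complex numbers and embeddings\<close>

text \<open>Only products of two square roots are adjoined because an automorphism then determines
  its signs up to a common factor, and the products of two signs are exactly what switching a Seidel
  matrix uses. With 360 * 16 elements in \<open>G\<close> and 60 in each stabilizer, the index is 96
  = 6 * 16: six switching classes in an orbit, and sixteen matrices in each class. Cyclic groups are
  solvable, so the two permutation modules are already isomorphic over the rationals and no
  character separates them. What separates them is integrality together with positivity: a form that
  is integral with integral inverse has components with eigenvalues 1 or -1, while the diagonal of a
  matrix times its transpose consists of sums of squares. Solvability of \<open>K\<close> enters
  only through a nontrivial element commuting with all its conjugates. The simple group of order 60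
  has no such element, and it does fix a matrix in one orbit and none in the other. All finite
  verifications concern permutations of six points, never elements of \<open>G\<close>.\<close>

definition csubfield :: "complex set \<Rightarrow> bool" where
  "csubfield K \<longleftrightarrow> 1 \<in> K \<and> (\<forall>x\<in>K. \<forall>y\<in>K. x - y \<in> K \<and> x * y \<in> K) \<and> (\<forall>x\<in>K. inverse x \<in> K)"

text \<open>The coefficient set need not be a ring: later it is also a prime ideal \<open>P\<close>,
  and \<open>polys_over P\<close> is then an ideal of polynomials.\<close>

definition polys_over :: "complex set \<Rightarrow> complex poly set" where
  "polys_over K = {p. \<forall>i. coeff p i \<in> K}"

text \<open>Nothing is required outside \<open>K\<close>, so extending an embedding means finding
  another total function that agrees with it on \<open>K\<close>.\<close>

definition embedding :: "complex set \<Rightarrow> (complex \<Rightarrow> complex) \<Rightarrow> bool" where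
  "embedding K h \<longleftrightarrow> h 1 = 1 \<and> (\<forall>x\<in>K. \<forall>y\<in>K. h (x + y) = h x + h y \<and> h (x * y) = h x * h y)"

definition csubring :: "complex set \<Rightarrow> bool" where
  "csubring R \<longleftrightarrow> 1 \<in> R \<and> (\<forall>x\<in>R. \<forall>y\<in>R. x - y \<in> R \<and> x * y \<in> R)"

locale csubr =
  fixes K :: "complex set"
  assumes csubring: "csubring K"
begin

lemma one_mem [simp]: "1 \<in> K" and diff_mem: "x \<in> K \<Longrightarrow> y \<in> K \<Longrightarrow> x - y \<in> K"
  and mult_mem: "x \<in> K \<Longrightarrow> y \<in> K \<Longrightarrow> x * y \<in> K"
  using csubring by (auto simp: csubring_def)

lemma zero_mem [simp]: "0 \<in> K"
  using diff_mem[of 1 1] by simp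

lemma uminus_mem: "x \<in> K \<Longrightarrow> - x \<in> K"
  using diff_mem[of 0 x] by simp

lemma add_mem: "x \<in> K \<Longrightarrow> y \<in> K \<Longrightarrow> x + y \<in> K"
  using diff_mem[of x "-y"] uminus_mem[of y] by simp

lemma power_mem: "x \<in> K \<Longrightarrow> x ^ n \<in> K"
  by (induction n) (auto intro: mult_mem)

lemma sum_mem: "(\<And>i. i \<in> I \<Longrightarrow> f i \<in> K) \<Longrightarrow> sum f I \<in> K"
  by (induction I rule: infinite_finite_induct) (auto intro: add_mem)

lemma prod_mem: "(\<And>i. i \<in> I \<Longrightarrow> f i \<in> K) \<Longrightarrow> prod f I \<in> K"
  by (induction I rule: infinite_finite_induct) (auto intro: mult_mem)

lemma of_nat_mem: "of_nat n \<in> K"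
  by (induction n) (auto intro: add_mem)

lemma of_int_mem: "of_int n \<in> K"
  by (cases n rule: int_cases2) (auto simp: of_nat_mem intro: uminus_mem)

lemmas ring_mems = diff_mem mult_mem uminus_mem add_mem power_mem sum_mem prod_mem of_nat_mem of_int_mem

lemma polys_over_simps [simp]: "0 \<in> polys_over K" "1 \<in> polys_over K"
  by (auto simp: polys_over_def)

lemma polys_over_add: "p \<in> polys_over K \<Longrightarrow> q \<in> polys_over K \<Longrightarrow> p + q \<in> polys_over K"
  and polys_over_diff: "p \<in> polys_over K \<Longrightarrow> q \<in> polys_over K \<Longrightarrow> p - q \<in> polys_over K"
  and polys_over_uminus: "p \<in> polys_over K \<Longrightarrow> - p \<in> polys_over K"
  and polys_over_mult: "p \<in> polys_over K \<Longrightarrow> q \<in> polys_over K \<Longrightarrow> p * q \<in> polys_over K"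
  and polys_over_smult: "c \<in> K \<Longrightarrow> p \<in> polys_over K \<Longrightarrow> smult c p \<in> polys_over K"
  and polys_over_monom: "c \<in> K \<Longrightarrow> monom c n \<in> polys_over K"
  and polys_over_pCons: "c \<in> K \<Longrightarrow> p \<in> polys_over K \<Longrightarrow> pCons c p \<in> polys_over K"
  by (auto simp: polys_over_def coeff_mult coeff_pCons coeff_monom split: nat.split intro!: ring_mems)

lemma polys_over_sum: "(\<And>i. i \<in> I \<Longrightarrow> f i \<in> polys_over K) \<Longrightarrow> sum f I \<in> polys_over K"
  by (induction I rule: infinite_finite_induct) (auto intro: polys_over_add)

lemma polys_over_prod: "(\<And>i. i \<in> I \<Longrightarrow> f i \<in> polys_over K) \<Longrightarrow> prod f I \<in> polys_over K"
  by (induction I rule: infinite_finite_induct) (auto intro: polys_over_mult)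

lemmas polys_overs = polys_over_add polys_over_diff polys_over_uminus polys_over_mult polys_over_smult
  polys_over_monom polys_over_pCons polys_over_sum polys_over_prod

lemma poly_mem: "p \<in> polys_over K \<Longrightarrow> x \<in> K \<Longrightarrow> poly p x \<in> K"
  by (auto simp: poly_altdef polys_over_def intro!: ring_mems)

text \<open>Division by a monic polynomial never divides by a coefficient, so a subring suffices.
  Each round cancels the leading term of \<open>p\<close> by a monomial multiple of
  \<open>m\<close>.\<close>

lemma polys_over_division:
  assumes "m \<in> polys_over K" "lead_coeff m = 1" "p \<in> polys_over K"
  shows "\<exists>q\<in>polys_over K. \<exists>r\<in>polys_over K. p = q * m + r \<and> (r = 0 \<or> degree r < degree m)"
  using assms(3)
proof (induction "degree p" arbitrary: p rule: less_induct)
  case less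
  show ?case
  proof (cases "p = 0 \<or> degree p < degree m")
    case True
    then show ?thesis using less.prems by (intro bexI[of _ 0] bexI[of _ p]) auto
  next
    case False
    then have p0: "p \<noteq> 0" and dm: "degree m \<le> degree p" by auto
    have m0: "m \<noteq> 0" using assms(2) by auto
    define t where "t = monom (lead_coeff p) (degree p - degree m)"
    define p' where "p' = p - t * m"
    have t: "t \<in> polys_over K" using less.prems by (auto simp: t_def polys_over_def intro!: ring_mems)
    have p': "p' \<in> polys_over K" unfolding p'_def by (intro polys_overs t less.prems assms)
    have dt: "degree t = degree p - degree m" using p0 by (simp add: t_def degree_monom_eq)
    have t0: "t \<noteq> 0" using p0 by (simp add: t_def)
    have dtm: "degree (t * m) = degree p" using t0 m0 dm dt by (simp add: degree_mult_eq)
    have ctm: "coeff (t * m) (degree p) = lead_coeff p"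
      using lead_coeff_mult[of t m] assms(2) dt by (simp add: dtm) (simp add: t_def)
    have small: "p' = 0 \<or> degree p' < degree p"
    proof -
      have "degree p' \<le> degree p" unfolding p'_def by (intro degree_diff_le) (auto simp: dtm)
      moreover have "coeff p' (degree p) = 0" by (simp add: p'_def ctm)
      ultimately show ?thesis
        by (metis eq_zero_or_degree_less)
    qed
    have "\<exists>q\<in>polys_over K. \<exists>r\<in>polys_over K. p' = q * m + r \<and> (r = 0 \<or> degree r < degree m)"
    proof (cases "p' = 0")
      case True
      then show ?thesis by (intro bexI[of _ 0]) auto
    next
      case False
      then show ?thesis using less.hyps[OF _ p'] small by auto
    qed
    then obtain q r where "q \<in> polys_over K" "r \<in> polys_over K" "p' = q * m + r" "r = 0 \<or> degree r < degree m"
      by auto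
    then show ?thesis
      by (intro bexI[of _ "q + t"] bexI[of _ r]) (auto simp: p'_def algebra_simps intro: polys_overs t)
  qed
qed

end

locale csub =
  fixes K :: "complex set"
  assumes csub: "csubfield K"

sublocale csub \<subseteq> csubr
  using csub by unfold_locales (auto simp: csubfield_def csubring_def)

context csub
begin

lemma inverse_mem: "x \<in> K \<Longrightarrow> inverse x \<in> K"
  using csub by (auto simp: csubfield_def)

lemma divide_mem: "x \<in> K \<Longrightarrow> y \<in> K \<Longrightarrow> x / y \<in> K"
  by (simp add: divide_inverse mult_mem inverse_mem)

lemma Rats_mem: "x \<in> \<rat> \<Longrightarrow> x \<in> K"
  by (elim Rats_cases') (auto intro: divide_mem of_int_mem)

lemmas mems = ring_mems inverse_mem divide_mem

end

lemma csubfield_Rats: "csubfield \<rat>"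
  by (auto simp: csubfield_def)

interpretation Rats: csub "\<rat>"
  by unfold_locales (rule csubfield_Rats)

locale cembedding = csub +
  fixes h :: "complex \<Rightarrow> complex"
  assumes emb: "embedding K h"
begin

lemma h_one [simp]: "h 1 = 1" and h_add: "x \<in> K \<Longrightarrow> y \<in> K \<Longrightarrow> h (x + y) = h x + h y"
  and h_mult: "x \<in> K \<Longrightarrow> y \<in> K \<Longrightarrow> h (x * y) = h x * h y"
  using emb by (auto simp: embedding_def)

lemma h_zero [simp]: "h 0 = 0"
  using h_add[of 0 0] by simp

lemma h_uminus: "x \<in> K \<Longrightarrow> h (- x) = - h x"
  using h_add[of x "-x"] by (simp add: uminus_mem add_eq_0_iff)

lemma h_diff: "x \<in> K \<Longrightarrow> y \<in> K \<Longrightarrow> h (x - y) = h x - h y"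
  using h_add[of x "-y"] by (simp add: uminus_mem h_uminus)

lemma h_inverse: "x \<in> K \<Longrightarrow> h (inverse x) = inverse (h x)"
  using h_mult[of x "inverse x"] by (cases "x = 0") (auto simp: inverse_mem inverse_unique)

lemma h_eq_0: "x \<in> K \<Longrightarrow> h x = 0 \<Longrightarrow> x = 0"
  using h_mult[of x "inverse x"] by (cases "x = 0") (auto simp: inverse_mem)

lemma h_inj: "inj_on h K"
  using h_diff h_eq_0 diff_mem by (intro inj_onI) (metis eq_iff_diff_eq_0)

lemma h_power: "x \<in> K \<Longrightarrow> h (x ^ n) = h x ^ n"
  by (induction n) (auto simp: h_mult power_mem)

lemma h_sum: "(\<And>i. i \<in> I \<Longrightarrow> f i \<in> K) \<Longrightarrow> h (sum f I) = (\<Sum>i\<in>I. h (f i))"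
  by (induction I rule: infinite_finite_induct) (auto simp: h_add sum_mem)

lemma h_prod: "(\<And>i. i \<in> I \<Longrightarrow> f i \<in> K) \<Longrightarrow> h (prod f I) = (\<Prod>i\<in>I. h (f i))"
  by (induction I rule: infinite_finite_induct) (auto simp: h_mult prod_mem)

lemma h_of_nat [simp]: "h (of_nat n) = of_nat n"
  by (induction n) (auto simp: h_add of_nat_mem)

lemma h_of_int [simp]: "h (of_int n) = of_int n"
  by (cases n rule: int_cases2) (auto simp: h_uminus of_nat_mem)

lemma h_Rats: "x \<in> \<rat> \<Longrightarrow> h x = x"
  by (elim Rats_cases') (auto simp: divide_inverse h_mult h_inverse of_int_mem inverse_mem)

lemma map_poly_add: "p \<in> polys_over K \<Longrightarrow> q \<in> polys_over K \<Longrightarrow> map_poly h (p + q) = map_poly h p + map_poly h q"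
  and map_poly_mult: "p \<in> polys_over K \<Longrightarrow> q \<in> polys_over K \<Longrightarrow> map_poly h (p * q) = map_poly h p * map_poly h q"
  by (auto simp: poly_eq_iff coeff_map_poly coeff_mult polys_over_def h_add h_sum h_mult mems)

lemma poly_map_poly: "p \<in> polys_over K \<Longrightarrow> x \<in> K \<Longrightarrow> poly (map_poly h p) (h x) = h (poly p x)"
proof (induction p)
  case (pCons a p)
  have "a \<in> K" using pCons.prems(1) by (auto simp: polys_over_def dest: spec[of _ 0])
  moreover have "p \<in> polys_over K"
    using pCons.prems(1) by (auto simp: polys_over_def coeff_pCons split: nat.splits dest: spec[of _ "Suc _"])
  ultimately show ?case using pCons by (simp add: map_poly_pCons h_add h_mult poly_mem mems)
qed auto

lemma map_poly_Rats: "p \<in> polys_over \<rat> \<Longrightarrow> map_poly h p = p"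
  by (auto simp: poly_eq_iff coeff_map_poly polys_over_def h_Rats)

end

section \<open>Simple algebraic extensions and the extension of embeddings\<close>

definition adjoin :: "complex set \<Rightarrow> complex \<Rightarrow> complex set" where
  "adjoin K \<alpha> = {poly p \<alpha> |p. p \<in> polys_over K}"

text \<open>\<open>m\<close> is the minimal polynomial, characterized by minimal degree among the
  annihilating polynomials rather than by irreducibility.\<close>

locale simple_ext = csub +
  fixes \<alpha> :: complex and m :: "complex poly"
  assumes m_over: "m \<in> polys_over K" and monic: "lead_coeff m = 1" and root: "poly m \<alpha> = 0"
    and minimal: "\<And>p. p \<in> polys_over K \<Longrightarrow> poly p \<alpha> = 0 \<Longrightarrow> degree p < degree m \<Longrightarrow> p = 0"
begin

lemma vanishing_imp_multiple:
  assumes "p \<in> polys_over K" "poly p \<alpha> = 0"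
  shows "\<exists>q\<in>polys_over K. p = q * m"
proof -
  obtain q r where qr: "q \<in> polys_over K" "r \<in> polys_over K" "p = q * m + r" "r = 0 \<or> degree r < degree m"
    using polys_over_division[OF m_over monic assms(1)] by blast
  have "poly r \<alpha> = 0" using qr(3) assms(2) root by simp
  then have "r = 0" using qr(2,4) minimal by blast
  then show ?thesis using qr by auto
qed

text \<open>A Euclidean descent: dividing \<open>m\<close> by \<open>r\<close> leaves a remainder of
  smaller degree whose value at \<alpha> is a multiple of the value of \<open>r\<close>, so an
  inverse of the former gives one of the latter. The remainder does not vanish at \<alpha>, for
  otherwise \<open>m\<close> would be a product and a factor of smaller degree would vanish
  there.\<close>

lemma inverse_in_adjoin:
  assumes "q \<in> polys_over K" "poly q \<alpha> \<noteq> 0"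
  shows "\<exists>u\<in>polys_over K. poly u \<alpha> * poly q \<alpha> = 1"
proof -
  have *: "\<exists>u\<in>polys_over K. poly u \<alpha> * poly r \<alpha> = 1"
    if "r \<in> polys_over K" "poly r \<alpha> \<noteq> 0" "degree r < degree m" for r
    using that
  proof (induction "degree r" arbitrary: r rule: less_induct)
    case less
    have r0: "r \<noteq> 0" using less.prems by auto
    define c where "c = lead_coeff r"
    have c: "c \<in> K" "c \<noteq> 0" using less.prems r0 by (auto simp: c_def polys_over_def)
    define r1 where "r1 = smult (inverse c) r"
    have r1: "r1 \<in> polys_over K" "lead_coeff r1 = 1" "degree r1 = degree r" "poly r1 \<alpha> \<noteq> 0"
      using c less.prems r0 by (auto simp: r1_def c_def intro!: polys_overs mems)
    show ?case
    proof (cases "degree r = 0")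
      case True
      then obtain a where a: "r = [:a:]" by (metis degree_eq_zeroE)
      have "a \<in> K" using less.prems(1) a by (auto simp: polys_over_def dest: spec[of _ 0])
      then show ?thesis using a less.prems(2)
        by (intro bexI[of _ "[:inverse a:]"]) (auto intro!: polys_overs mems)
    next
      case False
      obtain k r' where kr: "k \<in> polys_over K" "r' \<in> polys_over K" "m = k * r1 + r'" "r' = 0 \<or> degree r' < degree r"
        using polys_over_division[OF r1(1,2) m_over] r1(3) by auto
      have dr': "degree r' < degree r" using kr(4) False by auto
      have "poly r' \<alpha> \<noteq> 0"
      proof
        assume 0: "poly r' \<alpha> = 0"
        then have "r' = 0" using minimal[OF kr(2)] dr' less.prems(3) by auto
        then have mk: "m = k * r1" using kr(3) by simp
        have "k \<noteq> 0" "r1 \<noteq> 0" using mk monic by auto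
        then have "degree k < degree m" using mk False r1(3) by (simp add: degree_mult_eq)
        moreover have "poly k \<alpha> = 0" using root r1(4) unfolding mk by simp
        ultimately show False using minimal[OF kr(1)] \<open>k \<noteq> 0\<close> by auto
      qed
      then obtain u where u: "u \<in> polys_over K" "poly u \<alpha> * poly r' \<alpha> = 1"
        using less.hyps[OF dr' kr(2)] dr' less.prems(3) by auto
      have "poly r' \<alpha> = - poly k \<alpha> * inverse c * poly r \<alpha>"
        using root unfolding kr(3) by (simp add: r1_def add_eq_0_iff)
      then show ?thesis using u
        by (intro bexI[of _ "u * smult (- inverse c) k"]) (auto intro!: polys_overs mems kr c simp: mult_ac)
    qed
  qed
  obtain k r where kr: "k \<in> polys_over K" "r \<in> polys_over K" "q = k * m + r" "r = 0 \<or> degree r < degree m"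
    using polys_over_division[OF m_over monic assms(1)] by auto
  have "poly q \<alpha> = poly r \<alpha>" using kr(3) root by simp
  then show ?thesis using * kr assms(2) by (metis poly_0)
qed

lemma csubfield_adjoin: "csubfield (adjoin K \<alpha>)"
  unfolding csubfield_def
proof (intro conjI ballI)
  show "1 \<in> adjoin K \<alpha>" by (auto simp: adjoin_def intro!: exI[of _ 1])
  fix x assume "x \<in> adjoin K \<alpha>"
  then obtain p where p: "x = poly p \<alpha>" "p \<in> polys_over K" by (auto simp: adjoin_def)
  show "inverse x \<in> adjoin K \<alpha>"
  proof (cases "x = 0")
    case True
    then show ?thesis by (auto simp: adjoin_def intro!: exI[of _ 0])
  next
    case False
    then obtain u where u: "u \<in> polys_over K" "poly u \<alpha> * poly p \<alpha> = 1" using inverse_in_adjoin p by auto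
    have "inverse x = poly u \<alpha>" using u(2) p(1) by (metis inverse_unique mult.commute)
    then show ?thesis using u by (auto simp: adjoin_def)
  qed
  fix y assume "y \<in> adjoin K \<alpha>"
  then obtain q where q: "y = poly q \<alpha>" "q \<in> polys_over K" by (auto simp: adjoin_def)
  show "x - y \<in> adjoin K \<alpha>" using p q by (auto simp: adjoin_def intro!: exI[of _ "p - q"] polys_overs)
  show "x * y \<in> adjoin K \<alpha>" using p q by (auto simp: adjoin_def intro!: exI[of _ "p * q"] polys_overs)
qed

lemma subset_adjoin: "K \<subseteq> adjoin K \<alpha>"
  by (auto simp: adjoin_def intro!: exI[of _ "[:_:]"] polys_overs)

lemma gen_in_adjoin: "\<alpha> \<in> adjoin K \<alpha>"
  by (auto simp: adjoin_def intro!: exI[of _ "[:0,1:]"] polys_overs)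

text \<open>Two polynomials with the same value at \<alpha> differ by a multiple of
  \<open>m\<close>, and the transported \<open>m\<close> vanishes at \<beta>. So evaluating the
  transported polynomial at \<beta> is well defined.\<close>

lemma extend_embedding:
  assumes "embedding K h" "poly (map_poly h m) \<beta> = 0"
  shows "\<exists>h'. embedding (adjoin K \<alpha>) h' \<and> (\<forall>x\<in>K. h' x = h x) \<and> h' \<alpha> = \<beta>"
proof -
  interpret h: cembedding K h by unfold_locales (rule assms)
  have wd: "poly (map_poly h p) \<beta> = poly (map_poly h q) \<beta>"
    if pq: "p \<in> polys_over K" "q \<in> polys_over K" "poly p \<alpha> = poly q \<alpha>" for p q
  proof -
    obtain k where k: "k \<in> polys_over K" "p - q = k * m"
      using vanishing_imp_multiple[of "p - q"] pq by (auto intro: polys_overs)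
    have "map_poly h p = map_poly h (q + k * m)" using k by (simp add: algebra_simps flip: k(2))
    also have "\<dots> = map_poly h q + map_poly h k * map_poly h m"
      using k pq m_over by (simp add: h.map_poly_add h.map_poly_mult polys_overs)
    finally show ?thesis using assms(2) by simp
  qed
  define pick where "pick x = (SOME p. p \<in> polys_over K \<and> poly p \<alpha> = x)" for x
  define h' where "h' x = poly (map_poly h (pick x)) \<beta>" for x
  have h': "h' (poly p \<alpha>) = poly (map_poly h p) \<beta>" if "p \<in> polys_over K" for p
  proof -
    have "pick (poly p \<alpha>) \<in> polys_over K \<and> poly (pick (poly p \<alpha>)) \<alpha> = poly p \<alpha>"
      unfolding pick_def by (rule someI[of _ p]) (use that in auto)
    then show ?thesis unfolding h'_def using wd that by blast
  qed
  have "embedding (adjoin K \<alpha>) h'"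
    unfolding embedding_def
  proof (intro conjI ballI)
    show "h' 1 = 1" using h'[of 1] by (simp add: map_poly_1)
    fix x y assume "x \<in> adjoin K \<alpha>" "y \<in> adjoin K \<alpha>"
    then obtain p q where p: "x = poly p \<alpha>" "p \<in> polys_over K" and q: "y = poly q \<alpha>" "q \<in> polys_over K"
      by (auto simp: adjoin_def)
    show "h' (x + y) = h' x + h' y"
      using h'[of "p + q"] p q by (simp add: h' polys_overs h.map_poly_add)
    show "h' (x * y) = h' x * h' y"
      using h'[of "p * q"] p q by (simp add: h' polys_overs h.map_poly_mult)
  qed
  moreover have "h' x = h x" if "x \<in> K" for x
    using h'[of "[:x:]"] that by (simp add: polys_overs map_poly_pCons)
  moreover have "h' \<alpha> = \<beta>"
    using h'[of "[:0,1:]"] by (simp add: polys_overs map_poly_pCons)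
  ultimately show ?thesis by blast
qed

end

lemma (in csub) obtain_minimal_poly:
  assumes "p \<in> polys_over K" "p \<noteq> 0" "poly p \<alpha> = 0"
  obtains m where "simple_ext K \<alpha> m"
proof -
  define P where "P n \<longleftrightarrow> (\<exists>p. p \<in> polys_over K \<and> p \<noteq> 0 \<and> poly p \<alpha> = 0 \<and> degree p = n)" for n
  have "P (degree p)" using assms by (auto simp: P_def)
  then have "P (LEAST n. P n)" by (rule LeastI)
  then obtain q where q: "q \<in> polys_over K" "q \<noteq> 0" "poly q \<alpha> = 0" "degree q = (LEAST n. P n)"
    by (auto simp: P_def)
  define m where "m = smult (inverse (lead_coeff q)) q"
  have "lead_coeff q \<in> K" using q by (auto simp: polys_over_def)
  then have "m \<in> polys_over K" "lead_coeff m = 1" "poly m \<alpha> = 0"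
    using q(1-3) by (auto simp: m_def intro!: polys_overs mems)
  moreover have "degree m = (LEAST n. P n)"
    using q(2,4) degree_smult_eq[of "inverse (lead_coeff q)" q] leading_coeff_0_iff[of q] by (metis m_def inverse_nonzero_iff_nonzero)
  moreover have "r = 0" if "r \<in> polys_over K" "poly r \<alpha> = 0" "degree r < (LEAST n. P n)" for r
    using that not_less_Least[of "degree r" P] by (auto simp: P_def)
  ultimately have "simple_ext K \<alpha> m" by unfold_locales auto
  then show ?thesis by (rule that)
qed

text \<open>The transported minimal polynomial has a complex root, and \<alpha> can be sent to
  it.\<close>

lemma extend_embedding_one:
  assumes "csubfield K" "embedding K h" "p \<in> polys_over K" "p \<noteq> 0" "poly p \<alpha> = 0"
  shows "\<exists>K' h'. csubfield K' \<and> K \<subseteq> K' \<and> \<alpha> \<in> K' \<and> embedding K' h' \<and> (\<forall>x\<in>K. h' x = h x)"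
proof -
  interpret cembedding K h by unfold_locales (use assms in auto)
  obtain m where "simple_ext K \<alpha> m" using obtain_minimal_poly[OF assms(3-5)] .
  then interpret simple_ext K \<alpha> m .
  have d: "degree m \<noteq> 0" using root monic by (metis degree_eq_zeroE lead_coeff_pCons(2) poly_0 poly_pCons add.right_neutral mult_zero_right zero_neq_one)
  have "degree (map_poly h m) = degree m"
    by (rule map_poly_degree_eq) (use monic in auto)
  then obtain \<beta> where "poly (map_poly h m) \<beta> = 0"
    using fundamental_theorem_of_algebra_alt d by (metis degree_pCons_0 constant_degree fundamental_theorem_of_algebra)
  then show ?thesis using extend_embedding[OF emb] csubfield_adjoin subset_adjoin gen_in_adjoin by blast
qed

lemma extend_embedding_finite:
  assumes "finite S" "csubfield K" "embedding K h"
    "\<And>s. s \<in> S \<Longrightarrow> \<exists>p\<in>polys_over \<rat>. p \<noteq> 0 \<and> poly p s = 0"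
  shows "\<exists>K' h'. csubfield K' \<and> K \<subseteq> K' \<and> S \<subseteq> K' \<and> embedding K' h' \<and> (\<forall>x\<in>K. h' x = h x)"
  using assms(1,4)
proof (induction S)
  case empty
  then show ?case using assms by blast
next
  case (insert s S)
  then obtain K' h' where K': "csubfield K'" "K \<subseteq> K'" "S \<subseteq> K'" "embedding K' h'" "\<forall>x\<in>K. h' x = h x"
    by auto
  interpret csub K' by unfold_locales (rule K')
  obtain p where p: "p \<in> polys_over \<rat>" "p \<noteq> 0" "poly p s = 0" using insert.prems by blast
  have "p \<in> polys_over K'" using p(1) Rats_mem by (auto simp: polys_over_def)
  from extend_embedding_one[OF K'(1,4) this p(2,3)] obtain K'' h'' where
    "csubfield K''" "K' \<subseteq> K''" "s \<in> K''" "embedding K'' h''" "\<forall>x\<in>K'. h'' x = h' x" by blast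
  then show ?case using K' by (intro exI[of _ K''] exI[of _ h'']) auto
qed

definition generated_field :: "complex set \<Rightarrow> complex set" where
  "generated_field S = \<Inter>{K. csubfield K \<and> S \<subseteq> K}"

lemma csubfield_generated: "csubfield (generated_field S)"
  by (auto simp: generated_field_def csubfield_def)

lemma generated_field_superset: "S \<subseteq> generated_field S"
  by (auto simp: generated_field_def)

lemma generated_field_least: "csubfield K \<Longrightarrow> S \<subseteq> K \<Longrightarrow> generated_field S \<subseteq> K"
  by (auto simp: generated_field_def)

text \<open>The minimal polynomial of an irrational \<open>x\<close> has a second root. Otherwise it
  would be a power of a linear factor, and its second highest coefficient, \<open>-n * x\<close>,
  would be rational; characteristic 0 replaces any discussion of separability.\<close>

lemma exists_moving_embedding:
  assumes "p \<in> polys_over \<rat>" "p \<noteq> 0" "poly p x = 0" "x \<notin> \<rat>"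
  shows "\<exists>K h. csubfield K \<and> x \<in> K \<and> embedding K h \<and> h x \<noteq> x"
proof -
  obtain m where "simple_ext \<rat> x m" using Rats.obtain_minimal_poly[OF assms(1-3)] .
  then interpret simple_ext "\<rat>" x m .
  have emb: "embedding \<rat> id" by (auto simp: embedding_def)
  have "\<exists>\<beta>. poly m \<beta> = 0 \<and> \<beta> \<noteq> x"
  proof (rule ccontr)
    assume no: "\<not> ?thesis"
    define n where "n = order x m"
    have m0: "m \<noteq> 0" using monic by auto
    obtain q where q: "m = [:-x, 1:] ^ n * q" "\<not> [:-x, 1:] dvd q"
      using order_decomp[OF m0] by (auto simp: n_def)
    have "poly q z \<noteq> 0" for z
      using no q by (cases "z = x") (auto simp: poly_eq_0_iff_dvd poly_power)
    then have "degree q = 0"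
      using fundamental_theorem_of_algebra_alt[of q] by (metis degree_pCons_0 fundamental_theorem_of_algebra constant_degree)
    then obtain c where c: "q = [:c:]" by (metis degree_eq_zeroE)
    have "lead_coeff ([:-x, 1:] ^ n) = 1" by (simp add: lead_coeff_power)
    then have "c = 1" using monic q(1) unfolding c by (simp add: lead_coeff_mult del: mult_pCons_right)
    then have m: "m = [:-x, 1:] ^ n" using q c by simp
    have n0: "n > 0" using root m by (cases n) auto
    have "coeff ([:-x, 1:] ^ n) (n - 1) = - of_nat n * x"
      using coeff_linear_poly_power[of "n - 1" n "-x" 1] n0
      by (cases n) (auto simp: algebra_simps)
    then have "of_nat n * x \<in> \<rat>" using m_over m by (auto simp: polys_over_def) (metis Rats_minus_iff)
    then have "of_nat n * x / of_nat n \<in> \<rat>" by (intro Rats_divide) auto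
    then show False using assms(4) n0 by simp
  qed
  then obtain \<beta> where b: "poly m \<beta> = 0" "\<beta> \<noteq> x" by blast
  have "poly (map_poly id m) \<beta> = 0" using b by (simp add: map_poly_id)
  from extend_embedding[OF emb this] obtain h' where "embedding (adjoin \<rat> x) h'" "h' x = \<beta>" by blast
  then show ?thesis using b csubfield_adjoin gen_in_adjoin by blast
qed

section \<open>Galois groups of normal number fields\<close>

lemma CF_field: "field complex_field"
  by (rule field_from_type_algebra)

lemma CF_domain: "domain complex_field"
  using CF_field by (rule field.axioms)

interpretation CF: ring complex_field
  by (rule ring_from_type_algebra)

lemma CF_simps [simp]: "carrier complex_field = UNIV" "x \<otimes>\<^bsub>complex_field\<^esub> y = x * y"
  "\<one>\<^bsub>complex_field\<^esub> = 1" "\<zero>\<^bsub>complex_field\<^esub> = 0" "x \<oplus>\<^bsub>complex_field\<^esub> y = x + y"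
  by (simp_all add: ring_of_type_algebra_def)

lemma CF_uminus [simp]: "\<ominus>\<^bsub>complex_field\<^esub> x = - x"
  by (rule CF.minus_equality) auto

lemma CF_inverse: "x \<noteq> 0 \<Longrightarrow> inv\<^bsub>complex_field\<^esub> x = inverse x"
  by (rule comm_monoid.comm_inv_char[OF cring.axioms(2)[OF cring_from_type_algebra]]) auto

lemma CF_pow [simp]: "x [^]\<^bsub>complex_field\<^esub> (n::nat) = x ^ n"
  by (induction n) auto

lemma subfield_iff_csubfield: "subfield K complex_field \<longleftrightarrow> csubfield K"
proof
  assume K: "subfield K complex_field"
  note sr = subringE[OF subfieldE(1)[OF K]]
  show "csubfield K"
    unfolding csubfield_def
  proof (intro conjI ballI)
    show "1 \<in> K" using sr(3) by simp
    fix x assume x: "x \<in> K"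
    show "inverse x \<in> K"
      using CF.subfield_m_inv(1)[OF K, of x] x sr(2) by (cases "x = 0") (auto simp: CF_inverse)
    fix y assume y: "y \<in> K"
    show "x - y \<in> K" using sr(7)[OF x sr(5)[OF y]] by simp
    show "x * y \<in> K" using sr(6)[OF x y] by simp
  qed
next
  assume "csubfield K"
  then interpret csub K by unfold_locales
  have "subring K complex_field"
    by (rule CF.subringI) (auto intro: mems)
  then show "subfield K complex_field"
    by (rule field.subfieldI'[OF CF_field]) (auto simp: CF_inverse intro: mems)
qed

text \<open>Polynomials of the algebra library are coefficient lists with the leading coefficient
  first, whence the reversal.\<close>

lemma CF_eval: "CF.eval l x = poly (Poly (rev l)) x"
  by (induction l) (auto simp: Poly_append poly_monom Poly_snoc algebra_simps)

lemma CF_algebraic_iff: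
  assumes "csubfield K"
  shows "(CF.algebraic over K) x \<longleftrightarrow> (\<exists>p\<in>polys_over K. p \<noteq> 0 \<and> poly p x = 0)"
proof
  interpret csub K by unfold_locales (rule assms)
  have K: "subring K complex_field" using assms by (intro subfieldE(1)) (simp add: subfield_iff_csubfield)
  {
    assume "(CF.algebraic over K) x"
    then obtain l where l: "l \<in> carrier (univ_poly complex_field K)" "l \<noteq> []" "CF.eval l x = 0"
      using domain.algebraicE[OF CF_domain K, of x] by auto
    have 1: "set l \<subseteq> K" "hd l \<noteq> 0" using l by (auto simp: univ_poly_def polynomial_def)
    have "Poly (rev l) \<in> polys_over K"
      using 1(1) by (auto simp: polys_over_def nth_default_def) (metis in_set_conv_nth length_rev set_rev subsetD)
    moreover have "Poly (rev l) \<noteq> 0"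
    proof
      assume "Poly (rev l) = 0"
      then have "coeff (Poly (rev l)) (length l - 1) = 0" by simp
      then show False using l(2) 1(2) by (simp add: nth_default_def rev_nth hd_conv_nth)
    qed
    ultimately show "\<exists>p\<in>polys_over K. p \<noteq> 0 \<and> poly p x = 0"
      using l(3) by (auto simp: CF_eval)
  }
  {
    assume "\<exists>p\<in>polys_over K. p \<noteq> 0 \<and> poly p x = 0"
    then obtain p where p: "p \<in> polys_over K" "p \<noteq> 0" "poly p x = 0" by blast
    define l where "l = rev (coeffs p)"
    have "l \<noteq> []" using p by (simp add: l_def)
    moreover have "l \<in> carrier (univ_poly complex_field K)"
    proof -
      have "set l \<subseteq> K" using p(1) by (auto simp: l_def polys_over_def coeffs_def)
      moreover have "hd l \<noteq> 0" using p(2) by (simp add: l_def hd_rev last_coeffs_eq_coeff_degree)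
      ultimately show ?thesis by (auto simp: univ_poly_def polynomial_def)
    qed
    moreover have "CF.eval l x = \<zero>\<^bsub>complex_field\<^esub>" using p(3) by (simp add: CF_eval l_def)
    ultimately show "(CF.algebraic over K) x" by (intro CF.algebraicI)
  }
qed

lemma csubfield_algebraic: "csubfield {x. \<exists>p\<in>polys_over \<rat>. p \<noteq> 0 \<and> poly p x = 0}"
  using field.subfield_of_algebraics[OF CF_field, of "\<rat>"]
  by (simp add: subfield_iff_csubfield csubfield_Rats CF_algebraic_iff)

text \<open>Provides the integer parameter in the primitive element arguments: each unwanted
  coincidence is a root of one of finitely many nonzero polynomials.\<close>

lemma exists_nonroot:
  fixes P :: "complex poly set"
  assumes "finite P" "0 \<notin> P"
  shows "\<exists>t::nat. \<forall>p\<in>P. poly p (of_nat t) \<noteq> 0"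
proof -
  have "finite (\<Union>p\<in>P. {x. poly p x = 0})"
    using assms by (auto intro!: poly_roots_finite)
  moreover have "infinite (range (of_nat :: nat \<Rightarrow> complex))"
    by (intro range_inj_infinite inj_of_nat)
  ultimately obtain x where "x \<in> range (of_nat :: nat \<Rightarrow> complex)" "x \<notin> (\<Union>p\<in>P. {x. poly p x = 0})"
    by (meson infinite_super subsetI)
  then show ?thesis by blast
qed

section \<open>The Galois group of a field over the rationals and its orbits\<close>

context csub
begin

abbreviation "G \<equiv> Gal K \<rat>"

lemma Gal_iff:
  assumes "F \<subseteq> K"
  shows "\<sigma> \<in> carrier (Gal K F) \<longleftrightarrow>
    \<sigma> \<in> extensional K \<and> bij_betw \<sigma> K K \<and> embedding K \<sigma> \<and> (\<forall>x\<in>F. \<sigma> x = x)"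
proof -
  have "bij_betw \<sigma> K K \<Longrightarrow> \<sigma> \<in> K \<rightarrow> K" by (auto dest: bij_betwE)
  then show ?thesis
    by (auto simp: Gal_def BijGroup_def Bij_def ring_iso_def ring_hom_def embedding_def)
qed

lemma Gal_app_mem: "\<sigma> \<in> carrier G \<Longrightarrow> x \<in> K \<Longrightarrow> \<sigma> x \<in> K"
  by (auto simp: Gal_def Bij_def dest: bij_betwE)

text \<open>Embeddings fix every rational number, so the condition of fixing the base field
  disappears.\<close>

lemma G_iff: "\<sigma> \<in> carrier G \<longleftrightarrow> \<sigma> \<in> extensional K \<and> bij_betw \<sigma> K K \<and> embedding K \<sigma>"
proof -
  have "\<rat> \<subseteq> K" using Rats_mem by blast
  moreover have "embedding K \<sigma> \<Longrightarrow> \<forall>x\<in>\<rat>. \<sigma> x = x"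
    using cembedding.h_Rats[of K \<sigma>] by (simp add: cembedding_def cembedding_axioms_def csub_axioms)
  ultimately show ?thesis by (auto simp: Gal_iff)
qed

lemma G_cembedding: "\<sigma> \<in> carrier G \<Longrightarrow> cembedding K \<sigma>"
  by unfold_locales (auto simp: G_iff)

lemma Gal_mult: "\<sigma> \<in> carrier G \<Longrightarrow> \<tau> \<in> carrier G \<Longrightarrow> \<sigma> \<otimes>\<^bsub>G\<^esub> \<tau> = compose K \<sigma> \<tau>"
  by (auto simp: Gal_def BijGroup_def)

lemma Gal_mult_app: "\<sigma> \<in> carrier G \<Longrightarrow> \<tau> \<in> carrier G \<Longrightarrow> x \<in> K \<Longrightarrow> (\<sigma> \<otimes>\<^bsub>G\<^esub> \<tau>) x = \<sigma> (\<tau> x)"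
  by (simp add: Gal_mult compose_eq)

lemma Gal_one: "\<one>\<^bsub>Gal K F\<^esub> = (\<lambda>x\<in>K. x)"
  by (simp add: Gal_def BijGroup_def)

lemma Gal_eqI: "\<sigma> \<in> carrier G \<Longrightarrow> \<tau> \<in> carrier G \<Longrightarrow> (\<And>x. x \<in> K \<Longrightarrow> \<sigma> x = \<tau> x) \<Longrightarrow> \<sigma> = \<tau>"
  by (auto simp: G_iff intro: extensionalityI)

lemma group_G: "group G"
proof -
  have "subgroup (carrier G) (BijGroup K)"
  proof (rule group.subgroupI[OF group_BijGroup])
    show "carrier G \<subseteq> carrier (BijGroup K)" by (auto simp: Gal_def BijGroup_def)
    have "(\<lambda>x\<in>K. x) \<in> carrier G"
      by (auto simp: G_iff embedding_def mems bij_betw_def inj_on_def)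
    then show "carrier G \<noteq> {}" by blast
  next
    fix \<sigma> assume s: "\<sigma> \<in> carrier G"
    then have b: "bij_betw \<sigma> K K" by (auto simp: G_iff)
    interpret cembedding K \<sigma> by (rule G_cembedding[OF s])
    define \<tau> where "\<tau> = restrict (inv_into K \<sigma>) K"
    have bt: "bij_betw \<tau> K K" unfolding \<tau>_def using bij_betw_inv_into[OF b] by (simp cong: bij_betw_cong)
    have t: "\<tau> x \<in> K" "\<sigma> (\<tau> x) = x" if "x \<in> K" for x
      using bt that b by (auto simp: \<tau>_def bij_betw_def f_inv_into_f inv_into_into)
    have u: "\<tau> x = y" if "x \<in> K" "y \<in> K" "\<sigma> y = x" for x y
      using that t[of x] h_inj by (auto dest: inj_onD)
    have "\<tau> \<in> carrier G"
      using bt by (auto simp: G_iff embedding_def h_add h_mult t mems intro!: u) (simp add: \<tau>_def)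
    moreover have "inv\<^bsub>BijGroup K\<^esub> \<sigma> = \<tau>"
      using s by (simp add: inv_BijGroup \<tau>_def Gal_def)
    ultimately show "inv\<^bsub>BijGroup K\<^esub> \<sigma> \<in> carrier G" by simp
  next
    fix \<sigma> \<tau> assume st: "\<sigma> \<in> carrier G" "\<tau> \<in> carrier G"
    then interpret s: cembedding K \<sigma> + t: cembedding K \<tau> by (simp_all add: G_cembedding)
    have B: "\<sigma> \<in> Bij K" "\<tau> \<in> Bij K" using st by (auto simp: G_iff Bij_def)
    then have "compose K \<sigma> \<tau> \<in> Bij K" by (rule compose_Bij)
    moreover have "embedding K (compose K \<sigma> \<tau>)"
      using st by (auto simp: embedding_def compose_def t.h_add t.h_mult s.h_add s.h_mult mems Gal_app_mem)
    ultimately show "\<sigma> \<otimes>\<^bsub>BijGroup K\<^esub> \<tau> \<in> carrier G"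
      using B by (auto simp: BijGroup_def G_iff Bij_def)
  qed
  then have "group (BijGroup K\<lparr>carrier := carrier G\<rparr>)"
    by (rule subgroup.subgroup_is_group[OF _ group_BijGroup])
  moreover have "BijGroup K\<lparr>carrier := carrier G\<rparr> = G" by (simp add: Gal_def)
  ultimately show ?thesis by simp
qed

sublocale G: group G
  by (rule group_G)

lemma Gal_one_app [simp]: "x \<in> K \<Longrightarrow> \<one>\<^bsub>G\<^esub> x = x"
  by (simp add: Gal_one)

lemma Gal_inv_app: "\<sigma> \<in> carrier G \<Longrightarrow> x \<in> K \<Longrightarrow> \<sigma> ((inv\<^bsub>G\<^esub> \<sigma>) x) = x"
  "\<sigma> \<in> carrier G \<Longrightarrow> x \<in> K \<Longrightarrow> (inv\<^bsub>G\<^esub> \<sigma>) (\<sigma> x) = x"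
  using Gal_mult_app[of \<sigma> "inv\<^bsub>G\<^esub> \<sigma>" x] Gal_mult_app[of "inv\<^bsub>G\<^esub> \<sigma>" \<sigma> x] by simp_all

definition orb :: "complex \<Rightarrow> complex set" where
  "orb \<eta> = (\<lambda>\<sigma>. \<sigma> \<eta>) ` carrier G"

lemma orb_refl: "\<eta> \<in> K \<Longrightarrow> \<eta> \<in> orb \<eta>"
  by (auto simp: orb_def intro!: rev_image_eqI[of "\<one>\<^bsub>G\<^esub>"])

lemma orb_subset: "\<eta> \<in> K \<Longrightarrow> orb \<eta> \<subseteq> K"
  by (auto simp: orb_def Gal_app_mem)

lemma orb_perm:
  assumes "\<eta> \<in> K" "\<sigma> \<in> carrier G"
  shows "bij_betw \<sigma> (orb \<eta>) (orb \<eta>)"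
proof (rule bij_betwI[of _ _ _ "inv\<^bsub>G\<^esub> \<sigma>"])
  have *: "\<tau> x \<in> orb \<eta>" if x: "x \<in> orb \<eta>" and tau: "\<tau> \<in> carrier G" for \<tau> x
  proof -
    obtain \<rho> where r: "\<rho> \<in> carrier G" "x = \<rho> \<eta>" using x by (auto simp: orb_def)
    then have "\<tau> x = (\<tau> \<otimes>\<^bsub>G\<^esub> \<rho>) \<eta>" using tau assms by (simp add: Gal_mult_app)
    then show ?thesis using tau r by (auto simp: orb_def)
  qed
  show "\<sigma> \<in> orb \<eta> \<rightarrow> orb \<eta>" "inv\<^bsub>G\<^esub> \<sigma> \<in> orb \<eta> \<rightarrow> orb \<eta>" using * assms by auto
qed (use orb_subset[OF assms(1)] assms in \<open>auto simp: Gal_inv_app\<close>)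

end

lemma (in cembedding) map_poly_prod_linear:
  assumes "A \<subseteq> K"
  shows "map_poly h (\<Prod>a\<in>A. [:-a, 1:]) = (\<Prod>a\<in>A. [:- h a, 1:])"
proof (cases "finite A")
  case True
  then show ?thesis using assms
  proof (induction A)
    case (insert a A)
    have "map_poly h ([:-a, 1:] * (\<Prod>a\<in>A. [:-a, 1:])) = map_poly h [:-a, 1:] * map_poly h (\<Prod>a\<in>A. [:-a, 1:])"
      using insert.prems by (intro map_poly_mult polys_overs) (auto intro: mems)
    then show ?case using insert by (simp add: map_poly_pCons h_uminus del: mult_pCons_left)
  qed (simp add: map_poly_1)
qed (simp add: map_poly_1)

section \<open>Fields in which only the rationals are fixed by all automorphisms\<close>

locale galois_field = csub +
  assumes fixed: "\<And>x. x \<in> K \<Longrightarrow> (\<And>\<sigma>. \<sigma> \<in> carrier (Gal K \<rat>) \<Longrightarrow> \<sigma> x = x) \<Longrightarrow> x \<in> \<rat>"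
begin

lemma polys_over_fixed:
  assumes "p \<in> polys_over K" "\<And>\<sigma>. \<sigma> \<in> carrier G \<Longrightarrow> map_poly \<sigma> p = p"
  shows "p \<in> polys_over \<rat>"
proof -
  have "coeff p i \<in> \<rat>" for i
  proof (rule fixed)
    show "coeff p i \<in> K" using assms(1) by (auto simp: polys_over_def)
    fix \<sigma> assume s: "\<sigma> \<in> carrier G"
    interpret cembedding K \<sigma> by (rule G_cembedding[OF s])
    show "\<sigma> (coeff p i) = coeff p i" using assms(2)[OF s] by (metis coeff_map_poly h_zero)
  qed
  then show ?thesis by (auto simp: polys_over_def)
qed

lemma orbit_poly:
  assumes "\<eta> \<in> K"
  shows "(\<Prod>a\<in>orb \<eta>. [:-a, 1:]) \<in> polys_over \<rat>"
proof (rule polys_over_fixed)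
  have O: "orb \<eta> \<subseteq> K" using orb_subset assms .
  then show "(\<Prod>a\<in>orb \<eta>. [:-a, 1:]) \<in> polys_over K"
    by (intro polys_overs) (auto intro: mems)
  fix \<sigma> assume s: "\<sigma> \<in> carrier G"
  interpret cembedding K \<sigma> by (rule G_cembedding[OF s])
  show "map_poly \<sigma> (\<Prod>a\<in>orb \<eta>. [:-a, 1:]) = (\<Prod>a\<in>orb \<eta>. [:-a, 1:])"
    using prod.reindex_bij_betw[OF orb_perm[OF assms s], of "\<lambda>a. [:-a, 1:]"] map_poly_prod_linear[OF O] by simp
qed

text \<open>Lagrange interpolation through the points with abscissa \<sigma> \<eta> and ordinate
  \<sigma> \<open>y\<close>, one for each conjugate of \<eta>. The hypothesis on stabilizers makes
  the ordinates well defined; automorphisms permute the points, so the interpolating polynomial is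
  invariant and has rational coefficients.\<close>

lemma interpolation:
  assumes "\<eta> \<in> K" "y \<in> K" "finite (orb \<eta>)" "\<And>\<sigma>. \<sigma> \<in> carrier G \<Longrightarrow> \<sigma> \<eta> = \<eta> \<Longrightarrow> \<sigma> y = y"
  shows "\<exists>p\<in>polys_over \<rat>. degree p < card (orb \<eta>) \<and> poly p \<eta> = y"
proof -
  let ?O = "orb \<eta>"
  have O: "?O \<subseteq> K" using orb_subset assms(1) .
  define f where "f o' = (SOME \<sigma>. \<sigma> \<in> carrier G \<and> \<sigma> \<eta> = o') y" for o'
  have f: "f (\<sigma> \<eta>) = \<sigma> y" if s: "\<sigma> \<in> carrier G" for \<sigma>
  proof -
    define \<tau> where "\<tau> = (SOME \<tau>. \<tau> \<in> carrier G \<and> \<tau> \<eta> = \<sigma> \<eta>)"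
    have t: "\<tau> \<in> carrier G" "\<tau> \<eta> = \<sigma> \<eta>"
      using someI[of "\<lambda>\<tau>. \<tau> \<in> carrier G \<and> \<tau> \<eta> = \<sigma> \<eta>" \<sigma>] s by (auto simp: \<tau>_def)
    define \<rho> where "\<rho> = inv\<^bsub>G\<^esub> \<sigma> \<otimes>\<^bsub>G\<^esub> \<tau>"
    have r: "\<rho> \<in> carrier G" using s t by (simp add: \<rho>_def)
    have "\<rho> \<eta> = \<eta>" using s t assms by (simp add: \<rho>_def Gal_mult_app Gal_inv_app)
    then have "\<rho> y = y" using assms(4) r by blast
    then have "\<sigma> (\<rho> y) = \<sigma> y" by simp
    then have "\<tau> y = \<sigma> y" using s t assms(2) by (simp add: \<rho>_def Gal_mult_app Gal_inv_app Gal_app_mem)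
    then show ?thesis by (simp add: f_def \<tau>_def)
  qed
  have fK: "f a \<in> K" if "a \<in> ?O" for a
    using that f assms(2) by (auto simp: orb_def Gal_app_mem)
  define l where "l a = (\<Prod>b\<in>?O - {a}. [:-b, 1:])" for a
  define Q where "Q = (\<Sum>a\<in>?O. smult (f a / (\<Prod>b\<in>?O - {a}. (a - b))) (l a))"
  have lK: "l a \<in> polys_over K" for a
    unfolding l_def using O by (intro polys_overs) (auto intro: mems)
  have QK: "Q \<in> polys_over K"
    unfolding Q_def using O fK by (intro polys_overs lK mems) auto
  have O0: "card ?O > 0" using assms orb_refl by (auto simp: card_gt_0_iff)
  have dl: "degree (l a) \<le> card ?O - 1" if "a \<in> ?O" for a
  proof -
    have "degree (l a) \<le> (\<Sum>b\<in>?O - {a}. degree [:-b, 1:])" unfolding l_def using assms(3) by (intro degree_prod_sum_le[unfolded comp_def]) auto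
    then show ?thesis using that assms(3) by simp
  qed
  have dQ: "degree Q < card ?O"
  proof -
    have "degree Q \<le> card ?O - 1" unfolding Q_def using dl by (intro degree_sum_le assms(3)) (auto intro: order.trans[OF degree_smult_le])
    then show ?thesis using O0 by simp
  qed
  have Qv: "poly Q a = f a" if "a \<in> ?O" for a
  proof -
    have "poly (smult (f b / (\<Prod>c\<in>?O - {b}. (b - c))) (l b)) a = (if b = a then f a else 0)" if "b \<in> ?O" for b
    proof (cases "b = a")
      case True
      have "(\<Prod>c\<in>?O - {a}. (a - c)) \<noteq> 0" using assms(3) by auto
      then show ?thesis using True by (simp add: l_def poly_prod)
    next
      case False
      then have "poly (l b) a = 0" unfolding l_def poly_prod using assms(3) \<open>a \<in> ?O\<close> by (intro prod_zero) auto
      then show ?thesis using False by simp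
    qed
    then show ?thesis unfolding Q_def poly_sum using that assms(3) by simp
  qed
  have "Q \<in> polys_over \<rat>"
  proof (rule polys_over_fixed[OF QK])
    fix \<sigma> assume s: "\<sigma> \<in> carrier G"
    interpret cembedding K \<sigma> by (rule G_cembedding[OF s])
    note b = orb_perm[OF assms(1) s]
    show "map_poly \<sigma> Q = Q"
    proof (rule poly_eqI_degree[of ?O])
      fix a assume "a \<in> ?O"
      then obtain c where c: "c \<in> ?O" "a = \<sigma> c" using b by (auto simp: bij_betw_def)
      then obtain \<tau> where t: "\<tau> \<in> carrier G" "c = \<tau> \<eta>" by (auto simp: orb_def)
      have "poly (map_poly \<sigma> Q) a = \<sigma> (f c)" using c O QK Qv by (simp add: poly_map_poly subset_iff)
      also have "\<dots> = (\<sigma> \<otimes>\<^bsub>G\<^esub> \<tau>) y" using t s assms(2) by (simp add: f Gal_mult_app)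
      also have "\<dots> = f ((\<sigma> \<otimes>\<^bsub>G\<^esub> \<tau>) \<eta>)" using s t by (intro f[symmetric]) auto
      also have "\<dots> = f a" using s t c assms(1) by (simp add: Gal_mult_app)
      finally show "poly (map_poly \<sigma> Q) a = poly Q a" using Qv \<open>a \<in> ?O\<close> by simp
    next
      show "degree (map_poly \<sigma> Q) < card ?O" using dQ map_poly_degree_leq[of \<sigma> Q] by (metis h_zero le_less_trans)
    qed (rule dQ)
  qed
  moreover have "poly Q \<eta> = y" using Qv[OF orb_refl[OF assms(1)]] f[of "\<one>\<^bsub>G\<^esub>"] assms by simp
  ultimately show ?thesis using dQ by blast
qed

text \<open>For each nontrivial \<sigma> the displacement of the combination is a nonzero polynomial
  in \<open>t\<close>; an integer that avoids the roots of all of them works for every \<sigma> at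
  once.\<close>

lemma generic_combination:
  assumes "finite (carrier G)" "\<And>k. k < (n::nat) \<Longrightarrow> f k \<in> K"
    "\<And>\<sigma>. \<sigma> \<in> carrier G \<Longrightarrow> (\<And>k. k < n \<Longrightarrow> \<sigma> (f k) = f k) \<Longrightarrow> \<sigma> = \<one>\<^bsub>G\<^esub>"
  shows "\<exists>t::nat. \<forall>\<sigma>\<in>carrier G. \<sigma> (\<Sum>k<n. of_nat t ^ k * f k) = (\<Sum>k<n. of_nat t ^ k * f k) \<longrightarrow> \<sigma> = \<one>\<^bsub>G\<^esub>"
proof -
  \<comment> \<open>The displacement of the combination under \<sigma>, as a polynomial in the
    parameter.\<close>
  define P where "P \<sigma> = (\<Sum>k<n. monom (\<sigma> (f k) - f k) k)" for \<sigma> :: "complex \<Rightarrow> complex"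
  have P0: "P \<sigma> \<noteq> 0" if s: "\<sigma> \<in> carrier G" "\<sigma> \<noteq> \<one>\<^bsub>G\<^esub>" for \<sigma>
  proof
    assume 0: "P \<sigma> = 0"
    have "\<sigma> (f k) - f k = 0" if "k < n" for k
    proof -
      have "coeff (P \<sigma>) k = \<sigma> (f k) - f k" unfolding P_def using that by (simp add: coeff_sum)
      then show ?thesis using 0 by simp
    qed
    then show False using assms(3)[OF s(1)] s(2) by auto
  qed
  have "finite (P ` (carrier G - {\<one>\<^bsub>G\<^esub>}))" "0 \<notin> P ` (carrier G - {\<one>\<^bsub>G\<^esub>})"
    using assms(1) P0 by force+
  from exists_nonroot[OF this]
  obtain t :: nat where t: "\<forall>p\<in>P ` (carrier G - {\<one>\<^bsub>G\<^esub>}). poly p (of_nat t) \<noteq> 0" by blast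
  show ?thesis
  proof (intro exI[of _ t] ballI impI)
    fix \<sigma> assume s: "\<sigma> \<in> carrier G" and e: "\<sigma> (\<Sum>k<n. of_nat t ^ k * f k) = (\<Sum>k<n. of_nat t ^ k * f k)"
    interpret cembedding K \<sigma> by (rule G_cembedding[OF s])
    have "\<sigma> (\<Sum>k<n. of_nat t ^ k * f k) = (\<Sum>k<n. of_nat t ^ k * \<sigma> (f k))"
      using assms(2) by (subst h_sum) (auto intro!: mems sum.cong simp: h_mult h_power mems)
    then have "poly (P \<sigma>) (of_nat t) = 0" using e
      by (simp add: P_def poly_sum poly_monom sum_subtractf algebra_simps)
    then show "\<sigma> = \<one>\<^bsub>G\<^esub>" using t s by auto
  qed
qed

end


text \<open>\<open>combine\<close> stops at the end of the shorter list, hence the truncation to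
  \<open>n\<close> coefficients. The offset \<open>a\<close> is there for the induction.\<close>

lemma combine_powers:
  "CF.combine Ks (map (\<lambda>i. \<eta> ^ (i + a)) [0..<n]) = \<eta> ^ a * poly (Poly (take n Ks)) \<eta>"
proof (induction n arbitrary: a Ks)
  case (Suc n)
  show ?case
  proof (cases Ks)
    case (Cons k Ks')
    have "map (\<lambda>i. \<eta> ^ (i + a)) [0..<Suc n] = \<eta> ^ a # map (\<lambda>i. \<eta> ^ (i + Suc a)) [0..<n]"
      by (subst upt_conv_Cons) (simp_all add: map_Suc_upt[symmetric] del: upt_Suc)
    then show ?thesis using Suc.IH[of Ks' "Suc a"] Cons by (simp add: algebra_simps del: upt_Suc)
  qed simp
qed (cases Ks; simp)

section \<open>Fields generated by a finite set that every embedding maps into itself\<close>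

locale normal_field =
  fixes S :: "complex set"
  assumes finite_S: "finite S"
    and algebraic_S: "\<And>s. s \<in> S \<Longrightarrow> \<exists>p\<in>polys_over \<rat>. p \<noteq> 0 \<and> poly p s = 0"
    and stable_S: "\<And>h. embedding (generated_field S) h \<Longrightarrow> h ` S \<subseteq> S"
begin

abbreviation "L \<equiv> generated_field S"

sublocale csub L
  by unfold_locales (rule csubfield_generated)

lemma S_in_L: "s \<in> S \<Longrightarrow> s \<in> L"
  using generated_field_superset by blast

text \<open>An injective self-map of the finite set \<open>S\<close> is onto. The image of
  \<open>L\<close>, and the elements of \<open>L\<close> sent into \<open>L\<close>, are then
  subfields containing \<open>S\<close>, so both contain \<open>L\<close>.\<close>

lemma restrict_embedding:
  assumes "embedding L h"
  shows "restrict h L \<in> carrier G"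
proof -
  interpret h: cembedding L h by unfold_locales (rule assms)
  have inj: "inj_on h L" by (rule h.h_inj)
  then have "inj_on h S" using S_in_L by (auto intro: inj_on_subset)
  then have hS: "h ` S = S" by (rule endo_inj_surj[OF finite_S stable_S[OF assms]])
  have c1: "csubfield (h ` L)"
    unfolding csubfield_def
  proof (intro conjI ballI)
    show "1 \<in> h ` L" by (rule rev_image_eqI[of 1]) auto
    fix x assume "x \<in> h ` L"
    then obtain x' where x: "x' \<in> L" "x = h x'" by blast
    then show "inverse x \<in> h ` L" by (intro rev_image_eqI[of "inverse x'"]) (simp_all add: h.h_inverse inverse_mem)
    fix y assume "y \<in> h ` L"
    then obtain y' where y: "y' \<in> L" "y = h y'" by blast
    show "x - y \<in> h ` L" using x y by (intro rev_image_eqI[of "x' - y'"]) (simp_all add: h.h_diff diff_mem)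
    show "x * y \<in> h ` L" using x y by (intro rev_image_eqI[of "x' * y'"]) (simp_all add: h.h_mult mult_mem)
  qed
  have c2: "csubfield {x \<in> L. h x \<in> L}"
    by (auto simp: csubfield_def h.h_diff h.h_mult h.h_inverse mems)
  have "L \<subseteq> h ` L" using hS S_in_L by (intro generated_field_least c1) blast
  moreover have "L \<subseteq> {x \<in> L. h x \<in> L}" using hS S_in_L by (intro generated_field_least c2) blast
  ultimately have "bij_betw h L L" using inj by (auto simp: bij_betw_def)
  then show ?thesis using assms by (auto simp: G_iff embedding_def mems cong: bij_betw_cong)
qed

lemma algebraic_L: "x \<in> L \<Longrightarrow> \<exists>p\<in>polys_over \<rat>. p \<noteq> 0 \<and> poly p x = 0"
  using generated_field_least[OF csubfield_algebraic, of S] algebraic_S by blast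

lemma Gal_determined:
  assumes "\<sigma> \<in> carrier G" "\<tau> \<in> carrier G" "\<And>s. s \<in> S \<Longrightarrow> \<sigma> s = \<tau> s"
  shows "\<sigma> = \<tau>"
proof -
  interpret s: cembedding L \<sigma> + t: cembedding L \<tau> using assms by (simp_all add: G_cembedding)
  have "csubfield {x \<in> L. \<sigma> x = \<tau> x}"
    by (auto simp: csubfield_def s.h_diff s.h_mult s.h_inverse t.h_diff t.h_mult t.h_inverse mems)
  then have "L \<subseteq> {x \<in> L. \<sigma> x = \<tau> x}" using assms S_in_L by (intro generated_field_least) auto
  then show ?thesis using assms by (intro Gal_eqI) auto
qed

lemma Gal_S: "\<sigma> \<in> carrier G \<Longrightarrow> s \<in> S \<Longrightarrow> \<sigma> s \<in> S"
  using stable_S by (auto simp: G_iff)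

lemma finite_G: "finite (carrier G)"
proof (rule finite_imageD)
  show "finite ((\<lambda>\<sigma>. restrict \<sigma> S) ` carrier G)"
    by (rule finite_subset[OF _ finite_PiE[OF finite_S finite_S]]) (use Gal_S in auto)
  show "inj_on (\<lambda>\<sigma>. restrict \<sigma> S) (carrier G)"
  proof (rule inj_onI, rule Gal_determined)
    fix \<sigma> \<tau> s assume "restrict \<sigma> S = restrict \<tau> S" "s \<in> S"
    then show "\<sigma> s = \<tau> s" by (metis restrict_apply')
  qed auto
qed

text \<open>An irrational element is moved by an embedding of some subfield; extended over
  \<open>S\<close> and restricted to \<open>L\<close>, this becomes an automorphism that moves
  it.\<close>

sublocale galois_field L
proof unfold_locales
  fix x assume x: "x \<in> L" and fix': "\<And>\<sigma>. \<sigma> \<in> carrier G \<Longrightarrow> \<sigma> x = x"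
  show "x \<in> \<rat>"
  proof (rule ccontr)
    assume n: "x \<notin> \<rat>"
    obtain p where p: "p \<in> polys_over \<rat>" "p \<noteq> 0" "poly p x = 0" using algebraic_L[OF x] by blast
    obtain K h where K: "csubfield K" "x \<in> K" "embedding K h" "h x \<noteq> x"
      using exists_moving_embedding[OF p n] by blast
    obtain K' h' where K': "csubfield K'" "S \<subseteq> K'" "embedding K' h'" "\<forall>x\<in>K. h' x = h x"
      using extend_embedding_finite[OF finite_S K(1,3) algebraic_S] by blast
    have "L \<subseteq> K'" by (rule generated_field_least) (use K' in auto)
    then have "embedding L h'" using K'(3) by (auto simp: embedding_def)
    from fix'[OF restrict_embedding[OF this]] x K K' show False by simp
  qed
qed

lemma finite_orb: "finite (orb \<eta>)"
  by (simp add: orb_def finite_G)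

lemma free_element: "\<exists>\<theta>\<in>L. \<forall>\<sigma>\<in>carrier G. \<sigma> \<theta> = \<theta> \<longrightarrow> \<sigma> = \<one>\<^bsub>G\<^esub>"
proof -
  obtain f and n :: nat where f: "S = f ` {..<n}"
    using finite_S by (metis finite_imp_nat_seg_image_inj_on lessThan_def)
  have "\<exists>t::nat. \<forall>\<sigma>\<in>carrier G. \<sigma> (\<Sum>k<n. of_nat t ^ k * f k) = (\<Sum>k<n. of_nat t ^ k * f k) \<longrightarrow> \<sigma> = \<one>\<^bsub>G\<^esub>"
  proof (rule generic_combination[OF finite_G])
    show "f k \<in> L" if "k < n" for k using f S_in_L that by blast
    fix \<sigma> assume s: "\<sigma> \<in> carrier G" and fx: "\<And>k. k < n \<Longrightarrow> \<sigma> (f k) = f k"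
    show "\<sigma> = \<one>\<^bsub>G\<^esub>"
    proof (rule Gal_determined[OF s])
      fix x assume "x \<in> S"
      then have "x \<in> L" "\<sigma> x = x" using S_in_L f fx by (blast, auto)
      then show "\<sigma> x = \<one>\<^bsub>G\<^esub> x" by simp
    qed simp
  qed
  then obtain t :: nat where "\<forall>\<sigma>\<in>carrier G. \<sigma> (\<Sum>k<n. of_nat t ^ k * f k) = (\<Sum>k<n. of_nat t ^ k * f k) \<longrightarrow> \<sigma> = \<one>\<^bsub>G\<^esub>"
    by blast
  moreover have "(\<Sum>k<n. of_nat t ^ k * f k) \<in> L" using f S_in_L by (intro mems) auto
  ultimately show ?thesis by blast
qed

text \<open>Take the polynomial whose roots are the translates under \<open>H\<close> of an element
  \<theta> with trivial stabilizer. It is fixed by \<sigma> exactly if \<sigma> \<theta> is one of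
  these roots, that is, if \<sigma> lies in \<open>H\<close>. Its value at a suitable integer keeps
  this stabilizer.\<close>

lemma stabiliser_element:
  assumes H: "subgroup H G"
  shows "\<exists>\<eta>\<in>L. \<forall>\<sigma>\<in>carrier G. \<sigma> \<eta> = \<eta> \<longleftrightarrow> \<sigma> \<in> H"
proof -
  interpret H: subgroup H G by (rule H)
  obtain \<theta> where th: "\<theta> \<in> L" "\<And>\<sigma>. \<sigma> \<in> carrier G \<Longrightarrow> \<sigma> \<theta> = \<theta> \<Longrightarrow> \<sigma> = \<one>\<^bsub>G\<^esub>" using free_element by blast
  have HG: "\<sigma> \<in> carrier G" if "\<sigma> \<in> H" for \<sigma> using that by (rule H.mem_carrier)
  define Y where "Y = (\<lambda>\<sigma>. \<sigma> \<theta>) ` H"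
  have OL: "Y \<subseteq> L" using th(1) by (auto simp: Y_def Gal_app_mem HG)
  have finO: "finite Y" unfolding Y_def using finite_subset[OF H.subset finite_G] by simp
  define q where "q = (\<Prod>a\<in>Y. [:-a, 1:])"
  have qL: "q \<in> polys_over L" unfolding q_def using OL by (intro polys_overs) (auto intro: mems)
  have q0: "poly q x = 0 \<longleftrightarrow> x \<in> Y" for x using finO by (auto simp: q_def poly_prod)
  have stab: "map_poly \<sigma> q = q" if s: "\<sigma> \<in> H" for \<sigma>
  proof -
    interpret cembedding L \<sigma> by (rule G_cembedding[OF HG[OF s]])
    have sub: "\<tau> ` Y \<subseteq> Y" if t: "\<tau> \<in> H" for \<tau>
    proof -
      have "\<tau> (\<rho> \<theta>) \<in> Y" if "\<rho> \<in> H" for \<rho>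
        using t that th(1) HG by (auto simp: Y_def Gal_mult_app[symmetric] intro!: rev_image_eqI[of "\<tau> \<otimes>\<^bsub>G\<^esub> \<rho>"])
      then show ?thesis by (auto simp: Y_def)
    qed
    have "inj_on \<sigma> Y" using h_inj OL by (rule inj_on_subset)
    then have "\<sigma> ` Y = Y" by (rule endo_inj_surj[OF finO sub[OF s]])
    then have "bij_betw \<sigma> Y Y" using \<open>inj_on \<sigma> Y\<close> by (simp add: bij_betw_def)
    then show ?thesis unfolding q_def using prod.reindex_bij_betw[of \<sigma> Y Y "\<lambda>a. [:-a, 1:]"] map_poly_prod_linear[OF OL] by simp
  qed
  have unstab: "map_poly \<sigma> q \<noteq> q" if s: "\<sigma> \<in> carrier G" "\<sigma> \<notin> H" for \<sigma>
  proof
    interpret cembedding L \<sigma> by (rule G_cembedding[OF s(1)])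
    assume e: "map_poly \<sigma> q = q"
    have "\<theta> \<in> Y" unfolding Y_def using th(1) by (intro rev_image_eqI[of "\<one>\<^bsub>G\<^esub>"]) auto
    then have "poly q \<theta> = 0" using q0 by simp
    then have "poly (map_poly \<sigma> q) (\<sigma> \<theta>) = 0" using poly_map_poly[OF qL th(1)] by simp
    then have "\<sigma> \<theta> \<in> Y" using e q0 by simp
    then obtain \<tau> where t: "\<tau> \<in> H" "\<sigma> \<theta> = \<tau> \<theta>" by (auto simp: Y_def)
    have "(inv\<^bsub>G\<^esub> \<tau> \<otimes>\<^bsub>G\<^esub> \<sigma>) \<theta> = \<theta>" using t s HG th(1) by (simp add: Gal_mult_app Gal_inv_app)
    then have "inv\<^bsub>G\<^esub> \<tau> \<otimes>\<^bsub>G\<^esub> \<sigma> = \<one>\<^bsub>G\<^esub>" using th(2) s t HG by simp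
    then have "\<sigma> = \<tau>" using s t HG by (metis G.inv_closed G.inv_equality G.inv_inv)
    then show False using t s by simp
  qed
  define P where "P = (\<lambda>\<sigma>. map_poly \<sigma> q - q) ` (carrier G - H)"
  have "finite P" "0 \<notin> P" using unstab finite_G by (auto simp: P_def)
  from exists_nonroot[OF this] obtain t :: nat where t: "\<forall>p\<in>P. poly p (of_nat t) \<noteq> 0" by blast
  have *: "\<sigma> (poly q (of_nat t)) = poly (map_poly \<sigma> q) (of_nat t)" if "\<sigma> \<in> carrier G" for \<sigma>
  proof -
    interpret cembedding L \<sigma> by (rule G_cembedding[OF that])
    show ?thesis using poly_map_poly[OF qL of_nat_mem[of t]] by simp
  qed
  have "\<sigma> (poly q (of_nat t)) = poly q (of_nat t) \<longleftrightarrow> \<sigma> \<in> H" if "\<sigma> \<in> carrier G" for \<sigma>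
  proof (cases "\<sigma> \<in> H")
    case False
    then have "map_poly \<sigma> q - q \<in> P" using that by (auto simp: P_def)
    then show ?thesis using t False *[OF that] by auto
  qed (simp add: * stab that)
  moreover have "poly q (of_nat t) \<in> L" using qL by (intro poly_mem mems)
  ultimately show ?thesis by blast
qed

text \<open>The fibres of evaluation at \<eta> are left cosets of \<open>H\<close>; Lagrange's
  theorem, applied to right cosets, turns the fibre count into the stated index.\<close>

lemma card_orb:
  assumes "subgroup H G" "\<eta> \<in> L" "\<And>\<sigma>. \<sigma> \<in> carrier G \<Longrightarrow> \<sigma> \<eta> = \<eta> \<longleftrightarrow> \<sigma> \<in> H"
  shows "card (orb \<eta>) = card (rcosets\<^bsub>G\<^esub> H)"
proof -
  interpret H: subgroup H G by (rule assms)
  have fib: "card {\<sigma> \<in> carrier G. \<sigma> \<eta> = a} = card H" if a: "a \<in> orb \<eta>" for a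
  proof -
    obtain \<tau> where t: "\<tau> \<in> carrier G" "a = \<tau> \<eta>" using a by (auto simp: orb_def)
    have "bij_betw (\<lambda>\<sigma>. \<tau> \<otimes>\<^bsub>G\<^esub> \<sigma>) H {\<sigma> \<in> carrier G. \<sigma> \<eta> = a}"
    proof (rule bij_betwI[of _ _ _ "\<lambda>\<sigma>. inv\<^bsub>G\<^esub> \<tau> \<otimes>\<^bsub>G\<^esub> \<sigma>"])
      show "(\<lambda>\<sigma>. \<tau> \<otimes>\<^bsub>G\<^esub> \<sigma>) \<in> H \<rightarrow> {\<sigma> \<in> carrier G. \<sigma> \<eta> = a}"
      proof
        fix \<sigma> assume "\<sigma> \<in> H"
        then have s: "\<sigma> \<in> carrier G" "\<sigma> \<eta> = \<eta>" using H.mem_carrier assms(3) by blast+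
        then have "(\<tau> \<otimes>\<^bsub>G\<^esub> \<sigma>) \<eta> = a" using t assms(2) by (simp add: Gal_mult_app)
        then show "\<tau> \<otimes>\<^bsub>G\<^esub> \<sigma> \<in> {\<sigma> \<in> carrier G. \<sigma> \<eta> = a}" using t s by simp
      qed
      show "(\<lambda>\<sigma>. inv\<^bsub>G\<^esub> \<tau> \<otimes>\<^bsub>G\<^esub> \<sigma>) \<in> {\<sigma> \<in> carrier G. \<sigma> \<eta> = a} \<rightarrow> H"
      proof
        fix \<sigma> assume "\<sigma> \<in> {\<sigma> \<in> carrier G. \<sigma> \<eta> = a}"
        then have s: "\<sigma> \<in> carrier G" "\<sigma> \<eta> = \<tau> \<eta>" using t by auto
        then have "(inv\<^bsub>G\<^esub> \<tau> \<otimes>\<^bsub>G\<^esub> \<sigma>) \<eta> = \<eta>" using t assms(2) by (simp add: Gal_mult_app Gal_inv_app)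
        then show "inv\<^bsub>G\<^esub> \<tau> \<otimes>\<^bsub>G\<^esub> \<sigma> \<in> H" using assms(3) s t by simp
      qed
    qed (use t in \<open>auto simp: G.m_assoc[symmetric]\<close>)
    then show ?thesis by (simp add: bij_betw_same_card)
  qed
  have "carrier G = (\<Union>a\<in>orb \<eta>. {\<sigma> \<in> carrier G. \<sigma> \<eta> = a})" by (auto simp: orb_def)
  then have "card (carrier G) = card (\<Union>a\<in>orb \<eta>. {\<sigma> \<in> carrier G. \<sigma> \<eta> = a})" by simp
  also have "\<dots> = (\<Sum>a\<in>orb \<eta>. card {\<sigma> \<in> carrier G. \<sigma> \<eta> = a})"
    by (rule card_UN_disjoint) (auto simp: finite_G finite_orb)
  also have "\<dots> = card (orb \<eta>) * card H" using fib by simp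
  finally have e: "card (carrier G) = card (orb \<eta>) * card H" .
  have "card (rcosets\<^bsub>G\<^esub> H) * card H = card (orb \<eta>) * card H"
    using G.lagrange[OF assms(1), unfolded Coset.order_def] e by (rule trans)
  moreover have "card H > 0" using H.one_closed finite_subset[OF H.subset finite_G] by (metis card_gt_0_iff empty_iff)
  ultimately show ?thesis by simp
qed

definition fixed_by :: "(complex \<Rightarrow> complex) set \<Rightarrow> complex set" where
  "fixed_by H = {x \<in> L. \<forall>\<sigma>\<in>H. \<sigma> x = x}"

text \<open>The powers of an element \<eta> with stabilizer \<open>H\<close>, up to the number of
  its conjugates, form a basis. A rational relation of smaller degree would vanish at all
  conjugates, and interpolation expresses every fixed element.\<close>

lemma degree_fixed_by:
  assumes H: "subgroup H G"
  shows "number_field_of_degree (card (rcosets\<^bsub>G\<^esub> H)) (fixed_by H)"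
proof -
  interpret H: subgroup H G by (rule H)
  have HG: "\<sigma> \<in> carrier G" if "\<sigma> \<in> H" for \<sigma> using that by (rule H.mem_carrier)
  have csf: "csubfield (fixed_by H)"
  proof -
    note emb = G_cembedding[OF HG]
    show ?thesis
      by (auto simp: csubfield_def fixed_by_def mems cembedding.h_diff[OF emb] cembedding.h_mult[OF emb]
          cembedding.h_inverse[OF emb] cembedding.h_one[OF emb])
  qed
  then interpret F: csub "fixed_by H" by unfold_locales
  obtain \<eta> where eta: "\<eta> \<in> L" "\<And>\<sigma>. \<sigma> \<in> carrier G \<Longrightarrow> \<sigma> \<eta> = \<eta> \<longleftrightarrow> \<sigma> \<in> H"
    using stabiliser_element[OF H] by blast
  define n where "n = card (orb \<eta>)"
  have n: "n = card (rcosets\<^bsub>G\<^esub> H)" using card_orb[OF H eta] by (simp add: n_def)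
  define Us where "Us = map (\<lambda>i. \<eta> ^ i) [0..<n]"
  have comb: "CF.combine Ks Us = poly (Poly (take n Ks)) \<eta>" for Ks
    using combine_powers[of Ks \<eta> 0 n] by (simp add: Us_def)
  have etaF: "\<eta> \<in> fixed_by H" using eta HG by (auto simp: fixed_by_def)
  have Qsf: "subfield \<rat> complex_field" by (simp add: subfield_iff_csubfield csubfield_Rats)
  have Qpoly: "Poly Ks \<in> polys_over \<rat>" if "set Ks \<subseteq> \<rat>" for Ks
    using that by (auto simp: polys_over_def nth_default_def)
  have ind: "CF.independent \<rat> Us"
  proof (rule CF.trivial_combine_imp_independent[OF Qsf])
    show "set Us \<subseteq> carrier complex_field" by simp
    fix Ks assume Ks: "set Ks \<subseteq> \<rat>" "CF.combine Ks Us = \<zero>\<^bsub>complex_field\<^esub>"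
    define p where "p = Poly (take n Ks)"
    have p: "p \<in> polys_over \<rat>" unfolding p_def using Ks(1) set_take_subset by (intro Qpoly) fast
    have pe: "poly p \<eta> = 0" using Ks(2) by (simp add: comb p_def)
    have "p = 0"
    proof (rule ccontr)
      assume p0: "p \<noteq> 0"
      have "orb \<eta> \<subseteq> {x. poly p x = 0}"
      proof
        fix x assume "x \<in> orb \<eta>"
        then obtain \<sigma> where s: "\<sigma> \<in> carrier G" "x = \<sigma> \<eta>" by (auto simp: orb_def)
        interpret cembedding L \<sigma> by (rule G_cembedding[OF s(1)])
        have "p \<in> polys_over L" using p Rats_mem by (auto simp: polys_over_def)
        then have "poly (map_poly \<sigma> p) (\<sigma> \<eta>) = 0" using pe eta(1) by (simp add: poly_map_poly)
        then show "x \<in> {x. poly p x = 0}" using s by (simp add: map_poly_Rats[OF p])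
      qed
      then have "n \<le> card {x. poly p x = 0}" unfolding n_def using p0 by (intro card_mono) (auto simp: poly_roots_finite)
      also have "\<dots> \<le> degree p" using p0 by (rule card_poly_roots_bound)
      finally have dp: "n \<le> degree p" .
      \<comment> \<open>\<open>p\<close> is built from at most \<open>n\<close> coefficients, so all
        coefficients from index \<open>n\<close> on vanish.\<close>
      have "coeff p (degree p) = 0" using dp by (simp add: p_def nth_default_def)
      then show False using p0 by simp
    qed
    then have "\<forall>x\<in>set (take n Ks). x = 0"
      unfolding p_def by (metis Poly_eq_0 in_set_replicate)
    then show "set (take (length Us) Ks) \<subseteq> {\<zero>\<^bsub>complex_field\<^esub>}" by (auto simp: Us_def)
  qed
  have span: "CF.Span \<rat> Us = fixed_by H"
  proof -
    have "CF.Span \<rat> Us = {CF.combine Ks Us |Ks. set Ks \<subseteq> \<rat>}"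
      by (rule CF.Span_eq_combine_set[OF Qsf]) simp
    also have "\<dots> = fixed_by H"
    proof (intro equalityI subsetI)
      fix x assume "x \<in> {CF.combine Ks Us |Ks. set Ks \<subseteq> \<rat>}"
      then obtain Ks where Ks: "x = CF.combine Ks Us" "set Ks \<subseteq> \<rat>" by blast
      have "Poly (take n Ks) \<in> polys_over \<rat>" using Ks(2) set_take_subset by (intro Qpoly) fast
      then have "Poly (take n Ks) \<in> polys_over (fixed_by H)" using F.Rats_mem by (auto simp: polys_over_def)
      then show "x \<in> fixed_by H" using Ks etaF by (simp add: comb F.poly_mem)
    next
      fix y assume y: "y \<in> fixed_by H"
      then have "\<exists>p\<in>polys_over \<rat>. degree p < card (orb \<eta>) \<and> poly p \<eta> = y"
        by (intro interpolation eta finite_orb) (auto simp: fixed_by_def eta)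
      then obtain p where p: "p \<in> polys_over \<rat>" "degree p < n" "poly p \<eta> = y" by (auto simp: n_def)
      have "length (coeffs p) \<le> n" using p(2) by (cases "p = 0") (auto simp: length_coeffs_degree)
      then have "CF.combine (coeffs p) Us = y" using p(3) by (simp add: comb)
      moreover have "set (coeffs p) \<subseteq> \<rat>" using p(1) by (auto simp: polys_over_def coeffs_def)
      ultimately show "y \<in> {CF.combine Ks Us |Ks. set Ks \<subseteq> \<rat>}" by blast
    qed
    finally show ?thesis .
  qed
  have "CF.dimension (length Us) \<rat> (fixed_by H)"
    using CF.dimensionI[OF Qsf ind span] .
  then show ?thesis
    using csf n by (simp add: number_field_of_degree_def subfield_iff_csubfield Us_def)
qed

text \<open>The fixed field contains an element whose stabilizer is exactly
  \<open>H\<close>.\<close>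

lemma Gal_fixed_by:
  assumes H: "subgroup H G"
  shows "carrier (Gal L (fixed_by H)) = H"
proof
  interpret H: subgroup H G by (rule H)
  obtain \<eta> where eta: "\<eta> \<in> L" "\<And>\<sigma>. \<sigma> \<in> carrier G \<Longrightarrow> \<sigma> \<eta> = \<eta> \<longleftrightarrow> \<sigma> \<in> H"
    using stabiliser_element[OF H] by blast
  have sub: "fixed_by H \<subseteq> L" by (auto simp: fixed_by_def)
  have etaF: "\<eta> \<in> fixed_by H" using eta H.mem_carrier by (auto simp: fixed_by_def)
  show "carrier (Gal L (fixed_by H)) \<subseteq> H"
  proof
    fix \<sigma> assume "\<sigma> \<in> carrier (Gal L (fixed_by H))"
    then have "\<sigma> \<in> carrier G" "\<sigma> \<eta> = \<eta>" using etaF by (auto simp: Gal_iff[OF sub] G_iff)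
    then show "\<sigma> \<in> H" using eta(2) by blast
  qed
  show "H \<subseteq> carrier (Gal L (fixed_by H))"
    using H.mem_carrier by (auto simp: Gal_iff[OF sub] G_iff) (auto simp: fixed_by_def)
qed

lemma fixed_by_one: "fixed_by {\<one>\<^bsub>G\<^esub>} = L"
  by (auto simp: fixed_by_def)

lemma galois_number_field_L: "galois_number_field L"
proof -
  have "number_field L"
    using degree_fixed_by[OF G.triv_subgroup] fixed_by_one by (auto simp: number_field_def)
  moreover have "{x \<in> L. \<forall>\<sigma>\<in>carrier G. \<sigma> x = x} = \<rat>"
  proof (intro equalityI subsetI)
    fix x :: complex assume x: "x \<in> \<rat>"
    then have "\<sigma> x = x" if "\<sigma> \<in> carrier G" for \<sigma>
      using cembedding.h_Rats[OF G_cembedding[OF that]] by blast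
    then show "x \<in> {x \<in> L. \<forall>\<sigma>\<in>carrier G. \<sigma> x = x}" using Rats_mem[OF x] by simp
  qed (simp add: fixed)
  ultimately show ?thesis by (simp add: galois_number_field_def)
qed

text \<open>A Galois field \<open>M\<close> containing the fixed field contains an element \<eta>
  with stabilizer \<open>H\<close>, hence all its conjugates. As the conjugates of \<open>H\<close>
  intersect trivially, some combination of these conjugates has trivial stabilizer and generates
  \<open>L\<close>.\<close>

lemma galois_closure_fixed_by:
  assumes H: "subgroup H G"
    and core: "\<And>\<sigma>. \<sigma> \<in> carrier G \<Longrightarrow> (\<And>\<tau>. \<tau> \<in> carrier G \<Longrightarrow> inv\<^bsub>G\<^esub> \<tau> \<otimes>\<^bsub>G\<^esub> \<sigma> \<otimes>\<^bsub>G\<^esub> \<tau> \<in> H) \<Longrightarrow> \<sigma> = \<one>\<^bsub>G\<^esub>"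
  shows "is_galois_closure L (fixed_by H)"
  unfolding is_galois_closure_def
proof (intro conjI allI impI galois_number_field_L)
  show "fixed_by H \<subseteq> L" by (auto simp: fixed_by_def)
  interpret H: subgroup H G by (rule H)
  fix M assume M: "galois_number_field M \<and> fixed_by H \<subseteq> M"
  then have "csubfield M"
    by (auto simp: galois_number_field_def number_field_def number_field_of_degree_def subfield_iff_csubfield)
  then interpret M: csub M by unfold_locales
  interpret M: galois_field M
    using M by unfold_locales (auto simp: galois_number_field_def)
  obtain \<eta> where eta: "\<eta> \<in> L" "\<And>\<sigma>. \<sigma> \<in> carrier G \<Longrightarrow> \<sigma> \<eta> = \<eta> \<longleftrightarrow> \<sigma> \<in> H"
    using stabiliser_element[OF H] by blast
  have etaM: "\<eta> \<in> M" using eta M H.mem_carrier by (auto simp: fixed_by_def)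
  obtain p where p: "p \<in> polys_over \<rat>" "p \<noteq> 0" "poly p \<eta> = 0" using algebraic_L[OF eta(1)] by blast
  have finM: "finite (M.orb \<eta>)"
  proof (rule finite_subset)
    show "finite {x. poly p x = 0}" using p(2) by (rule poly_roots_finite)
    show "M.orb \<eta> \<subseteq> {x. poly p x = 0}"
    proof
      fix x assume "x \<in> M.orb \<eta>"
      then obtain \<sigma> where s: "\<sigma> \<in> carrier M.G" "x = \<sigma> \<eta>" by (auto simp: M.orb_def)
      interpret cembedding M \<sigma> by (rule M.G_cembedding[OF s(1)])
      have "p \<in> polys_over M" using p M.Rats_mem by (auto simp: polys_over_def)
      then have "poly (map_poly \<sigma> p) (\<sigma> \<eta>) = 0" using p(3) etaM by (simp add: poly_map_poly)
      then show "x \<in> {x. poly p x = 0}" using s by (simp add: map_poly_Rats[OF p(1)])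
    qed
  qed
  define q where "q = (\<Prod>a\<in>M.orb \<eta>. [:-a, 1:])"
  have q: "q \<in> polys_over \<rat>" unfolding q_def by (rule M.orbit_poly[OF etaM])
  have q0: "poly q x = 0 \<longleftrightarrow> x \<in> M.orb \<eta>" for x using finM by (auto simp: q_def poly_prod)
  \<comment> \<open>The polynomial with the conjugates of \<eta> inside \<open>M\<close> as roots is
    rational, so the automorphisms of \<open>L\<close> also send \<eta> to one of its roots.\<close>
  have orbM: "orb \<eta> \<subseteq> M"
  proof
    fix x assume "x \<in> orb \<eta>"
    then obtain \<sigma> where s: "\<sigma> \<in> carrier G" "x = \<sigma> \<eta>" by (auto simp: orb_def)
    interpret cembedding L \<sigma> by (rule G_cembedding[OF s(1)])
    have "q \<in> polys_over L" using q Rats_mem by (auto simp: polys_over_def)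
    moreover have "poly q \<eta> = 0" using q0 M.orb_refl[OF etaM] by simp
    ultimately have "poly (map_poly \<sigma> q) (\<sigma> \<eta>) = 0" using eta(1) by (simp add: poly_map_poly)
    then have "x \<in> M.orb \<eta>" using q0 s by (simp add: map_poly_Rats[OF q])
    then show "x \<in> M" using M.orb_subset[OF etaM] by blast
  qed
  obtain f and n :: nat where f: "orb \<eta> = f ` {..<n}"
    using finite_orb by (metis finite_imp_nat_seg_image_inj_on lessThan_def)
  have "\<exists>t::nat. \<forall>\<sigma>\<in>carrier G. \<sigma> (\<Sum>k<n. of_nat t ^ k * f k) = (\<Sum>k<n. of_nat t ^ k * f k) \<longrightarrow> \<sigma> = \<one>\<^bsub>G\<^esub>"
  proof (rule generic_combination[OF finite_G])
    show "f k \<in> L" if "k < n" for k using f orb_subset[OF eta(1)] that by blast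
    fix \<sigma> assume s: "\<sigma> \<in> carrier G" and fx: "\<And>k. k < n \<Longrightarrow> \<sigma> (f k) = f k"
    show "\<sigma> = \<one>\<^bsub>G\<^esub>"
    proof (rule core[OF s])
      fix \<tau> assume t: "\<tau> \<in> carrier G"
      have "\<tau> \<eta> \<in> orb \<eta>" using t by (auto simp: orb_def)
      then have "\<sigma> (\<tau> \<eta>) = \<tau> \<eta>" using f fx by auto
      then have "(inv\<^bsub>G\<^esub> \<tau> \<otimes>\<^bsub>G\<^esub> \<sigma> \<otimes>\<^bsub>G\<^esub> \<tau>) \<eta> = \<eta>" using s t eta(1) by (simp add: Gal_mult_app Gal_inv_app Gal_app_mem)
      then show "inv\<^bsub>G\<^esub> \<tau> \<otimes>\<^bsub>G\<^esub> \<sigma> \<otimes>\<^bsub>G\<^esub> \<tau> \<in> H" using eta(2) s t by simp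
    qed
  qed
  then obtain t :: nat where t: "\<forall>\<sigma>\<in>carrier G. \<sigma> (\<Sum>k<n. of_nat t ^ k * f k) = (\<Sum>k<n. of_nat t ^ k * f k) \<longrightarrow> \<sigma> = \<one>\<^bsub>G\<^esub>"
    by blast
  define \<theta> where "\<theta> = (\<Sum>k<n. of_nat t ^ k * f k)"
  have thL: "\<theta> \<in> L" unfolding \<theta>_def using f orb_subset[OF eta(1)] by (intro mems) auto
  have thM: "\<theta> \<in> M" unfolding \<theta>_def using f orbM by (intro M.mems) auto
  show "L \<subseteq> M"
  proof
    fix y assume y: "y \<in> L"
    have "\<exists>p\<in>polys_over \<rat>. degree p < card (orb \<theta>) \<and> poly p \<theta> = y"
      by (rule interpolation[OF thL y finite_orb]) (use t y in \<open>auto simp: \<theta>_def\<close>)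
    then obtain p where "p \<in> polys_over \<rat>" "poly p \<theta> = y" by blast
    moreover from this have "p \<in> polys_over M" using M.Rats_mem by (auto simp: polys_over_def)
    ultimately show "y \<in> M" using M.poly_mem thM by blast
  qed
qed

end

section \<open>Finitely generated rings of integers and their prime ideals\<close>

inductive_set int_span :: "complex set \<Rightarrow> complex set" for B where
  zero: "0 \<in> int_span B"
| gen: "b \<in> B \<Longrightarrow> b \<in> int_span B"
| diff: "x \<in> int_span B \<Longrightarrow> y \<in> int_span B \<Longrightarrow> x - y \<in> int_span B"

lemma int_span_uminus: "x \<in> int_span B \<Longrightarrow> - x \<in> int_span B"
  using int_span.diff[OF int_span.zero, of x B] by simp

lemma int_span_add: "x \<in> int_span B \<Longrightarrow> y \<in> int_span B \<Longrightarrow> x + y \<in> int_span B"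
  using int_span.diff[OF _ int_span_uminus, of x B y] by simp

lemma int_span_nat: "x \<in> int_span B \<Longrightarrow> of_nat n * x \<in> int_span B"
  by (induction n) (auto simp: algebra_simps int_span.zero intro: int_span_add)

lemma int_span_int: "x \<in> int_span B \<Longrightarrow> of_int n * x \<in> int_span B"
  by (cases n rule: int_cases2) (auto intro: int_span_nat int_span_uminus)

lemma int_span_insert:
  assumes "x \<in> int_span (insert b B)"
  shows "\<exists>n. \<exists>y\<in>int_span B. x = of_int n * b + y"
  using assms
proof induction
  case zero
  then show ?case by (intro exI[of _ 0] bexI[of _ 0]) (auto intro: int_span.zero)
next
  case (gen c)
  show ?case
  proof (cases "c = b")
    case True
    then show ?thesis by (intro exI[of _ 1] bexI[of _ 0]) (auto intro: int_span.zero)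
  next
    case False
    then show ?thesis using gen by (intro exI[of _ 0] bexI[of _ c]) (auto intro: int_span.gen)
  qed
next
  case (diff x y)
  then obtain m n u v where "u \<in> int_span B" "v \<in> int_span B" "x = of_int m * b + u" "y = of_int n * b + v" by blast
  then show ?case by (intro exI[of _ "m - n"] bexI[of _ "u - v"]) (auto simp: algebra_simps intro: int_span.diff)
qed

text \<open>Induction on the generators. If some combination that really involves the new generator
  is rational, it serves to eliminate that generator from any other rational combination.\<close>

lemma int_span_denominator:
  assumes "finite B"
  shows "\<exists>D::int. D > 0 \<and> (\<forall>r\<in>int_span B \<inter> \<rat>. of_int D * r \<in> \<int>)"
  using assms
proof induction
  case empty
  have "x = 0" if "x \<in> int_span {}" for x using that by induction auto
  then show ?case by (intro exI[of _ 1]) force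
next
  case (insert b B)
  then obtain D :: int where D: "D > 0" "\<And>r. r \<in> int_span B \<Longrightarrow> r \<in> \<rat> \<Longrightarrow> of_int D * r \<in> \<int>" by auto
  show ?case
  proof (cases "\<exists>n y. n \<noteq> 0 \<and> y \<in> int_span B \<and> of_int n * b + y \<in> \<rat>")
    case False
    have "of_int D * r \<in> \<int>" if r: "r \<in> int_span (insert b B)" "r \<in> \<rat>" for r
    proof -
      obtain n y where "y \<in> int_span B" "r = of_int n * b + y" using int_span_insert[OF r(1)] by blast
      then show ?thesis using D False r by (cases "n = 0") auto
    qed
    then show ?thesis using D(1) by auto
  next
    case True
    then obtain n0 y0 where n0: "n0 \<noteq> 0" "y0 \<in> int_span B" "of_int n0 * b + y0 \<in> \<rat>" by blast
    define r0 where "r0 = of_int n0 * b + y0"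
    obtain p q :: int where pq: "q > 0" "r0 = of_int p / of_int q"
      using n0(3) by (metis Rats_cases' r0_def)
    have *: "of_int (D * q * n0) * r \<in> \<int>" if r: "r \<in> int_span (insert b B)" "r \<in> \<rat>" for r
    proof -
      obtain n y where y: "y \<in> int_span B" "r = of_int n * b + y" using int_span_insert[OF r(1)] by blast
      \<comment> \<open>Cross multiplication cancels \<open>b\<close>, which leaves an element of
        the smaller span.\<close>
      have e: "of_int n0 * r - of_int n * r0 = of_int n0 * y - of_int n * y0"
        by (simp add: y r0_def algebra_simps)
      have "of_int n0 * r - of_int n * r0 \<in> \<rat>" using r n0(3) by (auto simp: r0_def)
      then have "of_int D * (of_int n0 * r - of_int n * r0) \<in> \<int>"
        using D(2)[of "of_int n0 * y - of_int n * y0"] e int_span.diff int_span_int y(1) n0(2) by metis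
      then have "of_int q * (of_int D * (of_int n0 * r - of_int n * r0)) + of_int (D * n * p) \<in> \<int>" by auto
      also have "of_int q * (of_int D * (of_int n0 * r - of_int n * r0)) + of_int (D * n * p) = of_int (D * q * n0) * r"
        using pq by (simp add: field_simps)
      finally show ?thesis .
    qed
    \<comment> \<open>\<open>n0\<close> may be negative, while a positive denominator is
      claimed.\<close>
    have "of_int \<bar>D * q * n0\<bar> * r \<in> \<int>" if r: "r \<in> int_span (insert b B)" "r \<in> \<rat>" for r
      using *[OF that] by (auto simp: abs_if)
    moreover have "\<bar>D * q * n0\<bar> > 0" using D(1) pq(1) n0(1) by simp
    ultimately show ?thesis by blast
  qed
qed

text \<open>All powers of the reduced denominator divide \<open>D\<close>; already the power with
  exponent \<open>D\<close> would exceed \<open>D\<close> unless the denominator is 1.\<close>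

lemma bounded_denominator_powers_imp_int:
  fixes r :: complex
  assumes "r \<in> \<rat>" "D > (0::int)" "\<And>k::nat. of_int D * r ^ k \<in> \<int>"
  shows "r \<in> \<int>"
proof -
  obtain u v :: int where uv: "v > 0" "coprime u v" "r = of_int u / of_int v"
    using assms(1) by (metis Rats_cases')
  have dv: "v ^ k dvd D" for k :: nat
  proof -
    obtain m where m: "of_int D * r ^ k = of_int m" using assms(3)[of k] by (auto elim: Ints_cases)
    have "(of_int (D * u ^ k) :: complex) = of_int (m * v ^ k)"
      using m uv(1) by (simp add: uv(3) power_divide field_simps)
    then have "D * u ^ k = m * v ^ k" by (simp only: of_int_eq_iff)
    then have "v ^ k dvd D * u ^ k" by simp
    moreover have "coprime (v ^ k) (u ^ k)" using uv(2) by (simp add: coprime_commute)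
    ultimately show ?thesis by (simp add: coprime_dvd_mult_left_iff)
  qed
  have "v = 1"
  proof (rule ccontr)
    assume "v \<noteq> 1"
    then have "2 \<le> v" using uv(1) by simp
    then have "(2::int) ^ nat D \<le> v ^ nat D" by (intro power_mono) auto
    also have "\<dots> \<le> D" using dv[of "nat D"] assms(2) by (intro zdvd_imp_le) auto
    also have "D < 2 ^ nat D" using assms(2) less_exp[of "nat D"] by (metis int_nat_eq less_imp_le of_nat_less_numeral_power_cancel_iff zless_nat_eq_int_zless nat_eq_iff2 of_nat_less_iff of_nat_numeral of_nat_power)
    finally show False by simp
  qed
  then show ?thesis using uv(3) by simp
qed

text \<open>Finite generation as an additive group replaces integrality. Its use is
  \<open>rational_imp_int\<close>, since the powers of an element of \<open>R\<close> all lie in one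
  finitely generated group.\<close>

locale integral_ring = csubr R for R +
  assumes finitely_generated: "\<exists>B. finite B \<and> R \<subseteq> int_span B"
begin

lemma rational_imp_int:
  assumes "x \<in> R" "x \<in> \<rat>"
  shows "x \<in> \<int>"
proof -
  obtain B where B: "finite B" "R \<subseteq> int_span B" using finitely_generated by blast
  obtain D :: int where "D > 0" "\<forall>r\<in>int_span B \<inter> \<rat>. of_int D * r \<in> \<int>"
    using int_span_denominator[OF B(1)] by blast
  moreover have "x ^ k \<in> int_span B \<inter> \<rat>" for k using assms B(2) ring_mems(5) by auto
  ultimately show ?thesis using bounded_denominator_powers_imp_int[OF assms(2)] by blast
qed

end

section \<open>Prime ideals above a rational prime and congruences modulo them\<close>

locale prime_ideal = csubr R for R +
  fixes P :: "complex set" and p :: nat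
  assumes p_prime: "prime p" and P_sub: "P \<subseteq> R" and p_mem: "of_nat p \<in> P" and one_notin: "1 \<notin> P"
    and P_add: "x \<in> P \<Longrightarrow> y \<in> P \<Longrightarrow> x + y \<in> P" and P_mult: "x \<in> P \<Longrightarrow> y \<in> R \<Longrightarrow> x * y \<in> P"
    and P_prime: "x \<in> R \<Longrightarrow> y \<in> R \<Longrightarrow> x * y \<in> P \<Longrightarrow> x \<in> P \<or> y \<in> P"

text \<open>The multiples of \<open>p\<close> form a proper ideal because 1/p is not an integer.
  Zorn's lemma gives a maximal proper ideal above it, and a maximal ideal is prime.\<close>

lemma (in integral_ring) exists_prime_ideal:
  assumes p: "prime p"
  shows "\<exists>P. prime_ideal R P p"
proof -
  define I where "I = {J. J \<subseteq> R \<and> of_nat p \<in> J \<and> 1 \<notin> J \<and> (\<forall>x\<in>J. \<forall>y\<in>J. x + y \<in> J) \<and> (\<forall>x\<in>J. \<forall>y\<in>R. x * y \<in> J)}"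
  have "(\<lambda>x. of_nat p * x) ` R \<in> I"
  proof -
    have "1 \<notin> (\<lambda>x. of_nat p * x) ` R"
    proof
      assume "1 \<in> (\<lambda>x. of_nat p * x) ` R"
      then obtain x where x: "x \<in> R" "1 = of_nat p * x" by blast
      then have "x = 1 / of_nat p" using p by (simp add: field_simps)
      then have "x \<in> \<rat>" by simp
      then have "x \<in> \<int>" using rational_imp_int x by blast
      then obtain m where "x = of_int m" by (auto elim: Ints_cases)
      then have "(of_int (int p * m) :: complex) = of_int 1" using x(2) by simp
      then have "int p * m = 1" by (simp only: of_int_eq_iff)
      then show False using p by (auto simp: zmult_eq_1_iff)
    qed
    moreover have "of_nat p \<in> (\<lambda>x. of_nat p * x) ` R" by (rule rev_image_eqI[of 1]) auto
    moreover have "x + y \<in> (\<lambda>x. of_nat p * x) ` R" if xy: "x \<in> (\<lambda>x. of_nat p * x) ` R" "y \<in> (\<lambda>x. of_nat p * x) ` R" for x y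
    proof -
      obtain u v where "u \<in> R" "v \<in> R" "x = of_nat p * u" "y = of_nat p * v" using xy by blast
      then show ?thesis by (intro rev_image_eqI[of "u + v"]) (auto simp: algebra_simps intro: ring_mems)
    qed
    moreover have "x * y \<in> (\<lambda>x. of_nat p * x) ` R" if xy: "x \<in> (\<lambda>x. of_nat p * x) ` R" "y \<in> R" for x y
    proof -
      obtain u where "u \<in> R" "x = of_nat p * u" using xy by blast
      then show ?thesis using xy by (intro rev_image_eqI[of "u * y"]) (auto simp: algebra_simps intro: ring_mems)
    qed
    ultimately show ?thesis by (auto simp: I_def intro: ring_mems)
  qed
  then have ne: "I \<noteq> {}" by blast
  have ch: "\<Union>C \<in> I" if C: "C \<noteq> {}" "subset.chain I C" for C
  proof -
    have sub: "C \<subseteq> I" and lin: "\<And>U W. U \<in> C \<Longrightarrow> W \<in> C \<Longrightarrow> U \<subseteq> W \<or> W \<subseteq> U"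
      using C(2) by (auto simp: subset_chain_def)
    have "x + y \<in> \<Union>C" if xy: "x \<in> \<Union>C" "y \<in> \<Union>C" for x y
    proof -
      obtain U W where UW: "x \<in> U" "U \<in> C" "y \<in> W" "W \<in> C" using xy by blast
      then obtain Z where "Z \<in> C" "x \<in> Z" "y \<in> Z" using lin by blast
      then show ?thesis using sub by (auto simp: I_def)
    qed
    moreover have "\<Union>C \<subseteq> R" "1 \<notin> \<Union>C" using sub by (auto simp: I_def)
    moreover have "of_nat p \<in> \<Union>C" using sub C(1) by (auto simp: I_def)
    moreover have "x * y \<in> \<Union>C" if "x \<in> \<Union>C" "y \<in> R" for x y
      using that sub by (auto simp: I_def) blast
    ultimately show ?thesis unfolding I_def by blast
  qed
  obtain P where P: "P \<in> I" "\<And>U. U \<in> I \<Longrightarrow> P \<subseteq> U \<Longrightarrow> U = P"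
    using subset_Zorn_nonempty[OF ne ch] by blast
  have PI: "P \<subseteq> R" "of_nat p \<in> P" "1 \<notin> P" "\<And>x y. x \<in> P \<Longrightarrow> y \<in> P \<Longrightarrow> x + y \<in> P"
    "\<And>x y. x \<in> P \<Longrightarrow> y \<in> R \<Longrightarrow> x * y \<in> P"
    using P(1) by (auto simp: I_def)
  have "y \<in> P" if xy: "x \<in> R" "y \<in> R" "x * y \<in> P" "x \<notin> P" for x y
  proof -
    \<comment> \<open>The ideal generated by \<open>P\<close> and \<open>x\<close> is strictly
      larger than \<open>P\<close>, so by maximality it contains 1.\<close>
    define J where "J = {q + x * r |q r. q \<in> P \<and> r \<in> R}"
    have zP: "0 \<in> P" using PI(5)[OF PI(2) zero_mem] by simp
    have PJ: "P \<subseteq> J"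
    proof
      fix q assume q: "q \<in> P"
      have "q = q + x * 0" by simp
      then show "q \<in> J" unfolding J_def using q zero_mem by blast
    qed
    have "x = 0 + x * 1" by simp
    then have "x \<in> J" unfolding J_def using zP one_mem by blast
    then have "J \<noteq> P" using xy by blast
    then have "J \<notin> I" using P(2) PJ by blast
    moreover have "J \<subseteq> R" unfolding J_def using PI(1) xy(1) by (auto intro!: ring_mems)
    moreover have "of_nat p \<in> J" using PJ PI by blast
    moreover have "u + v \<in> J" if uv: "u \<in> J" "v \<in> J" for u v
    proof -
      obtain q r q' r' where "q \<in> P" "r \<in> R" "q' \<in> P" "r' \<in> R" "u = q + x * r" "v = q' + x * r'"
        using uv unfolding J_def by blast
      then have "u + v = (q + q') + x * (r + r')" "q + q' \<in> P" "r + r' \<in> R"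
        by (simp_all add: algebra_simps PI(4) ring_mems)
      then show ?thesis unfolding J_def by blast
    qed
    moreover have "u * v \<in> J" if uv: "u \<in> J" "v \<in> R" for u v
    proof -
      obtain q r where "q \<in> P" "r \<in> R" "u = q + x * r" using uv unfolding J_def by blast
      then have "u * v = q * v + x * (r * v)" "q * v \<in> P" "r * v \<in> R"
        using uv(2) by (simp_all add: algebra_simps PI(5) ring_mems)
      then show ?thesis unfolding J_def by blast
    qed
    ultimately have "1 \<in> J" unfolding I_def by blast
    then obtain q r where qr: "q \<in> P" "r \<in> R" "1 = q + x * r" unfolding J_def by blast
    have "y = q * y + x * y * r" using arg_cong[OF qr(3), of "\<lambda>z. z * y"] by (simp add: algebra_simps)
    moreover have "q * y + x * y * r \<in> P" using qr xy PI by blast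
    ultimately show ?thesis by simp
  qed
  then have "prime_ideal R P p" using p PI by unfold_locales (blast+)
  then show ?thesis by blast
qed

context prime_ideal
begin

lemma P_zero [simp]: "0 \<in> P"
  using P_mult[OF p_mem zero_mem] by simp

lemma P_mult2: "x \<in> R \<Longrightarrow> y \<in> P \<Longrightarrow> x * y \<in> P"
  using P_mult[of y x] by (simp add: mult.commute)

lemma P_uminus: "x \<in> P \<Longrightarrow> - x \<in> P"
  using P_mult[of x "-1"] uminus_mem[OF one_mem] by simp

lemma P_diff: "x \<in> P \<Longrightarrow> y \<in> P \<Longrightarrow> x - y \<in> P"
  using P_add[of x "-y"] P_uminus by simp

lemma P_sum: "(\<And>i. i \<in> A \<Longrightarrow> f i \<in> P) \<Longrightarrow> sum f A \<in> P"
  by (induction A rule: infinite_finite_induct) (auto intro: P_add)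

lemma P_int_iff: "of_int n \<in> P \<longleftrightarrow> int p dvd n"
proof
  assume n: "of_int n \<in> P"
  show "int p dvd n"
  proof (rule ccontr)
    assume "\<not> int p dvd n"
    then have "coprime (int p) n" using p_prime by (simp add: prime_imp_coprime)
    then obtain u v where "u * int p + v * n = 1" by (metis bezout_int coprime_imp_gcd_eq_1)
    then have "of_int u * of_nat p + of_int v * of_int n = (1::complex)"
      by (metis of_int_1 of_int_add of_int_mult of_int_of_nat_eq)
    moreover have "of_int u * of_nat p + of_int v * of_int n \<in> P"
      using n p_mem by (intro P_add P_mult2 of_int_mem)
    ultimately show False using one_notin by simp
  qed
next
  assume "int p dvd n"
  then obtain k where "n = int p * k" by blast
  then show "of_int n \<in> P" using P_mult[OF p_mem of_int_mem[of k]] by simp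
qed

definition cong :: "complex \<Rightarrow> complex \<Rightarrow> bool" (infix "\<approx>\<^sub>P" 50) where
  "x \<approx>\<^sub>P y \<longleftrightarrow> x - y \<in> P"

lemma cong_refl [simp]: "x \<approx>\<^sub>P x"
  by (simp add: cong_def)

lemma cong_sym: "x \<approx>\<^sub>P y \<Longrightarrow> y \<approx>\<^sub>P x"
  using P_uminus[of "x - y"] by (simp add: cong_def)

lemma cong_trans [trans]: "x \<approx>\<^sub>P y \<Longrightarrow> y \<approx>\<^sub>P z \<Longrightarrow> x \<approx>\<^sub>P z"
  using P_add[of "x - y" "y - z"] by (simp add: cong_def)

lemma cong_add: "x \<approx>\<^sub>P y \<Longrightarrow> u \<approx>\<^sub>P v \<Longrightarrow> x + u \<approx>\<^sub>P y + v"
  using P_add[of "x - y" "u - v"] by (simp add: cong_def algebra_simps)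

lemma cong_mult:
  assumes "x \<approx>\<^sub>P y" "u \<approx>\<^sub>P v" "y \<in> R" "u \<in> R"
  shows "x * u \<approx>\<^sub>P y * v"
proof -
  have "(x - y) * u + y * (u - v) \<in> P" using assms by (intro P_add P_mult P_mult2) (auto simp: cong_def)
  then show ?thesis by (simp add: cong_def algebra_simps)
qed

lemma cong_power:
  assumes "x \<approx>\<^sub>P y" "x \<in> R" "y \<in> R"
  shows "x ^ n \<approx>\<^sub>P y ^ n"
  by (induction n) (auto intro!: cong_mult assms ring_mems)

lemma cong_int: "int p dvd m - n \<Longrightarrow> of_int m \<approx>\<^sub>P of_int n"
  using P_int_iff[of "m - n"] by (simp add: cong_def)

lemma P_prod:
  assumes "finite A" "\<And>i. i \<in> A \<Longrightarrow> f i \<in> R" "prod f A \<in> P"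
  shows "\<exists>i\<in>A. f i \<in> P"
  using assms
proof induction
  case (insert a A)
  then show ?case using P_prime[of "f a" "prod f A"] prod_mem[of A f] by auto
qed (use one_notin in auto)

lemma poly_P_add: "u \<in> polys_over P \<Longrightarrow> v \<in> polys_over P \<Longrightarrow> u + v \<in> polys_over P"
  and poly_P_diff: "u \<in> polys_over P \<Longrightarrow> v \<in> polys_over P \<Longrightarrow> u - v \<in> polys_over P"
  and poly_P_mult: "u \<in> polys_over P \<Longrightarrow> v \<in> polys_over R \<Longrightarrow> u * v \<in> polys_over P"
  by (auto simp: polys_over_def coeff_mult intro!: P_add P_diff P_sum P_mult)

lemma zero_poly_P: "0 \<in> polys_over P"
  by (simp add: polys_over_def)

lemma poly_P_sum: "(\<And>i. i \<in> A \<Longrightarrow> f i \<in> polys_over P) \<Longrightarrow> sum f A \<in> polys_over P"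
  by (induction A rule: infinite_finite_induct) (auto intro: poly_P_add simp: zero_poly_P)

text \<open>Gauss's argument: at the sum of the lowest indices whose coefficients lie outside
  \<open>P\<close>, the product has a coefficient outside \<open>P\<close>.\<close>

lemma poly_P_prime:
  assumes u: "u \<in> polys_over R" and v: "v \<in> polys_over R" and uv: "u * v \<in> polys_over P"
  shows "u \<in> polys_over P \<or> v \<in> polys_over P"
proof (rule ccontr)
  assume "\<not> ?thesis"
  then have ex: "\<exists>i. coeff u i \<notin> P" "\<exists>j. coeff v j \<notin> P" by (auto simp: polys_over_def)
  define i where "i = (LEAST i. coeff u i \<notin> P)"
  define j where "j = (LEAST j. coeff v j \<notin> P)"
  have i1: "coeff u i \<notin> P" unfolding i_def by (rule LeastI_ex[OF ex(1)])
  have i2: "coeff u k \<in> P" if "k < i" for k using not_less_Least[OF that[unfolded i_def]] by blast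
  note i = i1 i2
  have j1: "coeff v j \<notin> P" unfolding j_def by (rule LeastI_ex[OF ex(2)])
  have j2: "coeff v k \<in> P" if "k < j" for k using not_less_Least[OF that[unfolded j_def]] by blast
  note j = j1 j2
  have R: "coeff u k \<in> R" "coeff v k \<in> R" for k using u v by (auto simp: polys_over_def)
  have "coeff (u * v) (i + j) = coeff u i * coeff v j + (\<Sum>k\<in>{..i + j} - {i}. coeff u k * coeff v (i + j - k))"
    unfolding coeff_mult by (subst sum.remove[of _ i]) auto
  moreover have "(\<Sum>k\<in>{..i + j} - {i}. coeff u k * coeff v (i + j - k)) \<in> P"
  proof (rule P_sum)
    fix k assume k: "k \<in> {..i + j} - {i}"
    show "coeff u k * coeff v (i + j - k) \<in> P"
    proof (cases "k < i")
      case True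
      then show ?thesis using i R P_mult by blast
    next
      case False
      then have "i + j - k < j" using k by auto
      then show ?thesis using j R P_mult2 by blast
    qed
  qed
  moreover have "coeff (u * v) (i + j) \<in> P" using uv by (auto simp: polys_over_def)
  ultimately have "coeff u i * coeff v j \<in> P" using P_diff by (metis add_diff_cancel_right')
  then show False using P_prime R i j by blast
qed

lemma poly_P_prod:
  assumes "finite A" "\<And>i. i \<in> A \<Longrightarrow> f i \<in> polys_over R" "prod f A \<in> polys_over P"
  shows "\<exists>i\<in>A. f i \<in> polys_over P"
  using assms
proof induction
  case empty
  then have "coeff 1 0 \<in> P" unfolding polys_over_def by (metis mem_Collect_eq prod.empty)
  then show ?case using one_notin by simp
next
  case (insert a A)
  then show ?case using poly_P_prime[of "f a" "prod f A"] polys_over_prod[of A f] by auto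
qed

lemma poly_P_nat: "p dvd n \<Longrightarrow> u \<in> polys_over R \<Longrightarrow> of_nat n * u \<in> polys_over P"
proof -
  assume "p dvd n" "u \<in> polys_over R"
  then obtain k where k: "n = p * k" by blast
  have "of_nat n * coeff u i \<in> P" for i
  proof -
    have "of_nat p * (of_nat k * coeff u i) \<in> P"
      using \<open>u \<in> polys_over R\<close> by (intro P_mult p_mem ring_mems) (auto simp: polys_over_def)
    then show ?thesis by (simp add: k mult.assoc)
  qed
  then show ?thesis by (simp add: polys_over_def of_nat_poly)
qed

text \<open>The inner binomial coefficients are divisible by \<open>p\<close>, so only the two outer
  terms survive.\<close>

lemma freshman:
  assumes "u \<in> polys_over R" "v \<in> polys_over R"
  shows "(u + v) ^ p - u ^ p - v ^ p \<in> polys_over P"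
proof -
  have p1: "p > 1" using p_prime by (rule prime_gt_1_nat)
  have pw: "x ^ n \<in> polys_over R" if "x \<in> polys_over R" for x n using that by (induction n) (auto intro: polys_overs)
  let ?t = "\<lambda>k. of_nat (p choose k) * u ^ k * v ^ (p - k)"
  have "(u + v) ^ p = (\<Sum>k\<le>p. ?t k)" by (rule binomial_ring)
  also have "{..p} = insert 0 (insert p {1..<p})" using p1 by auto
  also have "(\<Sum>k\<in>\<dots>. ?t k) = v ^ p + (u ^ p + (\<Sum>k\<in>{1..<p}. ?t k))" using p1 by (subst sum.insert, simp, simp, subst sum.insert) auto
  finally have "(u + v) ^ p - u ^ p - v ^ p = (\<Sum>k\<in>{1..<p}. ?t k)" by simp
  moreover have "?t k \<in> polys_over P" if "k \<in> {1..<p}" for k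
  proof -
    have "p dvd p choose k" using that p_prime by (intro dvd_choose_prime) auto
    then have "of_nat (p choose k) * (u ^ k * v ^ (p - k)) \<in> polys_over P"
      using assms by (intro poly_P_nat polys_overs pw)
    then show ?thesis by (simp add: mult.assoc)
  qed
  ultimately show ?thesis using poly_P_sum[of "{1..<p}" ?t] by simp
qed

lemma freshman_sum:
  assumes "finite A" "\<And>i. i \<in> A \<Longrightarrow> f i \<in> polys_over R"
  shows "(\<Sum>i\<in>A. f i) ^ p - (\<Sum>i\<in>A. f i ^ p) \<in> polys_over P"
  using assms
proof induction
  case empty
  then show ?case using prime_gt_0_nat[OF p_prime] by (simp add: power_0_left polys_over_def)
next
  case (insert a A)
  have "((f a + sum f A) ^ p - f a ^ p - sum f A ^ p) + (sum f A ^ p - (\<Sum>i\<in>A. f i ^ p)) \<in> polys_over P"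
    using insert by (intro poly_P_add freshman polys_overs) auto
  then show ?case using insert by (simp add: algebra_simps)
qed

end

section \<open>Frobenius elements\<close>

lemma coeff_mult_linear: "coeff ([:-u, 1:] * q) j = (if j = 0 then 0 else coeff q (j - 1)) - u * coeff q j"
  for q :: "'a::comm_ring_1 poly"
  by (cases j) simp_all

lemma map_poly_prod_linear_over:
  fixes h :: "'a::comm_ring_1 \<Rightarrow> 'a"
  assumes "finite A" "\<And>a. a \<in> A \<Longrightarrow> f a \<in> T"
    and T: "0 \<in> T" "1 \<in> T" "\<And>u v. u \<in> T \<Longrightarrow> v \<in> T \<Longrightarrow> u - v \<in> T" "\<And>u v. u \<in> T \<Longrightarrow> v \<in> T \<Longrightarrow> u * v \<in> T"
    and h: "h 0 = 0" "h 1 = 1" "\<And>u v. u \<in> T \<Longrightarrow> v \<in> T \<Longrightarrow> h (u - v) = h u - h v"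
      "\<And>u v. u \<in> T \<Longrightarrow> v \<in> T \<Longrightarrow> h (u * v) = h u * h v"
  shows "(\<forall>j. coeff (\<Prod>a\<in>A. [:- f a, 1:]) j \<in> T) \<and>
    map_poly h (\<Prod>a\<in>A. [:- f a, 1:]) = (\<Prod>a\<in>A. [:- h (f a), 1:])"
  using assms(1,2)
proof (induction A)
  case empty
  then show ?case using T h by (auto simp: coeff_1 map_poly_1)
next
  case (insert a A)
  define q where "q = (\<Prod>a\<in>A. [:- f a, 1:])"
  have q: "coeff q j \<in> T" for j using insert by (auto simp: q_def)
  have fa: "f a \<in> T" using insert by simp
  have m: "map_poly h q = (\<Prod>a\<in>A. [:- h (f a), 1:])" using insert by (auto simp: q_def)
  have e: "(\<Prod>a\<in>insert a A. [:- f a, 1:]) = [:- f a, 1:] * q"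
    unfolding q_def using insert by (subst prod.insert) auto
  have "map_poly h ([:- f a, 1:] * q) = [:- h (f a), 1:] * map_poly h q"
    by (rule poly_eqI) (use q fa T h in \<open>simp only: coeff_mult_linear coeff_map_poly; simp\<close>)
  then show ?case unfolding e using insert q fa T
    by (subst prod.insert) (auto simp: m coeff_mult_linear simp del: mult_pCons_left)
qed

lemma pcompose_pow: "pcompose (q ^ n) r = pcompose q r ^ n"
  for q r :: "'a::comm_ring_1 poly"
  by (induction n) (auto simp: pcompose_1 pcompose_mult)

context prime_ideal
begin

definition pcong :: "complex poly \<Rightarrow> complex poly \<Rightarrow> bool" (infix "\<simeq>\<^sub>t" 50) where
  "u \<simeq>\<^sub>t v \<longleftrightarrow> u - v \<in> polys_over P"

lemma pcong_refl [simp]: "u \<simeq>\<^sub>t u"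
  by (simp add: pcong_def polys_over_def)

lemma pcong_trans [trans]: "u \<simeq>\<^sub>t v \<Longrightarrow> v \<simeq>\<^sub>t w \<Longrightarrow> u \<simeq>\<^sub>t w"
  using poly_P_add[of "u - v" "v - w"] by (simp add: pcong_def)

lemma pcong_sym: "u \<simeq>\<^sub>t v \<Longrightarrow> v \<simeq>\<^sub>t u"
  using poly_P_diff[of 0 "u - v"] by (simp add: pcong_def polys_over_def)

lemma pcong_mult:
  assumes "x \<simeq>\<^sub>t y" "u \<simeq>\<^sub>t v" "y \<in> polys_over R" "u \<in> polys_over R"
  shows "x * u \<simeq>\<^sub>t y * v"
proof -
  have "(x - y) * u + (u - v) * y \<in> polys_over P" using assms by (intro poly_P_add poly_P_mult) (auto simp: pcong_def)
  then show ?thesis by (simp add: pcong_def algebra_simps)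
qed

lemma polys_over_power: "x \<in> polys_over R \<Longrightarrow> x ^ n \<in> polys_over R"
  by (induction n) (auto intro: polys_overs)

lemma pcong_power:
  assumes "x \<simeq>\<^sub>t y" "x \<in> polys_over R" "y \<in> polys_over R"
  shows "x ^ n \<simeq>\<^sub>t y ^ n"
  by (induction n) (auto intro!: pcong_mult assms polys_over_power)

lemma pcong_sum: "(\<And>i. i \<in> A \<Longrightarrow> f i \<simeq>\<^sub>t g i) \<Longrightarrow> sum f A \<simeq>\<^sub>t sum g A"
  using poly_P_sum[of A "\<lambda>i. f i - g i"] by (simp add: pcong_def sum_subtractf)

text \<open>Fermat's little theorem, as the additivity of the \<open>p\<close>-th power on a sum of
  \<open>n\<close> ones.\<close>

lemma fermat_nat: "of_nat n ^ p \<approx>\<^sub>P of_nat n"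
proof -
  have "(\<Sum>i<n. 1) ^ p - (\<Sum>i<n. 1 ^ p) \<in> polys_over P"
    by (rule freshman_sum) auto
  then have "coeff (of_nat n ^ p - of_nat n) 0 \<in> P" by (simp add: polys_over_def)
  moreover have "coeff (of_nat n ^ p - of_nat n) 0 = (of_nat n ^ p - of_nat n :: complex)"
    by (simp flip: poly_0_coeff_0)
  ultimately show ?thesis by (simp add: cong_def)
qed

lemma fermat_int: "of_int n ^ p \<approx>\<^sub>P of_int n"
proof -
  define m where "m = nat (n mod int p)"
  have p0: "int p > 0" using prime_gt_0_nat[OF p_prime] by simp
  have "of_int n \<approx>\<^sub>P of_nat m"
    using cong_int[of n "int m"] p0 by (simp add: m_def)
  then have "of_int n ^ p \<approx>\<^sub>P of_nat m ^ p" by (rule cong_power) (auto intro: ring_mems)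
  also have "\<dots> \<approx>\<^sub>P of_nat m" by (rule fermat_nat)
  also have "\<dots> \<approx>\<^sub>P of_int n" by (rule cong_sym) fact
  finally show ?thesis .
qed

text \<open>The substitution of X^p for X.\<close>

definition up :: "complex poly \<Rightarrow> complex poly" where
  "up q = pcompose q (monom 1 p)"

lemma up_expand: "up q = (\<Sum>i\<le>degree q. monom (coeff q i) (i * p))"
proof -
  have "up (monom c i) = monom c (i * p)" for c i
    by (simp add: up_def monom_altdef pcompose_smult pcompose_pow pcompose_pCons power_mult[symmetric] mult.commute)
  then have "up (\<Sum>i\<le>degree q. monom (coeff q i) i) = (\<Sum>i\<le>degree q. monom (coeff q i) (i * p))"
    by (simp add: up_def pcompose_sum)
  then show ?thesis by (simp add: poly_as_sum_of_monoms)
qed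

lemma coeff_up: "coeff (up q) (k * p) = coeff q k"
proof -
  have p0: "p > 0" using p_prime by (rule prime_gt_0_nat)
  have "coeff (up q) (k * p) = (\<Sum>i\<le>degree q. if i = k then coeff q i else 0)"
    unfolding up_expand coeff_sum using p0 by (intro sum.cong) auto
  also have "\<dots> = coeff q k" by (simp add: coeff_eq_0)
  finally show ?thesis .
qed

lemma up_in_P: "up q \<in> polys_over P \<Longrightarrow> q \<in> polys_over P"
proof -
  assume "up q \<in> polys_over P"
  then have "coeff (up q) (k * p) \<in> P" for k by (simp add: polys_over_def)
  then show ?thesis by (simp add: polys_over_def coeff_up)
qed

definition frob_poly :: "complex poly \<Rightarrow> complex poly" where
  "frob_poly q = (\<Sum>i\<le>degree q. monom (coeff q i ^ p) i)"

lemma frob_poly_R: "q \<in> polys_over R \<Longrightarrow> frob_poly q \<in> polys_over R"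
  unfolding frob_poly_def by (intro polys_overs ring_mems) (auto simp: polys_over_def)

lemma up_R: "q \<in> polys_over R \<Longrightarrow> up q \<in> polys_over R"
  unfolding up_expand by (intro polys_overs ring_mems) (auto simp: polys_over_def)

text \<open>The \<open>p\<close>-th power acts on a polynomial modulo \<open>P\<close> by raising
  the coefficients to the power \<open>p\<close> and stretching the exponents by
  \<open>p\<close>.\<close>

lemma power_cong_up:
  assumes "q \<in> polys_over R"
  shows "q ^ p \<simeq>\<^sub>t up (frob_poly q)"
proof -
  have up_monom: "up (monom c i) = monom c (i * p)" for c i
    by (simp add: up_def monom_altdef pcompose_smult pcompose_pow pcompose_pCons power_mult[symmetric] mult.commute)
  have "(\<Sum>i\<le>degree q. monom (coeff q i) i) ^ p - (\<Sum>i\<le>degree q. monom (coeff q i) i ^ p) \<in> polys_over P"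
    using assms by (intro freshman_sum polys_overs) (auto simp: polys_over_def)
  moreover have "up (frob_poly q) = (\<Sum>i\<le>degree q. monom (coeff q i) i ^ p)"
    using up_monom by (simp add: frob_poly_def up_def pcompose_sum monom_power mult.commute)
  ultimately show ?thesis by (simp add: poly_as_sum_of_monoms pcong_def)
qed

lemma frob_poly_int:
  assumes "\<And>i. coeff q i \<in> \<int>"
  shows "frob_poly q \<simeq>\<^sub>t q"
proof -
  have "monom (coeff q i ^ p) i \<simeq>\<^sub>t monom (coeff q i) i" for i
  proof -
    obtain m where "coeff q i = of_int m" using assms[of i] by (auto elim: Ints_cases)
    then show ?thesis using fermat_int[of m] by (auto simp: pcong_def polys_over_def cong_def)
  qed
  then have "frob_poly q \<simeq>\<^sub>t (\<Sum>i\<le>degree q. monom (coeff q i) i)"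
    unfolding frob_poly_def by (intro pcong_sum)
  then show ?thesis by (simp add: poly_as_sum_of_monoms)
qed

lemma up_cong: "u \<simeq>\<^sub>t v \<Longrightarrow> u \<in> polys_over R \<Longrightarrow> v \<in> polys_over R \<Longrightarrow> up u \<simeq>\<^sub>t up v"
proof -
  assume "u \<simeq>\<^sub>t v"
  then have "up (u - v) \<in> polys_over P"
    using P_zero by (auto simp: up_expand polys_over_def pcong_def coeff_sum intro!: P_sum)
  then show ?thesis by (simp add: pcong_def up_def pcompose_diff)
qed

end

locale frobenius = nf?: normal_field S + R: integral_ring R + pid: prime_ideal R P p for S R P p +
  assumes S_R: "S \<subseteq> R"
begin

text \<open>All generators are packed as coefficients into one polynomial, so that a single \<sigma>
  is found for all of them at once. No decomposition group and no assumption on ramification is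
  involved; the polynomials over \<open>P\<close> being a prime ideal is what selects
  \<sigma>.\<close>

theorem exists_frobenius: "\<exists>\<sigma>\<in>carrier G. \<forall>s\<in>S. pid.cong (s ^ p) (\<sigma> s)"
proof -
  obtain g and n :: nat where g: "S = g ` {..<n}"
    using finite_S by (metis finite_imp_nat_seg_image_inj_on lessThan_def)
  have gS: "g k \<in> S" if "k < n" for k using g that by blast
  \<comment> \<open>The family of conjugates of the generators under \<sigma>, encoded in an
    auxiliary variable.\<close>
  define T where "T \<sigma> = (\<Sum>k<n. monom (\<sigma> (g k)) k)" for \<sigma> :: "complex \<Rightarrow> complex"
  have cX: "coeff (T \<sigma>) k = (if k < n then \<sigma> (g k) else 0)" for \<sigma> k
    by (simp add: T_def coeff_sum)
  have XL: "T \<sigma> \<in> polys_over L" and XR: "T \<sigma> \<in> polys_over R" if "\<sigma> \<in> carrier G" for \<sigma>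
    using gS Gal_S[OF that] S_R S_in_L by (auto simp: polys_over_def cX)
  \<comment> \<open>Its coefficients are invariant under \<open>G\<close> and lie over
    \<open>R\<close>, hence are polynomials with integer coefficients; these are unchanged by the
    \<open>p\<close>-th power modulo \<open>P\<close>.\<close>
  define F where "F = (\<Prod>\<sigma>\<in>carrier G. [:- T \<sigma>, 1:])"
  have FR: "coeff F j \<in> polys_over R" for j
    unfolding F_def using map_poly_prod_linear_over[OF finite_G, of T "polys_over R" id] XR
    by (auto intro: R.polys_overs)
  have FL: "coeff F j \<in> polys_over L" for j
    unfolding F_def using map_poly_prod_linear_over[OF finite_G, of T "polys_over L" id] XL
    by (auto intro: polys_overs)
  have inv: "map_poly \<tau> (coeff F j) = coeff F j" if t: "\<tau> \<in> carrier G" for \<tau> j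
  proof -
    interpret cembedding L \<tau> by (rule G_cembedding[OF t])
    have d: "map_poly \<tau> (u - v) = map_poly \<tau> u - map_poly \<tau> v" if "u \<in> polys_over L" "v \<in> polys_over L" for u v
      using that by (auto simp: poly_eq_iff coeff_map_poly polys_over_def h_diff)
    have "map_poly \<tau> (T \<sigma>) = T (\<tau> \<otimes>\<^bsub>G\<^esub> \<sigma>)" if "\<sigma> \<in> carrier G" for \<sigma>
      using that t gS S_in_L by (auto simp: poly_eq_iff coeff_map_poly cX Gal_mult_app)
    then have "map_poly (map_poly \<tau>) F = (\<Prod>\<sigma>\<in>carrier G. [:- T (\<tau> \<otimes>\<^bsub>G\<^esub> \<sigma>), 1:])"
      unfolding F_def
      using map_poly_prod_linear_over[OF finite_G, of T "polys_over L" "map_poly \<tau>"] XL d map_poly_mult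
      by (auto intro: polys_overs simp: map_poly_1)
    also have "\<dots> = F"
    proof -
      have "bij_betw (\<lambda>\<sigma>. \<tau> \<otimes>\<^bsub>G\<^esub> \<sigma>) (carrier G) (carrier G)"
        by (rule bij_betwI[of _ _ _ "\<lambda>\<sigma>. inv\<^bsub>G\<^esub> \<tau> \<otimes>\<^bsub>G\<^esub> \<sigma>"]) (use t in \<open>auto simp: G.m_assoc[symmetric]\<close>)
      then show ?thesis unfolding F_def
        using prod.reindex_bij_betw[of "\<lambda>\<sigma>. \<tau> \<otimes>\<^bsub>G\<^esub> \<sigma>" "carrier G" "carrier G" "\<lambda>\<sigma>. [:- T \<sigma>, 1:]"] by simp
    qed
    finally have "map_poly (map_poly \<tau>) F = F" .
    then show ?thesis by (metis coeff_map_poly map_poly_0)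
  qed
  have FZ: "coeff (coeff F j) i \<in> \<int>" for i j
  proof (rule R.rational_imp_int)
    show "coeff (coeff F j) i \<in> R" using FR by (auto simp: polys_over_def)
    show "coeff (coeff F j) i \<in> \<rat>" using polys_over_fixed[OF FL inv] by (auto simp: polys_over_def)
  qed
  define x where "x = T \<one>\<^bsub>G\<^esub>"
  define y where "y = (\<Sum>k<n. monom (g k ^ p) k)"
  have xR: "x \<in> polys_over R" unfolding x_def by (rule XR) simp
  have cx: "coeff x k = (if k < n then g k else 0)" for k
    using gS S_in_L by (simp add: x_def cX)
  have yR: "y \<in> polys_over R" unfolding y_def using gS S_R by (intro R.polys_overs R.ring_mems) auto
  \<comment> \<open>A zero generator may lower the degree of \<open>x\<close>; positivity of
    \<open>p\<close> keeps the missing coefficients equal, as 0 raised to \<open>p\<close> is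
    0.\<close>
  have fy: "pid.frob_poly x = y"
  proof -
    have "p > 0" using pid.p_prime by (rule prime_gt_0_nat)
    then have "coeff (pid.frob_poly x) k = coeff y k" for k
      using le_degree[of x k] cx[of k] by (auto simp: pid.frob_poly_def y_def coeff_sum cx power_0_left) blast
    then show ?thesis by (simp add: poly_eq_iff)
  qed
  have "poly F x = 0"
    unfolding F_def poly_prod x_def by (rule prod_zero[OF finite_G]) (rule bexI[of _ "\<one>\<^bsub>G\<^esub>"], auto)
  then have "(\<Sum>j\<le>degree F. coeff F j * x ^ j) ^ p = 0"
    using prime_gt_0_nat[OF pid.p_prime] by (simp add: poly_altdef)
  moreover have "(\<Sum>j\<le>degree F. coeff F j * x ^ j) ^ p - (\<Sum>j\<le>degree F. (coeff F j * x ^ j) ^ p) \<in> polys_over P"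
    by (rule pid.freshman_sum) (auto intro!: R.polys_overs FR pid.polys_over_power xR)
  ultimately have "pid.pcong 0 (\<Sum>j\<le>degree F. (coeff F j * x ^ j) ^ p)" by (simp add: pid.pcong_def power_0_left)
  also have "pid.pcong \<dots> (\<Sum>j\<le>degree F. pid.up (coeff F j) * pid.up y ^ j)"
  proof (rule pid.pcong_sum)
    fix j
    have 1: "pid.pcong (coeff F j ^ p) (pid.up (coeff F j))"
    proof -
      have "pid.pcong (coeff F j ^ p) (pid.up (pid.frob_poly (coeff F j)))" by (rule pid.power_cong_up[OF FR])
      also have "pid.pcong \<dots> (pid.up (coeff F j))"
        by (intro pid.up_cong pid.frob_poly_int FZ pid.frob_poly_R FR)
      finally show ?thesis .
    qed
    have "pid.pcong (x ^ p) (pid.up y)" using pid.power_cong_up[OF xR] by (simp add: fy)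
    then have "pid.pcong ((x ^ p) ^ j) (pid.up y ^ j)"
      by (intro pid.pcong_power pid.polys_over_power xR pid.up_R yR)
    then have "pid.pcong (coeff F j ^ p * (x ^ p) ^ j) (pid.up (coeff F j) * pid.up y ^ j)"
      by (intro pid.pcong_mult 1 pid.polys_over_power xR pid.up_R FR)
    moreover have "(coeff F j * x ^ j) ^ p = coeff F j ^ p * (x ^ p) ^ j"
      by (simp add: power_mult_distrib flip: power_mult) (simp add: mult.commute)
    ultimately show "pid.pcong ((coeff F j * x ^ j) ^ p) (pid.up (coeff F j) * pid.up y ^ j)" by simp
  qed
  also have "(\<Sum>j\<le>degree F. pid.up (coeff F j) * pid.up y ^ j) = pid.up (poly F y)"
    by (simp add: poly_altdef pid.up_def pcompose_sum pcompose_mult pcompose_pow)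
  finally have "pid.pcong (pid.up (poly F y)) 0" by (rule pid.pcong_sym)
  then have "poly F y \<in> polys_over P" using pid.up_in_P[of "poly F y"] by (simp add: pid.pcong_def)
  \<comment> \<open>The product of the differences lies over the prime ideal, so one difference
    does, and its coefficients are the wanted congruences.\<close>
  then have "(\<Prod>\<sigma>\<in>carrier G. y - T \<sigma>) \<in> polys_over P" by (simp add: F_def poly_prod)
  then have "\<exists>\<sigma>\<in>carrier G. y - T \<sigma> \<in> polys_over P"
    by (rule pid.poly_P_prod[OF finite_G, rotated]) (intro R.polys_overs yR XR)
  then obtain \<sigma> where s: "\<sigma> \<in> carrier G" "y - T \<sigma> \<in> polys_over P" by blast
  have "g k ^ p - \<sigma> (g k) \<in> P" if "k < n" for k
  proof -
    have "coeff (y - T \<sigma>) k \<in> P" using s by (auto simp: polys_over_def)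
    then show ?thesis using that by (simp add: cX y_def coeff_sum)
  qed
  then show ?thesis using s(1) g by (auto simp: pid.cong_def)
qed

text \<open>\<sigma> is not assumed to preserve \<open>P\<close>. The induction applies the
  hypothesis at \<sigma> \<open>s\<close>, which is again in \<open>S\<close>, instead of applying
  \<sigma> to a congruence.\<close>

lemma frobenius_power:
  assumes "\<sigma> \<in> carrier G" "\<And>s. s \<in> S \<Longrightarrow> pid.cong (s ^ p) (\<sigma> s)" "s \<in> S"
  shows "pid.cong (s ^ (p ^ n)) ((\<sigma> [^]\<^bsub>G\<^esub> n) s)"
  using assms(3)
proof (induction n arbitrary: s)
  case 0
  then show ?case using S_in_L by simp
next
  case (Suc n)
  have s: "s \<in> R" "\<sigma> s \<in> R" "\<sigma> s \<in> S" using Suc.prems S_R Gal_S[OF assms(1)] by auto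
  have "s ^ (p ^ Suc n) = (s ^ p) ^ (p ^ n)" by (simp flip: power_mult)
  also have "pid.cong \<dots> (\<sigma> s ^ (p ^ n))"
    by (intro pid.cong_power assms(2) Suc.prems R.ring_mems s)
  also have "pid.cong \<dots> ((\<sigma> [^]\<^bsub>G\<^esub> n) (\<sigma> s))" by (rule Suc.IH[OF s(3)])
  also have "(\<sigma> [^]\<^bsub>G\<^esub> n) (\<sigma> s) = (\<sigma> [^]\<^bsub>G\<^esub> Suc n) s"
    using assms(1) Suc.prems S_in_L by (simp add: Gal_mult_app)
  finally show ?case .
qed

end

section \<open>The Vandermonde product of six numbers\<close>

text \<open>Used twice: for the complex roots, where it detects even Galois permutations, and for
  integers, where it identifies the parity of inversions with the sign.\<close>

definition vdm :: "(nat \<Rightarrow> 'a::comm_ring_1) \<Rightarrow> 'a" where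
  "vdm f = (\<Prod>i<6. \<Prod>j<i. f i - f j)"

lemma prod_upto6: "(\<Prod>i<(6::nat). f i) = f 0 * f 1 * f 2 * f 3 * f 4 * (f 5 :: 'a::comm_monoid_mult)"
  by (simp add: eval_nat_numeral)

lemma all_less6: "(\<forall>i<6. P i) \<longleftrightarrow> P 0 \<and> P 1 \<and> P 2 \<and> P 3 \<and> P 4 \<and> P (5::nat)"
  by (simp add: eval_nat_numeral All_less_Suc2)

lemma vdm_expand: "vdm f = (f 1 - f 0) * (f 2 - f 0) * (f 2 - f 1) * (f 3 - f 0) * (f 3 - f 1) * (f 3 - f 2) *
    (f 4 - f 0) * (f 4 - f 1) * (f 4 - f 2) * (f 4 - f 3) *
    (f 5 - f 0) * (f 5 - f 1) * (f 5 - f 2) * (f 5 - f 3) * (f 5 - f 4)"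
  by (simp add: vdm_def prod_upto6) (simp add: eval_nat_numeral mult.assoc)

text \<open>In each of the fifteen cases the factors are permuted, and an odd number of them changes
  sign.\<close>

lemma vdm_transpose_less:
  assumes "q < 6" "p < q"
  shows "vdm (f \<circ> Transposition.transpose p q) = - vdm f"
proof -
  define D where "D i j = f i - f j" for i j
  have a: "D j i = - D i j" for i j by (simp add: D_def)
  note * = a[of 1 0] a[of 2 0] a[of 2 1] a[of 3 0] a[of 3 1] a[of 3 2] a[of 4 0] a[of 4 1] a[of 4 2] a[of 4 3]
    a[of 5 0] a[of 5 1] a[of 5 2] a[of 5 3] a[of 5 4]
  have n: "(0::nat) \<noteq> 1" "(0::nat) \<noteq> 2" "(0::nat) \<noteq> 3" "(0::nat) \<noteq> 4" "(0::nat) \<noteq> 5"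
    "(1::nat) \<noteq> 2" "(1::nat) \<noteq> 3" "(1::nat) \<noteq> 4" "(1::nat) \<noteq> 5" "(2::nat) \<noteq> 3" "(2::nat) \<noteq> 4" "(2::nat) \<noteq> 5"
    "(3::nat) \<noteq> 4" "(3::nat) \<noteq> 5" "(4::nat) \<noteq> 5" by simp_all
  define t where "t = Transposition.transpose p q"
  have t: "t i = (if i = p then q else if i = q then p else i)" for i
    by (simp add: t_def Transposition.transpose_def)
  have e: "vdm (f \<circ> t) = D (t 1) (t 0) * D (t 2) (t 0) * D (t 2) (t 1) * D (t 3) (t 0) * D (t 3) (t 1) * D (t 3) (t 2) *
    D (t 4) (t 0) * D (t 4) (t 1) * D (t 4) (t 2) * D (t 4) (t 3) *
    D (t 5) (t 0) * D (t 5) (t 1) * D (t 5) (t 2) * D (t 5) (t 3) * D (t 5) (t 4)"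
    by (simp add: vdm_expand D_def)
  have e': "vdm f = D 1 0 * D 2 0 * D 2 1 * D 3 0 * D 3 1 * D 3 2 * D 4 0 * D 4 1 * D 4 2 * D 4 3 *
    D 5 0 * D 5 1 * D 5 2 * D 5 3 * D 5 4"
    by (simp add: vdm_expand D_def)
  have "q = 1 \<and> p = 0 \<or> q = 2 \<and> p = 0 \<or> q = 2 \<and> p = 1 \<or> q = 3 \<and> p = 0 \<or> q = 3 \<and> p = 1 \<or> q = 3 \<and> p = 2 \<or>
    q = 4 \<and> p = 0 \<or> q = 4 \<and> p = 1 \<or> q = 4 \<and> p = 2 \<or> q = 4 \<and> p = 3 \<or>
    q = 5 \<and> p = 0 \<or> q = 5 \<and> p = 1 \<or> q = 5 \<and> p = 2 \<or> q = 5 \<and> p = 3 \<or> q = 5 \<and> p = 4"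
    using assms by presburger
  then show ?thesis
    unfolding t_def[symmetric] e e'
    by (elim disjE conjE;
      simp only: t n n[symmetric] if_True if_False not_False_eq_True refl HOL.simp_thms;
      simp only: * mult_minus_left mult_minus_right minus_minus mult_ac)
qed

lemma vdm_transpose:
  assumes "p < 6" "q < 6" "p \<noteq> q"
  shows "vdm (f \<circ> Transposition.transpose p q) = - vdm f"
  using vdm_transpose_less[of q p f] vdm_transpose_less[of p q f] assms
  by (metis linorder_neqE_nat Transposition.transpose_commute)

lemma vdm_permutes:
  assumes "\<pi> permutes {..<6}"
  shows "vdm (f \<circ> \<pi>) = of_int (sign \<pi>) * vdm f"
  using finite_lessThan assms
proof (induction rule: permutes_rev_induct)
  case id
  then show ?case by simp
next
  case (swap p q \<rho>)
  have "vdm (f \<circ> (\<rho> \<circ> Transposition.transpose p q)) = - vdm (f \<circ> \<rho>)"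
    using vdm_transpose[of p q "f \<circ> \<rho>"] swap(1-3) by (simp add: comp_assoc)
  moreover have "sign (\<rho> \<circ> Transposition.transpose p q) = - sign \<rho>"
    using swap by (subst sign_compose) (auto simp: sign_swap_id permutation_swap_id intro: permutation_permutes[THEN iffD2])
  moreover have "vdm (f \<circ> \<rho>) = of_int (sign \<rho>) * vdm f" by (rule swap.IH)
  ultimately show ?case by (simp only: of_int_minus mult_minus_left)
qed

section \<open>The sextic \<open>x\<^sup>6 + 30 x + 25\<close>\<close>

lemma exists_sextic_roots: "\<exists>a :: nat \<Rightarrow> complex. \<forall>x. x ^ 6 + 30 * x + 25 = (\<Prod>i<6. x - a i)"
proof -
  define F :: "complex poly" where "F = [:25, 30, 0, 0, 0, 0, 1:]"
  have "F \<noteq> 0" by (simp add: F_def)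
  from alg_closed_imp_factorization[OF this] obtain A where
    A: "size A = degree F" "F = smult (lead_coeff F) (\<Prod>x\<in>#A. [:-x, 1:])" by blast
  obtain l where l: "mset l = A" using ex_mset by blast
  have len: "length l = 6" using A(1) l by (auto simp: F_def size_mset[symmetric])
  have "x ^ 6 + 30 * x + 25 = (\<Prod>i<6. x - l ! i)" for x
  proof -
    have "x ^ 6 + 30 * x + 25 = poly F x" by (simp add: F_def algebra_simps eval_nat_numeral)
    also have "\<dots> = poly (\<Prod>x\<in>#A. [:-x, 1:]) x" by (subst A(2)) (simp add: F_def)
    also have "\<dots> = prod_list (map (\<lambda>y. x - y) l)"
      by (simp add: l[symmetric] poly_prod_mset image_mset.compositionality comp_def prod_mset_prod_list[symmetric] del: prod_mset_prod_list)
    also have "\<dots> = (\<Prod>i<6. x - l ! i)" by (subst prod.list_conv_set_nth) (simp add: len lessThan_atLeast0)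
    finally show ?thesis .
  qed
  then show ?thesis by blast
qed

locale sextic =
  fixes a :: "nat \<Rightarrow> complex"
  assumes roots: "\<And>x. x ^ 6 + 30 * x + 25 = (\<Prod>i<6. x - a i)"
begin

lemma root_iff: "x ^ 6 + 30 * x + 25 = 0 \<longleftrightarrow> (\<exists>i<6. x = a i)"
  by (simp add: roots prod_zero_iff) auto

lemma root: "i < 6 \<Longrightarrow> a i ^ 6 = - 30 * a i - 25"
proof -
  assume "i < 6"
  then have "a i ^ 6 + 30 * a i + 25 = 0" using root_iff by blast
  then show ?thesis by (simp add: eq_neg_iff_add_eq_0 algebra_simps)
qed

lemma prod_roots: "(\<Prod>i<6. a i) = 25"
  using roots[of 0] by (simp add: prod_upto6)

lemma sextic_poly: "[:25, 30, 0, 0, 0, 0, 1:] = (\<Prod>i<6. [:- a i, 1:])"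
proof (rule poly_ext)
  fix x :: complex
  have "poly [:25, 30, 0, 0, 0, 0, 1:] x = x ^ 6 + 30 * x + 25" by (simp add: algebra_simps eval_nat_numeral)
  then show "poly [:25, 30, 0, 0, 0, 0, 1:] x = poly (\<Prod>i<6. [:- a i, 1:]) x" by (simp add: poly_prod roots)
qed

lemma derivative_at_root:
  assumes "i < 6"
  shows "(\<Prod>j\<in>{..<6} - {i}. a i - a j) = 6 * a i ^ 5 + 30"
proof -
  define q where "q = (\<Prod>j\<in>{..<6} - {i}. [:- a j, 1:])"
  have "[:25, 30, 0, 0, 0, 0, 1:] = [:- a i, 1:] * q"
    unfolding sextic_poly q_def using assms by (subst prod.remove[of _ i]) auto
  then have "poly (pderiv [:25, 30, 0, 0, 0, 0, 1:]) (a i) = poly (pderiv ([:- a i, 1:] * q)) (a i)" by simp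
  also have "\<dots> = poly q (a i)" by (simp only: pderiv_mult) (simp add: pderiv_pCons)
  also have "\<dots> = (\<Prod>j\<in>{..<6} - {i}. a i - a j)" by (simp add: q_def poly_prod)
  finally show ?thesis by (simp add: pderiv_pCons algebra_simps eval_nat_numeral)
qed

text \<open>At a root, \<open>a f'(a) = -150(a + 1)\<close>, so the discriminant comes down to \<open>f(-1)\<close>.\<close>

lemma discriminant: "vdm a ^ 2 = 1350000 ^ 2"
proof -
  have *: "a i * (\<Prod>j\<in>{..<6} - {i}. a i - a j) = 150 * (- 1 - a i)" if "i < 6" for i
  proof -
    have "a i * (6 * a i ^ 5 + 30) = 6 * a i ^ 6 + 30 * a i" by (simp add: algebra_simps eval_nat_numeral)
    also have "\<dots> = 150 * (- 1 - a i)" unfolding root[OF that] by (simp add: algebra_simps)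
    finally show ?thesis by (simp only: derivative_at_root[OF that])
  qed
  have "(\<Prod>i<6. a i * (\<Prod>j\<in>{..<6} - {i}. a i - a j)) = (\<Prod>i<6. 150 * (- 1 - a i))"
    by (rule prod.cong) (use * in auto)
  also have "\<dots> = 150 ^ 6 * (\<Prod>i<6. - 1 - a i)" by (simp only: prod.distrib prod_constant card_lessThan)
  \<comment> \<open>The value 1 - 30 + 25 of the sextic at -1.\<close>
  also have "(\<Prod>i<6. - 1 - a i) = - 4" using roots[of "-1"] by simp
  finally have e: "25 * (\<Prod>i<6. \<Prod>j\<in>{..<6} - {i}. a i - a j) = - 4 * 150 ^ 6"
    by (simp add: prod.distrib prod_roots)
  have "(\<Prod>j\<in>{..<6} - {i}. a i - a j) = (if i = 0 then 1 else a i - a 0) * (if i = 1 then 1 else a i - a 1) *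
    (if i = 2 then 1 else a i - a 2) * (if i = 3 then 1 else a i - a 3) * (if i = 4 then 1 else a i - a 4) *
    (if i = 5 then 1 else a i - a 5)" if "i < 6" for i
  proof -
    have "(\<Prod>j\<in>{..<6} - {i}. a i - a j) = (\<Prod>j<6. if i = j then 1 else a i - a j)"
      by (intro prod.mono_neutral_cong_left) auto
    then show ?thesis by (simp add: prod_upto6)
  qed
  then have "(\<Prod>i<6. \<Prod>j\<in>{..<6} - {i}. a i - a j) = (\<Prod>i<6. (if i = 0 then 1 else a i - a 0) * (if i = 1 then 1 else a i - a 1) *
    (if i = 2 then 1 else a i - a 2) * (if i = 3 then 1 else a i - a 3) * (if i = 4 then 1 else a i - a 4) *
    (if i = 5 then 1 else a i - a 5))"
    by (intro prod.cong) auto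
  \<comment> \<open>Each of the fifteen pairs occurs in both orders, which gives the sign
    -1.\<close>
  also have "\<dots> = - vdm a * vdm a"
  proof -
    define D where "D i j = a i - a j" for i j
    have r: "D j i = - D i j" for i j by (simp add: D_def)
    note * = r[of 1 0] r[of 2 0] r[of 2 1] r[of 3 0] r[of 3 1] r[of 3 2] r[of 4 0] r[of 4 1] r[of 4 2] r[of 4 3]
      r[of 5 0] r[of 5 1] r[of 5 2] r[of 5 3] r[of 5 4]
    have n: "(0::nat) \<noteq> 1" "(0::nat) \<noteq> 2" "(0::nat) \<noteq> 3" "(0::nat) \<noteq> 4" "(0::nat) \<noteq> 5"
      "(1::nat) \<noteq> 2" "(1::nat) \<noteq> 3" "(1::nat) \<noteq> 4" "(1::nat) \<noteq> 5" "(2::nat) \<noteq> 3" "(2::nat) \<noteq> 4" "(2::nat) \<noteq> 5"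
      "(3::nat) \<noteq> 4" "(3::nat) \<noteq> 5" "(4::nat) \<noteq> 5" by simp_all
    show ?thesis
      unfolding vdm_expand prod_upto6 D_def[symmetric]
      by (simp only: n n[symmetric] if_True if_False refl mult_1_left mult_1_right,
        simp only: * mult_minus_left mult_minus_right minus_minus,
        simp only: mult_ac)
  qed
  \<comment> \<open>Hence the constant 1350000 = 2 * 150^3 / 5.\<close>
  finally have "25 * (vdm a ^ 2) = 4 * 150 ^ 6" using e by (simp add: power2_eq_square)
  then show ?thesis by simp
qed

lemma a_distinct: "i < 6 \<Longrightarrow> j < 6 \<Longrightarrow> a i = a j \<Longrightarrow> i = j"
proof (rule ccontr)
  assume ij: "i < 6" "j < 6" "a i = a j" "i \<noteq> j"
  have *: "vdm a = 0" if "i < 6" "j < i" "a i = a j" for i j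
  proof -
    have "(\<Prod>j<i. a i - a j) = 0" using that by (intro prod_zero) auto
    then show ?thesis unfolding vdm_def using that by (intro prod_zero) auto
  qed
  have "vdm a = 0" using *[of i j] *[of j i] ij by (metis linorder_neqE_nat)
  then show False using discriminant by simp
qed

lemma a_nonzero: "i < 6 \<Longrightarrow> a i \<noteq> 0"
  using root[of i] by auto

section \<open>The field generated by products of two square roots of the roots\<close>

definition b :: "nat \<Rightarrow> complex" where "b i = csqrt (a i)"

definition c :: "nat \<Rightarrow> nat \<Rightarrow> complex" where "c i j = b i * b j"

text \<open>Both signs occur because an embedding may send a product only to the negative of another
  one. The case \<open>i = j\<close> puts the roots themselves into \<open>S\<close>.\<close>

definition S :: "complex set" where
  "S = {s. \<exists>i<6. \<exists>j<6. s = c i j \<or> s = - c i j}"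

lemma b_square [simp]: "b i ^ 2 = a i"
  by (simp add: b_def)

lemma c_diag [simp]: "c i i = a i"
  by (simp add: c_def flip: power2_eq_square)

lemma c_mult: "c i j * c j k = a j * c i k"
  by (simp add: c_def power2_eq_square mult_ac flip: b_square)

lemma c_square: "c i j ^ 2 = a i * a j"
  by (simp add: c_def power_mult_distrib)

lemma c_nonzero: "i < 6 \<Longrightarrow> j < 6 \<Longrightarrow> c i j \<noteq> 0"
  using c_square[of i j] a_nonzero by auto

lemma c_in_S: "i < 6 \<Longrightarrow> j < 6 \<Longrightarrow> c i j \<in> S"
  by (auto simp: S_def)

lemma a_in_S: "i < 6 \<Longrightarrow> a i \<in> S"
  using c_in_S[of i i] by simp

lemma embedding_root:
  assumes "embedding K h" "csubfield K" "i < 6" "a i \<in> K"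
  shows "\<exists>j<6. h (a i) = a j"
proof -
  interpret cembedding K h by unfold_locales (use assms in auto)
  have "h (a i) ^ 6 = h (a i ^ 6)" using assms by (simp add: h_power)
  also have "\<dots> = h (- of_int 30 * a i - of_int 25)" using root[OF assms(3)] by simp
  also have "\<dots> = - 30 * h (a i) - 25"
    using assms h_of_int[of 30] h_of_int[of 25] of_int_mem[of 30] of_int_mem[of 25]
    by (subst h_diff) (auto simp: h_mult h_uminus mems)
  finally show ?thesis using root_iff[of "h (a i)"] by simp
qed

text \<open>The square root is a zero of the sextic evaluated at X^2. It need not lie in the field
  generated by \<open>S\<close>, but it shows that the products are algebraic.\<close>

lemma algebraic_a: "i < 6 \<Longrightarrow> \<exists>p\<in>polys_over \<rat>. p \<noteq> 0 \<and> poly p (b i) = 0"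
proof (intro bexI conjI)
  show "[:25, 0, 30, 0, 0, 0, 0, 0, 0, 0, 0, 0, 1:] \<in> polys_over \<rat>"
    by (intro Rats.polys_overs) auto
  assume "i < 6"
  have "poly [:25, 0, 30, 0, 0, 0, 0, 0, 0, 0, 0, 0, 1:] (b i) = (b i ^ 2) ^ 6 + 30 * b i ^ 2 + 25"
    by (simp add: algebra_simps eval_nat_numeral)
  then show "poly [:25, 0, 30, 0, 0, 0, 0, 0, 0, 0, 0, 0, 1:] (b i) = 0"
    using root[OF \<open>i < 6\<close>] by simp
qed auto

sublocale nf: normal_field S
proof
  show "finite S"
  proof (rule finite_subset)
    show "S \<subseteq> (\<lambda>(i, j). c i j) ` ({..<6} \<times> {..<6}) \<union> (\<lambda>(i, j). - c i j) ` ({..<6} \<times> {..<6})"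
      by (auto simp: S_def)
  qed auto
next
  fix s assume "s \<in> S"
  then obtain i j where ij: "i < 6" "j < 6" "s = c i j \<or> s = - c i j" by (auto simp: S_def)
  let ?A = "{x. \<exists>p\<in>polys_over \<rat>. p \<noteq> 0 \<and> poly p x = 0}"
  interpret A: csub ?A by unfold_locales (rule csubfield_algebraic)
  have "b i \<in> ?A" "b j \<in> ?A" using algebraic_a ij by auto
  then have "c i j \<in> ?A" unfolding c_def by (rule A.mult_mem)
  then have "s \<in> ?A" using ij(3) A.uminus_mem by auto
  then show "\<exists>p\<in>polys_over \<rat>. p \<noteq> 0 \<and> poly p s = 0" by blast
next
  fix h assume h: "embedding (generated_field S) h"
  interpret cembedding "generated_field S" h
    by unfold_locales (rule csubfield_generated, rule h)
  have SK: "s \<in> generated_field S" if "s \<in> S" for s using generated_field_superset that by blast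
  have hc: "h (c i j) \<in> S" if ij: "i < 6" "j < 6" for i j
  proof -
    obtain i' j' where i': "i' < 6" "h (a i) = a i'" and j': "j' < 6" "h (a j) = a j'"
      using embedding_root[OF h csubfield_generated] ij SK[OF a_in_S] by metis
    have "h (c i j) ^ 2 = h (c i j ^ 2)" using SK[OF c_in_S[OF ij]] by (simp add: h_power)
    also have "\<dots> = a i' * a j'" using SK a_in_S ij i' j' by (simp add: c_square h_mult)
    also have "\<dots> = c i' j' ^ 2" by (simp add: c_square)
    finally have "h (c i j) = c i' j' \<or> h (c i j) = - c i' j'" by (simp add: power2_eq_iff)
    then show ?thesis using i' j' by (auto simp: S_def)
  qed
  have neg: "- s \<in> S" if "s \<in> S" for s using that by (auto simp: S_def) (metis minus_minus)+
  show "h ` S \<subseteq> S"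
  proof
    fix x assume "x \<in> h ` S"
    then obtain s where s: "s \<in> S" "x = h s" by blast
    then obtain i j where ij: "i < 6" "j < 6" "s = c i j \<or> s = - c i j" by (auto simp: S_def)
    then show "x \<in> S" using hc[OF ij(1,2)] neg s SK[OF c_in_S[OF ij(1,2)]] by (auto simp: h_uminus)
  qed
qed

abbreviation "G \<equiv> nf.G"

section \<open>The permutation and the signs of an automorphism\<close>

definition pm :: "(complex \<Rightarrow> complex) \<Rightarrow> nat \<Rightarrow> nat" where
  "pm \<sigma> i = (if i < 6 then THE j. j < 6 \<and> \<sigma> (a i) = a j else i)"

text \<open>If \<sigma> sends each \<open>b i\<close> to a sign times another root, this is the
  product of the signs at \<open>i\<close> and \<open>j\<close>. Only such products are visible in
  the field, and they determine the signs up to a common factor.\<close>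

definition es :: "(complex \<Rightarrow> complex) \<Rightarrow> nat \<Rightarrow> nat \<Rightarrow> int" where
  "es \<sigma> i j = (if \<sigma> (c i j) = c (pm \<sigma> i) (pm \<sigma> j) then 1 else - 1)"

lemma L_mem: "i < 6 \<Longrightarrow> j < 6 \<Longrightarrow> c i j \<in> nf.L" "i < 6 \<Longrightarrow> a i \<in> nf.L"
  using nf.S_in_L c_in_S a_in_S by auto

context
  fixes \<sigma> assumes \<sigma>: "\<sigma> \<in> carrier G"
begin

interpretation s: cembedding "nf.L" \<sigma>
  by (rule nf.G_cembedding[OF \<sigma>])

lemma pm_spec: "i < 6 \<Longrightarrow> pm \<sigma> i < 6 \<and> \<sigma> (a i) = a (pm \<sigma> i)"
proof -
  assume i: "i < 6"
  obtain j where "j < 6" "\<sigma> (a i) = a j"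
    using embedding_root[OF s.emb csubfield_generated i L_mem(2)[OF i]] by blast
  then have "\<exists>!j. j < 6 \<and> \<sigma> (a i) = a j" using a_distinct by metis
  from theI'[OF this] show ?thesis using i by (simp add: pm_def)
qed

lemmas pm_less = pm_spec[THEN conjunct1] and pm_app = pm_spec[THEN conjunct2]

lemma pm_permutes: "pm \<sigma> permutes {..<6}"
proof (rule bij_imp_permutes)
  have "inj_on (pm \<sigma>) {..<6}"
  proof (rule inj_onI)
    fix i j assume ij: "i \<in> {..<6}" "j \<in> {..<6}" "pm \<sigma> i = pm \<sigma> j"
    then have "\<sigma> (a i) = \<sigma> (a j)" using pm_app by simp
    then have "a i = a j" using s.h_inj L_mem(2) ij by (auto dest: inj_onD)
    then show "i = j" using ij a_distinct by simp
  qed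
  moreover have "pm \<sigma> ` {..<6} \<subseteq> {..<6}" using pm_less by auto
  ultimately show "bij_betw (pm \<sigma>) {..<6} {..<6}"
    by (simp add: bij_betw_def endo_inj_surj)
  show "pm \<sigma> i = i" if "i \<notin> {..<6}" for i using that by (simp add: pm_def)
qed

lemma es_app: "i < 6 \<Longrightarrow> j < 6 \<Longrightarrow> \<sigma> (c i j) = of_int (es \<sigma> i j) * c (pm \<sigma> i) (pm \<sigma> j)"
proof -
  assume ij: "i < 6" "j < 6"
  have "\<sigma> (c i j) ^ 2 = \<sigma> (c i j ^ 2)" using L_mem ij by (simp add: s.h_power)
  also have "\<dots> = c (pm \<sigma> i) (pm \<sigma> j) ^ 2" using L_mem ij by (simp add: c_square s.h_mult pm_app)
  finally show ?thesis by (auto simp: es_def power2_eq_iff)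
qed

lemma es_range: "es \<sigma> i j \<in> {1, -1}"
  by (simp add: es_def)

text \<open>Apply \<sigma> to \<open>c i j * c j k = a j * c i k\<close>. The identity says that
  \<open>es\<close> is a product of two signs, one for each index.\<close>

lemma es_cocycle:
  assumes "i < 6" "j < 6" "k < 6"
  shows "es \<sigma> i j * es \<sigma> j k = es \<sigma> i k"
proof -
  have "\<sigma> (c i j * c j k) = \<sigma> (a j * c i k)" by (simp add: c_mult)
  then have "of_int (es \<sigma> i j * es \<sigma> j k) * (c (pm \<sigma> i) (pm \<sigma> j) * c (pm \<sigma> j) (pm \<sigma> k)) =
      of_int (es \<sigma> i k) * (a (pm \<sigma> j) * c (pm \<sigma> i) (pm \<sigma> k))"
    using assms L_mem by (simp add: s.h_mult es_app pm_app mult_ac)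
  then have "(of_int (es \<sigma> i j * es \<sigma> j k) :: complex) = of_int (es \<sigma> i k)"
    using assms by (simp add: c_mult a_nonzero c_nonzero pm_less)
  then show ?thesis by (simp only: of_int_eq_iff)
qed

text \<open>The discriminant is a square, so the Vandermonde product of the roots is rational, and
  an odd permutation would negate it.\<close>

lemma pm_even: "evenperm (pm \<sigma>)"
proof -
  have v: "vdm a = 1350000 \<or> vdm a = - 1350000" using discriminant by (simp only: power2_eq_iff)
  then have "vdm a \<in> \<rat>" by auto
  then have "\<sigma> (vdm a) = vdm a" by (rule s.h_Rats)
  moreover have "\<sigma> (vdm a) = vdm (a \<circ> pm \<sigma>)"
  proof -
    have d: "a i - a j \<in> nf.L" if "i < 6" "j < 6" for i j using L_mem(2) that by (intro nf.mems)
    have "\<sigma> (\<Prod>j<i. a i - a j) = (\<Prod>j<i. a (pm \<sigma> i) - a (pm \<sigma> j))" if "i < 6" for i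
    proof -
      have "\<sigma> (\<Prod>j<i. a i - a j) = (\<Prod>j<i. \<sigma> (a i - a j))" using d that by (intro s.h_prod) auto
      also have "\<dots> = (\<Prod>j<i. a (pm \<sigma> i) - a (pm \<sigma> j))"
        using L_mem(2) that by (intro prod.cong) (auto simp: s.h_diff pm_app)
      finally show ?thesis .
    qed
    moreover have "\<sigma> (vdm a) = (\<Prod>i<6. \<sigma> (\<Prod>j<i. a i - a j))"
      unfolding vdm_def using d by (intro s.h_prod) (auto intro!: nf.prod_mem d)
    ultimately show ?thesis by (simp add: vdm_def)
  qed
  moreover have "vdm (a \<circ> pm \<sigma>) = of_int (sign (pm \<sigma>)) * vdm a" by (rule vdm_permutes[OF pm_permutes])
  moreover have "vdm a \<noteq> 0" using v by auto
  ultimately have "(of_int (sign (pm \<sigma>)) :: complex) = 1" by simp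
  then have "sign (pm \<sigma>) = 1" by (simp only: of_int_eq_1_iff)
  then show ?thesis by (auto simp: sign_def split: if_splits)
qed

text \<open>The product of all six square roots is 5 or -5, hence rational and fixed. Pairing the
  indices writes it as an element of the field; this is the parity condition on the signs.\<close>

lemma es_prod: "es \<sigma> 0 1 * es \<sigma> 2 3 * es \<sigma> 4 5 = 1"
proof -
  have b: "(\<Prod>i<6. b i) ^ 2 = 5 ^ 2" using prod_roots by (simp add: prod_power_distrib)
  then have b5: "(\<Prod>i<6. b i) = 5 \<or> (\<Prod>i<6. b i) = - 5" by (simp only: power2_eq_iff)
  have "c 0 1 * c 2 3 * c 4 5 = (\<Prod>i<6. b i)" by (simp add: c_def prod_upto6 mult_ac)
  then have "(\<Prod>i<6. b i) = \<sigma> (c 0 1 * c 2 3 * c 4 5)" using b5 s.h_Rats by auto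
  also have "\<dots> = \<sigma> (c 0 1) * \<sigma> (c 2 3) * \<sigma> (c 4 5)" using L_mem by (simp add: s.h_mult nf.mems)
  also have "\<dots> = of_int (es \<sigma> 0 1 * es \<sigma> 2 3 * es \<sigma> 4 5) * (\<Prod>i<6. b (pm \<sigma> i))"
    by (simp only: es_app zero_less_numeral one_less_numeral_iff numeral_less_iff semiring_norm) (simp add: prod_upto6 c_def mult_ac)
  finally have "of_int (es \<sigma> 0 1 * es \<sigma> 2 3 * es \<sigma> 4 5) * (\<Prod>i<6. b (pm \<sigma> i)) = (\<Prod>i<6. b i)" by simp
  moreover have "(\<Prod>i<6. b (pm \<sigma> i)) = (\<Prod>i<6. b i)"
    using prod.permute[OF pm_permutes, of b] by (simp add: comp_def)
  moreover have "(\<Prod>i<6. b i) \<noteq> 0" using b by (metis power_zero_numeral power_eq_0_iff zero_neq_numeral)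
  ultimately have "(of_int (es \<sigma> 0 1 * es \<sigma> 2 3 * es \<sigma> 4 5) :: complex) = of_int 1" by simp
  then show ?thesis by (simp only: of_int_eq_iff)
qed

end

lemma pm_mult:
  assumes "\<sigma> \<in> carrier G" "\<tau> \<in> carrier G"
  shows "pm (\<sigma> \<otimes>\<^bsub>G\<^esub> \<tau>) = pm \<sigma> \<circ> pm \<tau>"
proof
  fix i
  show "pm (\<sigma> \<otimes>\<^bsub>G\<^esub> \<tau>) i = (pm \<sigma> \<circ> pm \<tau>) i"
  proof (cases "i < 6")
    case True
    have "a (pm (\<sigma> \<otimes>\<^bsub>G\<^esub> \<tau>) i) = (\<sigma> \<otimes>\<^bsub>G\<^esub> \<tau>) (a i)"
      using assms True by (simp add: pm_app)
    also have "\<dots> = \<sigma> (\<tau> (a i))" using assms True L_mem by (intro nf.Gal_mult_app)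
    also have "\<dots> = a (pm \<sigma> (pm \<tau> i))" using assms True by (simp add: pm_app pm_less)
    finally show ?thesis using assms True by (auto intro!: a_distinct pm_less)
  next
    case False
    then show ?thesis by (simp add: pm_def)
  qed
qed

lemma es_mult:
  assumes "\<sigma> \<in> carrier G" "\<tau> \<in> carrier G" "i < 6" "j < 6"
  shows "es (\<sigma> \<otimes>\<^bsub>G\<^esub> \<tau>) i j = es \<tau> i j * es \<sigma> (pm \<tau> i) (pm \<tau> j)"
proof -
  interpret s: cembedding "nf.L" \<sigma> by (rule nf.G_cembedding) fact
  note less = pm_less[OF assms(2)]
  have "of_int (es (\<sigma> \<otimes>\<^bsub>G\<^esub> \<tau>) i j) * c (pm \<sigma> (pm \<tau> i)) (pm \<sigma> (pm \<tau> j)) = (\<sigma> \<otimes>\<^bsub>G\<^esub> \<tau>) (c i j)"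
    using assms es_app[of "\<sigma> \<otimes>\<^bsub>G\<^esub> \<tau>" i j] by (simp add: pm_mult)
  also have "\<dots> = \<sigma> (\<tau> (c i j))" using assms L_mem by (intro nf.Gal_mult_app) auto
  also have "\<dots> = of_int (es \<tau> i j * es \<sigma> (pm \<tau> i) (pm \<tau> j)) * c (pm \<sigma> (pm \<tau> i)) (pm \<sigma> (pm \<tau> j))"
    using assms L_mem less by (simp add: es_app s.h_mult nf.of_int_mem)
  finally have "(of_int (es (\<sigma> \<otimes>\<^bsub>G\<^esub> \<tau>) i j) :: complex) = of_int (es \<tau> i j * es \<sigma> (pm \<tau> i) (pm \<tau> j))"
    using assms less by (simp add: c_nonzero pm_less del: of_int_mult)
  then show ?thesis by (simp only: of_int_eq_iff)
qed

lemma pm_es_faithful: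
  assumes "\<sigma> \<in> carrier G" "\<tau> \<in> carrier G" "pm \<sigma> = pm \<tau>" "\<And>i j. i < 6 \<Longrightarrow> j < 6 \<Longrightarrow> es \<sigma> i j = es \<tau> i j"
  shows "\<sigma> = \<tau>"
proof (rule nf.Gal_determined[OF assms(1,2)])
  interpret s: cembedding "nf.L" \<sigma> + t: cembedding "nf.L" \<tau> by (rule nf.G_cembedding, fact)+
  fix s assume "s \<in> S"
  then obtain i j where ij: "i < 6" "j < 6" "s = c i j \<or> s = - c i j" by (auto simp: S_def)
  have "\<sigma> (c i j) = \<tau> (c i j)" using ij assms by (simp add: es_app)
  then show "\<sigma> s = \<tau> s" using ij L_mem by (auto simp: s.h_uminus t.h_uminus)
qed

end

section \<open>Arithmetic modulo a prime and the sextic\<close>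

datatype sixtuple = Six int int int int int int

fun add6 :: "int \<Rightarrow> sixtuple \<Rightarrow> sixtuple \<Rightarrow> sixtuple" where
  "add6 p (Six a b c d e f) (Six a' b' c' d' e' f') =
     Six ((a + a') mod p) ((b + b') mod p) ((c + c') mod p) ((d + d') mod p) ((e + e') mod p) ((f + f') mod p)"

fun smult6 :: "int \<Rightarrow> int \<Rightarrow> sixtuple \<Rightarrow> sixtuple" where
  "smult6 p k (Six a b c d e f) =
     Six (k * a mod p) (k * b mod p) (k * c mod p) (k * d mod p) (k * e mod p) (k * f mod p)"

text \<open>A sextuple stands for a polynomial of degree at most 5 modulo \<open>p\<close> and modulo
  \<open>x\<^sup>6 + 30 x + 25\<close>; this is multiplication by \<open>x\<close>.\<close>

fun shift6 :: "int \<Rightarrow> sixtuple \<Rightarrow> sixtuple" where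
  "shift6 p (Six a b c d e f) = Six (- 25 * f mod p) ((a - 30 * f) mod p) b c d e"

fun mult6 :: "int \<Rightarrow> sixtuple \<Rightarrow> sixtuple \<Rightarrow> sixtuple" where
  "mult6 p (Six a b c d e f) v =
     add6 p (smult6 p a v) (shift6 p (add6 p (smult6 p b v) (shift6 p (add6 p (smult6 p c v) (shift6 p
       (add6 p (smult6 p d v) (shift6 p (add6 p (smult6 p e v) (shift6 p (smult6 p f v))))))))))"

text \<open>Repeated squaring, with the bits of the exponent given from the least significant one
  on.\<close>

fun pow6 :: "int \<Rightarrow> bool list \<Rightarrow> sixtuple \<Rightarrow> sixtuple" where
  "pow6 p [] v = Six 1 0 0 0 0 0"
| "pow6 p (b # bs) v = (let s = pow6 p bs (mult6 p v v) in if b then mult6 p v s else s)"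

fun bits_nat :: "bool list \<Rightarrow> nat" where
  "bits_nat [] = 0"
| "bits_nat (b # bs) = (if b then 1 else 0) + 2 * bits_nat bs"

fun eval6 :: "sixtuple \<Rightarrow> complex \<Rightarrow> complex" where
  "eval6 (Six a b c d e f) z = of_int a + z * (of_int b + z * (of_int c + z * (of_int d + z * (of_int e + z * of_int f))))"

section \<open>The ring generated by the square roots of the roots\<close>

context sextic
begin

text \<open>Generated by the individual square roots and not only by their products, so it may leave
  the field; it only has to contain \<open>S\<close>.\<close>

definition R :: "complex set" where
  "R = \<Inter>{T. csubring T \<and> b ` {..<6} \<subseteq> T}"

lemma csubring_R: "csubring R"
  by (auto simp: R_def csubring_def)

sublocale R: csubr R
  by unfold_locales (rule csubring_R)

lemma b_in_R: "i < 6 \<Longrightarrow> b i \<in> R"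
  by (auto simp: R_def)

lemma c_in_R: "i < 6 \<Longrightarrow> j < 6 \<Longrightarrow> c i j \<in> R"
  unfolding c_def by (intro R.ring_mems b_in_R)

lemma a_in_R: "i < 6 \<Longrightarrow> a i \<in> R"
  using c_in_R[of i i] by simp

lemma S_subset_R: "S \<subseteq> R"
  by (auto simp: S_def intro!: c_in_R R.uminus_mem)

definition monomial6 :: "(nat \<Rightarrow> nat) \<Rightarrow> complex" where
  "monomial6 e = (\<Prod>k<6. b k ^ e k)"

text \<open>Exponents below 12 suffice, since the twelfth power of each generator is an integral
  combination of lower powers.\<close>

definition monomials6 :: "complex set" where
  "monomials6 = monomial6 ` ({..<6} \<rightarrow>\<^sub>E {..<12})"

lemma monomial6_upd: "i < 6 \<Longrightarrow> monomial6 (e(i := k)) = b i ^ k * (\<Prod>j\<in>{..<6} - {i}. b j ^ e j)"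
  unfolding monomial6_def by (subst prod.remove[of _ i]) (auto intro!: prod.cong)

lemma monomial6_in: "(\<And>k. k < 6 \<Longrightarrow> e k < 12) \<Longrightarrow> monomial6 e \<in> monomials6"
  unfolding monomials6_def
  by (intro rev_image_eqI[of "restrict e {..<6}"]) (auto simp: monomial6_def)

lemma b_pow12: "i < 6 \<Longrightarrow> b i ^ 12 = - 30 * b i ^ 2 - 25"
  using root[of i] power_mult[of "b i" 2 6] by simp

lemma span_b:
  assumes "x \<in> int_span monomials6" "i < 6"
  shows "b i * x \<in> int_span monomials6"
  using assms(1)
proof induction
  case (gen m)
  then obtain e where e: "m = monomial6 e" "\<And>k. k < 6 \<Longrightarrow> e k < 12"
    by (auto simp: monomials6_def PiE_def Pi_def)
  have up: "b i * m = monomial6 (e(i := Suc (e i)))"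
    using monomial6_upd[OF assms(2), of e "e i"] monomial6_upd[OF assms(2), of e "Suc (e i)"] e by simp
  show ?case
  proof (cases "Suc (e i) < 12")
    case True
    then show ?thesis unfolding up by (intro int_span.gen monomial6_in) (auto simp: e)
  next
    case False
    then have s: "Suc (e i) = 12" using e(2)[OF assms(2)] by simp
    have "b i * m = of_int (- 30) * monomial6 (e(i := 2)) + of_int (- 25) * monomial6 (e(i := 0))"
      unfolding up s monomial6_upd[OF assms(2)] b_pow12[OF assms(2)] by (simp add: algebra_simps)
    also have "\<dots> \<in> int_span monomials6"
      by (intro int_span_add int_span_int int_span.gen monomial6_in) (auto simp: e)
    finally show ?thesis .
  qed
qed (auto simp: algebra_simps intro: int_span.intros)

lemma span_mult:
  assumes "x \<in> int_span monomials6" "y \<in> int_span monomials6"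
  shows "x * y \<in> int_span monomials6"
  using assms(1)
proof induction
  case (gen m)
  then obtain e where e: "m = monomial6 e" by (auto simp: monomials6_def)
  have pow: "b i ^ n * z \<in> int_span monomials6" if "z \<in> int_span monomials6" "i < 6" for i n z
    by (induction n) (use that span_b in \<open>auto simp: mult.assoc\<close>)
  have "b 0 ^ e 0 * (b 1 ^ e 1 * (b 2 ^ e 2 * (b 3 ^ e 3 * (b 4 ^ e 4 * (b 5 ^ e 5 * y))))) \<in> int_span monomials6"
    by (intro pow assms(2)) auto
  then show ?case by (simp add: e monomial6_def prod_upto6 mult.assoc)
qed (auto simp: algebra_simps intro: int_span.intros)

sublocale R: integral_ring R
proof unfold_locales
  have one: "1 \<in> int_span monomials6"
    using int_span.gen[OF monomial6_in[of "\<lambda>_. 0"]] by (simp add: monomial6_def)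
  have "csubring (int_span monomials6)"
    by (auto simp: csubring_def one span_mult intro: int_span.diff)
  moreover have "b ` {..<6} \<subseteq> int_span monomials6" using span_b[OF one] by auto
  ultimately have "R \<subseteq> int_span monomials6" by (auto simp: R_def)
  moreover have "finite monomials6" by (auto simp: monomials6_def intro!: finite_PiE)
  ultimately show "\<exists>B. finite B \<and> R \<subseteq> int_span B" by blast
qed

lemma pm_pow:
  assumes "\<sigma> \<in> carrier G"
  shows "pm (\<sigma> [^]\<^bsub>G\<^esub> (n::nat)) = pm \<sigma> ^^ n"
proof (induction n)
  case 0
  have "pm \<one>\<^bsub>G\<^esub> i = i" for i
  proof (cases "i < 6")
    case True
    then have "\<one>\<^bsub>G\<^esub> (a i) = a (pm \<one>\<^bsub>G\<^esub> i)" by (intro pm_app) auto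
    then have "a i = a (pm \<one>\<^bsub>G\<^esub> i)" using L_mem(2)[OF True] by simp
    then show ?thesis using a_distinct pm_less[of "\<one>\<^bsub>G\<^esub>" i] True by (metis nf.G.one_closed)
  qed (simp add: pm_def)
  then show ?case by auto
next
  case (Suc n)
  then show ?case using assms by (simp add: pm_mult funpow_Suc_right del: funpow.simps)
qed

end

section \<open>Reduction of the roots modulo a prime above p\<close>

locale sextic_mod = sextic a + pid: prime_ideal R P p for a P p +
  assumes p5: "p > 5"
begin

sublocale frobenius S R P p
  by unfold_locales (rule S_subset_R)

text \<open>Both numbers have only the prime factors 2, 3 and 5. So the roots stay distinct and
  nonzero modulo \<open>P\<close>.\<close>

lemma p_not_dvd: "\<not> int p dvd 1350000" "\<not> int p dvd 25"
proof -
  have p: "prime (int p)" using pid.p_prime by simp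
  have small: "\<not> int p dvd q" if "q \<in> {2, 3, 5}" for q
    using that p5 zdvd_imp_le[of "int p" q] by auto
  have "(1350000::int) = 2 ^ 4 * 3 ^ 3 * 5 ^ 5" by simp
  then show "\<not> int p dvd 1350000"
    using small p by (metis insertI1 insertI2 prime_dvd_mult_iff prime_dvd_power)
  have "(25::int) = 5 ^ 2" by simp
  then show "\<not> int p dvd 25" using small p by (metis insertI1 insertI2 prime_dvd_power)
qed

lemma a_diff_notin_P:
  assumes "i < 6" "j < 6" "i \<noteq> j"
  shows "a i - a j \<notin> P"
proof
  assume m: "a i - a j \<in> P"
  have *: "vdm a \<in> P" if "i < 6" "j < i" "a i - a j \<in> P" for i j
  proof -
    have "(\<Prod>j<i. a i - a j) = (a i - a j) * (\<Prod>j\<in>{..<i} - {j}. a i - a j)"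
      using that by (subst prod.remove[of _ j]) auto
    also have "\<dots> \<in> P" using that by (intro pid.P_mult R.ring_mems a_in_R) auto
    finally have "(\<Prod>j<i. a i - a j) \<in> P" .
    moreover have "vdm a = (\<Prod>j<i. a i - a j) * (\<Prod>i\<in>{..<6} - {i}. \<Prod>j<i. a i - a j)"
      unfolding vdm_def using that by (subst prod.remove[of _ i]) auto
    ultimately show ?thesis by (auto intro!: pid.P_mult R.ring_mems a_in_R)
  qed
  have "a j - a i \<in> P" using pid.P_uminus[OF m] by simp
  then have "vdm a \<in> P" using *[of i j] *[of j i] m assms by (metis linorder_neqE_nat)
  moreover have "vdm a = of_int 1350000 \<or> vdm a = of_int (- 1350000)"
    using discriminant by (simp only: power2_eq_iff of_int_numeral of_int_minus)
  ultimately have "int p dvd 1350000 \<or> int p dvd - 1350000" by (metis pid.P_int_iff)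
  then show False using p_not_dvd by simp
qed

lemma a_cong_imp_eq: "i < 6 \<Longrightarrow> j < 6 \<Longrightarrow> pid.cong (a i) (a j) \<Longrightarrow> i = j"
  using a_diff_notin_P by (auto simp: pid.cong_def)

lemma a_notin_P: "i < 6 \<Longrightarrow> a i \<notin> P"
proof
  assume i: "i < 6" "a i \<in> P"
  have "(\<Prod>i<6. a i) = a i * (\<Prod>j\<in>{..<6} - {i}. a j)" using i by (subst prod.remove[of _ i]) auto
  also have "\<dots> \<in> P" using i by (intro pid.P_mult R.ring_mems a_in_R) auto
  finally show False using p_not_dvd pid.P_int_iff[of 25] by (simp add: prod_roots)
qed

text \<open>The bound on the number of roots in a domain, with the distinct residues of
  \<open>a 0\<close>, ..., \<open>a (n - 1)\<close> as roots: split off a linear factor and use that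
  differences of roots are not in \<open>P\<close>.\<close>

lemma root_count:
  assumes "h \<in> polys_over R" "degree h < n" "n \<le> 6" "\<And>i. i < n \<Longrightarrow> poly h (a i) \<in> P"
  shows "h \<in> polys_over P"
  using assms
proof (induction n arbitrary: h)
  case (Suc n)
  define q where "q = synthetic_div h (a n)"
  have h: "h = [:- a n, 1:] * q + [:poly h (a n):]"
    using synthetic_div_correct'[of "a n" h] by (simp add: q_def)
  have qR: "q \<in> polys_over R"
  proof -
    have hR: "coeff h i \<in> R" for i using Suc.prems(1) by (auto simp: polys_over_def)
    have "coeff (synthetic_div g (a n)) i \<in> R" if "\<And>i. coeff g i \<in> R" for g i
      using that
    proof (induction g arbitrary: i)
      case (pCons x g)
      have "coeff g i \<in> R" for i using pCons.prems[of "Suc i"] by simp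
      then have "coeff (synthetic_div g (a n)) i \<in> R" "poly g (a n) \<in> R" for i
        using pCons.IH Suc.prems(3) by (auto intro!: R.poly_mem a_in_R simp: polys_over_def)
      then show ?case by (auto simp: coeff_pCons split: nat.split)
    qed simp
    then show ?thesis using hR by (simp add: q_def polys_over_def)
  qed
  show ?case
  proof (cases "degree h = 0")
    case True
    then obtain x where "h = [:x:]" by (metis degree_eq_zeroE)
    moreover from this have "x \<in> P" using Suc.prems(4)[of 0] by simp
    ultimately show ?thesis by (auto simp: polys_over_def coeff_pCons split: nat.split)
  next
    case False
    have "q \<in> polys_over P"
    proof (rule Suc.IH[OF qR])
      show "degree q < n" using Suc.prems(2) False by (simp add: q_def degree_synthetic_div)
      show "n \<le> 6" using Suc.prems by simp
      fix i assume i: "i < n"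
      have "poly h (a i) = (a i - a n) * poly q (a i) + poly h (a n)"
        by (subst h) (simp add: algebra_simps)
      then have "(a i - a n) * poly q (a i) = poly h (a i) - poly h (a n)" by simp
      also have "\<dots> \<in> P" using Suc.prems(4) i by (intro pid.P_diff) auto
      finally have m: "(a i - a n) * poly q (a i) \<in> P" .
      have l: "i < 6" "n < 6" "i \<noteq> n" using i Suc.prems(3) by auto
      have "a i - a n \<in> R" "poly q (a i) \<in> R"
        using a_in_R[OF l(1)] a_in_R[OF l(2)] qR by (auto intro: R.poly_mem R.diff_mem)
      then show "poly q (a i) \<in> P" using pid.P_prime[OF _ _ m] a_diff_notin_P[OF l] by blast
    qed
    moreover have "[:- a n, 1:] \<in> polys_over R"
      using a_in_R[of n] Suc.prems(3) by (intro R.polys_overs R.uminus_mem) auto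
    ultimately have "q * [:- a n, 1:] \<in> polys_over P" by (rule pid.poly_P_mult)
    moreover have "[:poly h (a n):] \<in> polys_over P"
      using Suc.prems(4)[of n] by (auto simp: polys_over_def coeff_pCons split: nat.split)
    ultimately have "q * [:- a n, 1:] + [:poly h (a n):] \<in> polys_over P" by (rule pid.poly_P_add)
    then show ?thesis using h by (simp only: mult.commute[of q])
  qed
qed auto

lemma eval6_R: "z \<in> R \<Longrightarrow> eval6 u z \<in> R"
  by (cases u) (auto intro!: R.ring_mems)

lemma mod_cong: "pid.cong (of_int (x mod int p)) (of_int x)"
  by (rule pid.cong_int) (simp add: mod_eq_dvd_iff[symmetric])

lemma eval6_cong_coeffs:
  assumes "z \<in> R" "pid.cong (of_int a1) (of_int a2)" "pid.cong (of_int b1) (of_int b2)" "pid.cong (of_int c1) (of_int c2)"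
    "pid.cong (of_int d1) (of_int d2)" "pid.cong (of_int e1) (of_int e2)" "pid.cong (of_int f1) (of_int f2)"
  shows "pid.cong (eval6 (Six a1 b1 c1 d1 e1 f1) z) (eval6 (Six a2 b2 c2 d2 e2 f2) z)"
  unfolding eval6.simps by (intro pid.cong_add pid.cong_mult assms pid.cong_refl R.ring_mems)

lemma eval6_add: "z \<in> R \<Longrightarrow> pid.cong (eval6 (add6 (int p) u v) z) (eval6 u z + eval6 v z)"
proof (cases u; cases v)
  fix a b c d e f a' b' c' d' e' f'
  assume z: "z \<in> R" and uv: "u = Six a b c d e f" "v = Six a' b' c' d' e' f'"
  have "pid.cong (eval6 (add6 (int p) u v) z) (eval6 (Six (a + a') (b + b') (c + c') (d + d') (e + e') (f + f')) z)"
    unfolding uv add6.simps by (intro eval6_cong_coeffs z mod_cong)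
  then show ?thesis by (simp add: uv algebra_simps)
qed

lemma eval6_smult: "z \<in> R \<Longrightarrow> pid.cong (eval6 (smult6 (int p) k u) z) (of_int k * eval6 u z)"
proof (cases u)
  fix a b c d e f
  assume z: "z \<in> R" and u: "u = Six a b c d e f"
  have "pid.cong (eval6 (smult6 (int p) k u) z) (eval6 (Six (k * a) (k * b) (k * c) (k * d) (k * e) (k * f)) z)"
    unfolding u smult6.simps by (intro eval6_cong_coeffs z mod_cong)
  then show ?thesis by (simp add: u algebra_simps)
qed

context
  fixes z assumes z: "z \<in> R" and z6: "z ^ 6 = - 30 * z - 25"
begin

lemma eval6_shift: "pid.cong (eval6 (shift6 (int p) u) z) (z * eval6 u z)"
proof (cases u)
  fix a b c d e f
  assume u: "u = Six a b c d e f"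
  have "pid.cong (eval6 (shift6 (int p) u) z) (eval6 (Six (- 25 * f) (a - 30 * f) b c d e) z)"
    unfolding u shift6.simps by (intro eval6_cong_coeffs z mod_cong pid.cong_refl)
  also have "eval6 (Six (- 25 * f) (a - 30 * f) b c d e) z = z * eval6 u z"
  proof -
    have "z * eval6 u z = of_int a * z + of_int b * z ^ 2 + of_int c * z ^ 3 + of_int d * z ^ 4 + of_int e * z ^ 5 + of_int f * z ^ 6"
      by (simp add: u algebra_simps eval_nat_numeral)
    then show ?thesis unfolding z6 by (simp add: algebra_simps eval_nat_numeral)
  qed
  finally show ?thesis .
qed

lemma eval6_horner:
  assumes "pid.cong (eval6 w z) y" "y \<in> R"
  shows "pid.cong (eval6 (add6 (int p) (smult6 (int p) k v) (shift6 (int p) w)) z) (of_int k * eval6 v z + z * y)"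
proof -
  have "pid.cong (eval6 (add6 (int p) (smult6 (int p) k v) (shift6 (int p) w)) z)
      (eval6 (smult6 (int p) k v) z + eval6 (shift6 (int p) w) z)" by (rule eval6_add[OF z])
  also have "pid.cong \<dots> (of_int k * eval6 v z + z * eval6 w z)"
    by (intro pid.cong_add eval6_smult z eval6_shift)
  also have "pid.cong \<dots> (of_int k * eval6 v z + z * y)"
    by (intro pid.cong_add pid.cong_mult pid.cong_refl assms z eval6_R)
  finally show ?thesis .
qed

lemma eval6_mult: "pid.cong (eval6 (mult6 (int p) u v) z) (eval6 u z * eval6 v z)"
proof (cases u)
  fix a b c d e f
  assume u: "u = Six a b c d e f"
  let ?v = "eval6 v z"
  have "pid.cong (eval6 (mult6 (int p) u v) z)
      (of_int a * ?v + z * (of_int b * ?v + z * (of_int c * ?v + z * (of_int d * ?v + z * (of_int e * ?v + z * (of_int f * ?v))))))"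
    unfolding u mult6.simps
    by (intro eval6_horner eval6_smult z R.ring_mems eval6_R)
  then show ?thesis by (simp add: u algebra_simps)
qed

lemma eval6_pow: "pid.cong (eval6 (pow6 (int p) bs v) z) (eval6 v z ^ bits_nat bs)"
proof (induction bs arbitrary: v)
  case (Cons b bs)
  have "pid.cong (eval6 (pow6 (int p) bs (mult6 (int p) v v)) z) (eval6 (mult6 (int p) v v) z ^ bits_nat bs)" by (rule Cons.IH)
  also have "pid.cong \<dots> ((eval6 v z * eval6 v z) ^ bits_nat bs)"
    by (intro pid.cong_power eval6_mult eval6_R R.ring_mems z)
  finally have 1: "pid.cong (eval6 (pow6 (int p) bs (mult6 (int p) v v)) z) (eval6 v z ^ (2 * bits_nat bs))"
    by (simp add: power_mult power2_eq_square)
  show ?case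
  proof (cases b)
    case True
    have "pid.cong (eval6 (pow6 (int p) (b # bs) v) z) (eval6 v z * eval6 (pow6 (int p) bs (mult6 (int p) v v)) z)"
      using True eval6_mult by (simp add: Let_def)
    also have "pid.cong \<dots> (eval6 v z * eval6 v z ^ (2 * bits_nat bs))"
      by (intro pid.cong_mult 1 pid.cong_refl eval6_R z)
    finally show ?thesis using True by simp
  qed (use 1 in \<open>simp add: Let_def\<close>)
qed simp

lemma eval6_pow_step:
  assumes "pid.cong x (eval6 u z)" "x \<in> R" "pow6 (int p) bs u = v" "bits_nat bs = n"
  shows "pid.cong (x ^ n) (eval6 v z)"
proof -
  have "pid.cong (x ^ n) (eval6 u z ^ n)" by (intro pid.cong_power assms eval6_R z)
  also have "pid.cong \<dots> (eval6 v z)" using pid.cong_sym[OF eval6_pow[of bs u]] assms(3,4) by simp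
  finally show ?thesis .
qed

end

text \<open>A polynomial of degree at most 5 with six distinct roots modulo \<open>P\<close> is
  zero. The common value \<open>x\<close> may be any element of \<open>R\<close>; it only affects
  the constant coefficient.\<close>

lemma eval6_not_all_zero:
  assumes "\<And>i. i < 6 \<Longrightarrow> eval6 (Six a1 b1 c1 d1 e1 f1) (a i) - x \<in> P" "x \<in> R"
  shows "int p dvd b1 \<and> int p dvd c1 \<and> int p dvd d1 \<and> int p dvd e1 \<and> int p dvd f1"
proof -
  define h where "h = [:of_int a1 - x, of_int b1, of_int c1, of_int d1, of_int e1, of_int f1:]"
  have "h \<in> polys_over R" unfolding h_def by (intro R.polys_overs R.ring_mems assms) auto
  moreover have "degree h < 6" unfolding h_def by (rule le_less_trans[OF degree_pCons_le])
     (auto simp: degree_pCons_eq_if)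
  moreover have "poly h (a i) \<in> P" if "i < 6" for i
    using assms(1)[OF that] by (simp add: h_def algebra_simps)
  ultimately have "h \<in> polys_over P" using root_count[of h 6] by simp
  then have "coeff h k \<in> P" for k by (auto simp: polys_over_def)
  from this[of 1] this[of 2] this[of 3] this[of 4] this[of 5] show ?thesis
    by (simp add: h_def eval_nat_numeral pid.P_int_iff)
qed

lemma obtain_frobenius:
  obtains \<sigma> where "\<sigma> \<in> carrier G" "\<And>s. s \<in> S \<Longrightarrow> pid.cong (s ^ p) (\<sigma> s)"
  using exists_frobenius by blast

context
  fixes \<sigma> assumes \<sigma>: "\<sigma> \<in> carrier G" and frob: "\<And>s. s \<in> S \<Longrightarrow> pid.cong (s ^ p) (\<sigma> s)"
begin

lemma frob_a: "i < 6 \<Longrightarrow> pid.cong (a i ^ p) (a (pm \<sigma> i))"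
  using frob[OF a_in_S] pm_app[OF \<sigma>] by simp

lemma frob_pow_a: "i < 6 \<Longrightarrow> pid.cong (a i ^ (p ^ n)) (a ((pm \<sigma> ^^ n) i))"
  using frobenius_power[OF \<sigma> frob a_in_S, of i n] pm_app[of "\<sigma> [^]\<^bsub>G\<^esub> n" i] \<sigma> by (simp add: pm_pow)

lemma pm_funpow_less: "i < 6 \<Longrightarrow> (pm \<sigma> ^^ n) i < 6"
  by (induction n) (auto intro: pm_less[OF \<sigma>])

lemma pm_funpow_id:
  assumes "\<And>i. i < 6 \<Longrightarrow> pid.cong (a i ^ (p ^ n)) (a i)"
  shows "pm \<sigma> ^^ n = id"
proof
  fix i
  show "(pm \<sigma> ^^ n) i = id i"
  proof (cases "i < 6")
    case True
    have "pid.cong (a ((pm \<sigma> ^^ n) i)) (a i)"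
      using frob_pow_a[OF True, of n] assms[OF True] pid.cong_sym pid.cong_trans by blast
    then show ?thesis using a_cong_imp_eq pm_funpow_less True by simp
  next
    case False
    then have "(pm \<sigma> ^^ n) i = i" by (induction n) (auto simp: pm_def)
    then show ?thesis by simp
  qed
qed

text \<open>If all roots were fixed, the residue of the \<open>p\<close>-th power of X would agree
  with X at six points, but its quadratic coefficient does not vanish.\<close>

lemma pm_nontrivial:
  assumes "\<And>i. i < 6 \<Longrightarrow> pid.cong (a i ^ p) (eval6 (Six a1 b1 c1 d1 e1 f1) (a i))" "\<not> int p dvd c1"
  shows "pm \<sigma> \<noteq> id"
proof
  assume id: "pm \<sigma> = id"
  have "eval6 (Six a1 (b1 - 1) c1 d1 e1 f1) (a i) - 0 \<in> P" if "i < 6" for i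
  proof -
    have "pid.cong (eval6 (Six a1 b1 c1 d1 e1 f1) (a i)) (a i)"
      using frob_a[OF that] assms(1)[OF that] id pid.cong_sym pid.cong_trans by (metis id_apply)
    then show ?thesis by (simp add: pid.cong_def algebra_simps)
  qed
  from eval6_not_all_zero[OF this R.zero_mem] assms(2) show False by blast
qed

end


lemma power_cong_first:
  assumes "i < 6" "pow6 (int p) bs (Six 0 1 0 0 0 0) = v" "bits_nat bs = n"
  shows "pid.cong (a i ^ n) (eval6 v (a i))"
  by (rule eval6_pow_step[OF a_in_R[OF assms(1)] root[OF assms(1)] _ _ assms(2,3)]) (simp_all add: a_in_R assms)

lemma power_cong_next:
  assumes "i < 6" "pow6 (int p) bs u = v" "bits_nat bs = p" "pid.cong (a i ^ (p ^ n)) (eval6 u (a i))"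
  shows "pid.cong (a i ^ (p ^ Suc n)) (eval6 v (a i))"
  using eval6_pow_step[OF a_in_R[OF assms(1)] root[OF assms(1)] assms(4) _ assms(2,3)] a_in_R[OF assms(1)]
  by (simp add: R.ring_mems mult.commute flip: power_mult)

end

section \<open>Frobenius elements at 7, 191 and 11\<close>

context sextic
begin

text \<open>The residues of X^7, X^(7^2), ... modulo 7 and the sextic return to X after exactly five
  steps, so Frobenius has order 5 on the roots.\<close>

lemma exists_five_cycle: "\<exists>\<sigma>\<in>carrier G. pm \<sigma> ^^ 5 = id \<and> pm \<sigma> \<noteq> id"
proof -
  obtain P where "prime_ideal R P 7" using R.exists_prime_ideal[of 7] by auto
  then interpret pid: prime_ideal R P 7 .
  interpret sextic_mod a P 7 by unfold_locales auto
  obtain \<sigma> where s: "\<sigma> \<in> carrier G" "\<And>s. s \<in> S \<Longrightarrow> pid.cong (s ^ 7) (\<sigma> s)" using obtain_frobenius by blast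
  let ?bs = "[True, True, True]"
  have b: "bits_nat ?bs = 7" by simp
  \<comment> \<open>Each line raises the previous residue to the seventh power.\<close>
  have p1: "pow6 (int 7) ?bs (Six 0 1 0 0 0 0) = Six 0 3 5 0 0 0"
    and p2: "pow6 (int 7) ?bs (Six 0 3 5 0 0 0) = Six 0 2 4 3 6 0"
    and p3: "pow6 (int 7) ?bs (Six 0 2 4 3 6 0) = Six 1 4 2 2 4 2"
    and p4: "pow6 (int 7) ?bs (Six 1 4 2 2 4 2) = Six 2 3 2 1 3 4"
    and p5: "pow6 (int 7) ?bs (Six 2 3 2 1 3 4) = Six 0 1 0 0 0 0"
    by code_simp+
  have 1: "pid.cong (a i ^ 7) (eval6 (Six 0 3 5 0 0 0) (a i))" if "i < 6" for i
    by (rule power_cong_first[OF that p1 b])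
  have "pid.cong (a i ^ (7 ^ 5)) (a i)" if i: "i < 6" for i
  proof -
    have "pid.cong (a i ^ (7 ^ (Suc (Suc (Suc (Suc 1)))))) (eval6 (Six 0 1 0 0 0 0) (a i))"
      by (rule power_cong_next[OF i p5 b], rule power_cong_next[OF i p4 b], rule power_cong_next[OF i p3 b], rule power_cong_next[OF i p2 b], use 1[OF i] in simp)
    then show ?thesis by simp
  qed
  then have "pm \<sigma> ^^ 5 = id" using pm_funpow_id[OF s, of 5] by blast
  moreover have "pm \<sigma> \<noteq> id" by (rule pm_nontrivial[OF s 1]) auto
  ultimately show ?thesis using s(1) by blast
qed

text \<open>The fixed point is what excludes a product of two 3-cycles; it comes from a root of the
  sextic in the prime field.\<close>

lemma exists_three_cycle: "\<exists>\<sigma>\<in>carrier G. pm \<sigma> ^^ 3 = id \<and> pm \<sigma> \<noteq> id \<and> (\<exists>i<6. pm \<sigma> i = i)"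
proof -
  have pr: "prime (191::nat)" by code_simp
  obtain P where "prime_ideal R P 191" using R.exists_prime_ideal[OF pr] by auto
  then interpret pid: prime_ideal R P 191 .
  interpret sextic_mod a P 191 by unfold_locales auto
  obtain \<sigma> where s: "\<sigma> \<in> carrier G" "\<And>s. s \<in> S \<Longrightarrow> pid.cong (s ^ 191) (\<sigma> s)" using obtain_frobenius by blast
  let ?bs = "[True, True, True, True, True, True, False, True]"
  have b: "bits_nat ?bs = 191" by simp
  have p1: "pow6 (int 191) ?bs (Six 0 1 0 0 0 0) = Six 120 58 135 182 28 43"
    and p2: "pow6 (int 191) ?bs (Six 120 58 135 182 28 43) = Six 164 116 140 57 95 167"
    and p3: "pow6 (int 191) ?bs (Six 164 116 140 57 95 167) = Six 0 1 0 0 0 0"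
    by code_simp+
  have 1: "pid.cong (a i ^ 191) (eval6 (Six 120 58 135 182 28 43) (a i))" if "i < 6" for i
    by (rule power_cong_first[OF that p1 b])
  have "pid.cong (a i ^ (191 ^ 3)) (a i)" if i: "i < 6" for i
  proof -
    have "pid.cong (a i ^ (191 ^ (Suc (Suc 1)))) (eval6 (Six 0 1 0 0 0 0) (a i))"
      by (rule power_cong_next[OF i p3 b], rule power_cong_next[OF i p2 b], use 1[OF i] in simp)
    then show ?thesis by simp
  qed
  then have "pm \<sigma> ^^ 3 = id" using pm_funpow_id[OF s, of 3] by blast
  moreover have "pm \<sigma> \<noteq> id" by (rule pm_nontrivial[OF s 1]) auto
  moreover have "\<exists>i<6. pm \<sigma> i = i"
  proof -
    \<comment> \<open>The value of the sextic at 53. So 53 is congruent to some root, and by Fermat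
      that root is fixed by Frobenius.\<close>
    have "(of_int (191 * 116043784) :: complex) \<in> P" by (subst pid.P_int_iff) simp
    then have "(\<Prod>i<6. of_int 53 - a i) \<in> P" using roots[of 53] by simp
    moreover have "of_int 53 - a i \<in> R" if "i \<in> {..<6}" for i using that by (intro R.ring_mems a_in_R) auto
    ultimately have "\<exists>i\<in>{..<6}. of_int 53 - a i \<in> P" by (intro pid.P_prod finite_lessThan)
    then obtain i where i: "i < 6" "of_int 53 - a i \<in> P" by blast
    then have c: "pid.cong (of_int 53) (a i)" by (simp add: pid.cong_def)
    have "pid.cong (a i) (of_int 53)" by (rule pid.cong_sym[OF c])
    also have "pid.cong \<dots> (of_int 53 ^ 191)" by (rule pid.cong_sym[OF pid.fermat_int])
    also have "pid.cong \<dots> (a i ^ 191)" using i by (intro pid.cong_power c R.ring_mems a_in_R)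
    also have "pid.cong \<dots> (a (pm \<sigma> i))" by (rule frob_a[OF s i(1)])
    finally show ?thesis using a_cong_imp_eq[of i "pm \<sigma> i"] i pm_less[OF s(1)] by metis
  qed
  ultimately show ?thesis using s(1) by blast
qed

text \<open>This element serves two purposes: having no fixed index it makes the permutation group
  transitive, and its fourth power is a pure switching that is not trivial.\<close>

lemma exists_fixed_point_free:
  "\<exists>\<sigma>\<in>carrier G. (\<forall>i<6. pm \<sigma> i \<noteq> i) \<and> pm \<sigma> ^^ 4 = id \<and> (\<exists>i<6. \<exists>j<6. es (\<sigma> [^]\<^bsub>G\<^esub> (4::nat)) i j = - 1)"
proof -
  obtain P where "prime_ideal R P 11" using R.exists_prime_ideal[of 11] by auto
  then interpret pid: prime_ideal R P 11 .
  interpret sextic_mod a P 11 by unfold_locales auto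
  obtain \<sigma> where s: "\<sigma> \<in> carrier G" "\<And>s. s \<in> S \<Longrightarrow> pid.cong (s ^ 11) (\<sigma> s)" using obtain_frobenius by blast
  let ?bs = "[True, True, False, True]"
  have b: "bits_nat ?bs = 11" by simp
  have p1: "pow6 (int 11) ?bs (Six 0 1 0 0 0 0) = Six 2 9 0 0 0 8"
    and p2: "pow6 (int 11) ?bs (Six 2 9 0 0 0 8) = Six 2 2 10 0 1 8"
    and p3: "pow6 (int 11) ?bs (Six 2 2 10 0 1 8) = Six 8 5 5 1 9 10"
    and p4: "pow6 (int 11) ?bs (Six 8 5 5 1 9 10) = Six 0 1 0 0 0 0"
    by code_simp+
  have 1: "pid.cong (a i ^ 11) (eval6 (Six 2 9 0 0 0 8) (a i))" if "i < 6" for i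
    by (rule power_cong_first[OF that p1 b])
  have "pid.cong (a i ^ (11 ^ 4)) (a i)" if i: "i < 6" for i
  proof -
    have "pid.cong (a i ^ (11 ^ (Suc (Suc (Suc 1))))) (eval6 (Six 0 1 0 0 0 0) (a i))"
      by (rule power_cong_next[OF i p4 b], rule power_cong_next[OF i p3 b], rule power_cong_next[OF i p2 b], use 1[OF i] in simp)
    then show ?thesis by simp
  qed
  then have pm4: "pm \<sigma> ^^ 4 = id" using pm_funpow_id[OF s, of 4] by blast
  \<comment> \<open>The second factor is the residue of X^11 - X. Being invertible, it vanishes at
    no root, so no root is fixed.\<close>
  have inv: "mult6 (int 11) (Six 5 8 5 9 5 2) (Six 2 8 0 0 0 8) = Six 1 0 0 0 0 0" by code_simp
  have free: "pm \<sigma> i \<noteq> i" if i: "i < 6" for i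
  proof
    assume "pm \<sigma> i = i"
    then have "pid.cong (a i) (eval6 (Six 2 9 0 0 0 8) (a i))"
      using frob_a[OF s i] 1[OF i] pid.cong_sym pid.cong_trans by metis
    then have "eval6 (Six 2 9 0 0 0 8) (a i) - a i \<in> P" using pid.cong_sym by (simp add: pid.cong_def)
    then have "eval6 (Six 2 8 0 0 0 8) (a i) \<in> P" by (simp add: algebra_simps)
    then have "eval6 (Six 5 8 5 9 5 2) (a i) * eval6 (Six 2 8 0 0 0 8) (a i) \<in> P"
      using i by (intro pid.P_mult2 eval6_R a_in_R)
    moreover have "pid.cong 1 (eval6 (Six 5 8 5 9 5 2) (a i) * eval6 (Six 2 8 0 0 0 8) (a i))"
      using eval6_mult[OF a_in_R[OF i] root[OF i], of "Six 5 8 5 9 5 2" "Six 2 8 0 0 0 8"] unfolding inv by simp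
    ultimately show False using pid.P_add pid.one_notin by (fastforce simp: pid.cong_def)
  qed
  let ?q = "Six 0 2 5 4 7 5"
  let ?cs = "[False, False, False, True, True, False, False, True, False, False, True, True, True]"
  \<comment> \<open>The exponent 7320 is (11^4 - 1) / 2: for \<open>c i j\<close>, whose square is
    \<open>a i * a j\<close>, being fixed by the fourth Frobenius power means that the power 7320 of
    \<open>a i * a j\<close> is 1.\<close>
  have pq: "pow6 (int 11) ?cs (Six 0 1 0 0 0 0) = ?q" by code_simp
  have bq: "bits_nat ?cs = 7320" by simp
  have q: "pid.cong (a i ^ 7320) (eval6 ?q (a i))" if "i < 6" for i
    by (rule power_cong_first[OF that pq bq])
  have "\<exists>i<6. \<exists>j<6. es (\<sigma> [^]\<^bsub>G\<^esub> (4::nat)) i j = - 1"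
  proof (rule ccontr)
    assume no: "\<not> ?thesis"
    let ?s = "\<sigma> [^]\<^bsub>G\<^esub> (4::nat)"
    have sG: "?s \<in> carrier G" using s(1) by simp
    have e1: "es ?s i j = 1" if "i < 6" "j < 6" for i j using no that es_range[OF sG] by blast
    have pmid: "pm ?s = id" using pm_pow[OF s(1), of 4] pm4 by simp
    have qq: "a i ^ 7320 * a j ^ 7320 - 1 \<in> P" if ij: "i < 6" "j < 6" for i j
    proof -
      have "pid.cong (c i j ^ (11 ^ 4)) (?s (c i j))" by (rule frobenius_power[OF s c_in_S[OF ij]])
      also have "?s (c i j) = c i j" using es_app[OF sG ij] e1[OF ij] pmid by simp
      finally have "c i j ^ 14641 - c i j \<in> P" by (simp add: pid.cong_def)
      also have "c i j ^ 14641 - c i j = c i j * ((c i j ^ 2) ^ 7320 - 1)"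
        using power_Suc[of "c i j" 14640] by (simp add: algebra_simps flip: power_mult)
      finally have m: "c i j * ((c i j ^ 2) ^ 7320 - 1) \<in> P" .
      have "c i j \<notin> P"
      proof
        assume "c i j \<in> P"
        then have "c i j * c i j \<in> P" using ij by (intro pid.P_mult c_in_R)
        then have "a i * a j \<in> P" using c_square[of i j] by (simp add: power2_eq_square)
        then show False using pid.P_prime a_in_R a_notin_P ij by blast
      qed
      moreover have "(c i j ^ 2) ^ 7320 - 1 \<in> R" using ij by (intro R.ring_mems R.one_mem c_in_R)
      ultimately have "(c i j ^ 2) ^ 7320 - 1 \<in> P" using pid.P_prime[OF c_in_R[OF ij] _ m] by blast
      then show ?thesis by (simp only: c_square power_mult_distrib)
    qed
    \<comment> \<open>If all these products were 1, the power 7320 of a root would not depend on the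
      root.\<close>
    have "eval6 ?q (a i) - a 0 ^ 7320 \<in> P" if i: "i < 6" for i
    proof -
      have R: "a i ^ 7320 \<in> R" "a 0 ^ 7320 \<in> R" using i by (auto intro!: R.power_mem a_in_R)
      have "a i ^ 7320 * (a 0 ^ 7320 * a 0 ^ 7320 - 1) - a 0 ^ 7320 * (a i ^ 7320 * a 0 ^ 7320 - 1) \<in> P"
        using i by (intro pid.P_diff pid.P_mult2 qq R) auto
      then have "a i ^ 7320 - a 0 ^ 7320 \<in> P"
        using pid.P_uminus by (fastforce simp: algebra_simps)
      then have "pid.cong (a i ^ 7320) (a 0 ^ 7320)" by (simp add: pid.cong_def)
      then show ?thesis using q[OF i] pid.cong_sym pid.cong_trans unfolding pid.cong_def[symmetric] by blast
    qed
    moreover have "a 0 ^ 7320 \<in> R" by (intro R.power_mem a_in_R) simp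
    \<comment> \<open>The linear coefficient of the residue is 2, so the residue cannot be constant
      on the six roots.\<close>
    ultimately have "int 11 dvd 2" using eval6_not_all_zero by blast
    then show False by simp
  qed
  then show ?thesis using s(1) free pm4 by blast
qed

end

section \<open>Generating the alternating group on six points\<close>

abbreviation finv :: "('a \<Rightarrow> 'b) \<Rightarrow> 'b \<Rightarrow> 'a" where "finv \<equiv> inv_into UNIV"

definition cyc3 :: "nat \<Rightarrow> nat \<Rightarrow> nat \<Rightarrow> nat \<Rightarrow> nat" where
  "cyc3 i j k x = (if x = i then j else if x = j then k else if x = k then i else x)"

lemma cyc3_transpose: "distinct [i, j, k] \<Longrightarrow> cyc3 i j k = Transposition.transpose i j \<circ> Transposition.transpose j k"
  by (auto simp: cyc3_def Transposition.transpose_def)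

lemma cyc3_permutes: "distinct [i, j, k] \<Longrightarrow> {i, j, k} \<subseteq> A \<Longrightarrow> cyc3 i j k permutes A"
  by (simp only: cyc3_transpose) (auto intro!: permutes_compose permutes_swap_id)

lemma cyc3_even: "distinct [i, j, k] \<Longrightarrow> evenperm (cyc3 i j k)"
  by (simp only: cyc3_transpose) (simp add: evenperm_comp permutation_swap_id evenperm_swap)

lemma cyc3_rotate: "distinct [i, j, k] \<Longrightarrow> cyc3 j k i = cyc3 i j k"
  by (auto simp: cyc3_def)

lemma cyc3_conj: "bij g \<Longrightarrow> g \<circ> cyc3 i j k \<circ> finv g = cyc3 (g i) (g j) (g k)"
proof
  fix x
  assume g: "bij g"
  then obtain y where x: "x = g y" by (metis bij_pointE)
  have "finv g x = y" using g x by (simp add: bij_is_inj)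
  moreover have "g a = g b \<longleftrightarrow> a = b" for a b using g by (simp add: bij_is_inj inj_eq)
  ultimately show "(g \<circ> cyc3 i j k \<circ> finv g) x = cyc3 (g i) (g j) (g k) x"
    by (simp add: cyc3_def x)
qed

definition rot5 :: "nat \<Rightarrow> nat" where
  "rot5 k = (if k < 4 then Suc k else if k = 4 then 0 else k)"

lemma rot5_simps [simp]: "rot5 0 = 1" "rot5 1 = 2" "rot5 (Suc 0) = 2" "rot5 2 = 3" "rot5 3 = 4" "rot5 4 = 0" "rot5 5 = 5"
  by (simp_all add: rot5_def)

locale perm_set =
  fixes \<Gamma> :: "(nat \<Rightarrow> nat) set"
  assumes perms: "\<pi> \<in> \<Gamma> \<Longrightarrow> \<pi> permutes {..<6}"
    and comp_closed: "\<pi> \<in> \<Gamma> \<Longrightarrow> \<rho> \<in> \<Gamma> \<Longrightarrow> \<pi> \<circ> \<rho> \<in> \<Gamma>"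
    and inv_closed: "\<pi> \<in> \<Gamma> \<Longrightarrow> finv \<pi> \<in> \<Gamma>"
    and id_in: "id \<in> \<Gamma>"
begin

definition T :: "nat \<Rightarrow> nat \<Rightarrow> nat \<Rightarrow> bool" where
  "T i j k \<longleftrightarrow> i < 6 \<and> j < 6 \<and> k < 6 \<and> distinct [i, j, k] \<and> cyc3 i j k \<in> \<Gamma>"

lemma T_rotate: "T i j k \<Longrightarrow> T j k i"
  using cyc3_rotate[of i j k] by (auto simp: T_def)

lemma T_inverse: "T i j k \<Longrightarrow> T i k j"
proof -
  assume t: "T i j k"
  have "cyc3 i j k \<circ> cyc3 i j k = cyc3 i k j" using t by (auto simp: T_def cyc3_def)
  then show ?thesis using t comp_closed[of "cyc3 i j k" "cyc3 i j k"] by (auto simp: T_def)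
qed

lemma T_conj: "g \<in> \<Gamma> \<Longrightarrow> T i j k \<Longrightarrow> T (g i) (g j) (g k)"
proof -
  assume g: "g \<in> \<Gamma>" and t: "T i j k"
  have b: "bij g" using perms[OF g] by (rule permutes_bij)
  have "g \<circ> cyc3 i j k \<circ> finv g \<in> \<Gamma>" using g t by (intro comp_closed inv_closed) (auto simp: T_def)
  then have "cyc3 (g i) (g j) (g k) \<in> \<Gamma>" by (simp add: cyc3_conj[OF b])
  moreover have "g x < 6" if "x < 6" for x using permutes_in_image[OF perms[OF g], of x] that by simp
  moreover have "g a = g b \<longleftrightarrow> a = b" for a b using b by (simp add: bij_is_inj inj_eq)
  ultimately show ?thesis using t by (auto simp: T_def)
qed

lemma T_cyc: "T l m n \<Longrightarrow> T i j k \<Longrightarrow> T (cyc3 l m n i) (cyc3 l m n j) (cyc3 l m n k)"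
  by (rule T_conj) (auto simp: T_def)

context
  assumes rot: "rot5 \<in> \<Gamma>"
begin

lemma T_rot: "T i j k \<Longrightarrow> T (rot5 i) (rot5 j) (rot5 k)"
  by (rule T_conj[OF rot])

text \<open>The ten triples in five points are the five rotations of {0, 1, 2} and the five of {0,
  2, 3}; the latter arises by conjugating the 3-cycle (0 1 2) with (1 2 3).\<close>

lemma T_012_all:
  assumes "T 0 1 2" "i < 5" "j < 5" "k < 5" "distinct [i, j, k]"
  shows "T i j k"
proof -
  have a: "T 1 2 3" "T 2 3 4" "T 3 4 0" "T 4 0 1"
    using T_rot[OF assms(1)] T_rot[OF T_rot[OF assms(1)]] T_rot[OF T_rot[OF T_rot[OF assms(1)]]]
      T_rot[OF T_rot[OF T_rot[OF T_rot[OF assms(1)]]]] by simp_all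
  have b: "T 0 2 3" using T_cyc[OF a(1) assms(1)] by (simp add: cyc3_def)
  have c: "T 1 3 4" "T 2 4 0" "T 3 0 1" "T 4 1 2"
    using T_rot[OF b] T_rot[OF T_rot[OF b]] T_rot[OF T_rot[OF T_rot[OF b]]]
      T_rot[OF T_rot[OF T_rot[OF T_rot[OF b]]]] by simp_all
  have six: "T x y z \<and> T y z x \<and> T z x y \<and> T x z y \<and> T z y x \<and> T y x z" if "T x y z" for x y z
    using that T_rotate T_inverse by blast
  have s: "i \<in> {0,1,2,3,4}" "j \<in> {0,1,2,3,4}" "k \<in> {0,1,2,3,4}" using assms by auto
  show ?thesis
    using s assms(5) six[OF assms(1)] six[OF a(1)] six[OF a(2)] six[OF a(3)] six[OF a(4)] six[OF b]
      six[OF c(1)] six[OF c(2)] six[OF c(3)] six[OF c(4)]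
    by (auto simp del: One_nat_def)
qed

text \<open>Conjugating by the rotated 3-cycle (2 3 0) makes the triple consecutive.\<close>

lemma T_013_imp: "T 0 1 3 \<Longrightarrow> T 0 1 2"
proof -
  assume t: "T 0 1 3"
  have "T 2 3 0" using T_rot[OF T_rot[OF t]] by simp
  from T_cyc[OF this t] have "T 2 1 0" by (simp add: cyc3_def)
  then show ?thesis using T_rotate T_inverse by blast
qed

lemma T_0_imp:
  assumes "T 0 x y" "x < 5" "y < 5"
  shows "T 0 1 2"
proof -
  have s: "x \<in> {1,2,3,4}" "y \<in> {1,2,3,4}" "x \<noteq> y" using assms by (auto simp: T_def)
  have r: "T (rot5 0) (rot5 x) (rot5 y)" "T (rot5 (rot5 0)) (rot5 (rot5 x)) (rot5 (rot5 y))"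
    "T (rot5 (rot5 (rot5 0))) (rot5 (rot5 (rot5 x))) (rot5 (rot5 (rot5 y)))"
    using assms(1) T_rot by blast+
  consider "T 0 1 2" | "T 0 2 1" | "T 0 1 3" | "T 0 3 1" | "T 0 1 4" | "T 0 4 1" | "T 0 2 3" | "T 0 3 2"
    | "T 0 2 4" | "T 0 4 2" | "T 0 3 4" | "T 0 4 3"
    using s assms(1) by (auto simp del: One_nat_def)
  then show ?thesis
  proof cases
    case 2 then show ?thesis using T_inverse by blast
  next
    case 3 then show ?thesis by (rule T_013_imp)
  next
    case 4 then show ?thesis using T_013_imp T_inverse by blast
  next
    case 5
    from T_rot[OF this] have "T 1 2 0" by simp
    then show ?thesis using T_rotate by blast
  next
    case 6
    from T_rot[OF T_inverse[OF this]] have "T 1 2 0" by simp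
    then show ?thesis using T_rotate by blast
  next
    case 7
    from T_rot[OF T_rot[OF T_rot[OF this]]] have "T 3 0 1" by simp
    then show ?thesis using T_rotate T_013_imp by blast
  next
    case 8
    from T_rot[OF T_rot[OF T_rot[OF T_inverse[OF this]]]] have "T 3 0 1" by simp
    then show ?thesis using T_rotate T_013_imp by blast
  next
    case 9
    from T_rot[OF this] have "T 1 3 0" by simp
    then show ?thesis using T_rotate T_inverse T_013_imp by blast
  next
    case 10
    from T_rot[OF this] have "T 1 0 3" by simp
    then show ?thesis using T_rotate T_inverse T_013_imp by blast
  next
    case 11
    from T_rot[OF T_rot[OF this]] have "T 2 0 1" by simp
    then show ?thesis using T_rotate by blast
  next
    case 12
    from T_rot[OF T_rot[OF T_inverse[OF this]]] have "T 2 0 1" by simp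
    then show ?thesis using T_rotate by blast
  qed
qed

lemma T_less5_imp:
  assumes "T i j k" "i < 5" "j < 5" "k < 5"
  shows "T 0 1 2"
proof -
  have *: "rot5 x < 5" if "x < 5" for x using that by (auto simp: rot5_def)
  have "i \<in> {0,1,2,3,4}" using assms by auto
  then have "\<exists>x y. x < 5 \<and> y < 5 \<and> T 0 x y"
  proof (elim insertE)
    assume "i = 0" then show ?thesis using assms by blast
  next
    assume "i = 4"
    then have "T 0 (rot5 j) (rot5 k)" using T_rot[OF assms(1)] by simp
    then show ?thesis using assms by (intro exI[of _ "rot5 j"] exI[of _ "rot5 k"]) (simp add: *)
  next
    assume "i = 3"
    then have "T 0 (rot5 (rot5 j)) (rot5 (rot5 k))" using T_rot[OF T_rot[OF assms(1)]] by simp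
    then show ?thesis using assms by (intro exI[of _ "rot5 (rot5 j)"] exI[of _ "rot5 (rot5 k)"]) (simp add: *)
  next
    assume "i = 2"
    then have "T 0 (rot5 (rot5 (rot5 j))) (rot5 (rot5 (rot5 k)))" using T_rot[OF T_rot[OF T_rot[OF assms(1)]]] by simp
    then show ?thesis using assms by (intro exI[of _ "rot5 (rot5 (rot5 j))"] exI[of _ "rot5 (rot5 (rot5 k))"]) (simp add: *)
  next
    assume "i = 1"
    then have "T 0 (rot5 (rot5 (rot5 (rot5 j)))) (rot5 (rot5 (rot5 (rot5 k))))" using T_rot[OF T_rot[OF T_rot[OF T_rot[OF assms(1)]]]] by simp
    then show ?thesis using assms by (intro exI[of _ "rot5 (rot5 (rot5 (rot5 j)))"] exI[of _ "rot5 (rot5 (rot5 (rot5 k)))"]) (simp add: *)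
  qed simp
  then show ?thesis using T_0_imp by blast
qed

text \<open>After a rotation the 3-cycle is (5 0 d). The rotation of it that begins 5, d carries 5
  to d and fixes 0, so conjugating by it gives a 3-cycle that avoids 5.\<close>

lemma T_5_imp:
  assumes "T 5 j k"
  shows "T 0 1 2"
proof -
  have jk: "j < 5" "k < 5" using assms by (auto simp: T_def)
  have *: "rot5 x < 5" if "x < 5" for x using that by (auto simp: rot5_def)
  have "j \<in> {0,1,2,3,4}" using jk by auto
  then have "\<exists>d<5. T 5 0 d"
  proof (elim insertE)
    assume "j = 0" then show ?thesis using assms jk by blast
  next
    assume "j = 4"
    then have "T 5 0 (rot5 k)" using T_rot[OF assms] by simp
    then show ?thesis using jk by (intro exI[of _ "rot5 k"]) (simp add: *)
  next
    assume "j = 3"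
    then have "T 5 0 (rot5 (rot5 k))" using T_rot[OF T_rot[OF assms]] by simp
    then show ?thesis using jk by (intro exI[of _ "rot5 (rot5 k)"]) (simp add: *)
  next
    assume "j = 2"
    then have "T 5 0 (rot5 (rot5 (rot5 k)))" using T_rot[OF T_rot[OF T_rot[OF assms]]] by simp
    then show ?thesis using jk by (intro exI[of _ "rot5 (rot5 (rot5 k))"]) (simp add: *)
  next
    assume "j = 1"
    then have "T 5 0 (rot5 (rot5 (rot5 (rot5 k))))" using T_rot[OF T_rot[OF T_rot[OF T_rot[OF assms]]]] by simp
    then show ?thesis using jk by (intro exI[of _ "rot5 (rot5 (rot5 (rot5 k)))"]) (simp add: *)
  qed simp
  then obtain d where d: "d < 5" "T 5 0 d" by blast
  then have "d \<in> {1,2,3,4}" by (auto simp: T_def)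
  then consider "d = 1" | "d = 2" | "d = 3" | "d = 4" by auto
  then show ?thesis
  proof cases
    case 1
    from T_rot[OF d(2)] 1 have "T 5 1 2" by simp
    from T_cyc[OF this d(2)] 1 have "T 1 0 2" by (simp add: cyc3_def)
    then show ?thesis by (rule T_less5_imp) auto
  next
    case 2
    from T_rot[OF T_rot[OF d(2)]] 2 have "T 5 2 4" by simp
    from T_cyc[OF this d(2)] 2 have "T 2 0 4" by (simp add: cyc3_def)
    then show ?thesis by (rule T_less5_imp) auto
  next
    case 3
    from T_rot[OF T_rot[OF T_rot[OF d(2)]]] 3 have "T 5 3 1" by simp
    from T_cyc[OF this d(2)] 3 have "T 3 0 1" by (simp add: cyc3_def)
    then show ?thesis by (rule T_less5_imp) auto
  next
    case 4
    from T_rot[OF T_rot[OF T_rot[OF T_rot[OF d(2)]]]] 4 have "T 5 4 3" by simp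
    from T_cyc[OF this d(2)] 4 have "T 4 0 3" by (simp add: cyc3_def)
    then show ?thesis by (rule T_less5_imp) auto
  qed
qed

lemma T_imp_012: "T i j k \<Longrightarrow> T 0 1 2"
proof -
  assume t: "T i j k"
  consider "i < 5" "j < 5" "k < 5" | "i = 5" | "j = 5" | "k = 5" using t by (fastforce simp: T_def)
  then show ?thesis
  proof cases
    case 1 then show ?thesis using T_less5_imp[OF t] by blast
  next
    case 2 then show ?thesis using T_5_imp t by blast
  next
    case 3 then show ?thesis using T_5_imp T_rotate[OF t] by blast
  next
    case 4 then show ?thesis using T_5_imp T_rotate[OF T_rotate[OF t]] by blast
  qed
qed

text \<open>With an element moving 5, the rotation makes the group transitive. A given triple misses
  some point \<open>m\<close>; carrying \<open>m\<close> back to 5 turns it into a triple among the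
  points 0 to 4.\<close>

lemma T_all:
  assumes "T a b c" "s \<in> \<Gamma>" "s 5 \<noteq> 5" and ijk: "i < 6" "j < 6" "k < 6" "distinct [i, j, k]"
  shows "T i j k"
proof -
  have t: "T x y z" if "x < 5" "y < 5" "z < 5" "distinct [x, y, z]" for x y z
    using T_012_all[OF T_imp_012[OF assms(1)]] that by blast
  have s5: "s 5 < 5" using permutes_in_image[OF perms[OF assms(2)], of 5] assms(3) by auto
  have "\<exists>g\<in>\<Gamma>. g 5 = m" if "m < 6" for m
  proof (cases "m = 5")
    case True then show ?thesis using id_in by (intro bexI[of _ id]) auto
  next
    case False
    then have m: "m \<in> {0,1,2,3,4}" using that by auto
    let ?r = "\<lambda>n. (rot5 ^^ n) \<circ> s"
    have g: "?r n \<in> \<Gamma>" for n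
    proof (induction n)
      case (Suc n)
      then show ?case using comp_closed[OF rot Suc] by (simp only: funpow.simps comp_assoc)
    qed (simp add: assms(2))
    have "(rot5 ^^ n) a = (a + n) mod 5" if "a < 5" for a n
      by (induction n) (use that in \<open>auto simp: rot5_def mod_Suc\<close>)
    then have "?r (m + 5 - s 5) 5 = m" using m s5 by auto
    then show ?thesis using g by blast
  qed
  moreover have "\<exists>m<6. m \<notin> {i, j, k}"
  proof (rule ccontr)
    assume "\<not> ?thesis"
    then have "{..<6} \<subseteq> {i, j, k}" by auto
    then have "card {..<6::nat} \<le> card {i, j, k}" by (intro card_mono) auto
    then show False using ijk by simp
  qed
  ultimately obtain m g where g: "g \<in> \<Gamma>" "g 5 = m" "m \<notin> {i, j, k}" by blast
  have gp: "g permutes {..<6}" by (rule perms[OF g(1)])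
  let ?h = "finv g"
  have h: "?h x < 5" if "x < 6" "x \<noteq> m" for x
  proof -
    have "?h x < 6" using permutes_in_image[OF permutes_inv[OF gp], of x] that by simp
    moreover have "?h x \<noteq> 5" using that g(2) permutes_inverses(1)[OF gp, of x] by metis
    ultimately show ?thesis by simp
  qed
  have "?h a \<noteq> ?h b" if "a \<noteq> b" for a b using that permutes_inverses(1)[OF gp] by metis
  then have "T (?h i) (?h j) (?h k)" using h g(3) ijk by (intro t) auto
  then have "T (g (?h i)) (g (?h j)) (g (?h k))" by (rule T_conj[OF g(1)])
  then show ?thesis by (simp add: permutes_inverses(1)[OF gp])
qed

text \<open>Multiplying by suitable 3-cycles fixes the points 0 to 3 one after another. What remains
  acts on {4, 5} and is even, hence trivial.\<close>

lemma all_even: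
  assumes T: "T a b c" "s \<in> \<Gamma>" "s 5 \<noteq> 5" and \<pi>: "\<pi> permutes {..<6}" "evenperm \<pi>"
  shows "\<pi> \<in> \<Gamma>"
proof -
  have perm: "permutation \<rho>" if "\<rho> permutes {..<6::nat}" for \<rho> using that permutation_permutes finite_lessThan by blast
  have "\<exists>\<gamma>\<in>\<Gamma>. evenperm \<gamma> \<and> (\<forall>i<m. (\<gamma> \<circ> \<pi>) i = i)" if "m \<le> 4" for m
    using that
  proof (induction m)
    case 0
    then show ?case using id_in by (intro bexI[of _ id]) auto
  next
    case (Suc m)
    then obtain \<gamma> where g: "\<gamma> \<in> \<Gamma>" "evenperm \<gamma>" "\<forall>i<m. (\<gamma> \<circ> \<pi>) i = i" by auto
    define \<rho> where "\<rho> = \<gamma> \<circ> \<pi>"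
    have rp: "\<rho> permutes {..<6}" unfolding \<rho>_def by (intro permutes_compose \<pi> perms g)
    show ?case
    proof (cases "\<rho> m = m")
      case True
      then show ?thesis using g by (intro bexI[of _ \<gamma>]) (auto simp: \<rho>_def less_Suc_eq)
    next
      case False
      define y where "y = \<rho> m"
      have y6: "y < 6" using permutes_in_image[OF rp, of m] Suc.prems by (simp add: y_def)
      have ym: "m < y"
      proof (rule ccontr)
        assume "\<not> m < y"
        then have "y < m" using False by (simp add: y_def)
        then have "\<rho> y = y" using g(3) by (simp add: \<rho>_def)
        then have "\<rho> y = \<rho> m" by (simp add: y_def)
        then show False using \<open>y < m\<close> permutes_inj[OF rp] by (metis injD less_irrefl)
      qed
      \<comment> \<open>The third point lies above \<open>m\<close>, so the points already fixed are
        not disturbed.\<close>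
      define z where "z = (if y = 5 then 4 else 5 :: nat)"
      have z: "z < 6" "m < z" "z \<noteq> y" using Suc.prems by (auto simp: z_def)
      have d: "distinct [y, m, z]" using ym z by auto
      have t: "cyc3 y m z \<in> \<Gamma>" using T_all[OF T y6 _ z(1) d] Suc.prems by (auto simp: T_def)
      show ?thesis
      proof (intro bexI[of _ "cyc3 y m z \<circ> \<gamma>"] conjI allI impI)
        show "cyc3 y m z \<circ> \<gamma> \<in> \<Gamma>" by (rule comp_closed[OF t g(1)])
        show "evenperm (cyc3 y m z \<circ> \<gamma>)"
          using perm[OF perms[OF t]] perm[OF perms[OF g(1)]] g(2) cyc3_even[OF d] by (simp add: evenperm_comp)
        fix i assume "i < Suc m"
        then consider "i = m" | "i < m" by linarith
        then show "((cyc3 y m z \<circ> \<gamma>) \<circ> \<pi>) i = i"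
        proof cases
          case 1
          then show ?thesis using y_def by (simp add: \<rho>_def cyc3_def)
        next
          case 2
          then show ?thesis using g(3) ym z by (simp add: cyc3_def)
        qed
      qed
    qed
  qed
  from this[of 4] obtain \<gamma> where g: "\<gamma> \<in> \<Gamma>" "evenperm \<gamma>" "\<forall>i<4. (\<gamma> \<circ> \<pi>) i = i" by auto
  define \<rho> where "\<rho> = \<gamma> \<circ> \<pi>"
  have rp: "\<rho> permutes {..<6}" unfolding \<rho>_def by (intro permutes_compose \<pi> perms g)
  have re: "evenperm \<rho>" unfolding \<rho>_def using g \<pi> perm perms by (subst evenperm_comp) auto
  have "\<rho> permutes {4, 5}"
  proof (rule permutes_superset[OF rp])
    fix x assume "x \<in> {..<6} - {4, 5 :: nat}"
    then have "x < 4" by auto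
    then show "\<rho> x = x" using g(3) by (simp add: \<rho>_def)
  qed
  then have "\<rho> = id \<or> \<rho> = Transposition.transpose 4 5" by (simp add: permutes_doubleton_iff)
  then have "\<gamma> \<circ> \<pi> = id" using re evenperm_swap[of 4 5] by (auto simp: \<rho>_def)
  then have "finv \<gamma> \<circ> (\<gamma> \<circ> \<pi>) = finv \<gamma>" by simp
  then have "\<pi> = finv \<gamma>" using permutes_inv_o(2)[OF perms[OF g(1)]] by (simp add: o_assoc)
  then show ?thesis using inv_closed g(1) by simp
qed

end

end

text \<open>An element of order 5 becomes the standard 5-cycle after relabelling.\<close>

lemma (in perm_set) generates_alternating:
  assumes c: "c \<in> \<Gamma>" "c ^^ 5 = id" "c \<noteq> id"
    and t: "t \<in> \<Gamma>" "t ^^ 3 = id" "t \<noteq> id" "f < 6" "t f = f"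
    and s: "s \<in> \<Gamma>" "\<And>i. i < 6 \<Longrightarrow> s i \<noteq> i"
    and \<pi>: "\<pi> permutes {..<6}" "evenperm \<pi>"
  shows "\<pi> \<in> \<Gamma>"
proof -
  have perm: "permutation \<rho>" if "\<rho> permutes {..<6::nat}" for \<rho> using that permutation_permutes finite_lessThan by blast
  have cp: "c permutes {..<6}" and tp: "t permutes {..<6}" by (rule perms, fact)+
  obtain x where x: "c x \<noteq> x" using c(3) by (metis eq_id_iff)
  have x6: "x < 6" using x cp by (metis lessThan_iff permutes_not_in)
  have ck6: "(c ^^ k) x < 6" for k
    by (induction k) (use x6 permutes_in_image[OF cp] in auto)
  have c5: "(c ^^ 5) x = x" by (simp add: c(2))
  have cne: "(c ^^ k) x \<noteq> x" if "0 < k" "k < 5" for k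
  proof
    assume e: "(c ^^ k) x = x"
    have e': "(c ^^ (k * n)) x = x" for n
    proof (induction n)
      case (Suc n)
      have "(c ^^ (k * Suc n)) x = (c ^^ k) ((c ^^ (k * n)) x)" by (simp only: mult_Suc_right funpow_add comp_apply)
      then show ?case using Suc e by simp
    qed simp
    have e5: "(c ^^ (5 * n)) x = x" for n
    proof (induction n)
      case (Suc n)
      have "(c ^^ (5 * Suc n)) x = (c ^^ 5) ((c ^^ (5 * n)) x)" by (simp only: mult_Suc_right funpow_add comp_apply)
      then show ?case using Suc c5 by simp
    qed simp
    have step: "(c ^^ (5 * n + 1)) x = c x" for n
      using e5[of n] by (simp only: funpow_add[of "5 * n" 1] Suc_eq_plus1[symmetric] funpow.simps comp_apply)
    have "k \<in> {1, 2, 3, 4}" using that by auto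
    then consider "k = 1" | "k = 2" | "k = 3" | "k = 4" by blast
    \<comment> \<open>Multiples of \<open>k\<close> that are 1 modulo 5: 3 * 2 = 6, 2 * 3 = 6 and 4
      * 4 = 16.\<close>
    then have "c x = x"
    proof cases
      case 1 then show ?thesis using e by simp
    next
      case 2 then show ?thesis using e'[of 3] step[of 1] by simp
    next
      case 3 then show ?thesis using e'[of 2] step[of 1] by simp
    next
      case 4 then show ?thesis using e'[of 4] step[of 3] by simp
    qed
    then show False using x by simp
  qed
  have inj: "k = l" if "k < 5" "l < 5" "(c ^^ k) x = (c ^^ l) x" for k l
  proof (rule ccontr)
    assume "k \<noteq> l"
    have *: False if kl: "k < l" "l < 5" "(c ^^ k) x = (c ^^ l) x" for k l
    proof -
      have "(c ^^ l) x = (c ^^ k) ((c ^^ (l - k)) x)" using kl by (metis add_diff_inverse_nat comp_apply funpow_add less_imp_not_less)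
      then have "(c ^^ k) x = (c ^^ k) ((c ^^ (l - k)) x)" using kl by simp
      then have "x = (c ^^ (l - k)) x"
        using inj_fn[OF permutes_inj[OF cp], of k] by (meson injD)
      moreover have "0 < l - k" "l - k < 5" using kl by linarith+
      ultimately show False using cne[of "l - k"] by metis
    qed
    show False using *[of k l] *[of l k] that \<open>k \<noteq> l\<close> by (metis linorder_neqE_nat)
  qed
  define Y where "Y = (\<lambda>k. (c ^^ k) x) ` {..<5}"
  have Y: "Y \<subseteq> {..<6}" "card Y = 5" using ck6 inj by (auto simp: Y_def inj_on_def card_image)
  have "card ({..<6} - Y) = 1" using Y by (subst card_Diff_subset) (auto intro: finite_subset)
  then obtain z where z: "{..<6} - Y = {z}" by (rule card_1_singletonE)
  \<comment> \<open>The relabelling lists the orbit of \<open>x\<close> under \<open>c\<close> and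
    then the sixth point, which is fixed by \<open>c\<close>; it conjugates \<open>c\<close> to
    \<open>rot5\<close>.\<close>
  define lam where "lam k = (if k < 5 then (c ^^ k) x else if k = 5 then z else k)" for k
  have z6: "z < 6" "z \<notin> Y" using z by auto
  have lp: "lam permutes {..<6}"
  proof (rule bij_imp_permutes)
    have "inj_on lam {..<6}"
    proof (rule inj_onI)
      fix k l assume kl: "k \<in> {..<6}" "l \<in> {..<6}" "lam k = lam l"
      then consider "k < 5" "l < 5" | "k < 5" "l = 5" | "k = 5" "l < 5" | "k = 5" "l = 5" by fastforce
      then show "k = l"
      proof cases
        case 1 then show ?thesis using inj kl by (simp add: lam_def)
      next
        case 2 then show ?thesis using z6(2) kl by (auto simp: lam_def Y_def)
      next
        case 3 then show ?thesis using z6(2) kl by (auto simp: lam_def Y_def)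
      qed simp
    qed
    moreover have "lam ` {..<6} \<subseteq> {..<6}" using ck6 z6 by (auto simp: lam_def)
    ultimately show "bij_betw lam {..<6} {..<6}" by (simp add: bij_betw_def endo_inj_surj)
    show "lam k = k" if "k \<notin> {..<6}" for k using that by (simp add: lam_def)
  qed
  have cz: "c z = z"
  proof (rule ccontr)
    assume ne: "c z \<noteq> z"
    have "c z < 6" using permutes_in_image[OF cp, of z] z6 by simp
    then have "c z \<in> Y" using ne z by blast
    then obtain k where k: "k < 5" "c z = (c ^^ k) x" by (auto simp: Y_def)
    have "c ((c ^^ ((k + 4) mod 5)) x) = (c ^^ k) x"
    proof (cases k)
      case 0
      have "c ((c ^^ 4) x) = (c ^^ 5) x" by (simp add: eval_nat_numeral)
      then show ?thesis using 0 c5 by simp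
    next
      case (Suc m)
      then have "(k + 4) mod 5 = m" using k(1) by simp
      then show ?thesis using Suc by simp
    qed
    then have "z = (c ^^ ((k + 4) mod 5)) x" using k(2) permutes_inj[OF cp] by (metis injD)
    then have "z \<in> Y" by (auto simp: Y_def)
    then show False using z6 by simp
  qed
  have clam: "c \<circ> lam = lam \<circ> rot5"
  proof
    fix k :: nat
    consider "k < 4" | "k = 4" | "k = 5" | "k > 5" by linarith
    then show "(c \<circ> lam) k = (lam \<circ> rot5) k"
    proof cases
      case 1 then show ?thesis by (simp add: lam_def rot5_def)
    next
      case 2
      have "c ((c ^^ 4) x) = (c ^^ 5) x" by (simp add: eval_nat_numeral)
      then show ?thesis using 2 c5 by (simp add: lam_def)
    next
      case 3 then show ?thesis using cz by (simp add: lam_def)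
    next
      case 4 then show ?thesis using permutes_not_in[OF cp, of k] by (simp add: lam_def rot5_def)
    qed
  qed
  define \<Delta> where "\<Delta> = (\<lambda>g. finv lam \<circ> g \<circ> lam) ` \<Gamma>"
  have ll: "lam \<circ> finv lam = id" "finv lam \<circ> lam = id" using permutes_inv_o[OF lp] by auto
  have ll': "lam (finv lam y) = y" "finv lam (lam y) = y" for y using permutes_inverses[OF lp] by auto
  interpret D: perm_set \<Delta>
  proof
    fix g h assume "g \<in> \<Delta>"
    then obtain g' where g': "g' \<in> \<Gamma>" "g = finv lam \<circ> g' \<circ> lam" by (auto simp: \<Delta>_def)
    show "g permutes {..<6}" unfolding g' by (intro permutes_compose permutes_inv lp perms g')
    show "finv g \<in> \<Delta>"
    proof -
      have "finv g = finv lam \<circ> finv g' \<circ> lam"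
        unfolding g' using permutes_bij[OF lp] permutes_bij[OF perms[OF g'(1)]]
        by (simp add: o_inv_distrib bij_comp bij_imp_bij_inv inv_inv_eq comp_assoc)
      then show ?thesis unfolding \<Delta>_def using inv_closed g' by blast
    qed
    assume "h \<in> \<Delta>"
    then obtain h' where h': "h' \<in> \<Gamma>" "h = finv lam \<circ> h' \<circ> lam" by (auto simp: \<Delta>_def)
    have "g \<circ> h = finv lam \<circ> (g' \<circ> h') \<circ> lam" unfolding g' h' by (auto simp: ll')
    then show "g \<circ> h \<in> \<Delta>" unfolding \<Delta>_def using comp_closed g' h' by blast
  next
    show "id \<in> \<Delta>" unfolding \<Delta>_def using id_in by (intro rev_image_eqI[of id]) (auto simp: ll)
  qed
  have rot: "rot5 \<in> \<Delta>"
  proof -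
    have "finv lam \<circ> c \<circ> lam = rot5" using clam by (simp add: comp_assoc) (simp add: o_assoc ll)
    then show ?thesis unfolding \<Delta>_def using c(1) by (intro image_eqI[of _ _ c]) simp_all
  qed
  have sD: "finv lam \<circ> s \<circ> lam \<in> \<Delta>" using s(1) by (auto simp: \<Delta>_def)
  have s5: "(finv lam \<circ> s \<circ> lam) 5 \<noteq> 5"
  proof
    assume "(finv lam \<circ> s \<circ> lam) 5 = 5"
    then have "lam ((finv lam \<circ> s \<circ> lam) 5) = lam 5" by simp
    then have "s (lam 5) = lam 5" by (simp add: ll')
    then show False using s(2)[of "lam 5"] permutes_in_image[OF lp, of 5] by simp
  qed
  obtain w where w: "t w \<noteq> w" using t(3) by (metis eq_id_iff)
  have t3: "t (t (t y)) = y" for y using t(2) by (metis comp_apply funpow.simps(1) funpow.simps(2) id_apply numeral_3_eq_3)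
  have tin: "t u = t v \<longleftrightarrow> u = v" for u v using permutes_inj[OF tp] by (auto dest: injD)
  have w6: "w < 6" using w tp by (metis lessThan_iff permutes_not_in)
  have tw6: "t y < 6" if "y < 6" for y using permutes_in_image[OF tp, of y] that by simp
  have dw: "distinct [y, t y, t (t y)]" if "t y \<noteq> y" for y
    using that t3 tin by (metis distinct_length_2_or_more distinct_singleton)
  have tc: "t = cyc3 w (t w) (t (t w))"
  proof
    fix y
    show "t y = cyc3 w (t w) (t (t w)) y"
    proof (cases "y \<in> {w, t w, t (t w)}")
      case True
      then show ?thesis using dw[OF w] t3 by (auto simp: cyc3_def)
    next
      case False
      have "t y = y"
      proof (rule ccontr)
        assume ne: "t y \<noteq> y"
        have y6: "y < 6" using ne tp by (metis lessThan_iff permutes_not_in)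
        have n1: "y \<noteq> w" "y \<noteq> t w" "y \<noteq> t (t w)" using False by auto
        have n2: "t y \<noteq> w" "t y \<noteq> t w" "t y \<noteq> t (t w)" using n1 t3 tin by metis+
        have n3: "t (t y) \<noteq> w" "t (t y) \<noteq> t w" "t (t y) \<noteq> t (t w)" using n1 n2 t3 tin by metis+
        have nf: "f \<notin> {w, t w, t (t w), y, t y, t (t y)}" using t(5) w ne t3 tin by (metis empty_iff insert_iff)
        \<comment> \<open>A second 3-cycle, together with the fixed point, would require seven
          points.\<close>
        have "distinct [f, w, t w, t (t w), y, t y, t (t y)]" using nf n1 n2 n3 dw[OF w] dw[OF ne] by auto
        then have "card {f, w, t w, t (t w), y, t y, t (t y)} = 7" using distinct_card by fastforce
        moreover have "card {f, w, t w, t (t w), y, t y, t (t y)} \<le> card {..<6::nat}"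
          using w6 y6 t(4) tw6 by (intro card_mono) auto
        ultimately show False by simp
      qed
      then show ?thesis using False by (simp add: cyc3_def)
    qed
  qed
  have tD: "finv lam \<circ> t \<circ> lam \<in> \<Delta>" using t(1) by (auto simp: \<Delta>_def)
  have "finv lam \<circ> t \<circ> lam = cyc3 (finv lam w) (finv lam (t w)) (finv lam (t (t w)))"
    using cyc3_conj[OF bij_imp_bij_inv[OF permutes_bij[OF lp]], of w "t w" "t (t w)"] tc
    by (simp add: inv_inv_eq[OF permutes_bij[OF lp]])
  then have "D.T (finv lam w) (finv lam (t w)) (finv lam (t (t w)))"
    using tD dw[OF w] permutes_in_image[OF permutes_inv[OF lp]] w6 tw6 ll'
    by (simp add: D.T_def) (metis lessThan_iff)
  moreover have "evenperm (finv lam \<circ> \<pi> \<circ> lam)"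
  proof -
    have "permutation lam" "permutation (finv lam)" "permutation \<pi>"
      using perm lp permutes_inv[OF lp] \<pi>(1) by blast+
    then show ?thesis using \<pi>(2) by (simp add: evenperm_comp permutation_compose evenperm_inv)
  qed
  moreover have "(finv lam \<circ> \<pi> \<circ> lam) permutes {..<6}" by (intro permutes_compose permutes_inv lp \<pi>)
  ultimately have "finv lam \<circ> \<pi> \<circ> lam \<in> \<Delta>" using D.all_even[OF rot _ sD s5] by blast
  then obtain g where g: "g \<in> \<Gamma>" "finv lam \<circ> \<pi> \<circ> lam = finv lam \<circ> g \<circ> lam" by (auto simp: \<Delta>_def)
  have "\<pi> y = g y" for y
  proof -
    have "lam ((finv lam \<circ> \<pi> \<circ> lam) (finv lam y)) = lam ((finv lam \<circ> g \<circ> lam) (finv lam y))" using g(2) by simp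
    then show ?thesis by (simp add: ll')
  qed
  then have "\<pi> = g" by blast
  then show ?thesis using g(1) by simp
qed

section \<open>Seidel matrices on six points\<close>

definition sgns :: "(nat \<Rightarrow> int) \<Rightarrow> bool" where
  "sgns s \<longleftrightarrow> (\<forall>i. s i \<in> {1, - 1})"

lemma sgnsD: "sgns s \<Longrightarrow> s i = 1 \<or> s i = - 1"
  by (simp add: sgns_def)

lemma sgns_square: "sgns s \<Longrightarrow> s i * s i = 1"
  using sgnsD[of s i] by auto

lemma sgns_mult: "sgns s \<Longrightarrow> sgns t \<Longrightarrow> sgns (\<lambda>i. s (p i) * t (q i))"
proof (unfold sgns_def, rule allI)
  fix i
  assume "\<forall>i. s i \<in> {1, - 1}" "\<forall>i. t i \<in> {1, - 1}"
  then have "s (p i) = 1 \<or> s (p i) = - 1" "t (q i) = 1 \<or> t (q i) = - 1" by blast+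
  then show "s (p i) * t (q i) \<in> {1, - 1}" by auto
qed

lemma sgns_one: "sgns (\<lambda>_. 1)"
  by (simp add: sgns_def)

text \<open>Signed permutations act from the right, as \<open>sact_sact\<close> shows, to match the
  right action on cosets. A common factor of the signs has no effect.\<close>

definition sact :: "(nat \<Rightarrow> nat \<Rightarrow> int) \<Rightarrow> (nat \<Rightarrow> nat) \<Rightarrow> (nat \<Rightarrow> int) \<Rightarrow> nat \<Rightarrow> nat \<Rightarrow> int" where
  "sact S \<pi> s = (\<lambda>i j. s i * s j * S (\<pi> i) (\<pi> j))"

lemma sact_sact: "sact (sact S \<pi> s) \<rho> t = sact S (\<pi> \<circ> \<rho>) (\<lambda>i. t i * s (\<rho> i))"
  by (simp add: sact_def fun_eq_iff mult_ac)

lemma sact_one: "sact S id (\<lambda>_. 1) = S"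
  by (simp add: sact_def)

lemma sact_uminus: "sact (\<lambda>i j. - S i j) \<pi> s = (\<lambda>i j. - sact S \<pi> s i j)"
  by (simp add: sact_def)

text \<open>Entries outside the six indices are zero, so that equality of functions is equality of
  matrices.\<close>

definition seidel :: "(nat \<Rightarrow> nat \<Rightarrow> int) \<Rightarrow> bool" where
  "seidel S \<longleftrightarrow> (\<forall>i j. S i j = S j i) \<and> (\<forall>i j. if i < 6 \<and> j < 6 \<and> i \<noteq> j then S i j \<in> {1, - 1} else S i j = 0)"

lemma seidel_sym: "seidel S \<Longrightarrow> S i j = S j i"
  by (simp add: seidel_def)

lemma seidel_range: "seidel S \<Longrightarrow> i < 6 \<Longrightarrow> j < 6 \<Longrightarrow> i \<noteq> j \<Longrightarrow> S i j = 1 \<or> S i j = - 1"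
  unfolding seidel_def by (drule conjunct2, drule spec[of _ i], drule spec[of _ j]) simp

lemma seidel_square: "seidel S \<Longrightarrow> i < 6 \<Longrightarrow> j < 6 \<Longrightarrow> i \<noteq> j \<Longrightarrow> S i j * S i j = 1"
  using seidel_range by fastforce

lemma seidel_zero: "seidel S \<Longrightarrow> \<not> (i < 6 \<and> j < 6 \<and> i \<noteq> j) \<Longrightarrow> S i j = 0"
  unfolding seidel_def by (drule conjunct2, drule spec[of _ i], drule spec[of _ j]) (simp split: if_splits)

lemma seidel_eqI:
  assumes "seidel S" "seidel T" "\<And>i j. i < 6 \<Longrightarrow> j < 6 \<Longrightarrow> i \<noteq> j \<Longrightarrow> S i j = T i j"
  shows "S = T"
proof (intro ext)
  fix i j
  show "S i j = T i j"
    using assms(3)[of i j] seidel_zero[OF assms(1), of i j] seidel_zero[OF assms(2), of i j]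
    by (cases "i < 6 \<and> j < 6 \<and> i \<noteq> j") auto
qed

lemma permutes6_less: "\<pi> permutes {..<6::nat} \<Longrightarrow> \<pi> i < 6 \<longleftrightarrow> i < 6"
  using permutes_in_image[of \<pi> "{..<6}" i] by simp

lemma permutes6_eq: "\<pi> permutes {..<6::nat} \<Longrightarrow> \<pi> i = \<pi> j \<longleftrightarrow> i = j"
  using permutes_inj[of \<pi> "{..<6}"] by (auto dest: injD)

lemma seidel_sact:
  assumes "seidel S" "\<pi> permutes {..<6}" "sgns s"
  shows "seidel (sact S \<pi> s)"
  unfolding seidel_def sact_def
proof (intro allI conjI)
  show "s i * s j * S (\<pi> i) (\<pi> j) = s j * s i * S (\<pi> j) (\<pi> i)" for i j using seidel_sym[OF assms(1)] by simp
  show "if i < 6 \<and> j < 6 \<and> i \<noteq> j then s i * s j * S (\<pi> i) (\<pi> j) \<in> {1, - 1} else s i * s j * S (\<pi> i) (\<pi> j) = 0" for i j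
    using seidel_range[OF assms(1), of "\<pi> i" "\<pi> j"] seidel_zero[OF assms(1), of "\<pi> i" "\<pi> j"]
      sgnsD[OF assms(3), of i] sgnsD[OF assms(3), of j]
    by (auto simp: permutes6_less[OF assms(2)] permutes6_eq[OF assms(2)])
qed

lemma seidel_uminus: "seidel S \<Longrightarrow> seidel (\<lambda>i j. - S i j)"
  unfolding seidel_def by (auto split: if_splits)

text \<open>The vertices \<open>0, \<dots>, 4\<close> form a pentagon whose edges are the non-residues modulo 5, and \<open>5\<close> is isolated.\<close>

definition neg_edges :: "bool list list" where
  "neg_edges = [[False, False, True, True, False, False],
                [False, False, False, True, True, False],
                [True, False, False, False, True, False],
                [True, True, False, False, False, False],
                [False, True, True, False, False, False],
                [False, False, False, False, False, False]]"

definition edge :: "nat \<Rightarrow> nat \<Rightarrow> bool" where "edge i j = neg_edges ! i ! j"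

definition paley :: "nat \<Rightarrow> nat \<Rightarrow> int" where
  "paley i j = (if i < 6 \<and> j < 6 \<and> i \<noteq> j then if edge i j then - 1 else 1 else 0)"

lemma edge_sym: "i < 6 \<Longrightarrow> j < 6 \<Longrightarrow> edge i j = edge j i"
proof -
  have "\<forall>i<6. \<forall>j<6. edge i j = edge j i"
    by (simp only: all_less6) (simp add: edge_def neg_edges_def)
  then show "i < 6 \<Longrightarrow> j < 6 \<Longrightarrow> edge i j = edge j i" by blast
qed

lemma seidel_paley: "seidel paley"
  unfolding seidel_def paley_def using edge_sym by auto

subsection \<open>Permutations as lists\<close>

definition idl :: "nat list" where "idl = [0, 1, 2, 3, 4, 5]"

definition fn :: "nat list \<Rightarrow> nat \<Rightarrow> nat" where "fn l i = (if i < 6 then l ! i else i)"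

definition lst :: "(nat \<Rightarrow> 'a) \<Rightarrow> 'a list" where "lst p = map p idl"

definition compl :: "'a list \<Rightarrow> nat list \<Rightarrow> 'a list" where "compl k l = map (\<lambda>i. k ! i) l"

definition invl :: "nat list \<Rightarrow> nat list" where
  "invl k = map (\<lambda>i. length (takeWhile (\<lambda>z. z \<noteq> i) k)) idl"

lemma idl_upt: "idl = [0..<6]"
  by (simp add: idl_def upt_rec)

lemma set_idl: "set idl = {..<6}"
  by (simp add: idl_upt atLeast0LessThan)

lemma lst_nth: "i < 6 \<Longrightarrow> lst p ! i = p i"
  by (simp add: lst_def idl_upt)

lemma length_lst: "length (lst p) = 6"
  by (simp add: lst_def idl_upt)

lemma fn_lst: "p permutes {..<6} \<Longrightarrow> fn (lst p) = p"
  by (rule ext) (simp add: fn_def lst_nth permutes_not_in)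

lemma lst_fn: "length l = 6 \<Longrightarrow> lst (fn l) = l"
  by (rule nth_equalityI) (simp_all add: length_lst lst_nth fn_def)

lemma lst_comp: "q permutes {..<6} \<Longrightarrow> lst (p \<circ> q) = compl (lst p) (lst q)"
proof -
  assume q: "q permutes {..<6}"
  have "p (q i) = lst p ! q i" if "i \<in> set idl" for i
    using that permutes6_less[OF q, of i] by (simp add: set_idl lst_nth)
  then show ?thesis by (auto simp: compl_def lst_def[of q] lst_def[of "p \<circ> q"])
qed

lemma lst_eq_iff: "p permutes {..<6} \<Longrightarrow> q permutes {..<6} \<Longrightarrow> lst p = lst q \<longleftrightarrow> p = q"
  by (metis fn_lst)

fun perm_lists :: "nat list \<Rightarrow> nat \<Rightarrow> nat list list" where
  "perm_lists xs 0 = [[]]"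
| "perm_lists xs (Suc n) = concat (map (\<lambda>x. map ((#) x) (perm_lists (remove1 x xs) n)) xs)"

lemma in_perm_lists: "distinct ys \<Longrightarrow> set ys \<subseteq> set xs \<Longrightarrow> ys \<in> set (perm_lists xs (length ys))"
proof (induction ys arbitrary: xs)
  case (Cons y ys)
  then have "set ys \<subseteq> set (remove1 y xs)" by (metis distinct.simps(2) in_set_remove1 list.set_intros(2) subset_iff)
  then have "ys \<in> set (perm_lists (remove1 y xs) (length ys))" using Cons by simp
  then show ?case using Cons.prems by auto
qed simp

lemma lst_in_perm_lists: "p permutes {..<6} \<Longrightarrow> lst p \<in> set (perm_lists idl 6)"
proof -
  assume p: "p permutes {..<6}"
  have "distinct (lst p)" using permutes_inj_on[OF p] by (simp add: lst_def distinct_map idl_upt atLeast0LessThan)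
  moreover have "set (lst p) \<subseteq> set idl" using permutes_image[OF p] by (simp add: lst_def set_idl)
  ultimately show ?thesis using in_perm_lists[of "lst p" idl] by (simp add: length_lst)
qed

definition perm_list :: "nat list \<Rightarrow> bool" where
  "perm_list l \<longleftrightarrow> length l = 6 \<and> distinct l \<and> list_all (\<lambda>x. x < 6) l"

lemma fn_permutes: "perm_list l \<Longrightarrow> fn l permutes {..<6}"
proof (rule bij_imp_permutes)
  assume l: "perm_list l"
  have "inj_on (fn l) {..<6}" using l by (auto simp: inj_on_def fn_def perm_list_def nth_eq_iff_index_eq)
  moreover have "fn l ` {..<6} \<subseteq> {..<6}" using l by (auto simp: fn_def perm_list_def list_all_length)
  ultimately show "bij_betw (fn l) {..<6} {..<6}" by (simp add: bij_betw_def endo_inj_surj)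
  show "fn l i = i" if "i \<notin> {..<6}" for i using that by (simp add: fn_def)
qed

fun xorl :: "bool list \<Rightarrow> bool" where
  "xorl [] = False"
| "xorl (b # bs) = (b \<noteq> xorl bs)"

text \<open>The parity of the number of inversions.\<close>

fun oddl :: "nat list \<Rightarrow> bool" where
  "oddl [] = False"
| "oddl (x # xs) = (xorl (map (\<lambda>y. y < x) xs) \<noteq> oddl xs)"

definition bsign :: "bool \<Rightarrow> int" where "bsign b = (if b then - 1 else 1)"

lemma bsign_xor: "bsign (b \<noteq> c) = bsign b * bsign c"
  by (simp add: bsign_def)

lemma bsign_xorl: "bsign (xorl bs) = prod_list (map bsign bs)"
  proof (induction bs)
  case (Cons b bs)
  then show ?case by (simp only: xorl.simps bsign_xor list.map prod_list.Cons)
qed (simp add: bsign_def)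

lemma bsign_oddl_Cons: "bsign (oddl (x # xs)) = prod_list (map (\<lambda>y. bsign (y < x)) xs) * bsign (oddl xs)"
  by (simp only: oddl.simps bsign_xor bsign_xorl map_map comp_def)

text \<open>The sign of the Vandermonde product of the values of \<open>p\<close> can be read in two
  ways: factor by factor it counts inversions, and by \<open>vdm_permutes\<close> it is the sign of
  \<open>p\<close>.\<close>

lemma oddl_lst:
  assumes p: "p permutes {..<6}"
  shows "oddl (lst p) \<longleftrightarrow> \<not> evenperm p"
proof -
  have sg: "sgn (int (p j) - int (p i)) = bsign (p j < p i)" if "i \<noteq> j" for i j
    using that permutes6_eq[OF p, of i j] by (auto simp: bsign_def sgn_if)
  have sgs: "sgn (int (p 1) - int (p 0)) = bsign (p 1 < p 0)"
    "sgn (int (p 2) - int (p 0)) = bsign (p 2 < p 0)"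
    "sgn (int (p 2) - int (p 1)) = bsign (p 2 < p 1)"
    "sgn (int (p 3) - int (p 0)) = bsign (p 3 < p 0)"
    "sgn (int (p 3) - int (p 1)) = bsign (p 3 < p 1)"
    "sgn (int (p 3) - int (p 2)) = bsign (p 3 < p 2)"
    "sgn (int (p 4) - int (p 0)) = bsign (p 4 < p 0)"
    "sgn (int (p 4) - int (p 1)) = bsign (p 4 < p 1)"
    "sgn (int (p 4) - int (p 2)) = bsign (p 4 < p 2)"
    "sgn (int (p 4) - int (p 3)) = bsign (p 4 < p 3)"
    "sgn (int (p 5) - int (p 0)) = bsign (p 5 < p 0)"
    "sgn (int (p 5) - int (p 1)) = bsign (p 5 < p 1)"
    "sgn (int (p 5) - int (p 2)) = bsign (p 5 < p 2)"
    "sgn (int (p 5) - int (p 3)) = bsign (p 5 < p 3)"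
    "sgn (int (p 5) - int (p 4)) = bsign (p 5 < p 4)"
    by (rule sg, simp)+
  have "sgn (vdm (int \<circ> p)) = bsign (oddl (lst p))"
    unfolding vdm_expand comp_apply lst_def idl_def list.map bsign_oddl_Cons prod_list.Cons prod_list.Nil oddl.simps(1)
    by (simp only: sgn_mult sgs bsign_def[of False] if_False mult_1_right mult_ac)
  moreover have "sgn (vdm (int \<circ> p)) = sign p"
    unfolding vdm_permutes[OF p] by (simp add: sgn_mult vdm_expand sign_def)
  ultimately show ?thesis by (auto simp: bsign_def sign_def split: if_splits)
qed

subsection \<open>Automorphisms of the Paley switching class\<close>

text \<open>Row 0 forces the switching: this is the only one, normalized to be trivial at vertex 0,
  for which the permuted Paley matrix can equal the Paley matrix (or its negative, if
  \<open>c\<close> holds). \<open>preserves\<close> then tests all entries.\<close>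

definition switch_of :: "bool \<Rightarrow> nat list \<Rightarrow> bool list" where
  "switch_of c l = map (\<lambda>i. i \<noteq> 0 \<and> ((edge 0 i \<noteq> edge (l ! 0) (l ! i)) \<noteq> c)) idl"

definition preserves :: "bool \<Rightarrow> nat list \<Rightarrow> bool" where
  "preserves c l = (let s = switch_of c l in
     list_all (\<lambda>i. list_all (\<lambda>j. i < j \<longrightarrow> (edge (l ! i) (l ! j) \<noteq> (s ! i \<noteq> s ! j)) = (edge i j \<noteq> c)) idl) idl)"

lemma preserves_lst:
  assumes p: "p permutes {..<6}" and s: "sgns s"
    and eq: "sact paley p s = (\<lambda>i j. bsign c * paley i j)"
  shows "preserves c (lst p)" "i < 6 \<Longrightarrow> switch_of c (lst p) ! i \<longleftrightarrow> s i \<noteq> s 0"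
proof -
  have e: "s i \<noteq> s j \<longleftrightarrow> (edge (p i) (p j) \<noteq> (edge i j \<noteq> c))" if "i < 6" "j < 6" "i \<noteq> j" for i j
    using fun_cong[OF fun_cong[OF eq, of i], of j] that sgnsD[OF s, of i] sgnsD[OF s, of j]
    by (auto simp: sact_def paley_def permutes6_less[OF p] permutes6_eq[OF p] bsign_def split: if_splits)
  have sw: "switch_of c (lst p) ! i \<longleftrightarrow> s i \<noteq> s 0" if "i < 6" for i
    using that e[of 0 i] by (cases "i = 0") (auto simp: switch_of_def idl_upt lst_nth)
  then show "i < 6 \<Longrightarrow> switch_of c (lst p) ! i \<longleftrightarrow> s i \<noteq> s 0" .
  have e2: "(edge (lst p ! i) (lst p ! j) \<noteq> (switch_of c (lst p) ! i \<noteq> switch_of c (lst p) ! j)) = (edge i j \<noteq> c)"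
    if "i < 6" "j < 6" "i < j" for i j
    unfolding sw[OF that(1)] sw[OF that(2)] using e[of i j] that sgnsD[OF s, of i] sgnsD[OF s, of j] sgnsD[OF s, of 0]
    by (auto simp: lst_nth)
  show "preserves c (lst p)"
    unfolding preserves_def Let_def list_all_iff set_idl by (intro ballI impI, rule e2) simp_all
qed

definition sw :: "bool \<Rightarrow> nat list \<Rightarrow> nat \<Rightarrow> int" where
  "sw c l i = bsign (i < 6 \<and> switch_of c l ! i)"

lemma sgns_sw: "sgns (sw c l)"
  by (simp add: sgns_def sw_def bsign_def)

lemma sact_sw:
  assumes l: "perm_list l" "preserves c l"
  shows "sact paley (fn l) (sw c l) = (\<lambda>i j. bsign c * paley i j)"
proof (rule seidel_eqI)
  have p: "fn l permutes {..<6}" by (rule fn_permutes[OF l(1)])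
  show "seidel (sact paley (fn l) (sw c l))" by (rule seidel_sact[OF seidel_paley p sgns_sw])
  show S: "seidel (\<lambda>i j. bsign c * paley i j)"
    using seidel_paley seidel_uminus[OF seidel_paley] by (cases c) (simp_all add: bsign_def)
  have lt: "sact paley (fn l) (sw c l) i j = bsign c * paley i j" if "i < 6" "j < 6" "i < j" for i j
  proof -
    have "(edge (l ! i) (l ! j) \<noteq> (switch_of c l ! i \<noteq> switch_of c l ! j)) = (edge i j \<noteq> c)"
      using l(2) that by (auto simp: preserves_def Let_def list_all_iff set_idl)
    then show ?thesis using that permutes6_eq[OF p, of i j] permutes6_less[OF p, of i] permutes6_less[OF p, of j]
      by (auto simp: sact_def sw_def paley_def bsign_def fn_def split: if_splits)
  qed
  fix i j :: nat
  assume ij: "i < 6" "j < 6" "i \<noteq> j"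
  show "sact paley (fn l) (sw c l) i j = bsign c * paley i j"
  proof (cases "i < j")
    case True
    then show ?thesis using lt ij by blast
  next
    case False
    then have "sact paley (fn l) (sw c l) j i = bsign c * paley j i" using lt ij by auto
    then show ?thesis
      using seidel_sym[OF seidel_sact[OF seidel_paley p sgns_sw], of c l i j] seidel_sym[OF seidel_paley, of i j] by simp
  qed
qed

section \<open>The sixty automorphisms of the Paley switching class\<close>

definition autos :: "nat list list" where
  "autos = [
    [0,1,2,3,4,5], [0,1,4,5,2,3], [0,2,1,3,5,4], [0,2,5,4,1,3], [0,3,4,2,5,1], [0,3,5,1,4,2],
    [0,4,1,5,3,2], [0,4,3,2,1,5], [0,5,2,4,3,1], [0,5,3,1,2,4], [1,0,2,5,4,3], [1,0,4,3,2,5],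
    [1,2,0,5,3,4], [1,2,3,4,0,5], [1,3,2,4,5,0], [1,3,5,0,2,4], [1,4,0,3,5,2], [1,4,5,2,0,3],
    [1,5,3,0,4,2], [1,5,4,2,3,0], [2,0,1,4,5,3], [2,0,5,3,1,4], [2,1,0,4,3,5], [2,1,3,5,0,4],
    [2,3,1,5,4,0], [2,3,4,0,1,5], [2,4,3,0,5,1], [2,4,5,1,3,0], [2,5,0,3,4,1], [2,5,4,1,0,3],
    [3,0,4,1,5,2], [3,0,5,2,4,1], [3,1,2,0,5,4], [3,1,5,4,2,0], [3,2,1,0,4,5], [3,2,4,5,1,0],
    [3,4,0,1,2,5], [3,4,2,5,0,1], [3,5,0,2,1,4], [3,5,1,4,0,2], [4,0,1,2,3,5], [4,0,3,5,1,2],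
    [4,1,0,2,5,3], [4,1,5,3,0,2], [4,2,3,1,5,0], [4,2,5,0,3,1], [4,3,0,5,2,1], [4,3,2,1,0,5],
    [4,5,1,3,2,0], [4,5,2,0,1,3], [5,0,2,1,3,4], [5,0,3,4,2,1], [5,1,3,2,4,0], [5,1,4,0,3,2],
    [5,2,0,1,4,3], [5,2,4,3,0,1], [5,3,0,4,1,2], [5,3,1,2,0,4], [5,4,1,0,2,3], [5,4,2,3,1,0]]"

lemma autos_complete: "list_all (\<lambda>l. preserves False l \<longrightarrow> l \<in> set autos) (perm_lists idl 6)"
  by code_simp

lemma anti_autos_odd: "list_all (\<lambda>l. preserves True l \<longrightarrow> oddl l) (perm_lists idl 6)"
  by code_simp

lemma autos_even:
  "list_all (\<lambda>l. perm_list l \<and> preserves False l \<and> \<not> oddl l \<and> \<not> xorl (switch_of False l)) autos"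
  by code_simp

lemma autos_two_transitive:
  "list_all (\<lambda>i. list_all (\<lambda>j. i = j \<or> list_ex (\<lambda>l. l ! i = 0 \<and> l ! j = 1) autos) idl) idl"
  by code_simp

text \<open>By 2-transitivity an even permutation can be corrected to fix 0 and 1. That leaves
  twelve even permutations of the other vertices, modulo the two automorphisms fixing 0 and 1: six
  representatives.\<close>

lemma autos_coset_reps:
  "list_all (\<lambda>l. oddl l \<or> list_ex (\<lambda>k. k ! (l ! 0) = 0 \<and> k ! (l ! 1) = 1 \<and>
     compl k l \<in> set [[0,1,2,3,4,5], [0,1,2,4,5,3], [0,1,2,5,3,4], [0,1,3,2,5,4], [0,1,3,4,2,5], [0,1,3,5,4,2]]) autos)
   (perm_lists idl 6)"
  by code_simp

text \<open>The four nontrivial conjugacy classes of the alternating group of degree 5: an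
  involution, the two classes of 5-cycles, and an element of order 3 with two 3-cycles. The
  condition says \<open>k \<circ> x = r \<circ> k\<close>.\<close>

lemma autos_conj_reps:
  "list_all (\<lambda>x. x = idl \<or> list_ex (\<lambda>k. compl k x \<in> set (map (\<lambda>r. compl r k)
     [[0,1,4,5,2,3], [0,2,5,4,1,3], [0,3,4,2,5,1], [1,2,0,5,3,4]])) autos) autos"
  by code_simp

text \<open>The conjugate of \<open>r\<close> by \<open>k\<close> commutes with \<open>r\<close>.
  This is the trace that solvability leaves on the elements of \<open>K\<close>.\<close>

definition centralizes_conj :: "nat list \<Rightarrow> nat list \<Rightarrow> bool" where
  "centralizes_conj r k = (let k' = invl k; y = compl k (compl r k') in compl k k' = idl \<and> compl y r = compl r y)"

lemma autos_inv: "list_all (\<lambda>k. compl k (invl k) = idl) autos"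
  by code_simp

text \<open>Such a \<open>k\<close> normalizes the group of order 5 generated by \<open>r\<close>,
  hence fixes its only fixed vertex, a set of odd size.\<close>

lemma autos_fix_point:
  "list_all (\<lambda>r. list_all (\<lambda>k. centralizes_conj r k \<longrightarrow> k ! 0 = 0) autos) [[0,2,5,4,1,3], [0,3,4,2,5,1]]"
  by code_simp

text \<open>One of the two orbits of the element of order 3; it is the vertex set of odd size in
  this case.\<close>

lemma autos_fix_triple:
  "list_all (\<lambda>k. centralizes_conj [1,2,0,5,3,4] k \<longrightarrow> k ! 0 < 3 \<and> k ! 1 < 3 \<and> k ! 2 < 3) autos"
  by code_simp

text \<open>The entrywise comparison of the Paley matrix with its image under the permutation
  [1,0,4,5,2,3] and the switching at 2 and 4, with \<open>True\<close> for sign -1.\<close>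

definition nu_edge :: "nat \<Rightarrow> nat \<Rightarrow> bool" where
  "nu_edge i j = (edge i j \<noteq> (edge ([1,0,4,5,2,3] ! i) ([1,0,4,5,2,3] ! j) \<noteq> ((i = 2 \<or> i = 4) \<noteq> (j = 2 \<or> j = 4))))"

text \<open>The involution lies in one Klein four-group, and the relevant \<open>k\<close> form its
  normalizer, an alternating group of degree 4. It acts on the six vertices like the rotations on
  the corners of an octahedron; the commuting odd permutation is the antipodal map with axes {0, 1},
  {2, 4}, {3, 5}.\<close>

lemma autos_commute_nu:
  "list_all (\<lambda>k. centralizes_conj [0,1,4,5,2,3] k \<longrightarrow> compl k [1,0,4,5,2,3] = compl [1,0,4,5,2,3] k \<and>
     list_all (\<lambda>i. list_all (\<lambda>j. i = j \<or> nu_edge (k ! i) (k ! j) = nu_edge i j) idl) idl) autos"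
  by code_simp

lemma prod_list_map_idl: "prod_list (map f idl) = (\<Prod>i<6. f i)" for f :: "nat \<Rightarrow> int"
  by (simp add: idl_def prod_upto6 mult_ac)

lemma prod_permutes6: "\<pi> permutes {..<6} \<Longrightarrow> (\<Prod>i<6. f (\<pi> i)) = (\<Prod>i<6. f i)" for f :: "nat \<Rightarrow> int"
  using prod.permute[of \<pi> "{..<6}" f] by (simp add: comp_def)

lemma prod_square6: "sgns s \<Longrightarrow> (\<Prod>i<6. s i) * (\<Prod>i<6. s i) = 1"
  by (simp add: prod.distrib[symmetric] sgns_square)

lemma prod_const6: "sgns s \<Longrightarrow> (\<Prod>i<6. s 0 * s i) = (\<Prod>i<6. s i)"
  using sgnsD[of s 0] by (auto simp: prod.distrib)

lemma prod_sw: "(\<Prod>i<6. sw c l i) = bsign (xorl (switch_of c l))"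
proof -
  have "map (sw c l) idl = map bsign (switch_of c l)"
    by (rule nth_equalityI) (simp_all add: sw_def switch_of_def idl_upt)
  then show ?thesis by (simp add: bsign_xorl prod_list_map_idl[symmetric])
qed

lemma even_id: "evenperm id"
  by simp

lemma evenperm6_comp:
  "\<pi> permutes {..<6::nat} \<Longrightarrow> \<rho> permutes {..<6} \<Longrightarrow> evenperm (\<pi> \<circ> \<rho>) \<longleftrightarrow> (evenperm \<pi> \<longleftrightarrow> evenperm \<rho>)"
  by (meson evenperm_comp finite_lessThan permutation_permutes)

lemma evenperm6_inv: "\<pi> permutes {..<6::nat} \<Longrightarrow> evenperm (finv \<pi>) \<longleftrightarrow> evenperm \<pi>"
  by (meson evenperm_inv finite_lessThan permutation_permutes)

lemma sact_cong:
  assumes "\<And>i j. i < 6 \<Longrightarrow> j < 6 \<Longrightarrow> i \<noteq> j \<Longrightarrow> s i * s j = t i * t j" "seidel S" "\<pi> permutes {..<6}"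
  shows "sact S \<pi> s = sact S \<pi> t"
proof (intro ext)
  fix i j
  show "sact S \<pi> s i j = sact S \<pi> t i j"
    using assms(1)[of i j] seidel_zero[OF assms(2), of "\<pi> i" "\<pi> j"] permutes6_less[OF assms(3)] permutes6_eq[OF assms(3)]
    by (cases "i < 6 \<and> j < 6 \<and> i \<noteq> j") (auto simp: sact_def)
qed

lemma sact_inverse:
  assumes "\<pi> permutes {..<6}" "sgns s"
  shows "sact (sact S \<pi> s) (finv \<pi>) (\<lambda>i. s (finv \<pi> i)) = S"
  unfolding sact_sact permutes_inv_o(1)[OF assms(1)] using assms(2) by (simp add: sgns_square sact_one)

lemma sact_inj:
  assumes "\<pi> permutes {..<6}" "sgns s" "sact S \<pi> s = sact T \<pi> s"
  shows "S = T"
  using sact_inverse[OF assms(1,2)] assms(3) by metis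

lemma sgns_comp: "sgns s \<Longrightarrow> sgns (\<lambda>i. s (p i))"
  by (simp add: sgns_def)

lemma sgns_times: "sgns s \<Longrightarrow> sgns t \<Longrightarrow> sgns (\<lambda>i. s i * t i)"
  using sgns_mult[of s t "\<lambda>i. i" "\<lambda>i. i"] by simp

text \<open>Both parities are forced by invariance of the Paley matrix; this keeps it out of the
  other orbit.\<close>

lemma autosI:
  assumes "p permutes {..<6}" "sgns s" "sact paley p s = paley"
  shows "lst p \<in> set autos" "evenperm p" "(\<Prod>i<6. s i) = 1"
proof -
  have e: "sact paley p s = (\<lambda>i j. bsign False * paley i j)" using assms(3) by (simp add: bsign_def)
  note pr = preserves_lst[OF assms(1,2) e]
  show l: "lst p \<in> set autos"
    using autos_complete pr(1) lst_in_perm_lists[OF assms(1)] by (auto simp: list_all_iff)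
  then have *: "\<not> oddl (lst p)" "\<not> xorl (switch_of False (lst p))" using autos_even by (auto simp: list_all_iff)
  then show "evenperm p" using oddl_lst[OF assms(1)] by simp
  have "s 0 * s i = sw False (lst p) i" if "i < 6" for i
    using pr(2)[OF that] that sgnsD[OF assms(2), of i] sgnsD[OF assms(2), of 0] by (auto simp: sw_def bsign_def)
  then have "(\<Prod>i<6. s 0 * s i) = (\<Prod>i<6. sw False (lst p) i)" by simp
  then show "(\<Prod>i<6. s i) = 1" using * by (simp add: prod_sw prod_const6[OF assms(2)] bsign_def)
qed

lemma anti_auto_odd:
  assumes "p permutes {..<6}" "sgns s" "sact paley p s = (\<lambda>i j. - paley i j)"
  shows "\<not> evenperm p"
proof -
  have e: "sact paley p s = (\<lambda>i j. bsign True * paley i j)" using assms(3) by (simp add: bsign_def)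
  show ?thesis
    using preserves_lst(1)[OF assms(1,2) e] anti_autos_odd lst_in_perm_lists[OF assms(1)] oddl_lst[OF assms(1)]
    by (auto simp: list_all_iff)
qed

lemma autosD:
  assumes "l \<in> set autos"
  shows "perm_list l" "fn l permutes {..<6}" "evenperm (fn l)" "sgns (sw False l)"
    "sact paley (fn l) (sw False l) = paley" "(\<Prod>i<6. sw False l i) = 1"
proof -
  have l: "perm_list l" "preserves False l" "\<not> oddl l" "\<not> xorl (switch_of False l)"
    using assms autos_even by (auto simp: list_all_iff)
  show "perm_list l" by fact
  show p: "fn l permutes {..<6}" by (rule fn_permutes) fact
  show "evenperm (fn l)" using oddl_lst[OF p] l by (simp add: lst_fn perm_list_def)
  show "sgns (sw False l)" by (rule sgns_sw)
  show "sact paley (fn l) (sw False l) = paley" using sact_sw[OF l(1,2)] by (simp add: bsign_def)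
  show "(\<Prod>i<6. sw False l i) = 1" using l by (simp add: prod_sw bsign_def)
qed

text \<open>A 4-cycle on the vertices 2 to 5. With an odd switching it carries the Paley matrix to
  its negative.\<close>

definition kappa :: "nat list" where "kappa = [0, 1, 3, 4, 5, 2]"

lemma kappa: "perm_list kappa" "preserves True kappa" "oddl kappa" "xorl (switch_of True kappa)"
  by code_simp+

lemma sact_kappa: "sact paley (fn kappa) (sw True kappa) = (\<lambda>i j. - paley i j)" "(\<Prod>i<6. sw True kappa i) = - 1"
  "fn kappa permutes {..<6}" "\<not> evenperm (fn kappa)"
proof -
  show "sact paley (fn kappa) (sw True kappa) = (\<lambda>i j. - paley i j)"
    using sact_sw[OF kappa(1,2)] by (simp add: bsign_def)
  show "(\<Prod>i<6. sw True kappa i) = - 1" using kappa by (simp add: prod_sw bsign_def)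
  show p: "fn kappa permutes {..<6}" by (rule fn_permutes[OF kappa(1)])
  show "\<not> evenperm (fn kappa)" using oddl_lst[OF p] kappa by (simp add: lst_fn perm_list_def)
qed

section \<open>The two orbits of Seidel matrices\<close>

definition Orb :: "int \<Rightarrow> (nat \<Rightarrow> nat \<Rightarrow> int) set" where
  "Orb \<epsilon> = {sact paley \<pi> s | \<pi> s. \<pi> permutes {..<6} \<and> evenperm \<pi> \<and> sgns s \<and> (\<Prod>i<6. s i) = \<epsilon>}"

lemma OrbI: "\<pi> permutes {..<6} \<Longrightarrow> evenperm \<pi> \<Longrightarrow> sgns s \<Longrightarrow> (\<Prod>i<6. s i) = \<epsilon> \<Longrightarrow> sact paley \<pi> s \<in> Orb \<epsilon>"
  unfolding Orb_def by blast

lemma OrbE: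
  assumes "T \<in> Orb \<epsilon>"
  obtains \<pi> s where "\<pi> permutes {..<6}" "evenperm \<pi>" "sgns s" "(\<Prod>i<6. s i) = \<epsilon>" "T = sact paley \<pi> s"
  using assms unfolding Orb_def by blast

lemma seidel_Orb: "T \<in> Orb \<epsilon> \<Longrightarrow> seidel T"
  by (elim OrbE) (simp add: seidel_sact seidel_paley)

lemma sact_Orb_even:
  assumes "T \<in> Orb \<epsilon>" "\<pi> permutes {..<6}" "evenperm \<pi>" "sgns t"
  shows "sact T \<pi> t \<in> Orb (\<epsilon> * (\<Prod>i<6. t i))"
proof -
  obtain \<rho> s where s: "\<rho> permutes {..<6}" "evenperm \<rho>" "sgns s" "(\<Prod>i<6. s i) = \<epsilon>" "T = sact paley \<rho> s"
    by (rule OrbE[OF assms(1)])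
  have "sact paley (\<rho> \<circ> \<pi>) (\<lambda>i. t i * s (\<pi> i)) \<in> Orb (\<epsilon> * (\<Prod>i<6. t i))"
  proof (rule OrbI)
    show "\<rho> \<circ> \<pi> permutes {..<6}" by (rule permutes_compose[OF assms(2) s(1)])
    show "evenperm (\<rho> \<circ> \<pi>)" using s assms by (simp add: evenperm6_comp)
    show "sgns (\<lambda>i. t i * s (\<pi> i))" by (rule sgns_times[OF assms(4) sgns_comp[OF s(3)]])
    show "(\<Prod>i<6. t i * s (\<pi> i)) = \<epsilon> * (\<Prod>i<6. t i)"
      using prod_permutes6[OF assms(2), of s] s(4) by (simp add: prod.distrib)
  qed
  then show ?thesis by (simp only: s(5) sact_sact)
qed

text \<open>The negation is absorbed by \<open>kappa\<close>, which repairs the parity of the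
  permutation and contributes the factor -1 to the signs.\<close>

lemma sact_Orb_odd:
  assumes "T \<in> Orb \<epsilon>" "\<pi> permutes {..<6}" "\<not> evenperm \<pi>" "sgns t"
  shows "(\<lambda>i j. - sact T \<pi> t i j) \<in> Orb (- \<epsilon> * (\<Prod>i<6. t i))"
proof -
  obtain \<rho> s where s: "\<rho> permutes {..<6}" "evenperm \<rho>" "sgns s" "(\<Prod>i<6. s i) = \<epsilon>" "T = sact paley \<rho> s"
    by (rule OrbE[OF assms(1)])
  have "(\<lambda>i j. - sact T \<pi> t i j) = sact (\<lambda>i j. - paley i j) (\<rho> \<circ> \<pi>) (\<lambda>i. t i * s (\<pi> i))"
    unfolding s(5) sact_sact by (rule sact_uminus[symmetric])
  also have "\<dots> = sact paley (fn kappa \<circ> (\<rho> \<circ> \<pi>)) (\<lambda>i. (t i * s (\<pi> i)) * sw True kappa ((\<rho> \<circ> \<pi>) i))"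
    unfolding sact_kappa(1)[symmetric] by (rule sact_sact)
  also have "\<dots> \<in> Orb (- \<epsilon> * (\<Prod>i<6. t i))"
  proof (rule OrbI)
    have rp: "\<rho> \<circ> \<pi> permutes {..<6}" by (rule permutes_compose[OF assms(2) s(1)])
    then show "fn kappa \<circ> (\<rho> \<circ> \<pi>) permutes {..<6}" by (intro permutes_compose[OF _ sact_kappa(3)])
    show "evenperm (fn kappa \<circ> (\<rho> \<circ> \<pi>))" using s assms rp sact_kappa by (simp add: evenperm6_comp)
    show "sgns (\<lambda>i. t i * s (\<pi> i) * sw True kappa ((\<rho> \<circ> \<pi>) i))" by (rule sgns_times[OF sgns_times[OF assms(4) sgns_comp[OF s(3)]] sgns_comp[OF sgns_sw]])
    show "(\<Prod>i<6. t i * s (\<pi> i) * sw True kappa ((\<rho> \<circ> \<pi>) i)) = - \<epsilon> * (\<Prod>i<6. t i)"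
      using prod_permutes6[OF rp, of "sw True kappa"] prod_permutes6[OF assms(2), of s] s(4) sact_kappa(2)
      by (simp add: prod.distrib)
  qed
  finally show ?thesis .
qed

lemma paley_in_Orb: "paley \<in> Orb 1"
  using OrbI[OF permutes_id even_id sgns_one, of 1] by (simp add: sact_one)

lemma paley_notin_Orb: "paley \<notin> Orb (- 1)" "(\<lambda>i j. - paley i j) \<notin> Orb \<epsilon>"
proof -
  show "paley \<notin> Orb (- 1)"
  proof
    assume "paley \<in> Orb (- 1)"
    then obtain \<pi> s where "\<pi> permutes {..<6}" "sgns s" "(\<Prod>i<6. s i) = - 1" "paley = sact paley \<pi> s" by (rule OrbE)
    then show False using autosI(3)[of \<pi> s] by simp
  qed
  show "(\<lambda>i j. - paley i j) \<notin> Orb \<epsilon>"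
  proof
    assume "(\<lambda>i j. - paley i j) \<in> Orb \<epsilon>"
    then obtain \<pi> s where "\<pi> permutes {..<6}" "evenperm \<pi>" "sgns s" "(\<lambda>i j. - paley i j) = sact paley \<pi> s" by (rule OrbE)
    then show False using anti_auto_odd[of \<pi> s] by simp
  qed
qed

subsection \<open>Interchanging the two orbits compatibly with centralizers\<close>

text \<open>A signed permutation fixing a matrix in the orbit of the Paley matrix becomes,
  transported by the presentation of that matrix, an automorphism of the Paley matrix.\<close>

lemma auto_conj:
  assumes \<pi>: "\<pi> permutes {..<6}" "sgns \<sigma>" and k: "k permutes {..<6}" "sgns s"
    and eq: "sact (sact paley \<pi> \<sigma>) k s = sact paley \<pi> \<sigma>"
  shows "lst (\<pi> \<circ> k \<circ> finv \<pi>) \<in> set autos"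
proof (rule autosI(1))
  show "\<pi> \<circ> k \<circ> finv \<pi> permutes {..<6}" using assms by (intro permutes_compose permutes_inv)
  show "sact paley (\<pi> \<circ> k \<circ> finv \<pi>) (\<lambda>i. \<sigma> (finv \<pi> i) * (s (finv \<pi> i) * \<sigma> (k (finv \<pi> i)))) = paley"
  proof -
    have "sact (sact (sact paley \<pi> \<sigma>) k s) (finv \<pi>) (\<lambda>i. \<sigma> (finv \<pi> i)) = paley"
      unfolding eq by (rule sact_inverse[OF \<pi>])
    then show ?thesis by (simp add: sact_sact comp_assoc mult_ac)
  qed
  show "sgns (\<lambda>i. \<sigma> (finv \<pi> i) * (s (finv \<pi> i) * \<sigma> (k (finv \<pi> i))))"
    by (rule sgns_times[OF sgns_comp[OF \<pi>(2)] sgns_times[OF sgns_comp[OF k(2)] sgns_comp[OF \<pi>(2)]]])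
qed

lemma autos_coset_zero:
  assumes "i < 6" "j < 6" "i \<noteq> j"
  shows "\<exists>l\<in>set autos. fn l i = 0 \<and> fn l j = 1"
  using autos_two_transitive assms by (auto simp: list_all_iff list_ex_iff set_idl fn_def)

lemma centralizes_conjI:
  assumes k: "k permutes {..<6}" "lst k \<in> set autos" and y: "y permutes {..<6}" and r: "fn r permutes {..<6}" "length r = 6"
    and e: "k \<circ> fn r = y \<circ> k" "y \<circ> fn r = fn r \<circ> y"
  shows "centralizes_conj r (lst k)"
proof -
  have kk: "compl (lst k) (invl (lst k)) = idl" using autos_inv k(2) by (simp add: list_all_iff)
  have ki: "invl (lst k) = lst (finv k)"
  proof (rule nth_equalityI)
    show "length (invl (lst k)) = length (lst (finv k))" by (simp add: invl_def idl_upt length_lst)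
    fix i assume "i < length (invl (lst k))"
    then have i: "i < 6" by (simp add: invl_def idl_upt)
    have "lst k ! (invl (lst k) ! i) = i"
      using arg_cong[OF kk, of "\<lambda>l. l ! i"] i by (simp add: compl_def idl_upt invl_def)
    moreover have "invl (lst k) ! i < 6"
    proof -
      have "i \<in> set (lst k)" using i permutes_image[OF k(1)] by (simp add: lst_def set_idl)
      then have "dropWhile (\<lambda>z. z \<noteq> i) (lst k) \<noteq> []" by (auto simp: dropWhile_eq_Nil_conv)
      then have "length (takeWhile (\<lambda>z. z \<noteq> i) (lst k)) < length (lst k)"
        using arg_cong[OF takeWhile_dropWhile_id[of "\<lambda>z. z \<noteq> i" "lst k"], of length]
        by (metis length_append length_greater_0_conv less_add_same_cancel1)
      then show ?thesis using i by (simp add: invl_def idl_upt length_lst)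
    qed
    ultimately have "k (invl (lst k) ! i) = i" by (simp add: lst_nth)
    then have "invl (lst k) ! i = finv k i" using permutes_inverses(2)[OF k(1), of "invl (lst k) ! i"] by simp
    then show "invl (lst k) ! i = lst (finv k) ! i" using i by (simp add: lst_nth)
  qed
  have kp: "finv k permutes {..<6}" using k by (intro permutes_inv)
  have "k \<circ> (fn r \<circ> finv k) = y \<circ> (k \<circ> finv k)" unfolding comp_assoc[symmetric] e(1) ..
  then have "y = k \<circ> (fn r \<circ> finv k)" by (simp add: permutes_inv_o(1)[OF k(1)])
  then have ly: "lst y = compl (lst k) (compl r (invl (lst k)))"
    using lst_comp[OF permutes_compose[OF kp r(1)], of k] lst_comp[OF kp, of "fn r"] lst_fn[OF r(2)] by (simp add: ki)
  have "compl (lst y) r = compl r (lst y)"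
    using lst_comp[OF r(1), of y] lst_comp[OF y, of "fn r"] e(2) lst_fn[OF r(2)] by simp
  then show ?thesis using kk ly by (simp add: centralizes_conj_def Let_def)
qed


lemma conj_reps_perm_list:
  "list_all perm_list [[0,1,4,5,2,3], [0,2,5,4,1,3], [0,3,4,2,5,1], [1,2,0,5,3,4]]" "perm_list [1,0,4,5,2,3]" "oddl [1,0,4,5,2,3]"
  by code_simp+

definition nu :: "nat \<Rightarrow> nat" where "nu = fn [1,0,4,5,2,3]"

definition nu_sign :: "nat \<Rightarrow> int" where "nu_sign i = bsign (i = 2 \<or> i = 4)"

lemma nu: "nu permutes {..<6}" "\<not> evenperm nu" "sgns nu_sign" "(\<Prod>i<6. nu_sign i) = 1" "lst nu = [1,0,4,5,2,3]"
proof -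
  show p: "nu permutes {..<6}" unfolding nu_def by (rule fn_permutes[OF conj_reps_perm_list(2)])
  show l: "lst nu = [1,0,4,5,2,3]" unfolding nu_def by (rule lst_fn) simp
  show "\<not> evenperm nu" using oddl_lst[OF p] conj_reps_perm_list(3) l by simp
  show "sgns nu_sign" by (simp add: sgns_def nu_sign_def bsign_def)
  show "(\<Prod>i<6. nu_sign i) = 1" by (simp add: prod_upto6 nu_sign_def bsign_def)
qed

lemma nu_edge:
  assumes "i < 6" "j < 6" "i \<noteq> j"
  shows "nu_sign i * nu_sign j * paley i j * paley (nu i) (nu j) = bsign (nu_edge i j)"
proof -
  have "paley i j = bsign (edge i j)" "paley (nu i) (nu j) = bsign (edge (nu i) (nu j))"
    using assms permutes6_less[OF nu(1)] permutes6_eq[OF nu(1)] by (simp_all add: paley_def bsign_def)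
  then show ?thesis using assms
    by (simp only: nu_edge_def bsign_xor nu_sign_def) (simp add: nu_def fn_def mult_ac)
qed

text \<open>For signs, \<open>a * v = u\<close> also reads \<open>v = a * u\<close>; substituting
  for both pairs cancels \<open>u\<close> and \<open>u'\<close>.\<close>

lemma sign_cancel:
  fixes p q u u' v v' a a' :: int
  assumes "a = 1 \<or> a = - 1" "a' = 1 \<or> a' = - 1" "v = 1 \<or> v = - 1" "v' = 1 \<or> v' = - 1"
    "a * v = u" "a' * v' = u'" "p * v * v' = q * u * u'"
  shows "a * p = q * a'"
  using assms(1-4) assms(7) unfolding assms(5,6)[symmetric] by (elim disjE) simp_all

text \<open>An injection interchanging the orbits and preserving fixed points of every signed
  permutation that also fixes \<open>T0\<close>. Its form depends only on the conjugacy class of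
  \<open>x\<close>, transported to the Paley matrix.\<close>

lemma exists_orbit_swap:
  assumes T0: "T0 \<in> Orb \<delta>"
    and \<Gamma>: "\<And>k. k \<in> \<Gamma> \<Longrightarrow> k permutes {..<6}" "\<And>k. k \<in> \<Gamma> \<Longrightarrow> \<exists>s. sgns s \<and> sact T0 k s = T0"
    and x: "x \<in> \<Gamma>" "x \<noteq> id" "\<And>k. k \<in> \<Gamma> \<Longrightarrow> \<exists>y\<in>\<Gamma>. k \<circ> x = y \<circ> k \<and> y \<circ> x = x \<circ> y"
  shows "\<exists>\<Theta>. inj \<Theta> \<and> (\<forall>\<epsilon>. \<Theta> ` Orb \<epsilon> \<subseteq> Orb (- \<epsilon>)) \<and>
    (\<forall>k\<in>\<Gamma>. \<forall>s T. sgns s \<longrightarrow> sact T0 k s = T0 \<longrightarrow> seidel T \<longrightarrow> sact T k s = T \<longrightarrow> sact (\<Theta> T) k s = \<Theta> T)"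
proof -
  obtain \<pi>0 s0 where s0: "\<pi>0 permutes {..<6}" "sgns s0" "T0 = sact paley \<pi>0 s0" by (rule OrbE[OF T0])
  define x1 where "x1 = \<pi>0 \<circ> x \<circ> finv \<pi>0"
  have x1p: "x1 permutes {..<6}" unfolding x1_def by (intro permutes_compose permutes_inv s0 \<Gamma> x)
  have x1a: "lst x1 \<in> set autos"
    using auto_conj[OF s0(1,2) \<Gamma>(1)[OF x(1)]] \<Gamma>(2)[OF x(1)] unfolding x1_def s0(3) by blast
  have x1x: "x1 \<circ> \<pi>0 = \<pi>0 \<circ> x" unfolding x1_def using permutes_inv_o(2)[OF s0(1)] by (simp add: comp_assoc)
  have "lst x1 \<noteq> idl"
  proof
    assume "lst x1 = idl"
    moreover have "lst id = idl" by (simp add: lst_def)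
    ultimately have "x1 = id" using lst_eq_iff[OF x1p permutes_id] by simp
    then have "\<pi>0 \<circ> x = \<pi>0 \<circ> id" using x1x by simp
    then have "x = id" using permutes6_eq[OF s0(1)] by (auto simp: fun_eq_iff)
    then show False using x by simp
  qed
  \<comment> \<open>An automorphism conjugating the transported \<open>x\<close> to its class
    representative.\<close>
  then obtain k0 r where k0: "k0 \<in> set autos" and r: "r \<in> set [[0,1,4,5,2,3], [0,2,5,4,1,3], [0,3,4,2,5,1], [1,2,0,5,3,4]]"
    and k0r: "compl k0 (lst x1) = compl r k0"
    using autos_conj_reps x1a unfolding list_all_iff list_ex_iff set_map by blast
  note k0D = autosD[OF k0]
  have rl: "perm_list r" using conj_reps_perm_list(1) r unfolding list_all_iff by blast
  have r6: "length r = 6" using rl by (simp add: perm_list_def)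
  have rp: "fn r permutes {..<6}" by (rule fn_permutes[OF rl])
  \<comment> \<open>As \<open>k0\<close> with its signs fixes the Paley matrix, this is another
    presentation of the same \<open>T0\<close>, for which \<open>x\<close> corresponds to
    \<open>r\<close> itself.\<close>
  define \<pi> where "\<pi> = fn k0 \<circ> \<pi>0"
  have \<pi>p: "\<pi> permutes {..<6}" unfolding \<pi>_def by (intro permutes_compose k0D s0)
  define \<sigma> where "\<sigma> i = s0 i * sw False k0 (\<pi>0 i)" for i
  have \<sigma>: "sgns \<sigma>" unfolding \<sigma>_def by (rule sgns_times[OF s0(2) sgns_comp[OF k0D(4)]])
  have T0\<pi>: "T0 = sact paley \<pi> \<sigma>"
    unfolding \<pi>_def \<sigma>_def sact_sact[symmetric] k0D(5) by (rule s0(3))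
  have "lst (fn k0 \<circ> x1) = lst (fn r \<circ> fn k0)"
    using k0r lst_fn[of k0] lst_fn[OF r6] k0D(1) by (simp add: lst_comp[OF x1p] lst_comp[OF k0D(2)] perm_list_def)
  then have "fn k0 \<circ> x1 = fn r \<circ> fn k0"
    using lst_eq_iff[of "fn k0 \<circ> x1" "fn r \<circ> fn k0"] permutes_compose k0D(2) x1p rp by blast
  then have \<pi>x: "\<pi> \<circ> x = fn r \<circ> \<pi>" unfolding \<pi>_def using x1x by (metis comp_assoc)
  have inv1: "finv \<pi> \<circ> \<pi> = id" and inv2: "\<pi> \<circ> finv \<pi> = id" using permutes_inv_o[OF \<pi>p] by auto
  have inv3: "finv \<pi> (\<pi> i) = i" "\<pi> (finv \<pi> i) = i" for i using permutes_inverses[OF \<pi>p] by auto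
  define cj where "cj k = \<pi> \<circ> k \<circ> finv \<pi>" for k
  have cj_comp: "cj k \<circ> cj l = cj (k \<circ> l)" for k l by (auto simp: cj_def inv3 fun_eq_iff)
  have cjx: "cj x = fn r" unfolding cj_def \<pi>x using inv2 by (simp add: comp_assoc)
  have cj_app: "cj k (\<pi> i) = \<pi> (k i)" for k i by (simp add: cj_def inv3)
  have cjp: "cj k permutes {..<6}" if "k \<in> \<Gamma>" for k
    unfolding cj_def by (intro permutes_compose permutes_inv \<pi>p \<Gamma>(1) that)
  have cja: "lst (cj k) \<in> set autos" if "k \<in> \<Gamma>" for k
    using auto_conj[OF \<pi>p \<sigma> \<Gamma>(1)[OF that]] \<Gamma>(2)[OF that] unfolding T0\<pi> cj_def by blast
  have cc: "centralizes_conj r (lst (cj k))" if k: "k \<in> \<Gamma>" for k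
  proof -
    obtain y where y: "y \<in> \<Gamma>" "k \<circ> x = y \<circ> k" "y \<circ> x = x \<circ> y" using x(3)[OF k] by blast
    show ?thesis
    proof (rule centralizes_conjI[OF cjp[OF k] cja[OF k] cjp[OF y(1)] rp r6])
      show "cj k \<circ> fn r = cj y \<circ> cj k" unfolding cjx[symmetric] cj_comp y(2) ..
      show "cj y \<circ> fn r = fn r \<circ> cj y" unfolding cjx[symmetric] cj_comp y(3) ..
    qed
  qed
  \<comment> \<open>Switching at a vertex set of odd size that the transported elements preserve; it
    is pulled back along \<pi>.\<close>
  have switch: ?thesis if P: "\<And>k i. k \<in> \<Gamma> \<Longrightarrow> i < 6 \<Longrightarrow> P (cj k i) \<longleftrightarrow> P i" "(\<Prod>i<6. bsign (P i)) = - 1" for P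
  proof -
    define b where "b i = bsign (P (\<pi> i))" for i
    have b: "sgns b" by (simp add: sgns_def b_def bsign_def)
    have bp: "(\<Prod>i<6. b i) = - 1" using prod_permutes6[OF \<pi>p, of "\<lambda>i. bsign (P i)"] P(2) by (simp add: b_def)
    show ?thesis
    proof (intro exI[of _ "\<lambda>T. sact T id b"] conjI ballI allI impI)
      show "inj (\<lambda>T. sact T id b)" by (rule injI) (rule sact_inj[OF permutes_id b])
      show "(\<lambda>T. sact T id b) ` Orb \<epsilon> \<subseteq> Orb (- \<epsilon>)" for \<epsilon>
        using sact_Orb_even[OF _ permutes_id even_id b, of _ \<epsilon>] bp by auto
      fix k s T
      assume k: "k \<in> \<Gamma>" and s: "sgns s" and T: "sact T k s = T"
      have "b (k i) = b i" for i
      proof (cases "i < 6")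
        case True
        then show ?thesis using P(1)[OF k, of "\<pi> i"] permutes6_less[OF \<pi>p] by (simp add: b_def cj_app)
      next
        case False
        then show ?thesis using permutes_not_in[OF \<Gamma>(1)[OF k], of i] by simp
      qed
      then have "sact (sact T id b) k s = sact (sact T k s) id b" unfolding sact_sact by (simp add: mult.commute)
      then show "sact (sact T id b) k s = sact T id b" by (simp add: T)
    qed
  qed
  from r consider "r = [0,1,4,5,2,3]" | "r \<in> set [[0,2,5,4,1,3], [0,3,4,2,5,1]]" | "r = [1,2,0,5,3,4]" by auto
  then show ?thesis
  proof cases
    case 2
    show ?thesis
    proof (rule switch[of "\<lambda>i. i = 0"])
      fix k i assume k: "k \<in> \<Gamma>"
      have "lst (cj k) ! 0 = 0" using autos_fix_point 2 cc[OF k] cja[OF k] unfolding list_all_iff by blast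
      then show "cj k i = 0 \<longleftrightarrow> i = 0" using permutes6_eq[OF cjp[OF k], of i 0] by (simp add: lst_nth)
    qed (simp add: prod_upto6 bsign_def)
  next
    case 3
    show ?thesis
    proof (rule switch[of "\<lambda>i. i < 3"])
      fix k i assume k: "k \<in> \<Gamma>" and i: "i < (6::nat)"
      have k3: "cj k 0 < 3" "cj k 1 < 3" "cj k 2 < 3"
        using autos_fix_triple 3 cc[OF k] cja[OF k] unfolding list_all_iff by (force simp: lst_nth)+
      have three: "{..<3::nat} = {0, 1, 2}" by auto
      have "cj k ` {..<3} \<subseteq> {..<3}" using k3 unfolding three image_insert image_empty lessThan_iff[symmetric] by (simp only: insert_subset empty_subsetI simp_thms)
      then have "cj k ` {..<3} = {..<3}"
        using permutes_inj_on[OF cjp[OF k]] by (intro endo_inj_surj) auto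
      then have "cj k i \<in> cj k ` {..<3} \<longleftrightarrow> cj k i < 3" by auto
      then show "cj k i < 3 \<longleftrightarrow> i < 3" using permutes_inj[OF cjp[OF k]] by (simp add: inj_image_mem_iff)
    qed (simp add: prod_upto6 bsign_def)
  next
    case 1
    define \<nu> where "\<nu> = finv \<pi> \<circ> nu \<circ> \<pi>"
    have \<nu>p: "\<nu> permutes {..<6}" unfolding \<nu>_def by (intro permutes_compose permutes_inv nu \<pi>p)
    have \<nu>o: "\<not> evenperm \<nu>" unfolding \<nu>_def using nu \<pi>p
      by (simp add: evenperm6_comp permutes_compose permutes_inv evenperm6_inv)
    have \<pi>\<nu>: "\<pi> (\<nu> i) = nu (\<pi> i)" for i by (simp add: \<nu>_def inv3)
    \<comment> \<open>\<open>nu\<close> with its signs, conjugated by the signed permutation that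
      presents \<open>T0\<close>.\<close>
    define t where "t i = \<sigma> i * \<sigma> (\<nu> i) * nu_sign (\<pi> i)" for i
    have t: "sgns t" unfolding t_def by (rule sgns_times[OF sgns_times[OF \<sigma> sgns_comp[OF \<sigma>]] sgns_comp[OF nu(3)]])
    have tp: "(\<Prod>i<6. t i) = 1"
      using prod_permutes6[OF \<nu>p, of \<sigma>] prod_permutes6[OF \<pi>p, of nu_sign] nu(4) prod_square6[OF \<sigma>]
      by (simp add: t_def prod.distrib)
    show ?thesis
    proof (intro exI[of _ "\<lambda>T i j. - sact T \<nu> t i j"] conjI ballI allI impI)
      show "inj (\<lambda>T i j. - sact T \<nu> t i j)"
      proof (rule injI)
        fix S T :: "nat \<Rightarrow> nat \<Rightarrow> int"
        assume "(\<lambda>i j. - sact S \<nu> t i j) = (\<lambda>i j. - sact T \<nu> t i j)"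
        then have "sact S \<nu> t = sact T \<nu> t" by (simp add: fun_eq_iff)
        then show "S = T" by (rule sact_inj[OF \<nu>p t])
      qed
      show "(\<lambda>T i j. - sact T \<nu> t i j) ` Orb \<epsilon> \<subseteq> Orb (- \<epsilon>)" for \<epsilon>
        using sact_Orb_odd[OF _ \<nu>p \<nu>o t, of _ \<epsilon>] tp by auto
      fix k s T
      assume k: "k \<in> \<Gamma>" and s: "sgns s" and T0k: "sact T0 k s = T0" and Ts: "seidel T" and Tk: "sact T k s = T"
      note kp = \<Gamma>(1)[OF k]
      have w: "compl (lst (cj k)) [1,0,4,5,2,3] = compl [1,0,4,5,2,3] (lst (cj k))"
        "\<And>i j. i < 6 \<Longrightarrow> j < 6 \<Longrightarrow> i \<noteq> j \<Longrightarrow> nu_edge (cj k i) (cj k j) = nu_edge i j"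
        using autos_commute_nu 1 cc[OF k] cja[OF k] unfolding list_all_iff set_idl by (force simp: lst_nth)+
      have "lst (cj k \<circ> nu) = lst (nu \<circ> cj k)"
        using w(1) by (simp add: lst_comp[OF nu(1)] lst_comp[OF cjp[OF k]] nu(5))
      then have "cj k \<circ> nu = nu \<circ> cj k"
        using lst_eq_iff[of "cj k \<circ> nu" "nu \<circ> cj k"] permutes_compose nu(1) cjp[OF k] by blast
      then have kn: "cj k (nu i) = nu (cj k i)" for i by (simp add: fun_eq_iff)
      have k\<nu>: "k (\<nu> i) = \<nu> (k i)" for i
      proof -
        have "\<pi> (k (\<nu> i)) = \<pi> (\<nu> (k i))" using kn[of "\<pi> i"] \<pi>\<nu>[of i] \<pi>\<nu>[of "k i"] cj_app[of k i] cj_app[of k "\<nu> i"] by simp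
        then show ?thesis by (simp add: permutes6_eq[OF \<pi>p])
      qed
      \<comment> \<open>The comparison of \<open>T0\<close> with its image under (\<nu>,
        \<open>t\<close>). It is the transported pattern \<open>nu_edge\<close>, so \<open>k\<close>
        preserves it.\<close>
      define A where "A i j = t i * t j * T0 i j * T0 (\<nu> i) (\<nu> j)" for i j
      have A: "A i j = bsign (nu_edge (\<pi> i) (\<pi> j))" if "i < 6" "j < 6" "i \<noteq> j" for i j
      proof -
        have "A i j = (\<sigma> i * \<sigma> i) * (\<sigma> j * \<sigma> j) * (\<sigma> (\<nu> i) * \<sigma> (\<nu> i)) * (\<sigma> (\<nu> j) * \<sigma> (\<nu> j)) *
          (nu_sign (\<pi> i) * nu_sign (\<pi> j) * paley (\<pi> i) (\<pi> j) * paley (nu (\<pi> i)) (nu (\<pi> j)))"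
          by (simp add: A_def T0\<pi> sact_def t_def \<pi>\<nu> mult_ac)
        then show ?thesis using that nu_edge[of "\<pi> i" "\<pi> j"]
          by (simp add: sgns_square[OF \<sigma>] permutes6_less[OF \<pi>p] permutes6_eq[OF \<pi>p])
      qed
      have AA: "A (k i) (k j) = A i j" if "i < 6" "j < 6" "i \<noteq> j" for i j
        using that A[of i j] A[of "k i" "k j"] w(2)[of "\<pi> i" "\<pi> j"]
        by (simp add: permutes6_less[OF kp] permutes6_eq[OF kp] permutes6_less[OF \<pi>p] permutes6_eq[OF \<pi>p] cj_app)
      \<comment> \<open>Since (\<open>k\<close>, \<open>s\<close>) fixes \<open>T0\<close>, the
        products of two signs of \<open>s\<close> are quotients of entries of \<open>T0\<close>.
        Invariance of \<open>A\<close> thus becomes the statement that (\<open>k\<close>,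
        \<open>s\<close>) and (\<nu>, \<open>t\<close>) commute on off-diagonal entries.\<close>
      have st: "s i * s j * (t (k i) * t (k j)) = t i * t j * (s (\<nu> i) * s (\<nu> j))" if "i < 6" "j < 6" "i \<noteq> j" for i j
      proof -
        have sd: "seidel T0" by (rule seidel_Orb[OF T0])
        have e1: "s i * s j * T0 (k i) (k j) = T0 i j" for i j using fun_cong[OF fun_cong[OF T0k]] by (simp add: sact_def)
        have e3: "t (k i) * t (k j) * T0 (k i) (k j) * T0 (k (\<nu> i)) (k (\<nu> j)) = t i * t j * T0 i j * T0 (\<nu> i) (\<nu> j)"
          using AA[OF that] by (simp add: A_def k\<nu>)
        have k6: "k x < 6 \<longleftrightarrow> x < 6" "\<nu> x < 6 \<longleftrightarrow> x < 6" "k x = k y \<longleftrightarrow> x = y" "\<nu> x = \<nu> y \<longleftrightarrow> x = y" for x y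
          by (rule permutes6_less[OF kp] permutes6_less[OF \<nu>p] permutes6_eq[OF kp] permutes6_eq[OF \<nu>p])+
        have ss: "s x * s y = 1 \<or> s x * s y = - 1" for x y using sgnsD[OF s, of x] sgnsD[OF s, of y] by auto
        have "T0 (k i) (k j) = 1 \<or> T0 (k i) (k j) = - 1" "T0 (k (\<nu> i)) (k (\<nu> j)) = 1 \<or> T0 (k (\<nu> i)) (k (\<nu> j)) = - 1"
          by (rule seidel_range[OF sd]; use that in \<open>simp add: k6\<close>)+
        then show ?thesis by (rule sign_cancel[OF ss ss _ _ e1[of i j] e1[of "\<nu> i" "\<nu> j"] e3])
      qed
      have "sact (sact T \<nu> t) k s = sact (sact T k s) \<nu> t"
      proof (rule seidel_eqI)
        show "seidel (sact (sact T \<nu> t) k s)" "seidel (sact (sact T k s) \<nu> t)" by (intro seidel_sact Ts \<nu>p t kp s)+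
        fix i j :: nat assume "i < 6" "j < 6" "i \<noteq> j"
        from st[OF this] show "sact (sact T \<nu> t) k s i j = sact (sact T k s) \<nu> t i j"
          by (simp add: sact_def k\<nu> mult.assoc[symmetric])
      qed
      then show "sact (\<lambda>i j. - sact T \<nu> t i j) k s = (\<lambda>i j. - sact T \<nu> t i j)" by (simp add: sact_uminus Tk)
    qed
  qed
qed

section \<open>Groups acting by even signed permutations\<close>

text \<open>The last nontrivial term of the derived series is abelian and normal, so any of its
  nontrivial elements commutes with all its conjugates.\<close>

lemma (in group) solvable_commuting_conjugates:
  assumes K: "subgroup K G" and sol: "solvable (G\<lparr>carrier := K\<rparr>)" and nt: "K \<noteq> {\<one>}"
  shows "\<exists>x\<in>K. x \<noteq> \<one> \<and> (\<forall>k\<in>K. \<exists>y\<in>K. k \<otimes> x = y \<otimes> k \<and> y \<otimes> x = x \<otimes> y)"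
proof -
  let ?K = "G\<lparr>carrier := K\<rparr>"
  interpret K: group ?K using K by (rule subgroup_imp_group)
  obtain n where n: "(derived ?K ^^ n) K = {\<one>}"
    using sol K.solvable_imp_trivial_derived_seq[of K] by (auto simp: solvable_def)
  define m where "m = (LEAST n. (derived ?K ^^ n) K = {\<one>})"
  have m: "(derived ?K ^^ m) K = {\<one>}" unfolding m_def by (rule LeastI) fact
  have "m \<noteq> 0" using m nt by (cases m) auto
  then obtain l where l: "m = Suc l" by (cases m) auto
  have ml: "(derived ?K ^^ l) K \<noteq> {\<one>}" using not_less_Least[of l "\<lambda>n. (derived ?K ^^ n) K = {\<one>}"] l by (simp add: m_def)
  define D where "D = (derived ?K ^^ l) K"
  have "(derived ?K ^^ i) K \<lhd> ?K" for i
  proof (induction i)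
    case 0
    have "carrier ?K \<lhd> ?K" by (rule K.normal_self)
    then show ?case by simp
  next
    case (Suc i)
    then show ?case using K.derived_is_normal by simp
  qed
  then have DN: "D \<lhd> ?K" unfolding D_def .
  have Dsub: "subgroup D ?K" using DN by (rule normal_imp_subgroup)
  have D1: "derived ?K D = {\<one>}" using m l by (simp add: D_def)
  have DK: "D \<subseteq> K" using subgroup.subset[OF Dsub] by simp
  obtain x where x: "x \<in> D" "x \<noteq> \<one>" using ml subgroup.one_closed[OF Dsub] unfolding D_def[symmetric] by auto
  have comm: "a \<otimes> b = b \<otimes> a" if ab: "a \<in> D" "b \<in> D" for a b
  proof -
    have aK: "a \<in> carrier ?K" "b \<in> carrier ?K" using ab DK by auto
    have "a \<otimes>\<^bsub>?K\<^esub> b \<otimes>\<^bsub>?K\<^esub> inv\<^bsub>?K\<^esub> a \<otimes>\<^bsub>?K\<^esub> inv\<^bsub>?K\<^esub> b \<in> derived ?K D"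
      unfolding derived_def by (rule generate.incl) (use ab in blast)
    then have e: "a \<otimes>\<^bsub>?K\<^esub> b \<otimes>\<^bsub>?K\<^esub> inv\<^bsub>?K\<^esub> a \<otimes>\<^bsub>?K\<^esub> inv\<^bsub>?K\<^esub> b = \<one>\<^bsub>?K\<^esub>" using D1 by simp
    have "a \<otimes>\<^bsub>?K\<^esub> b \<otimes>\<^bsub>?K\<^esub> inv\<^bsub>?K\<^esub> a = b"
      using K.inv_solve_right'[of "\<one>\<^bsub>?K\<^esub>" "a \<otimes>\<^bsub>?K\<^esub> b \<otimes>\<^bsub>?K\<^esub> inv\<^bsub>?K\<^esub> a" b] e aK
      by (metis K.inv_closed K.inv_equality K.inv_inv K.m_closed)
    then have "a \<otimes>\<^bsub>?K\<^esub> b = b \<otimes>\<^bsub>?K\<^esub> a"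
      using K.inv_solve_right'[of b "a \<otimes>\<^bsub>?K\<^esub> b" a] aK K.m_closed by metis
    then show ?thesis by simp
  qed
  show ?thesis
  proof (rule bexI[of _ x], intro conjI ballI)
    fix k assume k: "k \<in> K"
    then have kK: "k \<in> carrier ?K" "x \<in> carrier ?K" using x DK by auto
    have y: "k \<otimes>\<^bsub>?K\<^esub> x \<otimes>\<^bsub>?K\<^esub> inv\<^bsub>?K\<^esub> k \<in> D"
      using DN kK(1) x(1) K.normal_inv_iff by blast
    have "k \<otimes>\<^bsub>?K\<^esub> x = k \<otimes>\<^bsub>?K\<^esub> x \<otimes>\<^bsub>?K\<^esub> inv\<^bsub>?K\<^esub> k \<otimes>\<^bsub>?K\<^esub> k"
      using K.m_assoc[of "k \<otimes>\<^bsub>?K\<^esub> x" "inv\<^bsub>?K\<^esub> k" k] K.l_inv[OF kK(1)] K.r_one K.m_closed K.inv_closed kK by metis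
    then show "\<exists>y\<in>K. k \<otimes> x = y \<otimes> k \<and> y \<otimes> x = x \<otimes> y"
      using y comm[OF y x(1)] DK by (intro bexI[of _ "k \<otimes>\<^bsub>?K\<^esub> x \<otimes>\<^bsub>?K\<^esub> inv\<^bsub>?K\<^esub> k"]) auto
  qed (use x DK in auto)
qed

section \<open>Abstraction of the Galois group to its permutations and signs\<close>

locale signed_group = group G for G :: "('a, 'b) monoid_scheme" (structure) +
  fixes pm :: "'a \<Rightarrow> nat \<Rightarrow> nat" and es :: "'a \<Rightarrow> nat \<Rightarrow> nat \<Rightarrow> int"
  assumes finite_carrier: "finite (carrier G)"
    and pm_permutes: "g \<in> carrier G \<Longrightarrow> pm g permutes {..<6}"
    and pm_even: "g \<in> carrier G \<Longrightarrow> evenperm (pm g)"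
    and es_range: "g \<in> carrier G \<Longrightarrow> es g i j \<in> {1, - 1}"
    and es_cocycle: "g \<in> carrier G \<Longrightarrow> i < 6 \<Longrightarrow> j < 6 \<Longrightarrow> k < 6 \<Longrightarrow> es g i j * es g j k = es g i k"
    and es_prod: "g \<in> carrier G \<Longrightarrow> es g 0 1 * es g 2 3 * es g 4 5 = 1"
    and pm_mult: "g \<in> carrier G \<Longrightarrow> h \<in> carrier G \<Longrightarrow> pm (g \<otimes> h) = pm g \<circ> pm h"
    and es_mult: "g \<in> carrier G \<Longrightarrow> h \<in> carrier G \<Longrightarrow> i < 6 \<Longrightarrow> j < 6 \<Longrightarrow>
      es (g \<otimes> h) i j = es h i j * es g (pm h i) (pm h j)"
    and faithful: "g \<in> carrier G \<Longrightarrow> h \<in> carrier G \<Longrightarrow> pm g = pm h \<Longrightarrow>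
      (\<And>i j. i < 6 \<Longrightarrow> j < 6 \<Longrightarrow> es g i j = es h i j) \<Longrightarrow> g = h"
    and five: "\<exists>g\<in>carrier G. pm g ^^ 5 = id \<and> pm g \<noteq> id"
    and three: "\<exists>g\<in>carrier G. pm g ^^ 3 = id \<and> pm g \<noteq> id \<and> (\<exists>i<6. pm g i = i)"
    and four: "\<exists>g\<in>carrier G. (\<forall>i<6. pm g i \<noteq> i) \<and> pm g ^^ 4 = id \<and> (\<exists>i<6. \<exists>j<6. es (g [^] (4::nat)) i j = - 1)"
begin

lemma pm_less: "g \<in> carrier G \<Longrightarrow> pm g i < 6 \<longleftrightarrow> i < 6"
  by (rule permutes6_less) (rule pm_permutes)

lemma es_cases: "g \<in> carrier G \<Longrightarrow> es g i j = 1 \<or> es g i j = - 1"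
  using es_range[of g i j] by simp

lemma sgns_es: "g \<in> carrier G \<Longrightarrow> sgns (es g i)"
  using es_range by (simp add: sgns_def)

lemma es_diag: "g \<in> carrier G \<Longrightarrow> i < 6 \<Longrightarrow> es g i i = 1"
  using es_cocycle[of g i i i] es_cases[of g i i] by auto

lemma es_sym: "g \<in> carrier G \<Longrightarrow> i < 6 \<Longrightarrow> j < 6 \<Longrightarrow> es g i j = es g j i"
  using es_cocycle[of g i j i] es_diag[of g i] es_cases[of g i j] es_cases[of g j i] by auto

lemma es_split: "g \<in> carrier G \<Longrightarrow> k < 6 \<Longrightarrow> i < 6 \<Longrightarrow> j < 6 \<Longrightarrow> es g i j = es g k i * es g k j"
  using es_cocycle[of g i k j] es_sym[of g i k] by simp

lemma prod_es: "g \<in> carrier G \<Longrightarrow> (\<Prod>i<6. es g 0 i) = 1"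
  using es_prod[of g] es_split[of g 0 2 3] es_split[of g 0 4 5] es_diag[of g 0] by (simp add: prod_upto6 mult_ac)

text \<open>The signs are normalized to be 1 at index 0, and they are multiplied in pairs, so the
  normalization is immaterial; see \<open>act_app\<close>.\<close>

definition act :: "(nat \<Rightarrow> nat \<Rightarrow> int) \<Rightarrow> 'a \<Rightarrow> nat \<Rightarrow> nat \<Rightarrow> int" where
  "act S g = sact S (pm g) (es g 0)"

lemma act_app: "g \<in> carrier G \<Longrightarrow> i < 6 \<Longrightarrow> j < 6 \<Longrightarrow> act S g i j = es g i j * S (pm g i) (pm g j)"
  using es_split[of g 0 i j] by (simp add: act_def sact_def)

lemma seidel_act: "g \<in> carrier G \<Longrightarrow> seidel S \<Longrightarrow> seidel (act S g)"
  unfolding act_def by (intro seidel_sact pm_permutes sgns_es)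

lemma act_mult:
  assumes "seidel S" "g \<in> carrier G" "h \<in> carrier G"
  shows "act S (g \<otimes> h) = act (act S g) h"
proof (rule seidel_eqI)
  show "seidel (act S (g \<otimes> h))" "seidel (act (act S g) h)" using assms by (auto intro: seidel_act)
  fix i j :: nat assume ij: "i < 6" "j < 6"
  then show "act S (g \<otimes> h) i j = act (act S g) h i j"
    using assms by (simp add: act_app es_mult pm_mult pm_less mult_ac)
qed

lemma pm_one: "pm \<one> = id"
proof
  fix i
  have "pm \<one> (pm \<one> i) = pm \<one> i" using pm_mult[of \<one> \<one>] by (simp add: fun_eq_iff)
  then show "pm \<one> i = id i" using permutes6_eq[OF pm_permutes[of \<one>], of "pm \<one> i" i] by simp
qed

lemma es_one: "i < 6 \<Longrightarrow> j < 6 \<Longrightarrow> es \<one> i j = 1"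
  using es_mult[of \<one> \<one> i j] es_cases[of \<one> i j] by (auto simp: pm_one)

lemma act_one: "seidel S \<Longrightarrow> act S \<one> = S"
  by (rule seidel_eqI) (simp_all add: seidel_act act_app es_one pm_one)

lemma pm_inv: "g \<in> carrier G \<Longrightarrow> pm (inv g) = finv (pm g)"
proof -
  assume g: "g \<in> carrier G"
  have "pm g \<circ> pm (inv g) = id" using pm_mult[OF g inv_closed[OF g]] g by (simp add: pm_one)
  then have "finv (pm g) \<circ> (pm g \<circ> pm (inv g)) = finv (pm g)" by simp
  then show ?thesis unfolding comp_assoc[symmetric] permutes_inv_o(2)[OF pm_permutes[OF g]] by simp
qed

lemma es_inv: "g \<in> carrier G \<Longrightarrow> i < 6 \<Longrightarrow> j < 6 \<Longrightarrow> es (inv g) (pm g i) (pm g j) = es g i j"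
proof -
  assume *: "g \<in> carrier G" "i < 6" "j < 6"
  have "es g i j * es (inv g) (pm g i) (pm g j) = 1" using es_mult[of "inv g" g i j] * by (simp add: es_one)
  then show ?thesis using es_cases[of g i j] es_cases[of "inv g" "pm g i" "pm g j"] * by auto
qed

subsection \<open>Every even signed permutation occurs\<close>

text \<open>Equality of pairwise products expresses equality of signs up to a common factor.\<close>

definition occurs :: "(nat \<Rightarrow> nat) \<Rightarrow> (nat \<Rightarrow> int) \<Rightarrow> bool" where
  "occurs \<pi> s \<longleftrightarrow> (\<exists>g\<in>carrier G. pm g = \<pi> \<and> (\<forall>i<6. \<forall>j<6. es g i j = s i * s j))"

lemma occurs_self: "g \<in> carrier G \<Longrightarrow> k < 6 \<Longrightarrow> occurs (pm g) (es g k)"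
  unfolding occurs_def using es_split by blast

lemma occurs_mult:
  assumes "occurs \<pi> s" "occurs \<rho> t"
  shows "occurs (\<pi> \<circ> \<rho>) (\<lambda>i. t i * s (\<rho> i))"
proof -
  obtain g h where "g \<in> carrier G" "pm g = \<pi>" "\<forall>i<6. \<forall>j<6. es g i j = s i * s j"
    "h \<in> carrier G" "pm h = \<rho>" "\<forall>i<6. \<forall>j<6. es h i j = t i * t j" using assms unfolding occurs_def by blast
  then show ?thesis unfolding occurs_def
    by (intro bexI[of _ "g \<otimes> h"]) (auto simp: pm_mult es_mult pm_less mult_ac)
qed

lemma occurs_cong:
  assumes "occurs \<pi> s" "\<And>i. i < 6 \<Longrightarrow> t i = s i"
  shows "occurs \<pi> t"
  using assms unfolding occurs_def by auto

lemma occurs_times: "occurs id s \<Longrightarrow> occurs id t \<Longrightarrow> occurs id (\<lambda>i. s i * t i)"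
  using occurs_mult[of id t id s] by simp

lemma occurs_comp:
  assumes "occurs id s" "g \<in> carrier G"
  shows "occurs id (\<lambda>i. s (pm g i))"
proof -
  obtain v where v: "v \<in> carrier G" "pm v = id" "\<forall>i<6. \<forall>j<6. es v i j = s i * s j"
    using assms(1) unfolding occurs_def by blast
  have "pm (inv g \<otimes> v \<otimes> g) = id"
    using assms(2) v permutes_inv_o(2)[OF pm_permutes[OF assms(2)]] by (simp add: pm_mult pm_inv)
  moreover have "es (inv g \<otimes> v \<otimes> g) i j = s (pm g i) * s (pm g j)" if "i < 6" "j < 6" for i j
    using that assms(2) v es_inv[OF assms(2) that] es_cases[OF assms(2), of i j]
    by (auto simp: es_mult pm_less)
  ultimately show ?thesis unfolding occurs_def using assms(2) v(1) by (intro bexI[of _ "inv g \<otimes> v \<otimes> g"]) auto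
qed

lemma exists_pm:
  assumes "\<pi> permutes {..<6}" "evenperm \<pi>"
  shows "\<exists>g\<in>carrier G. pm g = \<pi>"
proof -
  interpret perm_set "pm ` carrier G"
  proof
    fix \<pi> assume "\<pi> \<in> pm ` carrier G"
    then obtain g where g: "g \<in> carrier G" "\<pi> = pm g" by blast
    show "\<pi> permutes {..<6}" using g pm_permutes by simp
    show "finv \<pi> \<in> pm ` carrier G" unfolding g(2) pm_inv[OF g(1), symmetric] using g(1) by simp
    fix \<rho> assume "\<rho> \<in> pm ` carrier G"
    then obtain h where h: "h \<in> carrier G" "\<rho> = pm h" by blast
    show "\<pi> \<circ> \<rho> \<in> pm ` carrier G"
      unfolding g(2) h(2) pm_mult[OF g(1) h(1), symmetric] using g(1) h(1) by simp
  next
    show "id \<in> pm ` carrier G" unfolding pm_one[symmetric] by simp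
  qed
  obtain c where c: "c \<in> carrier G" "pm c ^^ 5 = id" "pm c \<noteq> id" using five by blast
  obtain t f where t: "t \<in> carrier G" "pm t ^^ 3 = id" "pm t \<noteq> id" "f < 6" "pm t f = f" using three by blast
  obtain s where s: "s \<in> carrier G" "\<forall>i<6. pm s i \<noteq> i" using four by blast
  have "\<pi> \<in> pm ` carrier G"
    by (rule generates_alternating[of "pm c" "pm t" f "pm s"]) (use c t s assms in auto)
  then show ?thesis by blast
qed

definition switch2 :: "nat \<Rightarrow> nat \<Rightarrow> nat \<Rightarrow> int" where
  "switch2 a b x = (if x = a \<or> x = b then - 1 else 1)"

lemma switch2_commute: "switch2 a b = switch2 b a"
  by (auto simp: switch2_def)

text \<open>Conjugation by an element over a 3-cycle that fixes \<open>a\<close> and sends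
  \<open>d\<close> to \<open>b\<close>.\<close>

lemma occurs_switch2_step:
  assumes "occurs id (switch2 a b)" "a < 6" "b < 6" "d < 6" "a \<noteq> b" "d \<noteq> a"
  shows "occurs id (switch2 a d)"
proof (cases "d = b")
  case False
  have "card {a, b, d} \<le> 3" by (simp add: card_insert_if)
  then have "\<not> {..<6} \<subseteq> {a, b, d}" using card_mono[of "{a, b, d}" "{..<6::nat}"] by auto
  then obtain e where e: "e < 6" "e \<notin> {a, b, d}" by auto
  have d: "distinct [d, b, e]" using False e by auto
  obtain g where g: "g \<in> carrier G" "pm g = cyc3 d b e"
    using exists_pm[OF cyc3_permutes[OF d] cyc3_even[OF d]] assms e by auto
  show ?thesis
    by (rule occurs_cong[OF occurs_comp[OF assms(1) g(1)]])
      (use assms e False in \<open>auto simp: g(2) switch2_def cyc3_def\<close>)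
qed (use assms in simp)

text \<open>A single nontrivial pure switching, multiplied by its conjugate under a suitable
  3-cycle, becomes a switching at exactly two vertices.\<close>

lemma occurs_switch2:
  assumes "a < 6" "b < 6" "a \<noteq> b"
  shows "occurs id (switch2 a b)"
proof -
  have "\<exists>c d. c < 6 \<and> d < 6 \<and> c \<noteq> d \<and> occurs id (switch2 c d)"
  proof -
    obtain g i0 j0 where g: "g \<in> carrier G" "pm g ^^ 4 = id" "i0 < 6" "j0 < 6" "es (g [^] (4::nat)) i0 j0 = - 1"
      using four by blast
    define v where "v = g [^] (4::nat)"
    have vG: "v \<in> carrier G" using g by (simp add: v_def)
    have "pm (g [^] n) = pm g ^^ n" for n :: nat
      using g(1) by (induction n) (simp_all add: pm_one pm_mult funpow_swap1 fun_eq_iff)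
    then have pv: "pm v = id" using g by (simp add: v_def)
    define r where "r = es v i0"
    have r: "sgns r" unfolding r_def by (rule sgns_es[OF vG])
    have occ: "occurs id r" unfolding r_def using occurs_self[OF vG g(3)] pv by simp
    have r1: "r i0 = 1" "r j0 = - 1" using es_diag[OF vG g(3)] g(5) by (simp_all add: r_def v_def)
    have ij: "i0 \<noteq> j0" using r1 by auto
    have "card {i0, j0} \<le> 2" by (simp add: card_insert_if)
    then have "\<not> {..<6} \<subseteq> {i0, j0}" using card_mono[of "{i0, j0}" "{..<6::nat}"] by auto
    then obtain k where k: "k < 6" "k \<notin> {i0, j0}" by auto
    have d: "distinct [j0, i0, k]" using ij k by auto
    obtain h where h: "h \<in> carrier G" "pm h = cyc3 j0 i0 k"
      using exists_pm[OF cyc3_permutes[OF d] cyc3_even[OF d]] g k by auto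
    \<comment> \<open>The signs cancel except on the 3-cycle; there they are -1, \<open>r k\<close>
      and \<open>- r k\<close> at \<open>j0\<close>, \<open>i0\<close> and \<open>k\<close>.\<close>
    have o2: "occurs id (\<lambda>x. r x * r (pm h x))" by (rule occurs_times[OF occ occurs_comp[OF occ h(1)]])
    show ?thesis
    proof (cases "r k = 1")
      case True
      have "occurs id (switch2 j0 k)"
        by (rule occurs_cong[OF o2])
          (use True r1 d sgns_square[OF r] in \<open>auto simp: h(2) switch2_def cyc3_def\<close>)
      then show ?thesis using g k d by auto
    next
      case False
      then have rk: "r k = - 1" using sgnsD[OF r, of k] by simp
      have "occurs id (switch2 j0 i0)"
        by (rule occurs_cong[OF o2])
          (use rk r1 d sgns_square[OF r] in \<open>auto simp: h(2) switch2_def cyc3_def\<close>)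
      then show ?thesis using g d by auto
    qed
  qed
  then obtain c d where cd: "c < 6" "d < 6" "c \<noteq> d" "occurs id (switch2 c d)" by blast
  show ?thesis
  proof (cases "a = c")
    case True
    then show ?thesis using occurs_switch2_step[of c d b] cd assms by blast
  next
    case False
    then have "occurs id (switch2 a c)" using occurs_switch2_step[of c d a] cd assms switch2_commute by metis
    then show ?thesis using occurs_switch2_step[of a c b] cd assms False by blast
  qed
qed

lemma occurs_even_signs:
  assumes s: "sgns s" "(\<Prod>i<6. s i) = 1"
  shows "occurs id s"
proof -
  \<comment> \<open>One switching at {0, k} for each \<open>k\<close> whose sign differs from that
    at 0; the parity of \<open>s\<close> makes the value at 0 come out right.\<close>
  define q where "q k = (if s 0 * s k = - 1 then switch2 0 k else (\<lambda>_. 1))" for k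
  have q1: "occurs id (\<lambda>_. 1)" unfolding occurs_def by (rule bexI[of _ \<one>]) (simp_all add: pm_one es_one)
  have q: "occurs id (q k)" if "0 < k" "k < 6" for k
    using occurs_switch2[of 0 k] that q1 by (simp add: q_def)
  have "occurs id (\<lambda>i. q 1 i * (q 2 i * (q 3 i * (q 4 i * q 5 i))))"
    by (intro occurs_times q) simp_all
  then have "occurs id (\<lambda>i. s 0 * s i)"
  proof (rule occurs_cong)
    fix i :: nat assume "i < 6"
    then have i: "i \<in> {0, 1, 2, 3, 4, 5}" by auto
    have qk: "q k i = (if i = k then s 0 * s k else 1)" if "0 < k" "i \<noteq> 0" for k
      using that sgnsD[OF s(1), of 0] sgnsD[OF s(1), of k] by (auto simp: q_def switch2_def)
    have q0: "q k 0 = s 0 * s k" for k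
      using sgnsD[OF s(1), of 0] sgnsD[OF s(1), of k] by (auto simp: q_def switch2_def)
    show "s 0 * s i = q 1 i * (q 2 i * (q 3 i * (q 4 i * q 5 i)))"
    proof (cases "i = 0")
      case True
      have "s 1 * s 2 * s 3 * s 4 * s 5 = s 0" using s(2) sgnsD[OF s(1), of 0] by (auto simp: prod_upto6)
      moreover have "s 0 * s 0 = 1" by (rule sgns_square[OF s(1)])
      ultimately show ?thesis using sgnsD[OF s(1), of 0] unfolding True q0 by (auto simp: mult.assoc)
    next
      case False
      then show ?thesis using i by (auto simp: qk)
    qed
  qed
  then obtain g where g: "g \<in> carrier G" "pm g = id" "\<forall>i<6. \<forall>j<6. es g i j = (s 0 * s i) * (s 0 * s j)"
    unfolding occurs_def by blast
  then show ?thesis unfolding occurs_def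
    using sgnsD[OF s(1), of 0] by (intro bexI[of _ g]) auto
qed

text \<open>Lift the permutation by any element and correct the discrepancy of signs by a pure even
  switching.\<close>

theorem fullness:
  assumes \<pi>: "\<pi> permutes {..<6}" "evenperm \<pi>" and s: "sgns s" "(\<Prod>i<6. s i) = 1"
  shows "occurs \<pi> s"
proof -
  obtain g where g: "g \<in> carrier G" "pm g = \<pi>" using exists_pm[OF \<pi>] by blast
  have t: "sgns (\<lambda>i. s i * es g 0 i)" by (rule sgns_times[OF s(1) sgns_es[OF g(1)]])
  have "(\<Prod>i<6. s i * es g 0 i) = 1" using prod_es[OF g(1)] s(2) by (simp add: prod.distrib)
  then have "occurs (\<pi> \<circ> id) (\<lambda>i. (s i * es g 0 i) * es g 0 (id i))"
    using occurs_mult[OF occurs_self[OF g(1), of 0] occurs_even_signs[OF t]] g(2) by simp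
  then show ?thesis using sgns_square[OF sgns_es[OF g(1)]] by (simp add: mult.assoc)
qed

end

subsection \<open>Coset representatives and labels of switching classes\<close>

definition coset_reps :: "nat list list" where
  "coset_reps = [[0,1,2,3,4,5], [0,1,2,4,5,3], [0,1,2,5,3,4], [0,1,3,2,5,4], [0,1,3,4,2,5], [0,1,3,5,4,2]]"

text \<open>The label of a matrix records which of the vertices \<open>2, \<dots>, 5\<close> form a triple of positive sign
  with \<open>0\<close> and \<open>1\<close>; it depends only on the switching class.\<close>

definition label :: "(nat \<Rightarrow> nat \<Rightarrow> int) \<Rightarrow> bool list" where
  "label T = map (\<lambda>k. 2 \<le> k \<and> T 0 1 * T 0 k * T 1 k = 1) idl"

text \<open>The label computed from the permutation alone, for permutations fixing 0 and 1.\<close>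

definition list_label :: "nat list \<Rightarrow> bool list" where
  "list_label l = map (\<lambda>k. 2 \<le> k \<and> edge 0 (l ! k) = edge 1 (l ! k)) idl"

lemma coset_reps_check:
  "list_all (\<lambda>l. perm_list l \<and> \<not> oddl l \<and> l ! 0 = 0 \<and> l ! 1 = 1) coset_reps" "distinct (map list_label coset_reps)"
  "distinct coset_reps" "length coset_reps = 6"
  by code_simp+

lemma coset_repsD:
  assumes "l \<in> set coset_reps"
  shows "fn l permutes {..<6}" "evenperm (fn l)" "fn l 0 = 0" "fn l 1 = 1"
proof -
  have l: "perm_list l" "\<not> oddl l" "l ! 0 = 0" "l ! 1 = 1"
    using assms coset_reps_check(1) unfolding list_all_iff by blast+
  show p: "fn l permutes {..<6}" by (rule fn_permutes[OF l(1)])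
  show "evenperm (fn l)" using oddl_lst[OF p] l by (simp add: lst_fn perm_list_def)
  show "fn l 0 = 0" "fn l 1 = 1" using l by (simp_all add: fn_def)
qed

text \<open>Every sign occurs twice in the product over a triangle, and the entry at 0 and 1 is
  1.\<close>

lemma label_sact:
  assumes l: "l \<in> set coset_reps" and s: "sgns s"
  shows "label (sact paley (fn l) s) = list_label l"
  unfolding label_def list_label_def
proof (rule map_cong[OF refl])
  note lD = coset_repsD[OF l]
  fix k assume "k \<in> set idl"
  then have k: "k < 6" by (simp add: set_idl)
  let ?T = "sact paley (fn l) s"
  show "(2 \<le> k \<and> ?T 0 1 * ?T 0 k * ?T 1 k = 1) = (2 \<le> k \<and> edge 0 (l ! k) = edge 1 (l ! k))"
  proof (cases "2 \<le> k")
    case True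
    have e: "?T 0 1 * ?T 0 k * ?T 1 k = (s 0 * s 0) * (s 1 * s 1) * (s k * s k) * (paley 0 1 * paley 0 (fn l k) * paley 1 (fn l k))"
      unfolding sact_def lD(3,4) by (simp add: mult_ac)
    have "fn l k \<noteq> 0" "fn l k \<noteq> 1" "fn l k < 6"
      using permutes6_eq[OF lD(1), of k 0] permutes6_eq[OF lD(1), of k 1] permutes6_less[OF lD(1), of k] lD(3,4) True k by auto
    moreover have "paley 0 1 = 1" by (simp add: paley_def edge_def neg_edges_def)
    ultimately show ?thesis using k True unfolding e by (auto simp: sgns_square[OF s] paley_def fn_def)
  qed simp
qed

text \<open>Left multiplication of the permutation by an automorphism only changes the signs by an
  even switching, so the permutation may be taken among the six representatives.\<close>

lemma Orb_rep:
  assumes "T \<in> Orb \<epsilon>"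
  obtains l s where "l \<in> set coset_reps" "sgns s" "(\<Prod>i<6. s i) = \<epsilon>" "T = sact paley (fn l) s"
proof -
  obtain \<pi> s where s: "\<pi> permutes {..<6}" "evenperm \<pi>" "sgns s" "(\<Prod>i<6. s i) = \<epsilon>" "T = sact paley \<pi> s"
    by (rule OrbE[OF assms])
  have "\<not> oddl (lst \<pi>)" using oddl_lst s by simp
  then obtain k where k: "k \<in> set autos" "compl k (lst \<pi>) \<in> set coset_reps"
    using autos_coset_reps lst_in_perm_lists[OF s(1)] unfolding list_all_iff list_ex_iff coset_reps_def by blast
  note kD = autosD[OF k(1)]
  have "compl k (lst \<pi>) = lst (fn k \<circ> \<pi>)" using lst_comp[OF s(1), of "fn k"] kD(1) lst_fn[of k] by (simp add: perm_list_def)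
  then have f: "fn (compl k (lst \<pi>)) = fn k \<circ> \<pi>" using fn_lst permutes_compose[OF s(1) kD(2)] by simp
  have e: "T = sact paley (fn (compl k (lst \<pi>))) (\<lambda>i. s i * sw False k (\<pi> i))"
    unfolding f sact_sact[symmetric] kD(5) by (rule s(5))
  show ?thesis
  proof (rule that[OF k(2) _ _ e])
    show "sgns (\<lambda>i. s i * sw False k (\<pi> i))" by (rule sgns_times[OF s(3) sgns_comp[OF kD(4)]])
    show "(\<Prod>i<6. s i * sw False k (\<pi> i)) = \<epsilon>"
      using prod_permutes6[OF s(1), of "sw False k"] kD(6) s(4) by (simp add: prod.distrib)
  qed
qed

lemma list_label_inj: "l \<in> set coset_reps \<Longrightarrow> l' \<in> set coset_reps \<Longrightarrow> list_label l = list_label l' \<Longrightarrow> l = l'"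
  using coset_reps_check(2) by (simp add: distinct_map inj_on_def)

text \<open>The even switchings up to a global sign, normalized to be trivial at vertex \<open>5\<close>.\<close>

definition even_switch :: "nat set \<Rightarrow> nat \<Rightarrow> int" where
  "even_switch B i = (if i = 0 then \<Prod>k\<in>{1, 2, 3, 4}. bsign (k \<in> B) else if i < 5 then bsign (i \<in> B) else 1)"

lemma even_switch: "sgns (even_switch B)" "(\<Prod>i<6. even_switch B i) = 1"
  by (auto simp: sgns_def even_switch_def bsign_def prod_upto6)

text \<open>The label recovers the representative, and the entries in column 5 recover the
  switching.\<close>

lemma bij_Orb: "bij_betw (\<lambda>(l, B). sact paley (fn l) (even_switch B)) (set coset_reps \<times> Pow {1, 2, 3, 4}) (Orb 1)"
  unfolding bij_betw_def
proof
  let ?f = "\<lambda>(l, B). sact paley (fn l) (even_switch B)"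
  show "inj_on ?f (set coset_reps \<times> Pow {1, 2, 3, 4})"
  proof (rule inj_onI, clarify)
    fix l B l' B'
    assume l: "l \<in> set coset_reps" "l' \<in> set coset_reps" and B: "B \<subseteq> {1, 2, 3, 4}" "B' \<subseteq> {1, 2, 3, 4}"
      and e: "sact paley (fn l) (even_switch B) = sact paley (fn l') (even_switch B')"
    have ll: "l = l'" using label_sact[OF l(1) even_switch(1), of B] label_sact[OF l(2) even_switch(1), of B'] e list_label_inj l by simp
    note lD = coset_repsD[OF l(1)]
    have "i \<in> B \<longleftrightarrow> i \<in> B'" if i: "i \<in> {1, 2, 3, 4}" for i
    proof -
      have "paley (fn l i) (fn l 5) \<noteq> 0"
        using i seidel_range[OF seidel_paley, of "fn l i" "fn l 5"] permutes6_less[OF lD(1)] permutes6_eq[OF lD(1)] by auto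
      then have "even_switch B i * even_switch B 5 = even_switch B' i * even_switch B' 5"
        using fun_cong[OF fun_cong[OF e, of i], of 5] by (simp add: sact_def ll)
      then show ?thesis using i by (auto simp: even_switch_def bsign_def split: if_splits)
    qed
    then show "l = l' \<and> B = B'" using ll B by blast
  qed
  show "?f ` (set coset_reps \<times> Pow {1, 2, 3, 4}) = Orb 1"
  proof
    show "?f ` (set coset_reps \<times> Pow {1, 2, 3, 4}) \<subseteq> Orb 1"
      using coset_repsD OrbI even_switch by (auto intro!: OrbI)
    show "Orb 1 \<subseteq> ?f ` (set coset_reps \<times> Pow {1, 2, 3, 4})"
    proof
      fix T :: "nat \<Rightarrow> nat \<Rightarrow> int" assume "T \<in> Orb 1"
      then obtain l s where l: "l \<in> set coset_reps" and s: "sgns s" "(\<Prod>i<6. s i) = 1" and T: "T = sact paley (fn l) s"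
        by (rule Orb_rep)
      define B where "B = {i \<in> {1, 2, 3, 4}. s 5 * s i = - 1}"
      have sB: "s 5 * s i = bsign (i \<in> B)" if "i \<in> {1, 2, 3, 4}" for i
        using that sgnsD[OF s(1), of 5] sgnsD[OF s(1), of i] by (auto simp: B_def bsign_def)
      have "(\<Prod>k\<in>{1, 2, 3, 4}. bsign (k \<in> B)) = (\<Prod>k\<in>{1, 2, 3, 4}. s 5 * s k)"
        by (rule prod.cong[OF refl]) (simp add: sB)
      also have "\<dots> = s 1 * s 2 * s 3 * s 4" using sgnsD[OF s(1), of 5] by auto
      also have "\<dots> = s 5 * s 0" using s(2) sgnsD[OF s(1), of 0] sgnsD[OF s(1), of 5] by (auto simp: prod_upto6)
      finally have s0: "even_switch B 0 = s 5 * s 0" by (simp add: even_switch_def)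
      have es: "even_switch B i = s 5 * s i" if "i < 6" for i
      proof -
        have "i = 0 \<or> i \<in> {1, 2, 3, 4} \<or> i = 5" using that by auto
        then show ?thesis
        proof (elim disjE)
          assume "i \<in> {1, 2, 3, 4}"
          then show ?thesis using sB[of i] by (auto simp: even_switch_def)
        qed (use s0 sgns_square[OF s(1)] in \<open>simp_all add: even_switch_def\<close>)
      qed
      have "T = sact paley (fn l) (even_switch B)"
        unfolding T by (rule sact_cong[OF _ seidel_paley coset_repsD(1)[OF l]])
          (use sgnsD[OF s(1), of 5] in \<open>auto simp: es\<close>)
      then show "T \<in> ?f ` (set coset_reps \<times> Pow {1, 2, 3, 4})"
        using l by (intro image_eqI[of _ _ "(l, B)"]) (auto simp: B_def)
    qed
  qed
qed

lemma card_Orb_1: "card (Orb 1) = 96"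
proof -
  have "card (set coset_reps) = 6" using distinct_card[OF coset_reps_check(3)] coset_reps_check(4) by simp
  moreover have "card (Pow {1, 2, 3, 4 :: nat}) = 16" by (subst card_Pow) auto
  ultimately show ?thesis using bij_betw_same_card[OF bij_Orb] by (simp add: card_cartesian_product)
qed

definition flip0 :: "nat \<Rightarrow> int" where "flip0 i = (if i = 0 then - 1 else 1)"

lemma flip0: "sgns flip0" "(\<Prod>i<6. flip0 i) = - 1"
  by (simp_all add: sgns_def flip0_def prod_upto6)

lemma flip0_Orb: "T \<in> Orb \<epsilon> \<Longrightarrow> sact T id flip0 \<in> Orb (- \<epsilon>)"
  using sact_Orb_even[OF _ permutes_id even_id flip0(1), of T \<epsilon>] flip0(2) by simp

lemma inj_flip0: "inj (\<lambda>T. sact T id flip0)"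
  by (rule injI) (rule sact_inj[OF permutes_id flip0(1)])

lemma finite_Orb_1: "finite (Orb 1)"
  using card_Orb_1 by (intro card_ge_0_finite) simp

lemma flip0_image: "(\<lambda>T. sact T id flip0) ` Orb 1 = Orb (- 1)"
proof
  show "(\<lambda>T. sact T id flip0) ` Orb 1 \<subseteq> Orb (- 1)" using flip0_Orb[of _ 1] by auto
  show "Orb (- 1) \<subseteq> (\<lambda>T. sact T id flip0) ` Orb 1"
  proof
    fix T :: "nat \<Rightarrow> nat \<Rightarrow> int" assume T: "T \<in> Orb (- 1)"
    have "sact (sact T id flip0) id flip0 = T" unfolding sact_sact using sgns_square[OF flip0(1)] sact_one[of T] by simp
    then show "T \<in> (\<lambda>T. sact T id flip0) ` Orb 1" using flip0_Orb[OF T] by (intro image_eqI[of _ _ "sact T id flip0"]) auto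
  qed
qed

lemma card_Orb: "\<epsilon> = 1 \<or> \<epsilon> = - 1 \<Longrightarrow> card (Orb \<epsilon>) = 96"
proof (elim disjE)
  have "inj_on (\<lambda>T. sact T id flip0) (Orb 1)" using inj_flip0 by (rule inj_on_subset) simp
  from card_image[OF this] show "\<epsilon> = - 1 \<Longrightarrow> card (Orb \<epsilon>) = 96" by (simp add: flip0_image card_Orb_1)
qed (simp add: card_Orb_1)

lemma finite_Orb: "\<epsilon> = 1 \<or> \<epsilon> = - 1 \<Longrightarrow> finite (Orb \<epsilon>)"
  using card_Orb by (intro card_ge_0_finite) auto

text \<open>The Paley matrix itself, and the Paley matrix switched at vertex 0.\<close>

definition base :: "int \<Rightarrow> nat \<Rightarrow> nat \<Rightarrow> int" where
  "base \<epsilon> = sact paley id (\<lambda>i. if i = 0 then \<epsilon> else 1)"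

lemma base_in_Orb: "\<epsilon> = 1 \<or> \<epsilon> = - 1 \<Longrightarrow> base \<epsilon> \<in> Orb \<epsilon>"
  unfolding base_def by (rule OrbI[OF permutes_id even_id]) (auto simp: sgns_def prod_upto6)

subsection \<open>Cosets of stabilizers\<close>

context signed_group
begin

lemma act_Orb: "T \<in> Orb \<epsilon> \<Longrightarrow> g \<in> carrier G \<Longrightarrow> act T g \<in> Orb \<epsilon>"
  using sact_Orb_even[OF _ pm_permutes pm_even sgns_es, of T \<epsilon> g g 0] prod_es[of g] by (simp add: act_def)

lemma act_inverse: "seidel S \<Longrightarrow> g \<in> carrier G \<Longrightarrow> act (act S g) (inv g) = S"
  using act_mult[of S g "inv g"] by (simp add: act_one)

lemma act_cancel: "seidel S \<Longrightarrow> seidel T \<Longrightarrow> g \<in> carrier G \<Longrightarrow> act S g = act T g \<Longrightarrow> S = T"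
  using act_inverse by metis

text \<open>The signs of the base point and of the target have the same product, so their quotient
  is even and occurs in the group.\<close>

lemma Orb_transitive:
  assumes "S \<in> Orb \<epsilon>" "T \<in> Orb \<epsilon>" "\<epsilon> = 1 \<or> \<epsilon> = - 1"
  shows "\<exists>g\<in>carrier G. act S g = T"
proof -
  have base: "\<exists>g\<in>carrier G. act (base \<epsilon>) g = U" if U: "U \<in> Orb \<epsilon>" for U
  proof -
    obtain \<pi> s where s: "\<pi> permutes {..<6}" "evenperm \<pi>" "sgns s" "(\<Prod>i<6. s i) = \<epsilon>" "U = sact paley \<pi> s"
      by (rule OrbE[OF U])
    define d where "d i = (if i = 0 then \<epsilon> else 1)" for i :: nat
    have d: "sgns d" "(\<Prod>i<6. d i) = \<epsilon>" using assms(3) by (auto simp: d_def sgns_def prod_upto6)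
    have "sgns (\<lambda>i. s i * d (\<pi> i))" by (rule sgns_times[OF s(3) sgns_comp[OF d(1)]])
    moreover have "(\<Prod>i<6. s i * d (\<pi> i)) = 1"
      using prod_permutes6[OF s(1), of d] d(2) s(4) assms(3) by (auto simp: prod.distrib)
    ultimately have "occurs \<pi> (\<lambda>i. s i * d (\<pi> i))" by (rule fullness[OF s(1,2)])
    then obtain g where g: "g \<in> carrier G" "pm g = \<pi>" "\<forall>i<6. \<forall>j<6. es g i j = (s i * d (\<pi> i)) * (s j * d (\<pi> j))"
      unfolding occurs_def by blast
    have "act (base \<epsilon>) g = U"
    proof (rule seidel_eqI)
      show "seidel (act (base \<epsilon>) g)" by (intro seidel_act g seidel_Orb[OF base_in_Orb[OF assms(3)]])
      show "seidel U" by (rule seidel_Orb[OF U])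
      fix i j :: nat assume ij: "i < 6" "j < 6"
      have "act (base \<epsilon>) g i j = (d (\<pi> i) * d (\<pi> i)) * (d (\<pi> j) * d (\<pi> j)) * (s i * s j * paley (\<pi> i) (\<pi> j))"
        using ij g by (simp add: act_app base_def d_def[symmetric] sact_def mult_ac)
      then show "act (base \<epsilon>) g i j = U i j" by (simp add: sgns_square[OF d(1)] s(5) sact_def)
    qed
    then show ?thesis using g(1) by blast
  qed
  obtain a b where a: "a \<in> carrier G" "act (base \<epsilon>) a = S" and b: "b \<in> carrier G" "act (base \<epsilon>) b = T"
    using base assms by blast
  have sd: "seidel (base \<epsilon>)" by (rule seidel_Orb[OF base_in_Orb[OF assms(3)]])
  have "act S (inv a \<otimes> b) = T"
    using act_mult[of S "inv a" b] act_inverse[OF sd a(1)] a b seidel_Orb[OF assms(1)] by simp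
  then show ?thesis using a b by blast
qed

definition stab :: "(nat \<Rightarrow> nat \<Rightarrow> int) \<Rightarrow> 'a set" where
  "stab S = {g \<in> carrier G. act S g = S}"

text \<open>The right cosets of a stabilizer, indexed by the matrices of the orbit.\<close>

definition transporter :: "(nat \<Rightarrow> nat \<Rightarrow> int) \<Rightarrow> (nat \<Rightarrow> nat \<Rightarrow> int) \<Rightarrow> 'a set" where
  "transporter S T = {g \<in> carrier G. act S g = T}"

lemma subgroup_stab: "seidel S \<Longrightarrow> subgroup (stab S) G"
proof (rule subgroupI)
  assume S: "seidel S"
  show "stab S \<subseteq> carrier G" by (auto simp: stab_def)
  show "stab S \<noteq> {}" using act_one[OF S] by (auto simp: stab_def)
  show "inv g \<in> stab S" if "g \<in> stab S" for g
    using that act_inverse[OF S, of g] by (auto simp: stab_def)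
  show "g \<otimes> h \<in> stab S" if "g \<in> stab S" "h \<in> stab S" for g h
    using that act_mult[OF S, of g h] by (auto simp: stab_def)
qed

lemma stab_coset: "seidel S \<Longrightarrow> g \<in> carrier G \<Longrightarrow> stab S #> g = transporter S (act S g)"
proof
  assume S: "seidel S" and g: "g \<in> carrier G"
  show "stab S #> g \<subseteq> transporter S (act S g)"
    using g act_mult[OF S] by (auto simp: r_coset_def stab_def transporter_def)
  show "transporter S (act S g) \<subseteq> stab S #> g"
  proof
    fix h assume "h \<in> transporter S (act S g)"
    then have h: "h \<in> carrier G" "act S h = act S g" by (auto simp: transporter_def)
    have "act S (h \<otimes> inv g) = S" using act_mult[OF S h(1), of "inv g"] h g act_inverse[OF S g] by simp
    then have "h \<otimes> inv g \<in> stab S" using h g by (simp add: stab_def)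
    moreover have "h = h \<otimes> inv g \<otimes> g" using h g by (simp add: m_assoc)
    ultimately show "h \<in> stab S #> g" unfolding r_coset_def by blast
  qed
qed

context
  fixes \<epsilon> :: int and S
  assumes \<epsilon>: "\<epsilon> = 1 \<or> \<epsilon> = - 1" and S: "S \<in> Orb \<epsilon>"
begin

lemma rcosets_stab: "rcosets (stab S) = transporter S ` Orb \<epsilon>"
proof -
  have "Orb \<epsilon> = act S ` carrier G" using Orb_transitive[OF S _ \<epsilon>] act_Orb[OF S] by blast
  then show ?thesis using stab_coset[OF seidel_Orb[OF S]] by (auto simp: RCOSETS_def)
qed

lemma inj_transporter: "inj_on (transporter S) (Orb \<epsilon>)"
proof (rule inj_onI)
  fix T T' assume T: "T \<in> Orb \<epsilon>" and e: "transporter S T = transporter S T'"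
  obtain g where "g \<in> carrier G" "act S g = T" using Orb_transitive[OF S T \<epsilon>] by blast
  then have "g \<in> transporter S T'" using e by (auto simp: transporter_def)
  then show "T = T'" using \<open>act S g = T\<close> by (simp add: transporter_def)
qed

lemma transporter_coset: "T \<in> Orb \<epsilon> \<Longrightarrow> g \<in> carrier G \<Longrightarrow> transporter S T #> g = transporter S (act T g)"
proof -
  assume T: "T \<in> Orb \<epsilon>" and g: "g \<in> carrier G"
  note sd = seidel_Orb[OF S]
  obtain a where a: "a \<in> carrier G" "act S a = T" using Orb_transitive[OF S T \<epsilon>] by blast
  have "transporter S T #> g = stab S #> a #> g" using stab_coset[OF sd a(1)] a by simp
  also have "\<dots> = stab S #> (a \<otimes> g)" using a g by (intro coset_mult_assoc) (auto simp: stab_def)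
  also have "\<dots> = transporter S (act T g)" using stab_coset[OF sd, of "a \<otimes> g"] act_mult[OF sd a(1) g] a g by simp
  finally show ?thesis .
qed

lemma card_fixed_rcosets:
  assumes "K \<subseteq> carrier G"
  shows "card (fixed_rcosets G (stab S) K) = card {T \<in> Orb \<epsilon>. \<forall>k\<in>K. act T k = T}"
proof -
  have "transporter S T #> k = transporter S T \<longleftrightarrow> act T k = T" if "T \<in> Orb \<epsilon>" "k \<in> K" for T k
    using transporter_coset[of T k] inj_on_eq_iff[OF inj_transporter, of "act T k" T] act_Orb[of T \<epsilon> k] that assms by auto
  then have "fixed_rcosets G (stab S) K = transporter S ` {T \<in> Orb \<epsilon>. \<forall>k\<in>K. act T k = T}"
    unfolding fixed_rcosets_def rcosets_stab by auto
  then show ?thesis using card_image[OF inj_on_subset[OF inj_transporter]] by simp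
qed

lemma card_rcosets: "card (rcosets (stab S)) = 96"
  unfolding rcosets_stab using card_image[OF inj_transporter] card_Orb[OF \<epsilon>] by simp

text \<open>Such an element fixes the whole orbit. Comparing \<open>S\<close> with its switching at
  two vertices shows that no vertex is moved; then the nonzero entries of \<open>S\<close> leave no
  freedom for the signs.\<close>

lemma core_trivial:
  assumes g: "g \<in> carrier G" and core: "\<And>h. h \<in> carrier G \<Longrightarrow> inv h \<otimes> g \<otimes> h \<in> stab S"
  shows "g = \<one>"
proof -
  note sd = seidel_Orb[OF S]
  have fixed: "act T g = T" if T: "T \<in> Orb \<epsilon>" for T
  proof -
    obtain a where a: "a \<in> carrier G" "act S a = T" using Orb_transitive[OF S T \<epsilon>] by blast
    have "act S (inv (inv a) \<otimes> g \<otimes> inv a) = S" using core[of "inv a"] a by (simp add: stab_def)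
    then have "act (act T g) (inv a) = S" using a g act_mult[OF sd, of "a \<otimes> g" "inv a"] act_mult[OF sd a(1) g] by simp
    moreover have "act T (inv a) = S" using act_inverse[OF sd a(1)] a by simp
    ultimately show ?thesis
      using act_cancel[of "act T g" T "inv a"] seidel_Orb[OF T] seidel_act[OF g] a by simp
  qed
  note p = pm_permutes[OF g]
  have same: "s (pm g i) * s (pm g j) = s i * s j"
    if s: "sgns s" "(\<Prod>i<6. s i) = 1" and ij: "i < 6" "j < 6" "i \<noteq> j" for s i j
  proof -
    have T: "sact S id s \<in> Orb \<epsilon>" using sact_Orb_even[OF S permutes_id even_id s(1)] s(2) by simp
    have e1: "es g i j * S (pm g i) (pm g j) = S i j" using fun_cong[OF fun_cong[OF fixed[OF S]]] act_app[OF g ij(1,2)] by metis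
    have "(s (pm g i) * s (pm g j)) * S i j = es g i j * (s (pm g i) * s (pm g j) * S (pm g i) (pm g j))"
      unfolding e1[symmetric] by (simp only: mult_ac)
    also have "\<dots> = (s i * s j) * S i j"
      using fun_cong[OF fun_cong[OF fixed[OF T], of i], of j] act_app[OF g ij(1,2), of "sact S id s"] by (simp add: sact_def)
    finally have "(s (pm g i) * s (pm g j)) * S i j = (s i * s j) * S i j" .
    moreover have "S i j \<noteq> 0" using seidel_range[OF sd ij] by auto
    ultimately show ?thesis by simp
  qed
  have pid: "pm g = id"
  proof
    fix i
    show "pm g i = id i"
    proof (cases "i < 6")
      case i: True
      show ?thesis
      proof (rule ccontr)
        assume ne: "pm g i \<noteq> id i"
        have avoid: "\<exists>m<6. m \<notin> set xs" if "length xs < 6" for xs :: "nat list"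
        proof (rule ccontr)
          assume "\<not> ?thesis"
          then have "{..<6} \<subseteq> set xs" by auto
          then show False using card_mono[of "set xs" "{..<6}"] card_length[of xs] that by simp
        qed
        \<comment> \<open>With \<open>j\<close> and \<open>m\<close> chosen like this, switching at
          {i, m} negates the entry at (i, j) but not the one at its image.\<close>
        from avoid[of "[i, finv (pm g) i]"] have "\<exists>j<6. j \<notin> {i, finv (pm g) i}" by simp
        then obtain j where j: "j < 6" "j \<notin> {i, finv (pm g) i}" by blast
        from avoid[of "[i, j, pm g i, pm g j]"] have "\<exists>m<6. m \<notin> {i, j, pm g i, pm g j}" by simp
        then obtain m where m: "m < 6" "m \<notin> {i, j, pm g i, pm g j}" by blast
        have pj: "pm g j \<noteq> i" using j(2) permutes_inverses(2)[OF p] by auto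
        have "sgns (switch2 i m)" "(\<Prod>k<6. switch2 i m k) = 1"
        proof -
          show "sgns (switch2 i m)" by (simp add: sgns_def switch2_def)
          have im: "i \<noteq> m" using m by auto
          have "(\<Prod>k<6. switch2 i m k) = (\<Prod>k<6. if k = i then - 1 else 1) * (\<Prod>k<6. if k = m then - 1 else (1::int))"
            unfolding prod.distrib[symmetric] using im by (intro prod.cong) (auto simp: switch2_def)
          then show "(\<Prod>k<6. switch2 i m k) = 1" using i m by (simp add: prod.delta)
        qed
        then have "switch2 i m (pm g i) * switch2 i m (pm g j) = switch2 i m i * switch2 i m j"
          using same[of "switch2 i m" i j] i j by simp
        then show False using ne pj m j by (auto simp: switch2_def split: if_splits)
      qed
    next
      case False
      then show ?thesis using permutes_not_in[OF p, of i] by simp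
    qed
  qed
  have "es g i j = es \<one> i j" if "i < 6" "j < 6" for i j
  proof (cases "i = j")
    case True
    then show ?thesis using es_diag[OF g] es_one that by simp
  next
    case False
    have "es g i j * S i j = S i j" using fun_cong[OF fun_cong[OF fixed[OF S], of i], of j] act_app[OF g that, of S] pid by simp
    then show ?thesis using seidel_range[OF sd that False] es_one[OF that] by auto
  qed
  then show ?thesis using faithful[OF g one_closed] pid pm_one by simp
qed

end

text \<open>If neither orbit has a matrix fixed by \<open>K\<close>, both counts are 0. Otherwise a
  fixed matrix in either orbit yields an interchange of the orbits, which gives injections between
  the fixed points in both directions.\<close>

theorem solvably_equivalent_stabs: "solvably_equivalent G (stab (base 1)) (stab (base (- 1)))"
  unfolding solvably_equivalent_def
proof (intro conjI allI impI)
  have b: "base 1 \<in> Orb 1" "base (- 1) \<in> Orb (- 1)" by (rule base_in_Orb, simp)+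
  show "group G" by (rule is_group)
  show "finite (carrier G)" by (rule finite_carrier)
  show "subgroup (stab (base 1)) G" "subgroup (stab (base (- 1))) G" using b seidel_Orb subgroup_stab by blast+
  fix K assume K: "subgroup K G \<and> solvable (G\<lparr>carrier := K\<rparr>)"
  then have KG: "K \<subseteq> carrier G" by (auto dest: subgroup.subset)
  define F where "F \<epsilon> = {T \<in> Orb \<epsilon>. \<forall>k\<in>K. act T k = T}" for \<epsilon>
  have fin: "finite (F 1)" "finite (F (- 1))" unfolding F_def using finite_Orb by auto
  have "card (F 1) = card (F (- 1))"
  proof (cases "F 1 = {} \<and> F (- 1) = {}")
    case False
    then obtain \<delta> T0 where T0: "T0 \<in> F \<delta>" by blast
    then have T0': "T0 \<in> Orb \<delta>" "\<And>k. k \<in> K \<Longrightarrow> act T0 k = T0" by (auto simp: F_def)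
    have "\<exists>\<Theta>. inj \<Theta> \<and> (\<forall>\<epsilon>. \<Theta> ` F \<epsilon> \<subseteq> F (- \<epsilon>))"
    proof (cases "K = {\<one>}")
      case True
      then have "F \<epsilon> = Orb \<epsilon>" for \<epsilon> unfolding F_def using act_one seidel_Orb by auto
      then show ?thesis using inj_flip0 flip0_Orb by (intro exI[of _ "\<lambda>T. sact T id flip0"]) auto
    next
      case False
      then obtain x where x: "x \<in> K" "x \<noteq> \<one>" "\<And>k. k \<in> K \<Longrightarrow> \<exists>y\<in>K. k \<otimes> x = y \<otimes> k \<and> y \<otimes> x = x \<otimes> y"
        using solvable_commuting_conjugates K by blast
      \<comment> \<open>A pure switching that fixes a Seidel matrix is trivial, because the
        off-diagonal entries are nonzero.\<close>
      have "pm x \<noteq> id"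
      proof
        assume pid: "pm x = id"
        have xG: "x \<in> carrier G" using x KG by blast
        have "es x i j = es \<one> i j" if "i < 6" "j < 6" for i j
        proof (cases "i = j")
          case True
          then show ?thesis using es_diag[OF xG] es_one that by simp
        next
          case False
          have "es x i j * T0 i j = T0 i j" using T0'(2)[OF x(1)] act_app[OF xG that, of T0] pid by simp
          then show ?thesis using seidel_range[OF seidel_Orb[OF T0'(1)] that False] es_one[OF that] by auto
        qed
        then show False using faithful[OF xG one_closed] pid pm_one x(2) by simp
      qed
      have "\<exists>\<Theta>. inj \<Theta> \<and> (\<forall>\<epsilon>. \<Theta> ` Orb \<epsilon> \<subseteq> Orb (- \<epsilon>)) \<and>
        (\<forall>k\<in>pm ` K. \<forall>s T. sgns s \<longrightarrow> sact T0 k s = T0 \<longrightarrow> seidel T \<longrightarrow> sact T k s = T \<longrightarrow> sact (\<Theta> T) k s = \<Theta> T)"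
      proof (rule exists_orbit_swap[OF T0'(1)])
        show "k permutes {..<6}" if "k \<in> pm ` K" for k using that pm_permutes KG by auto
        show "\<exists>s. sgns s \<and> sact T0 k s = T0" if "k \<in> pm ` K" for k
          using that sgns_es T0'(2) KG unfolding act_def by blast
        show "pm x \<in> pm ` K" using x by blast
        show "pm x \<noteq> id" by fact
        fix k assume "k \<in> pm ` K"
        then obtain k' where k': "k' \<in> K" "k = pm k'" by blast
        obtain y where y: "y \<in> K" "k' \<otimes> x = y \<otimes> k'" "y \<otimes> x = x \<otimes> y" using x(3)[OF k'(1)] by blast
        have "k' \<in> carrier G" "x \<in> carrier G" "y \<in> carrier G" using k' x y KG by auto
        then have "k \<circ> pm x = pm y \<circ> k" "pm y \<circ> pm x = pm x \<circ> pm y"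
          unfolding k'(2) using y by (metis pm_mult)+
        then show "\<exists>y\<in>pm ` K. k \<circ> pm x = y \<circ> k \<and> y \<circ> pm x = pm x \<circ> y" using y(1) by blast
      qed
      then obtain \<Theta> where \<Theta>: "inj \<Theta>" "\<forall>\<epsilon>. \<Theta> ` Orb \<epsilon> \<subseteq> Orb (- \<epsilon>)"
        "\<forall>k\<in>pm ` K. \<forall>s T. sgns s \<longrightarrow> sact T0 k s = T0 \<longrightarrow> seidel T \<longrightarrow> sact T k s = T \<longrightarrow> sact (\<Theta> T) k s = \<Theta> T"
        by (elim exE conjE) (rule that)
      have "\<Theta> T \<in> F (- \<epsilon>)" if T: "T \<in> F \<epsilon>" for T \<epsilon>
      proof -
        have "T \<in> Orb \<epsilon>" using T by (simp add: F_def)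
        moreover have "act (\<Theta> T) k = \<Theta> T" if k: "k \<in> K" for k
          unfolding act_def
        proof (rule \<Theta>(3)[rule_format])
          show "pm k \<in> pm ` K" using k by blast
          show "sgns (es k 0)" using sgns_es k KG by blast
          show "sact T0 (pm k) (es k 0) = T0" using T0'(2)[OF k] by (simp add: act_def)
          show "seidel T" using T by (auto simp: F_def dest: seidel_Orb)
          show "sact T (pm k) (es k 0) = T" using T k by (simp add: F_def act_def)
        qed
        ultimately show ?thesis using \<Theta>(2)[rule_format, of \<epsilon>] by (auto simp: F_def)
      qed
      then show ?thesis using \<Theta>(1) by blast
    qed
    then obtain \<Theta> where \<Theta>: "inj \<Theta>" "\<And>\<epsilon>. \<Theta> ` F \<epsilon> \<subseteq> F (- \<epsilon>)" by blast
    have i: "inj_on \<Theta> A" for A using \<Theta>(1) by (rule inj_on_subset) simp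
    show ?thesis
      using card_inj_on_le[OF i \<Theta>(2)[of 1] fin(2)] card_inj_on_le[OF i, of "F (- 1)" "F 1"] \<Theta>(2)[of "- 1"] fin(1) by simp
  qed simp
  then show "card (fixed_rcosets G (stab (base 1)) K) = card (fixed_rcosets G (stab (base (- 1))) K)"
    using card_fixed_rcosets[OF _ b(1) KG] card_fixed_rcosets[OF _ b(2) KG] by (simp add: F_def)
qed

end

section \<open>Integral equivalence in terms of matrices\<close>

text \<open>A homomorphism of free abelian groups acts on coordinates by an integer matrix.\<close>

lemma hom_free_Abelian_lookup:
  assumes h: "h \<in> hom (free_Abelian_group A) (free_Abelian_group B)" and A: "finite A" and x: "Poly_Mapping.keys x \<subseteq> A"
  shows "Poly_Mapping.lookup (h x) b = (\<Sum>a\<in>A. Poly_Mapping.lookup x a * Poly_Mapping.lookup (h (frag_of a)) b)"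
proof -
  have add: "h (x + y) = h x + h y" if "Poly_Mapping.keys x \<subseteq> A" "Poly_Mapping.keys y \<subseteq> A" for x y
    using hom_mult[OF h, of x y] that by simp
  have h0: "h 0 = 0" using add[of 0 0] by simp
  have "Poly_Mapping.keys x \<subseteq> A \<and>
    Poly_Mapping.lookup (h x) b = (\<Sum>a\<in>A. Poly_Mapping.lookup x a * Poly_Mapping.lookup (h (frag_of a)) b)"
    using x
  proof (induction x rule: frag_induction)
    case (one a)
    have "(\<Sum>c\<in>A. (if c = a then 1 else 0) * Poly_Mapping.lookup (h (frag_of c)) b) = Poly_Mapping.lookup (h (frag_of a)) b"
      using one A by (simp add: if_distrib[of "\<lambda>x. x * _"] sum.delta cong: if_cong)
    then show ?case using one by (simp add: keys_frag_of)
  next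
    case (diff x y)
    have k: "Poly_Mapping.keys (x - y) \<subseteq> A" using diff keys_diff[of x y] by blast
    have "h x = h (x - y) + h y" using add[of "x - y" y] k diff by simp
    then have "h (x - y) = h x - h y" by simp
    then show ?case using k diff by (simp add: lookup_minus left_diff_distrib sum_subtractf)
  qed (simp add: h0)
  then show ?thesis ..
qed

lemma lookup_frag_extend_inj:
  assumes x: "Poly_Mapping.keys x \<subseteq> A" and f: "inj_on f A" and a: "a \<in> A"
  shows "Poly_Mapping.lookup (frag_extend (\<lambda>a. frag_of (f a)) x) (f a) = Poly_Mapping.lookup x a"
  using x
proof (induction x rule: frag_induction)
  case (one b)
  then show ?case using inj_on_eq_iff[OF f a, of b] by simp
qed (simp_all add: frag_extend_diff lookup_minus)

context group
begin

lemma perm_module_smult_of: "perm_module_smult G x (frag_of g) = frag_extend (\<lambda>C. frag_of (C #> g)) x"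
  by (simp add: perm_module_smult_def)

lemma rcosets_translate: "subgroup H G \<Longrightarrow> C \<in> rcosets H \<Longrightarrow> g \<in> carrier G \<Longrightarrow> C #> g \<in> rcosets H"
  by (auto simp: RCOSETS_def coset_mult_assoc subgroup.subset)

lemma inj_on_translate: "subgroup H G \<Longrightarrow> g \<in> carrier G \<Longrightarrow> inj_on (\<lambda>C. C #> g) (rcosets H)"
proof (rule inj_onI)
  fix C D assume H: "subgroup H G" and g: "g \<in> carrier G" and CD: "C \<in> rcosets H" "D \<in> rcosets H" "C #> g = D #> g"
  have "E #> g #> inv g = E" if "E \<in> rcosets H" for E
  proof -
    have "E \<subseteq> carrier G" using rcosets_subset_PowG[OF H] that by blast
    then show ?thesis using g by (simp add: coset_mult_assoc coset_mult_one)
  qed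
  then show "C = D" using CD by metis
qed

text \<open>\<open>y\<close> and \<open>y'\<close> are the matrices of an isomorphism and of its
  inverse in the coset bases. Linearity over the group ring, tested on single group elements,
  becomes invariance under simultaneous translation, because translation permutes the bases.\<close>

lemma integrally_equivalent_matrices:
  assumes H: "subgroup H1 G" "subgroup H2 G" and fin: "finite (rcosets H1)" "finite (rcosets H2)"
    and ie: "integrally_equivalent G H1 H2"
  obtains y y' :: "'a set \<Rightarrow> 'a set \<Rightarrow> int" where
    "\<And>C D g. C \<in> rcosets H1 \<Longrightarrow> D \<in> rcosets H2 \<Longrightarrow> g \<in> carrier G \<Longrightarrow> y (C #> g) (D #> g) = y C D"
    "\<And>C D g. C \<in> rcosets H1 \<Longrightarrow> D \<in> rcosets H2 \<Longrightarrow> g \<in> carrier G \<Longrightarrow> y' (D #> g) (C #> g) = y' D C"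
    "\<And>C C'. C \<in> rcosets H1 \<Longrightarrow> C' \<in> rcosets H1 \<Longrightarrow> (\<Sum>D\<in>rcosets H2. y C D * y' D C') = (if C = C' then 1 else 0)"
    "\<And>D D'. D \<in> rcosets H2 \<Longrightarrow> D' \<in> rcosets H2 \<Longrightarrow> (\<Sum>C\<in>rcosets H1. y' D C * y C D') = (if D = D' then 1 else 0)"
proof -
  let ?F1 = "free_Abelian_group (rcosets H1)" and ?F2 = "free_Abelian_group (rcosets H2)"
  obtain \<phi> where \<phi>: "\<phi> \<in> iso ?F1 ?F2"
    and eqv: "\<And>x r. x \<in> carrier ?F1 \<Longrightarrow> r \<in> carrier (free_Abelian_group (carrier G)) \<Longrightarrow>
      \<phi> (perm_module_smult G x r) = perm_module_smult G (\<phi> x) r"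
    using ie unfolding integrally_equivalent_def by blast
  define \<psi> where "\<psi> = inv_into (carrier ?F1) \<phi>"
  have \<psi>: "\<psi> \<in> iso ?F2 ?F1" unfolding \<psi>_def by (rule group.iso_set_sym[OF group_free_Abelian_group \<phi>])
  have hom: "\<phi> \<in> hom ?F1 ?F2" "\<psi> \<in> hom ?F2 ?F1" using \<phi> \<psi> by (auto simp: iso_def)
  have bij: "bij_betw \<phi> (carrier ?F1) (carrier ?F2)" using \<phi> by (simp add: iso_def)
  have \<psi>\<phi>: "\<psi> (\<phi> x) = x" if "x \<in> carrier ?F1" for x unfolding \<psi>_def using bij_betw_inv_into_left[OF bij that] .
  have \<phi>\<psi>: "\<phi> (\<psi> x) = x" if "x \<in> carrier ?F2" for x unfolding \<psi>_def using bij_betw_inv_into_right[OF bij that] .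
  have cl: "\<phi> x \<in> carrier ?F2" if "x \<in> carrier ?F1" for x using hom_in_carrier[OF hom(1) that] .
  have cl': "\<psi> x \<in> carrier ?F1" if "x \<in> carrier ?F2" for x using hom_in_carrier[OF hom(2) that] .
  have sm: "perm_module_smult G x (frag_of g) \<in> carrier (free_Abelian_group (rcosets H))"
    if "subgroup H G" "x \<in> carrier (free_Abelian_group (rcosets H))" "g \<in> carrier G" for H x g
    using that keys_frag_extend[of "\<lambda>C. frag_of (C #> g)" x] rcosets_translate[OF that(1) _ that(3)]
    by (fastforce simp: perm_module_smult_of keys_frag_of)
  have eqv': "\<psi> (perm_module_smult G x (frag_of g)) = perm_module_smult G (\<psi> x) (frag_of g)"
    if x: "x \<in> carrier ?F2" and g: "g \<in> carrier G" for x g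
  proof -
    have "\<phi> (perm_module_smult G (\<psi> x) (frag_of g)) = perm_module_smult G x (frag_of g)"
      using eqv[OF cl'[OF x], of "frag_of g"] g \<phi>\<psi>[OF x] by (simp add: keys_frag_of)
    then show ?thesis using \<psi>\<phi>[OF sm[OF H(1) cl'[OF x] g]] by simp
  qed
  define y where "y C D = Poly_Mapping.lookup (\<phi> (frag_of C)) D" for C D
  define y' where "y' D C = Poly_Mapping.lookup (\<psi> (frag_of D)) C" for C D
  show ?thesis
  proof (rule that[of y y'])
    fix C D g assume CD: "C \<in> rcosets H1" "D \<in> rcosets H2" and g: "g \<in> carrier G"
    have fC: "frag_of C \<in> carrier ?F1" and fD: "frag_of D \<in> carrier ?F2" using CD by (simp_all add: keys_frag_of)
    have "\<phi> (frag_of (C #> g)) = frag_extend (\<lambda>D. frag_of (D #> g)) (\<phi> (frag_of C))"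
      using eqv[OF fC, of "frag_of g"] g by (simp add: perm_module_smult_of keys_frag_of)
    then show "y (C #> g) (D #> g) = y C D"
      using lookup_frag_extend_inj[OF _ inj_on_translate[OF H(2) g] CD(2), of "\<phi> (frag_of C)"] cl[OF fC] by (simp add: y_def)
    have "\<psi> (frag_of (D #> g)) = frag_extend (\<lambda>C. frag_of (C #> g)) (\<psi> (frag_of D))"
      using eqv'[OF fD g] by (simp add: perm_module_smult_of)
    then show "y' (D #> g) (C #> g) = y' D C"
      using lookup_frag_extend_inj[OF _ inj_on_translate[OF H(1) g] CD(1), of "\<psi> (frag_of D)"] cl'[OF fD] by (simp add: y'_def)
  next
    fix C C' assume C: "C \<in> rcosets H1" "C' \<in> rcosets H1"
    have fC: "frag_of C \<in> carrier ?F1" using C by (simp add: keys_frag_of)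
    show "(\<Sum>D\<in>rcosets H2. y C D * y' D C') = (if C = C' then 1 else 0)"
      using hom_free_Abelian_lookup[OF hom(2) fin(2), of "\<phi> (frag_of C)" C'] cl[OF fC] \<psi>\<phi>[OF fC]
      by (simp add: y_def y'_def eq_commute)
  next
    fix D D' assume D: "D \<in> rcosets H2" "D' \<in> rcosets H2"
    have fD: "frag_of D \<in> carrier ?F2" using D by (simp add: keys_frag_of)
    show "(\<Sum>C\<in>rcosets H1. y' D C * y C D') = (if D = D' then 1 else 0)"
      using hom_free_Abelian_lookup[OF hom(1) fin(1), of "\<psi> (frag_of D)" D'] cl'[OF fD] \<phi>\<psi>[OF fD]
      by (simp add: y_def y'_def eq_commute)
  qed
qed

end

subsection \<open>Pairs of switching classes\<close>

text \<open>The six subsets of size 2 of the vertices 2 to 5, in the order of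
  \<open>coset_reps\<close>. The entries 0 and 3 are complementary; entry 1 represents the remaining
  relation.\<close>

definition labels :: "bool list list" where
  "labels = [
    [False, False, False, True, False, True], [False, False, False, False, True, True],
    [False, False, False, True, True, False], [False, False, True, False, True, False],
    [False, False, True, False, False, True], [False, False, True, True, False, False]]"

lemma labels_eq: "map list_label coset_reps = labels"
  by code_simp

definition opposite :: "bool list \<Rightarrow> bool list" where
  "opposite m = map (\<lambda>i. 2 \<le> i \<and> \<not> m ! i) idl"

text \<open>The even permutations preserving {0, 1}. The possible exchange of 0 and 1 compensates
  parity, so all 24 permutations of the other four vertices are induced.\<close>

definition pair_perms :: "nat list list" where
  "pair_perms = [
    [0,1,2,3,4,5], [0,1,2,4,5,3], [0,1,2,5,3,4], [0,1,3,2,5,4], [0,1,3,4,2,5], [0,1,3,5,4,2],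
    [0,1,4,2,3,5], [0,1,4,3,5,2], [0,1,4,5,2,3], [0,1,5,2,4,3], [0,1,5,3,2,4], [0,1,5,4,3,2],
    [1,0,2,3,5,4], [1,0,2,4,3,5], [1,0,2,5,4,3], [1,0,3,2,4,5], [1,0,3,4,5,2], [1,0,3,5,2,4],
    [1,0,4,2,5,3], [1,0,4,3,2,5], [1,0,4,5,3,2], [1,0,5,2,3,4], [1,0,5,3,4,2], [1,0,5,4,2,3]]"

lemma pair_perms: "list_all (\<lambda>l. perm_list l \<and> \<not> oddl l \<and> l ! 0 < 2 \<and> l ! 1 < 2) pair_perms"
  by code_simp

text \<open>The symmetric group of degree 4 has three orbits on ordered pairs of 2-subsets: equal,
  complementary, and meeting in one point.\<close>

lemma label_pairs: "list_all (\<lambda>m. list_all (\<lambda>n. list_ex (\<lambda>l. compl m l = labels ! 0 \<and>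
    compl n l = (if n = m then labels ! 0 else if n = opposite m then labels ! 3 else labels ! 1)) pair_perms) labels) labels"
  by code_simp

definition pair_type :: "int \<Rightarrow> int \<Rightarrow> int \<Rightarrow> bool list \<Rightarrow> bool list \<Rightarrow> int" where
  "pair_type a b c m n = (if n = m then a else if n = opposite m then b else c)"

text \<open>The multiplication table of the algebra of matrices of this shape, evaluated at the
  three types of pairs.\<close>

lemma sum_pair_types:
  "(\<Sum>m\<in>set labels. pair_type a b c (labels ! 0) m * pair_type a' b' c' m (labels ! 0)) = a * a' + b * b' + 4 * (c * c')"
  "(\<Sum>m\<in>set labels. pair_type a b c (labels ! 0) m * pair_type a' b' c' m (labels ! 3)) = a * b' + b * a' + 4 * (c * c')"
  "(\<Sum>m\<in>set labels. pair_type a b c (labels ! 0) m * pair_type a' b' c' m (labels ! 1)) =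
    a * c' + b * c' + c * a' + c * b' + 2 * (c * c')"
  by (simp_all add: labels_def pair_type_def opposite_def idl_def)

lemma label_in_labels: "T \<in> Orb \<epsilon> \<Longrightarrow> label T \<in> set labels"
  by (elim Orb_rep) (auto simp: label_sact labels_eq[symmetric])

lemma label_paley: "label paley = labels ! 0"
proof -
  have "fn [0,1,2,3,4,5] = id" using fn_lst[OF permutes_id] by (simp add: lst_def idl_def)
  then have "label paley = list_label [0,1,2,3,4,5]"
    using label_sact[of "[0,1,2,3,4,5]" "\<lambda>_. 1"] sgns_one by (simp add: coset_reps_def sact_one)
  also have "\<dots> = labels ! 0" unfolding labels_eq[symmetric] by (simp add: coset_reps_def)
  finally show ?thesis .
qed

text \<open>The three equations factor into products of corresponding eigenvalues, so each
  eigenvalue is 1 or -1. Two of them differ by \<open>6 * c\<close>, which forces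
  \<open>c = 0\<close>; then \<open>a + b\<close> and \<open>a - b\<close> are units and
  \<open>a\<close> is at most 1.\<close>

lemma unit_system:
  fixes a b c a' b' c' :: int
  assumes "a * a' + b * b' + 4 * (c * c') = 1" "a * b' + b * a' + 4 * (c * c') = 0"
    "a * c' + b * c' + c * a' + c * b' + 2 * (c * c') = 0"
  shows "a \<le> 1"
proof -
  have "(a - b) * (a' - b') = 1" "(a + b + 4 * c) * (a' + b' + 4 * c') = 1" "(a + b - 2 * c) * (a' + b' - 2 * c') = 1"
    using assms by (simp_all add: algebra_simps)
  then have "a - b = 1 \<or> a - b = - 1" "a + b + 4 * c = 1 \<or> a + b + 4 * c = - 1" "a + b - 2 * c = 1 \<or> a + b - 2 * c = - 1"
    by (metis zmult_eq_1_iff)+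
  then show ?thesis by presburger
qed

text \<open>The nontrivial characters of the even sign vectors modulo a global sign: products over
  sets of even size up to complement, each given by a unique pair.\<close>

definition edges6 :: "(nat \<times> nat) set" where
  "edges6 = {(0,1),(0,2),(0,3),(0,4),(0,5),(1,2),(1,3),(1,4),(1,5),(2,3),(2,4),(2,5),(3,4),(3,5),(4,5)}"

lemma edges6D: "(i, j) \<in> edges6 \<Longrightarrow> i < 6 \<and> j < 6 \<and> i \<noteq> j"
  by (auto simp: edges6_def)

lemma card_edges6: "card edges6 = 15" and finite_edges6: "finite edges6"
  by (simp_all add: edges6_def)

text \<open>Orthogonality: the sum of the sixteen characters at an even sign vector is 16 if the
  vector is constant and 0 otherwise.\<close>

lemma sum_edges6:
  assumes s: "sgns s" "(\<Prod>i<6. s i) = 1"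
  shows "1 + (\<Sum>(i, j)\<in>edges6. s i * s j) = (if \<forall>i<6. s i = s 0 then 16 else 0)"
proof -
  have "s 5 = s 0 * s 1 * s 2 * s 3 * s 4"
    using s(2) sgnsD[OF s(1), of 5] by (auto simp: prod_upto6)
  then show ?thesis
    using sgnsD[OF s(1), of 0] sgnsD[OF s(1), of 1] sgnsD[OF s(1), of 2] sgnsD[OF s(1), of 3] sgnsD[OF s(1), of 4]
    unfolding all_less6 by (elim disjE) (simp_all add: edges6_def)
qed

context signed_group
begin

text \<open>Equal labels mean the same coset representative, so only the signs differ, and their
  quotient is even.\<close>

lemma label_eq_imp_even_switch:
  assumes T: "T \<in> Orb 1" "T' \<in> Orb 1" "label T = label T'"
  obtains v s where "v \<in> carrier G" "pm v = id" "act T v = T'" "sgns s" "(\<Prod>i<6. s i) = 1" "\<And>i j. T' i j = s i * s j * T i j"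
proof -
  obtain l s where l: "l \<in> set coset_reps" "sgns s" "(\<Prod>i<6. s i) = 1" "T = sact paley (fn l) s" by (rule Orb_rep[OF T(1)])
  obtain l' s' where l': "l' \<in> set coset_reps" "sgns s'" "(\<Prod>i<6. s' i) = 1" "T' = sact paley (fn l') s'" by (rule Orb_rep[OF T(2)])
  have ll: "l' = l" using T(3) label_sact[OF l(1,2)] label_sact[OF l'(1,2)] list_label_inj[OF l(1) l'(1)] l(4) l'(4) by simp
  define u where "u i = s i * s' i" for i
  have u: "sgns u" unfolding u_def by (rule sgns_times[OF l(2) l'(2)])
  have up: "(\<Prod>i<6. u i) = 1" using l(3) l'(3) by (simp add: u_def prod.distrib)
  have e: "T' i j = u i * u j * T i j" for i j
  proof -
    have "u i * u j * T i j = (s i * s i) * (s j * s j) * T' i j" unfolding l(4) l'(4) ll by (simp add: u_def sact_def mult_ac)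
    then show ?thesis by (simp add: sgns_square[OF l(2)])
  qed
  obtain v where v: "v \<in> carrier G" "pm v = id" "\<forall>i<6. \<forall>j<6. es v i j = u i * u j"
    using fullness[OF permutes_id even_id u up] unfolding occurs_def by blast
  have "act T v = T'"
    by (rule seidel_eqI) (use v seidel_act[OF v(1)] seidel_Orb[OF T(1)] seidel_Orb[OF T(2)] e in \<open>auto simp: act_app\<close>)
  then show ?thesis using that v u up e by blast
qed

lemma label_act_even_switch:
  assumes "T \<in> Orb 1" "v \<in> carrier G" "pm v = id"
  shows "label (act T v) = label T"
proof -
  have "act T v 0 1 * act T v 0 k * act T v 1 k = T 0 1 * T 0 k * T 1 k" if "k < 6" for k
    using es_cocycle[OF assms(2), of 0 1 k] es_cases[OF assms(2), of 0 1] es_cases[OF assms(2), of 1 k] es_cases[OF assms(2), of 0 k] that assms(3)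
    by (auto simp: act_app[OF assms(2)])
  then show ?thesis unfolding label_def by (intro map_cong) (auto simp: set_idl)
qed

lemma label_act_pair:
  assumes T: "T \<in> Orb 1" and l: "l \<in> set pair_perms" and g: "g \<in> carrier G" "pm g = fn l"
  shows "label (act T g) = compl (label T) l" "fn l 0 = 0 \<and> fn l 1 = 1 \<or> fn l 0 = 1 \<and> fn l 1 = 0"
proof -
  have lD: "perm_list l" "l ! 0 < 2" "l ! 1 < 2" using l pair_perms unfolding list_all_iff by blast+
  have p: "fn l permutes {..<6}" by (rule fn_permutes[OF lD(1)])
  have "fn l 0 \<noteq> fn l 1" using permutes6_eq[OF p, of 0 1] by simp
  then show c: "fn l 0 = 0 \<and> fn l 1 = 1 \<or> fn l 0 = 1 \<and> fn l 1 = 0" using lD(2,3) by (auto simp: fn_def)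
  have sd: "T i j = T j i" for i j by (rule seidel_sym[OF seidel_Orb[OF T]])
  have e: "act T g 0 1 * act T g 0 k * act T g 1 k = T 0 1 * T 0 (fn l k) * T 1 (fn l k)" if k: "k < 6" for k
  proof -
    have "act T g 0 1 * act T g 0 k * act T g 1 k = T (fn l 0) (fn l 1) * T (fn l 0) (fn l k) * T (fn l 1) (fn l k)"
      using es_cocycle[OF g(1), of 0 1 k] es_cases[OF g(1), of 0 1] es_cases[OF g(1), of 1 k] es_cases[OF g(1), of 0 k] k
      by (auto simp: act_app[OF g(1)] g(2))
    then show ?thesis using c sd[of 1 0] by (auto simp: mult_ac)
  qed
  have two: "2 \<le> fn l k \<longleftrightarrow> 2 \<le> k" for k
    using c permutes6_eq[OF p, of k 0] permutes6_eq[OF p, of k 1] by auto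
  have "label (act T g) = map (\<lambda>k. label T ! (fn l k)) idl"
    unfolding label_def[of "act T g"]
  proof (rule map_cong[OF refl])
    fix k assume "k \<in> set idl"
    then have k: "k < 6" "fn l k < 6" using permutes6_less[OF p] by (simp_all add: set_idl)
    show "(2 \<le> k \<and> act T g 0 1 * act T g 0 k * act T g 1 k = 1) = label T ! fn l k"
      unfolding e[OF k(1)] using k(2) by (simp add: label_def idl_upt two)
  qed
  also have "\<dots> = compl (label T) (lst (fn l))" by (simp add: compl_def lst_def)
  finally show "label (act T g) = compl (label T) l" using lst_fn[of l] lD(1) by (simp add: perm_list_def)
qed

lemma compl_inj: "perm_list l \<Longrightarrow> length m = 6 \<Longrightarrow> length n = 6 \<Longrightarrow> compl m l = compl n l \<Longrightarrow> m = n"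
proof (rule nth_equalityI)
  fix i assume l: "perm_list l" "length m = 6" "length n = 6" "compl m l = compl n l" and i: "i < length m"
  have p: "fn l permutes {..<6}" by (rule fn_permutes[OF l(1)])
  define k where "k = finv (fn l) i"
  have fk: "fn l k = i" using permutes_inverses(1)[OF p] by (simp add: k_def)
  have k: "k < 6" using permutes6_less[OF permutes_inv[OF p], of i] i l by (simp add: k_def)
  then have "l ! k = i" using fk by (simp add: fn_def)
  then show "m ! i = n ! i" using arg_cong[OF l(4), of "\<lambda>xs. xs ! k"] k l(1) by (simp add: compl_def perm_list_def)
qed simp

lemma act_bij: "g \<in> carrier G \<Longrightarrow> bij_betw (\<lambda>T. act T g) (Orb \<epsilon>) (Orb \<epsilon>)"
proof (rule bij_betw_byWitness[where f' = "\<lambda>T. act T (inv g)"])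
  assume g: "g \<in> carrier G"
  show "\<forall>T\<in>Orb \<epsilon>. act (act T g) (inv g) = T" using act_inverse g seidel_Orb by blast
  show "\<forall>T\<in>Orb \<epsilon>. act (act T (inv g)) g = T" using act_inverse[of _ "inv g"] g seidel_Orb by force
  show "(\<lambda>T. act T g) ` Orb \<epsilon> \<subseteq> Orb \<epsilon>" "(\<lambda>T. act T (inv g)) ` Orb \<epsilon> \<subseteq> Orb \<epsilon>" using act_Orb g by auto
qed

section \<open>Invariant forms and their components along the characters of V\<close>

definition inv_form :: "((nat \<Rightarrow> nat \<Rightarrow> int) \<Rightarrow> (nat \<Rightarrow> nat \<Rightarrow> int) \<Rightarrow> int) \<Rightarrow> bool" where
  "inv_form Z \<longleftrightarrow> (\<forall>T\<in>Orb 1. \<forall>T'\<in>Orb 1. \<forall>g\<in>carrier G. Z (act T g) (act T' g) = Z T T')"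

definition block :: "bool list \<Rightarrow> (nat \<Rightarrow> nat \<Rightarrow> int) set" where
  "block m = {T \<in> Orb 1. label T = m}"

lemma finite_block: "finite (block m)"
  using finite_Orb_1 by (auto simp: block_def)

lemma sum_blocks: "(\<Sum>T\<in>Orb 1. f T) = (\<Sum>m\<in>set labels. \<Sum>T\<in>block m. f T)" for f :: "(nat \<Rightarrow> nat \<Rightarrow> int) \<Rightarrow> int"
  unfolding block_def using label_in_labels[of _ 1] by (intro sum.group[symmetric] finite_Orb_1) auto

text \<open>A function of signs that realizes a character: elements preserving {0, 1} change it by a
  global sign only, so products of two of its values are invariant. The trivial character is the
  constant 1, and one nontrivial character comes from the entry at (0, 1).\<close>

definition weight :: "((nat \<Rightarrow> nat \<Rightarrow> int) \<Rightarrow> int) \<Rightarrow> bool" where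
  "weight w \<longleftrightarrow> (\<forall>T\<in>Orb 1. w T * w T = 1) \<and>
     (\<forall>g\<in>carrier G. pm g ` {0, 1} = {0, 1} \<longrightarrow> (\<exists>e. e * e = 1 \<and> (\<forall>T\<in>Orb 1. w (act T g) = e * w T)))"

text \<open>The component of \<open>Z\<close> along the character given by \<open>w\<close>, between
  the matrix \<open>T\<close> and the switching class with label \<open>m\<close>.\<close>

definition block_sum :: "((nat \<Rightarrow> nat \<Rightarrow> int) \<Rightarrow> (nat \<Rightarrow> nat \<Rightarrow> int) \<Rightarrow> int) \<Rightarrow> ((nat \<Rightarrow> nat \<Rightarrow> int) \<Rightarrow> int) \<Rightarrow>
    (nat \<Rightarrow> nat \<Rightarrow> int) \<Rightarrow> bool list \<Rightarrow> int" where
  "block_sum Z w T m = (\<Sum>T'\<in>block m. Z T T' * (w T * w T'))"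

lemma block_sum_act:
  assumes Z: "inv_form Z" and w: "weight w" and T: "T \<in> Orb 1"
    and g: "g \<in> carrier G" "pm g ` {0, 1} = {0, 1}"
    and n: "\<And>T'. T' \<in> Orb 1 \<Longrightarrow> label (act T' g) = n \<longleftrightarrow> label T' = m"
  shows "block_sum Z w (act T g) n = block_sum Z w T m"
proof -
  from w[unfolded weight_def, THEN conjunct2, rule_format, OF g]
  obtain e where e: "e * e = 1" "\<forall>T\<in>Orb 1. w (act T g) = e * w T" by (elim exE conjE) (rule that)
  have "bij_betw (\<lambda>T. act T g) (block m) (block n)"
  proof (rule bij_betw_subset[OF act_bij[OF g(1), of 1]])
    show "block m \<subseteq> Orb 1" by (auto simp: block_def)
    show "(\<lambda>T. act T g) ` block m = block n"
    proof
      show "(\<lambda>T. act T g) ` block m \<subseteq> block n" using n act_Orb[OF _ g(1)] by (auto simp: block_def)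
      show "block n \<subseteq> (\<lambda>T. act T g) ` block m"
      proof
        fix U assume U: "U \<in> block n"
        then have "U \<in> (\<lambda>T. act T g) ` Orb 1" using bij_betw_imp_surj_on[OF act_bij[OF g(1), of 1]] by (simp add: block_def)
        then obtain V where "V \<in> Orb 1" "U = act V g" by blast
        then show "U \<in> (\<lambda>T. act T g) ` block m" using U n by (auto simp: block_def)
      qed
    qed
  qed
  then have "block_sum Z w (act T g) n = (\<Sum>T'\<in>block m. Z (act T g) (act T' g) * (w (act T g) * w (act T' g)))"
    unfolding block_sum_def by (rule sum.reindex_bij_betw[symmetric])
  also have "\<dots> = block_sum Z w T m"
    unfolding block_sum_def
  proof (rule sum.cong[OF refl])
    fix T' assume T': "T' \<in> block m"
    have "w (act T g) * w (act T' g) = (e * e) * (w T * w T')" using e(2) T T' by (auto simp: block_def)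
    moreover have "Z (act T g) (act T' g) = Z T T'" using Z T T' g unfolding inv_form_def block_def by blast
    ultimately show "Z (act T g) (act T' g) * (w (act T g) * w (act T' g)) = Z T T' * (w T * w T')" by (simp add: e(1))
  qed
  finally show ?thesis .
qed

text \<open>A permutation preserving {0, 1} moves the two labels to one of three standard positions,
  and an even switching moves \<open>T\<close> to the Paley matrix; neither changes the component.
  So it takes only three values.\<close>

lemma block_sum_pair_type:
  assumes Z: "inv_form Z" and w: "weight w"
  shows "\<exists>a b c. \<forall>T\<in>Orb 1. \<forall>m\<in>set labels. block_sum Z w T m = pair_type a b c (label T) m"
proof (intro exI ballI)
  fix T m assume T: "T \<in> Orb 1" and m: "m \<in> set labels"
  have lT: "label T \<in> set labels" by (rule label_in_labels[OF T])
  define n where "n = (if m = label T then labels ! 0 else if m = opposite (label T) then labels ! 3 else labels ! 1)"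
  obtain l where l: "l \<in> set pair_perms" "compl (label T) l = labels ! 0" "compl m l = n"
    using label_pairs lT m unfolding list_all_iff list_ex_iff n_def by blast
  have lD: "perm_list l" "\<not> oddl l" using l pair_perms unfolding list_all_iff by blast+
  have p: "fn l permutes {..<6}" by (rule fn_permutes[OF lD(1)])
  have "evenperm (fn l)" using oddl_lst[OF p] lD by (simp add: lst_fn perm_list_def)
  then obtain g where g: "g \<in> carrier G" "pm g = fn l" using exists_pm[OF p] by blast
  have g01: "pm g ` {0, 1} = {0, 1}" using label_act_pair(2)[OF T l(1) g] g(2) by auto
  have len: "length k = 6" if "k \<in> set labels" for k using that by (auto simp: labels_def)
  have "block_sum Z w T m = block_sum Z w (act T g) n"
  proof (rule block_sum_act[OF Z w T g(1) g01, symmetric])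
    fix T' assume T': "T' \<in> Orb 1"
    show "label (act T' g) = n \<longleftrightarrow> label T' = m"
      unfolding label_act_pair(1)[OF T' l(1) g] l(3)[symmetric]
      using compl_inj[OF lD(1) len[OF label_in_labels[OF T']] len[OF m]] by auto
  qed
  also have "\<dots> = block_sum Z w paley n"
  proof -
    have "label paley = label (act T g)" by (simp add: label_act_pair(1)[OF T l(1) g] l(2) label_paley)
    then obtain v where v: "v \<in> carrier G" "pm v = id" "act paley v = act T g"
      by (rule label_eq_imp_even_switch[OF paley_in_Orb act_Orb[OF T g(1)]]) blast
    show ?thesis unfolding v(3)[symmetric]
      by (rule block_sum_act[OF Z w paley_in_Orb v(1)]) (use v label_act_even_switch in auto)
  qed
  finally show "block_sum Z w T m = pair_type (block_sum Z w paley (labels ! 0)) (block_sum Z w paley (labels ! 3))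
      (block_sum Z w paley (labels ! 1)) (label T) m"
    by (simp add: n_def pair_type_def)
qed

text \<open>The components of \<open>Z\<close> and \<open>Z'\<close> along the same character are
  inverse 6 by 6 matrices of integers, and \<open>unit_system\<close> applies.\<close>

lemma block_sum_le_1:
  assumes Z: "inv_form Z" and Z': "inv_form Z'" and w: "weight w"
    and ZZ': "\<And>T T'. T \<in> Orb 1 \<Longrightarrow> T' \<in> Orb 1 \<Longrightarrow> (\<Sum>S\<in>Orb 1. Z T S * Z' S T') = (if T = T' then 1 else 0)"
    and T: "T \<in> Orb 1"
  shows "block_sum Z w T (label T) \<le> 1"
proof -
  obtain a b c where abc: "\<And>T m. T \<in> Orb 1 \<Longrightarrow> m \<in> set labels \<Longrightarrow> block_sum Z w T m = pair_type a b c (label T) m"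
    using block_sum_pair_type[OF Z w] by blast
  obtain a' b' c' where abc': "\<And>T m. T \<in> Orb 1 \<Longrightarrow> m \<in> set labels \<Longrightarrow> block_sum Z' w T m = pair_type a' b' c' (label T) m"
    using block_sum_pair_type[OF Z' w] by blast
  have ww: "w S * w S = 1" if "S \<in> Orb 1" for S using w[unfolded weight_def, THEN conjunct1] that by (rule bspec)
  have prod: "(\<Sum>m\<in>set labels. pair_type a b c (labels ! 0) m * pair_type a' b' c' m n) = (if n = labels ! 0 then 1 else 0)"
    if n: "n \<in> set labels" for n
  proof -
    have "(\<Sum>S\<in>Orb 1. Z paley S * (w paley * w S) * block_sum Z' w S n) =
      (\<Sum>S\<in>Orb 1. \<Sum>U\<in>block n. (Z paley S * Z' S U) * (w paley * w U))"
      unfolding block_sum_def sum_distrib_left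
    proof (intro sum.cong refl)
      fix S U assume S: "S \<in> Orb 1"
      \<comment> \<open>The intermediate sign enters twice and disappears, which makes the
        components multiplicative.\<close>
      have "Z paley S * (w paley * w S) * (Z' S U * (w S * w U)) = (w S * w S) * ((Z paley S * Z' S U) * (w paley * w U))"
        by (simp add: mult_ac)
      then show "Z paley S * (w paley * w S) * (Z' S U * (w S * w U)) = (Z paley S * Z' S U) * (w paley * w U)"
        by (simp add: ww[OF S])
    qed
    also have "\<dots> = (\<Sum>U\<in>block n. \<Sum>S\<in>Orb 1. (Z paley S * Z' S U) * (w paley * w U))" by (rule sum.swap)
    also have "\<dots> = (\<Sum>U\<in>block n. if U = paley then 1 else 0)"
    proof (rule sum.cong[OF refl])
      fix U assume "U \<in> block n"
      then have U: "U \<in> Orb 1" by (simp add: block_def)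
      have "(\<Sum>S\<in>Orb 1. (Z paley S * Z' S U) * (w paley * w U)) = (\<Sum>S\<in>Orb 1. Z paley S * Z' S U) * (w paley * w U)"
        by (rule sum_distrib_right[symmetric])
      then show "(\<Sum>S\<in>Orb 1. (Z paley S * Z' S U) * (w paley * w U)) = (if U = paley then 1 else 0)"
        using ZZ'[OF paley_in_Orb U] ww[OF paley_in_Orb] by auto
    qed
    also have "\<dots> = (if n = labels ! 0 then 1 else 0)"
      using label_paley paley_in_Orb finite_block[of n] by (auto simp: sum.delta block_def)
    finally have 1: "(\<Sum>S\<in>Orb 1. Z paley S * (w paley * w S) * block_sum Z' w S n) = (if n = labels ! 0 then 1 else 0)" .
    have "(\<Sum>S\<in>Orb 1. Z paley S * (w paley * w S) * block_sum Z' w S n) =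
      (\<Sum>m\<in>set labels. \<Sum>S\<in>block m. Z paley S * (w paley * w S) * block_sum Z' w S n)"
      by (rule sum_blocks)
    also have "\<dots> = (\<Sum>m\<in>set labels. block_sum Z w paley m * pair_type a' b' c' m n)"
      unfolding block_sum_def[of Z] sum_distrib_right
      by (intro sum.cong refl) (auto simp: abc'[OF _ n] block_def)
    also have "\<dots> = (\<Sum>m\<in>set labels. pair_type a b c (labels ! 0) m * pair_type a' b' c' m n)"
      by (intro sum.cong refl) (simp add: abc[OF paley_in_Orb] label_paley)
    finally show ?thesis using 1 by simp
  qed
  have "labels ! 3 \<noteq> labels ! 0" "labels ! 1 \<noteq> labels ! 0" by (simp_all add: labels_def)
  moreover have "labels ! 0 \<in> set labels" "labels ! 3 \<in> set labels" "labels ! 1 \<in> set labels" by (simp_all add: labels_def)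
  ultimately have "a \<le> 1"
    using prod[of "labels ! 0"] prod[of "labels ! 3"] prod[of "labels ! 1"] unit_system[of a a' b b' c c']
    unfolding sum_pair_types by simp
  then show ?thesis using abc[OF T label_in_labels[OF T]] by (simp add: pair_type_def)
qed

lemma weight_one: "weight (\<lambda>_. 1)"
  unfolding weight_def by (intro conjI ballI impI exI[of _ 1]) simp_all

lemma weight_01: "weight (\<lambda>T. T 0 1)"
  unfolding weight_def
proof (intro conjI ballI impI)
  show "T 0 1 * T 0 1 = 1" if "T \<in> Orb 1" for T using seidel_square[OF seidel_Orb[OF that], of 0 1] by simp
  fix g assume g: "g \<in> carrier G" "pm g ` {0, 1} = {0, 1}"
  show "\<exists>e. e * e = 1 \<and> (\<forall>T\<in>Orb 1. act T g 0 1 = e * T 0 1)"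
  proof (intro exI[of _ "es g 0 1"] conjI ballI)
    show "es g 0 1 * es g 0 1 = 1" using es_cases[OF g(1), of 0 1] by auto
    fix T :: "nat \<Rightarrow> nat \<Rightarrow> int" assume T: "T \<in> Orb 1"
    have "pm g 0 = 0 \<and> pm g 1 = 1 \<or> pm g 0 = 1 \<and> pm g 1 = 0"
      using g(2) permutes6_eq[OF pm_permutes[OF g(1)], of 0 1] by (auto simp: doubleton_eq_iff)
    then show "act T g 0 1 = es g 0 1 * T 0 1" using act_app[OF g(1), of 0 1 T] seidel_sym[OF seidel_Orb[OF T], of 0 1] by auto
  qed
qed

lemma label_act_eq:
  assumes "T \<in> Orb 1" "T' \<in> Orb 1" "label T = label T'" "g \<in> carrier G"
  shows "label (act T g) = label (act T' g)"
proof -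
  obtain v where v: "v \<in> carrier G" "pm v = id" "act T v = T'" by (rule label_eq_imp_even_switch[OF assms(1-3)]) blast
  note sd = seidel_Orb[OF assms(1)]
  have "act (act T g) (inv g \<otimes> v \<otimes> g) = act T' g"
    using v assms(4) act_mult[OF sd, of g "inv g \<otimes> v \<otimes> g"] act_mult[OF sd v(1) assms(4)] by (simp add: m_assoc[symmetric])
  moreover have "pm (inv g \<otimes> v \<otimes> g) = id"
    using assms(4) v permutes_inv_o(2)[OF pm_permutes[OF assms(4)]] by (simp add: pm_mult pm_inv)
  ultimately show ?thesis
    using label_act_even_switch[OF act_Orb[OF assms(1,4)], of "inv g \<otimes> v \<otimes> g"] v assms(4) by simp
qed

text \<open>2-transitivity of the automorphisms carries the pair (0, 1) to any pair, so all
  nontrivial characters are covered by the single weight at (0, 1).\<close>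

lemma edge_sum_le_1:
  assumes Z: "inv_form Z" and le: "\<And>T. T \<in> Orb 1 \<Longrightarrow> block_sum Z (\<lambda>T. T 0 1) T (label T) \<le> 1"
    and T: "T \<in> Orb 1" and ij: "i < 6" "j < 6" "i \<noteq> j"
  shows "(\<Sum>T'\<in>block (label T). Z T T' * (T i j * T' i j)) \<le> 1"
proof -
  obtain l where l: "l \<in> set autos" "fn l i = 0" "fn l j = 1" using autos_coset_zero[OF ij] by blast
  note lD = autosD[OF l(1)]
  obtain g where g: "g \<in> carrier G" "pm g = finv (fn l)"
    using exists_pm[OF permutes_inv[OF lD(2)]] lD(3) evenperm6_inv[OF lD(2)] by blast
  have p: "pm g 0 = i" "pm g 1 = j" unfolding g(2) using permutes_inverses(2)[OF lD(2)] l by metis+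
  have e: "act S g 0 1 = es g 0 1 * S i j" for S using act_app[OF g(1), of 0 1 S] p by simp
  have "bij_betw (\<lambda>T. act T g) (block (label T)) (block (label (act T g)))"
  proof (rule bij_betw_subset[OF act_bij[OF g(1), of 1]])
    show "block (label T) \<subseteq> Orb 1" by (auto simp: block_def)
    show "(\<lambda>T. act T g) ` block (label T) = block (label (act T g))"
    proof
      show "(\<lambda>T. act T g) ` block (label T) \<subseteq> block (label (act T g))"
        using label_act_eq[OF _ T _ g(1)] act_Orb[OF _ g(1)] by (auto simp: block_def)
      show "block (label (act T g)) \<subseteq> (\<lambda>T. act T g) ` block (label T)"
      proof
        fix U assume U: "U \<in> block (label (act T g))"
        then have "U \<in> (\<lambda>T. act T g) ` Orb 1" using bij_betw_imp_surj_on[OF act_bij[OF g(1), of 1]] by (simp add: block_def)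
        then obtain V where V: "V \<in> Orb 1" "U = act V g" by blast
        have "label (act V g) = label (act T g)" using U V by (simp add: block_def)
        from label_act_eq[OF act_Orb[OF V(1) g(1)] act_Orb[OF T g(1)] this inv_closed[OF g(1)]]
        have "label V = label T" using act_inverse[OF seidel_Orb[OF V(1)] g(1)] act_inverse[OF seidel_Orb[OF T] g(1)] by simp
        then show "U \<in> (\<lambda>T. act T g) ` block (label T)" using V by (auto simp: block_def)
      qed
    qed
  qed
  then have "block_sum Z (\<lambda>T. T 0 1) (act T g) (label (act T g)) =
    (\<Sum>T'\<in>block (label T). Z (act T g) (act T' g) * (act T g 0 1 * act T' g 0 1))"
    unfolding block_sum_def by (rule sum.reindex_bij_betw[symmetric])
  also have "\<dots> = (\<Sum>T'\<in>block (label T). Z T T' * (T i j * T' i j))"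
  proof (rule sum.cong[OF refl])
    fix T' assume T': "T' \<in> block (label T)"
    have "act T g 0 1 * act T' g 0 1 = T i j * T' i j" unfolding e using es_cases[OF g(1), of 0 1] by auto
    moreover have "Z (act T g) (act T' g) = Z T T'" using Z T T' g(1) unfolding inv_form_def block_def by blast
    ultimately show "Z (act T g) (act T' g) * (act T g 0 1 * act T' g 0 1) = Z T T' * (T i j * T' i j)" by simp
  qed
  finally show ?thesis using le[OF act_Orb[OF T g(1)]] by simp
qed

text \<open>Fourier inversion at the identity: 16 times the diagonal entry is the sum of the sixteen
  components within the switching class, each at most 1.\<close>

lemma diagonal_le_1:
  assumes Z: "inv_form Z" and Z': "inv_form Z'"
    and ZZ': "\<And>T T'. T \<in> Orb 1 \<Longrightarrow> T' \<in> Orb 1 \<Longrightarrow> (\<Sum>S\<in>Orb 1. Z T S * Z' S T') = (if T = T' then 1 else 0)"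
    and T: "T \<in> Orb 1"
  shows "Z T T \<le> 1"
proof -
  have le: "block_sum Z w S (label S) \<le> 1" if "weight w" "S \<in> Orb 1" for w S
    by (rule block_sum_le_1[OF Z Z' that(1) ZZ' that(2)])
  have orth: "1 + (\<Sum>(i, j)\<in>edges6. T i j * T' i j) = (if T' = T then 16 else 0)" if T': "T' \<in> block (label T)" for T'
  proof -
    have T'O: "T' \<in> Orb 1" "label T = label T'" using T' by (auto simp: block_def)
    obtain s where s: "sgns s" "(\<Prod>i<6. s i) = 1" "\<And>i j. T' i j = s i * s j * T i j"
      by (rule label_eq_imp_even_switch[OF T T'O]) blast
    have tt: "T i j * T' i j = s i * s j" if "(i, j) \<in> edges6" for i j
    proof -
      have "T i j * T' i j = s i * s j * (T i j * T i j)" by (simp add: s(3) mult_ac)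
      then show ?thesis using seidel_square[OF seidel_Orb[OF T]] edges6D[OF that] by simp
    qed
    have "(\<Sum>(i, j)\<in>edges6. T i j * T' i j) = (\<Sum>(i, j)\<in>edges6. s i * s j)"
      by (rule sum.cong[OF refl]) (auto simp: tt)
    moreover have "(\<forall>i<6. s i = s 0) \<longleftrightarrow> T' = T"
    proof
      assume c: "\<forall>i<6. s i = s 0"
      show "T' = T"
      proof (rule seidel_eqI[OF seidel_Orb[OF T'O(1)] seidel_Orb[OF T]])
        fix i j :: nat assume "i < 6" "j < 6"
        then have "s i = s 0" "s j = s 0" using c by blast+
        then show "T' i j = T i j" using s(3)[of i j] sgns_square[OF s(1), of 0] by simp
      qed
    next
      assume e: "T' = T"
      show "\<forall>i<6. s i = s 0"
      proof (intro allI impI)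
        fix i :: nat assume i: "i < 6"
        show "s i = s 0"
        proof (cases "i = 0")
          case False
          then have "T i 0 \<noteq> 0" using seidel_range[OF seidel_Orb[OF T] i, of 0] by auto
          then have "s i * s 0 = 1" using s(3)[of i 0] e by simp
          then show ?thesis using sgnsD[OF s(1), of i] sgnsD[OF s(1), of 0] by auto
        qed simp
      qed
    qed
    ultimately show ?thesis using sum_edges6[OF s(1,2)] by simp
  qed
  have TB: "T \<in> block (label T)" using T by (simp add: block_def)
  have "16 * Z T T = (\<Sum>T'\<in>block (label T). Z T T' * (if T' = T then 16 else 0))"
    using TB finite_block[of "label T"] by (simp add: if_distrib[of "\<lambda>x. _ * x"] sum.delta cong: if_cong)
  \<comment> \<open>Orthogonality of characters replaces the indicator of
    \<open>T' = T\<close>.\<close>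
  also have "\<dots> = (\<Sum>T'\<in>block (label T). Z T T' * (1 + (\<Sum>(i, j)\<in>edges6. T i j * T' i j)))"
    by (rule sum.cong[OF refl]) (simp add: orth)
  also have "\<dots> = block_sum Z (\<lambda>_. 1) T (label T) + (\<Sum>(i, j)\<in>edges6. \<Sum>T'\<in>block (label T). Z T T' * (T i j * T' i j))"
    unfolding block_sum_def distrib_left sum.distrib sum_distrib_left case_prod_unfold by (subst sum.swap) simp
  also have "\<dots> \<le> 1 + (\<Sum>(i, j)\<in>edges6. 1)"
  proof (rule add_mono[OF le[OF weight_one T] sum_mono])
    fix p assume "p \<in> edges6"
    then show "(case p of (i, j) \<Rightarrow> \<Sum>T'\<in>block (label T). Z T T' * (T i j * T' i j)) \<le> (case p of (i, j) \<Rightarrow> 1)"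
      using edge_sum_le_1[OF Z le[OF weight_01] T] edges6D by (cases p) auto
  qed
  also have "\<dots> = 16" by (simp add: case_prod_unfold card_edges6)
  finally show ?thesis by simp
qed

text \<open>The entrywise product of two fixed matrices is invariant even without signs, since the
  signs occur twice. By 2-transitivity it is constant, so the second matrix would be the Paley
  matrix or its negative.\<close>

lemma no_common_fixed_matrix:
  assumes U: "U \<in> Orb (- 1)"
  shows "\<exists>h\<in>stab paley. act U h \<noteq> U"
proof (rule ccontr)
  assume "\<not> ?thesis"
  then have fixed: "\<And>h. h \<in> stab paley \<Longrightarrow> act U h = U" by blast
  note sd = seidel_Orb[OF U]
  have W: "U i j * paley i j = U 0 1 * paley 0 1" if ij: "i < 6" "j < 6" "i \<noteq> j" for i j
  proof -
    obtain l where l: "l \<in> set autos" "fn l i = 0" "fn l j = 1" using autos_coset_zero[OF ij] by blast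
    note lD = autosD[OF l(1)]
    obtain h where h: "h \<in> carrier G" "pm h = fn l" "\<forall>i<6. \<forall>j<6. es h i j = sw False l i * sw False l j"
      using fullness[OF lD(2,3,4,6)] unfolding occurs_def by blast
    have hp: "act paley h = paley"
      by (rule seidel_eqI[OF seidel_act[OF h(1) seidel_paley] seidel_paley])
        (use h fun_cong[OF fun_cong[OF lD(5)]] in \<open>simp add: act_app sact_def\<close>)
    then have hU: "act U h = U" using fixed h(1) by (simp add: stab_def)
    have "U i j * paley i j = act U h i j * act paley h i j" by (simp add: hp hU)
    also have "\<dots> = (es h i j * es h i j) * (U 0 1 * paley 0 1)" using act_app[OF h(1) ij(1,2)] h(2) l by simp
    also have "es h i j * es h i j = 1" using es_cases[OF h(1), of i j] by auto
    finally show ?thesis by simp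
  qed
  have UW: "U i j = (U 0 1 * paley 0 1) * paley i j" if "i < 6" "j < 6" "i \<noteq> j" for i j
    using W[OF that] seidel_range[OF seidel_paley that] by auto
  have "U 0 1 = 1 \<or> U 0 1 = - 1" by (rule seidel_range[OF sd]) simp_all
  moreover have "paley 0 1 = 1 \<or> paley 0 1 = - 1" by (rule seidel_range[OF seidel_paley]) simp_all
  ultimately have "U 0 1 * paley 0 1 = 1 \<or> U 0 1 * paley 0 1 = - 1" by (elim disjE) simp_all
  then show False
  proof
    assume c: "U 0 1 * paley 0 1 = 1"
    have "U i j = paley i j" if "i < 6" "j < 6" "i \<noteq> j" for i j using UW[OF that] c by simp
    then have "U = paley" by (rule seidel_eqI[OF sd seidel_paley])
    then show False using U paley_notin_Orb(1) by simp
  next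
    assume c: "U 0 1 * paley 0 1 = - 1"
    have "U i j = - paley i j" if "i < 6" "j < 6" "i \<noteq> j" for i j using UW[OF that] c by simp
    then have "U = (\<lambda>i j. - paley i j)" by (rule seidel_eqI[OF sd seidel_uminus[OF seidel_paley]])
    then show False using U paley_notin_Orb(2) by simp
  qed
qed

text \<open>The bound on the diagonal says that a row of the matrix has square sum at most 1. Its
  only nonzero position must be fixed by the stabilizer of the Paley matrix, which is
  impossible.\<close>

theorem not_integrally_equivalent_stabs: "\<not> integrally_equivalent G (stab (base 1)) (stab (base (- 1)))"
proof
  assume ie: "integrally_equivalent G (stab (base 1)) (stab (base (- 1)))"
  have e: "(1 :: int) = 1 \<or> (1 :: int) = - 1" "(- 1 :: int) = 1 \<or> (- 1 :: int) = - 1" by simp_all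
  have b: "base 1 \<in> Orb 1" "base (- 1) \<in> Orb (- 1)" using base_in_Orb e by blast+
  have H: "subgroup (stab (base 1)) G" "subgroup (stab (base (- 1))) G" using subgroup_stab seidel_Orb b by blast+
  note R1 = rcosets_stab[OF e(1) b(1)] and R2 = rcosets_stab[OF e(2) b(2)]
  note i1 = inj_transporter[OF e(1) b(1)] and i2 = inj_transporter[OF e(2) b(2)]
  note t1 = transporter_coset[OF e(1) b(1)] and t2 = transporter_coset[OF e(2) b(2)]
  have fin: "finite (rcosets (stab (base 1)))" "finite (rcosets (stab (base (- 1))))"
    unfolding R1 R2 using finite_Orb e by auto
  obtain y y' where y:
    "\<And>C D g. C \<in> rcosets (stab (base 1)) \<Longrightarrow> D \<in> rcosets (stab (base (- 1))) \<Longrightarrow> g \<in> carrier G \<Longrightarrow> (y (C #> g) (D #> g) :: int) = y C D"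
    "\<And>C D g. C \<in> rcosets (stab (base 1)) \<Longrightarrow> D \<in> rcosets (stab (base (- 1))) \<Longrightarrow> g \<in> carrier G \<Longrightarrow> (y' (D #> g) (C #> g) :: int) = y' D C"
    "\<And>C C'. C \<in> rcosets (stab (base 1)) \<Longrightarrow> C' \<in> rcosets (stab (base 1)) \<Longrightarrow>
      (\<Sum>D\<in>rcosets (stab (base (- 1))). y C D * y' D C') = (if C = C' then 1 else 0)"
    "\<And>D D'. D \<in> rcosets (stab (base (- 1))) \<Longrightarrow> D' \<in> rcosets (stab (base (- 1))) \<Longrightarrow>
      (\<Sum>C\<in>rcosets (stab (base 1)). y' D C * y C D') = (if D = D' then 1 else 0)"
    by (rule integrally_equivalent_matrices[OF H fin ie]) blast
  define Y where "Y T U = y (transporter (base 1) T) (transporter (base (- 1)) U)" for T U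
  define Y' where "Y' U T = y' (transporter (base (- 1)) U) (transporter (base 1) T)" for T U
  have Yact: "Y (act T g) (act U g) = Y T U" "Y' (act U g) (act T g) = Y' U T"
    if "T \<in> Orb 1" "U \<in> Orb (- 1)" "g \<in> carrier G" for T U g
    using y(1,2)[of "transporter (base 1) T" "transporter (base (- 1)) U" g] that
    by (simp_all add: Y_def Y'_def R1 R2 t1 t2)
  have YY': "(\<Sum>U\<in>Orb (- 1). Y T U * Y' U T') = (if T = T' then 1 else 0)" if "T \<in> Orb 1" "T' \<in> Orb 1" for T T'
    using y(3)[of "transporter (base 1) T" "transporter (base 1) T'"] that inj_on_eq_iff[OF i1]
    by (simp add: R1 R2 sum.reindex[OF i2] Y_def Y'_def)
  have Y'Y: "(\<Sum>T\<in>Orb 1. Y' U T * Y T U') = (if U = U' then 1 else 0)" if "U \<in> Orb (- 1)" "U' \<in> Orb (- 1)" for U U'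
    using y(4)[of "transporter (base (- 1)) U" "transporter (base (- 1)) U'"] that inj_on_eq_iff[OF i2]
    by (simp add: R1 R2 sum.reindex[OF i1] Y_def Y'_def)
  \<comment> \<open>The product with the transpose lives on the first orbit alone and has sums of
    squares on its diagonal; \<open>Z'\<close> is its inverse.\<close>
  define Z where "Z T T' = (\<Sum>U\<in>Orb (- 1). Y T U * Y T' U)" for T T'
  define Z' where "Z' T T' = (\<Sum>U\<in>Orb (- 1). Y' U T * Y' U T')" for T T'
  have re: "(\<Sum>U\<in>Orb (- 1). f (act U g)) = (\<Sum>U\<in>Orb (- 1). f U)" if "g \<in> carrier G" for g and f :: "(nat \<Rightarrow> nat \<Rightarrow> int) \<Rightarrow> int"
    by (rule sum.reindex_bij_betw[OF act_bij[OF that]])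
  have Zi: "inv_form Z" "inv_form Z'"
    unfolding inv_form_def Z_def Z'_def
    by (intro ballI, subst re[symmetric], assumption, simp add: Yact)+
  have ZZ': "(\<Sum>S\<in>Orb 1. Z T S * Z' S T') = (if T = T' then 1 else 0)" if T: "T \<in> Orb 1" "T' \<in> Orb 1" for T T'
  proof -
    have "(\<Sum>S\<in>Orb 1. Z T S * Z' S T') =
      (\<Sum>S\<in>Orb 1. \<Sum>U\<in>Orb (- 1). \<Sum>W\<in>Orb (- 1). Y T U * Y' W T' * (Y' W S * Y S U))"
      unfolding Z_def Z'_def sum_product by (intro sum.cong refl) (simp add: mult_ac)
    also have "\<dots> = (\<Sum>U\<in>Orb (- 1). \<Sum>S\<in>Orb 1. \<Sum>W\<in>Orb (- 1). Y T U * Y' W T' * (Y' W S * Y S U))"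
      by (rule sum.swap)
    also have "\<dots> = (\<Sum>U\<in>Orb (- 1). \<Sum>W\<in>Orb (- 1). \<Sum>S\<in>Orb 1. Y T U * Y' W T' * (Y' W S * Y S U))"
      by (intro sum.cong refl sum.swap)
    also have "\<dots> = (\<Sum>U\<in>Orb (- 1). \<Sum>W\<in>Orb (- 1). if W = U then Y T U * Y' W T' else 0)"
      unfolding sum_distrib_left[symmetric] by (intro sum.cong refl) (simp add: Y'Y)
    also have "\<dots> = (\<Sum>U\<in>Orb (- 1). Y T U * Y' U T')"
      using finite_Orb[OF e(2)] by (intro sum.cong refl) (simp add: sum.delta)
    finally show ?thesis using YY'[OF T] by simp
  qed
  have p: "paley \<in> Orb 1" by (rule paley_in_Orb)
  have "Z paley paley \<le> 1" by (rule diagonal_le_1[OF Zi ZZ' p])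
  then have sq: "(\<Sum>U\<in>Orb (- 1). Y paley U * Y paley U) \<le> 1" by (simp add: Z_def)
  have "\<exists>U0\<in>Orb (- 1). Y paley U0 \<noteq> 0"
  proof (rule ccontr)
    assume "\<not> ?thesis"
    then have "(\<Sum>U\<in>Orb (- 1). Y paley U * Y' U paley) = 0" by (intro sum.neutral) simp
    then show False using YY'[OF p p] by simp
  qed
  then obtain U0 where U0: "U0 \<in> Orb (- 1)" "Y paley U0 \<noteq> 0" by blast
  have unique: "U = U0" if U: "U \<in> Orb (- 1)" "Y paley U \<noteq> 0" for U
  proof (rule ccontr)
    assume ne: "U \<noteq> U0"
    have "(\<Sum>V\<in>{U, U0}. Y paley V * Y paley V) \<le> (\<Sum>U\<in>Orb (- 1). Y paley U * Y paley U)"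
      using U U0 finite_Orb[OF e(2)] by (intro sum_mono2) auto
    moreover
    have "x * x \<ge> 1" if "x \<noteq> 0" for x :: int
    proof -
      have "x * x \<noteq> 0" using that by simp
      then show ?thesis using zero_le_square[of x] by linarith
    qed
    from this[OF U(2)] this[OF U0(2)]
    have "(\<Sum>V\<in>{U, U0}. Y paley V * Y paley V) \<ge> 2" using ne by simp
    ultimately show False using sq by linarith
  qed
  obtain h where h: "h \<in> stab paley" "act U0 h \<noteq> U0" using no_common_fixed_matrix[OF U0(1)] by blast
  then have hG: "h \<in> carrier G" "act paley h = paley" by (auto simp: stab_def)
  \<comment> \<open>\<open>h\<close> fixes the row index, so it must fix the only column index with
    a nonzero entry.\<close>
  have "Y paley (act U0 h) = Y paley U0" using Yact(1)[OF p U0(1) hG(1)] hG(2) by simp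
  then have "act U0 h = U0" using unique[of "act U0 h"] act_Orb[OF U0(1) hG(1)] U0(2) by simp
  then show False using h by simp
qed

end

section \<open>The two number fields\<close>

theorem mainTheorem6:
  shows "\<exists>K1 K2 L :: complex set.
    number_field_of_degree 96 K1 \<and> number_field_of_degree 96 K2 \<and>
    is_galois_closure L K1 \<and> is_galois_closure L K2 \<and>
    solvably_equivalent (Gal L \<rat>) (carrier (Gal L K1)) (carrier (Gal L K2)) \<and>
    \<not> integrally_equivalent (Gal L \<rat>) (carrier (Gal L K1)) (carrier (Gal L K2))"
proof -
  obtain a :: "nat \<Rightarrow> complex" where "\<forall>x. x ^ 6 + 30 * x + 25 = (\<Prod>i<6. x - a i)" using exists_sextic_roots by blast
  then interpret sextic a by unfold_locales blast
  interpret sg: signed_group "nf.G" pm es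
  proof (intro signed_group.intro signed_group_axioms.intro)
    show "group nf.G" by (rule nf.group_G)
  qed (fact nf.finite_G pm_permutes pm_even es_range es_cocycle es_prod pm_mult es_mult pm_es_faithful
    exists_five_cycle exists_three_cycle exists_fixed_point_free)+
  define H where "H \<epsilon> = sg.stab (base \<epsilon>)" for \<epsilon>
  have H: "subgroup (H \<epsilon>) nf.G" "card (rcosets\<^bsub>nf.G\<^esub> (H \<epsilon>)) = 96" "is_galois_closure nf.L (nf.fixed_by (H \<epsilon>))"
    if \<epsilon>: "\<epsilon> = 1 \<or> \<epsilon> = - 1" for \<epsilon>
  proof -
    note b = base_in_Orb[OF \<epsilon>]
    show s: "subgroup (H \<epsilon>) nf.G" unfolding H_def by (rule sg.subgroup_stab[OF seidel_Orb[OF b]])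
    show "card (rcosets\<^bsub>nf.G\<^esub> (H \<epsilon>)) = 96" unfolding H_def by (rule sg.card_rcosets[OF \<epsilon> b])
    show "is_galois_closure nf.L (nf.fixed_by (H \<epsilon>))"
      by (rule nf.galois_closure_fixed_by[OF s]) (rule sg.core_trivial[OF \<epsilon> b], simp_all add: H_def)
  qed
  show ?thesis
  proof (intro exI conjI)
    show "number_field_of_degree 96 (nf.fixed_by (H 1))" "number_field_of_degree 96 (nf.fixed_by (H (- 1)))"
      using nf.degree_fixed_by[of "H 1"] nf.degree_fixed_by[of "H (- 1)"] H by simp_all
    show "is_galois_closure nf.L (nf.fixed_by (H 1))" "is_galois_closure nf.L (nf.fixed_by (H (- 1)))"
      using H by simp_all
    have g: "carrier (Gal nf.L (nf.fixed_by (H 1))) = H 1" "carrier (Gal nf.L (nf.fixed_by (H (- 1)))) = H (- 1)"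
      using nf.Gal_fixed_by H by simp_all
    show "solvably_equivalent (Gal nf.L \<rat>) (carrier (Gal nf.L (nf.fixed_by (H 1)))) (carrier (Gal nf.L (nf.fixed_by (H (- 1)))))"
      unfolding g unfolding H_def by (rule sg.solvably_equivalent_stabs)
    show "\<not> integrally_equivalent (Gal nf.L \<rat>) (carrier (Gal nf.L (nf.fixed_by (H 1)))) (carrier (Gal nf.L (nf.fixed_by (H (- 1)))))"
      unfolding g unfolding H_def by (rule sg.not_integrally_equivalent_stabs)
  qed
qed

end
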